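(* Let $m>0$. The only ancient solution to the Ricci flow in the class $\mathcal{A}$ is the Taub-NUT metric; that is, every ancient solution $(\mathbb{R}^4,g(t))_{t\le 0}$ in $\mathcal{A}$ is constant in time and is (up to isometry) a Taub-NUT metric $g_{\mathsf{TNUT}}$.
   Context: Let $\boldsymbol{o}$ be the origin of $\mathbb{R}^4=\mathbb{C}^2$. Let $\sigma_1,\sigma_2,\sigma_3$ be the left-invariant coframe on $S^3\cong SU(2)$ for which $\sigma_1^2+\sigma_2^2+\sigma_3^2$ is the round unit metric, $\sigma_3$ being dual to the vector field tangent to the Hopf fibres; then $\sigma_1^2+\sigma_2^2=\pi^*g_{S^2(1/2)}$, the pull-back under the Hopf map of the round metric on the 2-sphere of radius $1/2$. A complete metric on $\mathbb{R}^4$ invariant under the cohomogeneity-1 left action of $SU(2)$ and under rotations of the Hopf fibres has the form, away from $\boldsymbol{o}$, $g=ds^2+b^2(s)\,\pi^*g_{S^2(1/2)}+c^2(s)\,\sigma_3\otimes\sigma_3$, where $s=d_g(\boldsymbol{o},\cdot)$. It is a warped Berger metric if $c/b\le 1$; it has monotone coefficients if $b_s\ge 0$ and $c_s\ge 0$. At $\boldsymbol{o}$ one has $b=c=0$, $b_s=c_s=1$ and $b/c$ extends by $1$. For a family $g(t)$ of such metrics, $b$ and $c$ are functions on space-time and $\partial_s$ is taken with respect to the $g(t)$-distance from $\boldsymbol{o}$. Class $\mathcal{A}$ (for given $m>0$): all complete warped Berger ancient solutions $(\mathbb{R}^4,g(t))_{t\le0}$ to the Ricci flow $\partial_tg=-2\mathrm{Ric}$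 with monotone coefficients and curvature uniformly bounded in space-time such that, on $\mathbb{R}^4\times(-\infty,0]$, $$b_s\ \ge\ \frac{f(b/c)}{b/c},\qquad c\le m^{-1},$$ for some continuous positive function $f$ with $f(z)\to\infty$ as $z\to\infty$. Taub-NUT metric of mass $\mu>0$: the metric on $\mathbb{R}^4$ given away from the origin by $$g_{\mathsf{TNUT}}=\tfrac{1}{16}\Big(1+\tfrac{2\mu^{-1}}{x}\Big)dx^2+\tfrac{x^2}{4}\Big(1+\tfrac{2\mu^{-1}}{x}\Big)\pi^*g_{S^2(1/2)}+\frac{\mu^{-2}}{1+\frac{2\mu^{-1}}{x}}\,\sigma_3\otimes\sigma_3,\quad x>0.$$ Equivalently it is the complete warped Berger metric with bounded $c$ satisfying $c_s=(c/b)^2$ and $b_s=2-c/b$, and $\mu^{-1}=\sup c$. *)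

theory Defs
  imports "HOL-Analysis.Analysis"
begin

section \<open>Smooth maps\<close>

text \<open>
  \<open>Ck_on k S f\<close> is meant for sets \<open>S\<close> on which derivatives within \<open>S\<close> are unique: open sets and the
  closed space-time half-space \<open>UNIV \<times> {..0}\<close>, where it asks for derivatives that are one-sided in
  time at the boundary.
\<close>

primrec Ck_on :: "nat \<Rightarrow> 'a::euclidean_space set \<Rightarrow> ('a \<Rightarrow> 'b::real_normed_vector) \<Rightarrow> bool" where
  "Ck_on 0 S f \<longleftrightarrow> continuous_on S f"
| "Ck_on (Suc k) S f \<longleftrightarrow>
     (\<exists>f'. (\<forall>x\<in>S. (f has_derivative f' x) (at x within S)) \<and> (\<forall>v. Ck_on k S (\<lambda>x. f' x v)))"

definition smooth_on :: "'a::euclidean_space set \<Rightarrow> ('a \<Rightarrow> 'b::real_normed_vector) \<Rightarrow> bool" where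
  "smooth_on S f \<longleftrightarrow> (\<forall>k. Ck_on k S f)"


section \<open>Riemannian metrics on Euclidean space in the global chart\<close>

text \<open>A metric is given by its Gram matrices \<open>g x\<close> with respect to the standard coordinate fields.\<close>

type_synonym 'n metric = "real^'n \<Rightarrow> real^'n^'n"

definition ip :: "'n::finite metric \<Rightarrow> real^'n \<Rightarrow> real^'n \<Rightarrow> real^'n \<Rightarrow> real" where
  "ip g x v w = v \<bullet> (g x *v w)"

definition riemannian_metric :: "'n::finite metric \<Rightarrow> bool" where
  "riemannian_metric g \<longleftrightarrow> smooth_on UNIV g \<and>
     (\<forall>x. transpose (g x) = g x) \<and> (\<forall>x v. v \<noteq> 0 \<longrightarrow> ip g x v v > 0)"

definition curve_length :: "'n::finite metric \<Rightarrow> (real \<Rightarrow> real^'n) \<Rightarrow> real" where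
  "curve_length g \<gamma> = integral {0..1}
     (\<lambda>u. sqrt (ip g (\<gamma> u) (vector_derivative \<gamma> (at u)) (vector_derivative \<gamma> (at u))))"

definition riem_dist :: "'n::finite metric \<Rightarrow> real^'n \<Rightarrow> real^'n \<Rightarrow> real" where
  "riem_dist g p q =
     Inf {curve_length g \<gamma> |\<gamma>. \<gamma> C1_differentiable_on {0..1} \<and> \<gamma> 0 = p \<and> \<gamma> 1 = q}"

definition complete_riemannian_metric :: "'n::finite metric \<Rightarrow> bool" where
  "complete_riemannian_metric g \<longleftrightarrow>
     riemannian_metric g \<and> Metric_space.mcomplete UNIV (riem_dist g)"

definition isometry :: "'n::finite metric \<Rightarrow> 'n metric \<Rightarrow> (real^'n \<Rightarrow> real^'n) \<Rightarrow> bool" where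
  "isometry g h \<phi> \<longleftrightarrow> bij \<phi> \<and> smooth_on UNIV \<phi> \<and> smooth_on UNIV (inv \<phi>) \<and>
     (\<forall>x v w. ip h (\<phi> x) (frechet_derivative \<phi> (at x) v) (frechet_derivative \<phi> (at x) w) = ip g x v w)"

definition isometric :: "'n::finite metric \<Rightarrow> 'n metric \<Rightarrow> bool" where
  "isometric g h \<longleftrightarrow> (\<exists>\<phi>. isometry g h \<phi>)"


section \<open>Curvature\<close>

definition pd :: "'n::finite \<Rightarrow> (real^'n \<Rightarrow> real) \<Rightarrow> real^'n \<Rightarrow> real" where
  "pd i f x = frechet_derivative f (at x) (axis i 1)"

text \<open>\<open>christoffel g k i j\<close> is $\Gamma^k_{ij}$.\<close>

definition christoffel :: "'n::finite metric \<Rightarrow> 'n \<Rightarrow> 'n \<Rightarrow> 'n \<Rightarrow> real^'n \<Rightarrow> real" where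
  "christoffel g k i j x = (1/2) * (\<Sum>l\<in>UNIV. matrix_inv (g x) $ k $ l *
     (pd i (\<lambda>y. g y $ j $ l) x + pd j (\<lambda>y. g y $ i $ l) x - pd l (\<lambda>y. g y $ i $ j) x))"

text \<open>
  \<open>riemann g l i j k\<close> is the component $R^l_{ijk}$ in the convention
  $R(\partial_i,\partial_j)\partial_k = \sum_l R^l_{ijk}\,\partial_l$ with
  $R(X,Y)Z = \nabla_X\nabla_Y Z - \nabla_Y\nabla_X Z - \nabla_{[X,Y]}Z$, and
  $\mathrm{Ric}(Y,Z)$ is the trace of $X \mapsto R(X,Y)Z$ (positive on round spheres).
\<close>

definition riemann :: "'n::finite metric \<Rightarrow> 'n \<Rightarrow> 'n \<Rightarrow> 'n \<Rightarrow> 'n \<Rightarrow> real^'n \<Rightarrow> real" where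
  "riemann g l i j k x = pd i (christoffel g l j k) x - pd j (christoffel g l i k) x
     + (\<Sum>p\<in>UNIV. christoffel g p j k x * christoffel g l i p x
                  - christoffel g p i k x * christoffel g l j p x)"

definition ricci :: "'n::finite metric \<Rightarrow> real^'n \<Rightarrow> real^'n^'n" where
  "ricci g x = (\<chi> j k. \<Sum>i\<in>UNIV. riemann g i i j k x)"

definition curvature_norm :: "'n::finite metric \<Rightarrow> real^'n \<Rightarrow> real" where
  "curvature_norm g x = sqrt
     (\<Sum>l\<in>UNIV. \<Sum>i\<in>UNIV. \<Sum>j\<in>UNIV. \<Sum>k\<in>UNIV. \<Sum>l'\<in>UNIV. \<Sum>i'\<in>UNIV. \<Sum>j'\<in>UNIV. \<Sum>k'\<in>UNIV.
        g x $ l $ l' * matrix_inv (g x) $ i $ i' * matrix_inv (g x) $ j $ j' *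
        matrix_inv (g x) $ k $ k' * riemann g l i j k x * riemann g l' i' j' k' x)"

definition ancient_ricci_flow :: "(real \<Rightarrow> 'n::finite metric) \<Rightarrow> bool" where
  "ancient_ricci_flow g \<longleftrightarrow>
     (\<forall>t\<le>0. riemannian_metric (g t)) \<and>
     smooth_on (UNIV \<times> {..0}) (\<lambda>(x, t). g t x) \<and>
     (\<forall>t\<le>0. \<forall>x. ((\<lambda>\<tau>. g \<tau> x) has_vector_derivative (- 2) *\<^sub>R ricci (g t) x) (at t within {..0}))"

definition uniformly_bounded_curvature :: "(real \<Rightarrow> 'n::finite metric) \<Rightarrow> bool" where
  "uniformly_bounded_curvature g \<longleftrightarrow> (\<exists>K. \<forall>t\<le>0. \<forall>x. curvature_norm (g t) x \<le> K)"


section \<open>The group actions on $\mathbb{C}^2$ and the Hopf fibration\<close>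

definition to_C2 :: "real^4 \<Rightarrow> complex^2" where
  "to_C2 x = vector [Complex (x$1) (x$2), Complex (x$3) (x$4)]"

definition of_C2 :: "complex^2 \<Rightarrow> real^4" where
  "of_C2 p = vector [Re (p$1), Im (p$1), Re (p$2), Im (p$2)]"

definition SU2 :: "(complex^2^2) set" where
  "SU2 = {A. (\<chi> i j. cnj (A $ j $ i)) ** A = mat 1 \<and> det A = 1}"

definition su2_action :: "complex^2^2 \<Rightarrow> real^4 \<Rightarrow> real^4" where
  "su2_action A x = of_C2 (A *v to_C2 x)"

definition hopf_rotation :: "real \<Rightarrow> real^4 \<Rightarrow> real^4" where
  "hopf_rotation \<theta> x = of_C2 (cis \<theta> *s to_C2 x)"

text \<open>Both actions are linear, so each map is its own differential.\<close>

definition U2_invariant :: "4 metric \<Rightarrow> bool" where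
  "U2_invariant g \<longleftrightarrow>
     (\<forall>A\<in>SU2. \<forall>x v w. ip g (su2_action A x) (su2_action A v) (su2_action A w) = ip g x v w) \<and>
     (\<forall>\<theta> x v w. ip g (hopf_rotation \<theta> x) (hopf_rotation \<theta> v) (hopf_rotation \<theta> w) = ip g x v w)"

text \<open>
  Identify $(z,w)\in S^3$ with the matrix of $SU(2)$ with columns $(z,w)$ and $(-\bar w,\bar z)$.
  The left-invariant fields generated by the Lie algebra elements
  $((0,-1),(1,0))$, $((0,i),(i,0))$ and $((i,0),(0,-i))$ are the restrictions to $S^3$ of the
  following linear fields; the third is tangent to the Hopf fibres.
\<close>

definition X1 :: "real^4 \<Rightarrow> real^4" where
  "X1 x = of_C2 (vector [- cnj (to_C2 x $ 2), cnj (to_C2 x $ 1)])"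

definition X2 :: "real^4 \<Rightarrow> real^4" where
  "X2 x = of_C2 (vector [- \<i> * cnj (to_C2 x $ 2), \<i> * cnj (to_C2 x $ 1)])"

definition X3 :: "real^4 \<Rightarrow> real^4" where
  "X3 x = of_C2 (\<i> *s to_C2 x)"

text \<open>
  The dual coframe of $S^3$, pulled back to the complement of the origin by $x\mapsto x/|x|$:
  \<open>x\<close>, \<open>X1 x\<close>, \<open>X2 x\<close>, \<open>X3 x\<close> are orthogonal of the same Euclidean norm.
\<close>

definition \<sigma>1 :: "real^4 \<Rightarrow> real^4 \<Rightarrow> real" where "\<sigma>1 x v = (X1 x \<bullet> v) / (x \<bullet> x)"
definition \<sigma>2 :: "real^4 \<Rightarrow> real^4 \<Rightarrow> real" where "\<sigma>2 x v = (X2 x \<bullet> v) / (x \<bullet> x)"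
definition \<sigma>3 :: "real^4 \<Rightarrow> real^4 \<Rightarrow> real" where "\<sigma>3 x v = (X3 x \<bullet> v) / (x \<bullet> x)"

text \<open>
  The Hopf map onto the sphere of radius $1/2$ in $\mathbb{C}\times\mathbb{R}$, precomposed with
  $x\mapsto x/|x|$.
\<close>

definition hopf_map :: "real^4 \<Rightarrow> complex \<times> real" where
  "hopf_map x = (let z = to_C2 x $ 1; w = to_C2 x $ 2 in
     (1 / (x \<bullet> x)) *\<^sub>R (z * cnj w, ((cmod z)\<^sup>2 - (cmod w)\<^sup>2) / 2))"

definition hopf_pullback :: "real^4 \<Rightarrow> real^4 \<Rightarrow> real^4 \<Rightarrow> real" where
  "hopf_pullback x v w =
     frechet_derivative hopf_map (at x) v \<bullet> frechet_derivative hopf_map (at x) w"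


section \<open>Warped Berger metrics\<close>

text \<open>
  The coefficients \<open>b\<close> and \<open>c\<close> are functions of the distance \<open>s \<ge> 0\<close> from the origin. All
  derivatives in \<open>s\<close> are taken within \<open>{0..}\<close>, hence are one-sided at the origin.
\<close>

definition ds :: "(real \<Rightarrow> real) \<Rightarrow> real \<Rightarrow> real" where
  "ds b s = vector_derivative b (at s within {0..})"

definition has_berger_form :: "4 metric \<Rightarrow> (real \<Rightarrow> real) \<Rightarrow> (real \<Rightarrow> real) \<Rightarrow> bool" where
  "has_berger_form g b c \<longleftrightarrow>
     (\<forall>x. x \<noteq> 0 \<longrightarrow> riem_dist g 0 differentiable (at x) \<and>
        (\<forall>v w. ip g x v w =
           frechet_derivative (riem_dist g 0) (at x) v * frechet_derivative (riem_dist g 0) (at x) w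
           + (b (riem_dist g 0 x))\<^sup>2 * hopf_pullback x v w
           + (c (riem_dist g 0 x))\<^sup>2 * (\<sigma>3 x v * \<sigma>3 x w))) \<and>
     (\<forall>s>0. b s > 0 \<and> c s > 0) \<and>
     b 0 = 0 \<and> c 0 = 0 \<and>
     (b has_vector_derivative 1) (at 0 within {0..}) \<and> (c has_vector_derivative 1) (at 0 within {0..})"

definition warped_berger_metric :: "4 metric \<Rightarrow> (real \<Rightarrow> real) \<Rightarrow> (real \<Rightarrow> real) \<Rightarrow> bool" where
  "warped_berger_metric g b c \<longleftrightarrow>
     U2_invariant g \<and> has_berger_form g b c \<and> (\<forall>s>0. c s / b s \<le> 1)"

definition monotone_coefficients :: "(real \<Rightarrow> real) \<Rightarrow> (real \<Rightarrow> real) \<Rightarrow> bool" where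
  "monotone_coefficients b c \<longleftrightarrow> (\<forall>s\<ge>0. ds b s \<ge> 0 \<and> ds c s \<ge> 0)"

text \<open>The quotient \<open>b / c\<close>, extended by its limit at the origin.\<close>

definition bc_ratio :: "(real \<Rightarrow> real) \<Rightarrow> (real \<Rightarrow> real) \<Rightarrow> real \<Rightarrow> real" where
  "bc_ratio b c s = (if s = 0 then 1 else b s / c s)"

text \<open>Only the values of \<open>f\<close> on \<open>{1..}\<close> matter, since \<open>b / c \<ge> 1\<close>.\<close>

definition class_A :: "real \<Rightarrow> (real \<Rightarrow> 4 metric) set" where
  "class_A m = {g.
     ancient_ricci_flow g \<and>
     (\<forall>t\<le>0. complete_riemannian_metric (g t)) \<and>
     uniformly_bounded_curvature g \<and>
     (\<exists>b c f.
        (\<forall>t\<le>0. warped_berger_metric (g t) (b t) (c t) \<and> monotone_coefficients (b t) (c t)) \<and>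
        continuous_on {1..} f \<and> (\<forall>z\<ge>1. f z > (0::real)) \<and> filterlim f at_top at_top \<and>
        (\<forall>t\<le>0. \<forall>s\<ge>0.
           ds (b t) s \<ge> f (bc_ratio (b t) (c t) s) / bc_ratio (b t) (c t) s \<and>
           c t s \<le> inverse m))}"


section \<open>The Taub-NUT metric\<close>

text \<open>
  The radial coordinate of the explicit formula is realised as $|p|^2$; with this choice the
  metric extends smoothly over the origin, where the value below is the limit
  (cf. lemma \<open>taub_nut_closed_form\<close>).
\<close>

definition nut_coord :: "real^4 \<Rightarrow> real" where
  "nut_coord p = p \<bullet> p"

definition taub_nut :: "real \<Rightarrow> 4 metric" where
  "taub_nut \<mu> p = (\<chi> i j.
     (let x = nut_coord p; V = 1 + 2 * inverse \<mu> / x;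
          dx = frechet_derivative nut_coord (at p); v = axis i 1; w = axis j 1 in
      if p = 0 then inverse \<mu> / 2 * (v \<bullet> w)
      else (1/16) * V * (dx v * dx w)
           + x\<^sup>2 / 4 * V * hopf_pullback p v w
           + (inverse \<mu>)\<^sup>2 / V * (\<sigma>3 p v * \<sigma>3 p w)))"


section \<open>Consistency of the explicit formulas\<close>

lemma vector_4 [simp]:
  "(vector [a, b, c, d] :: 'a::zero^4) $ 1 = a"
  "(vector [a, b, c, d] :: 'a::zero^4) $ 2 = b"
  "(vector [a, b, c, d] :: 'a::zero^4) $ 3 = c"
  "(vector [a, b, c, d] :: 'a::zero^4) $ 4 = d"
  unfolding vector_def by simp_all

lemma C2_coords [simp]:
  "to_C2 x $ 1 = Complex (x$1) (x$2)" "to_C2 x $ 2 = Complex (x$3) (x$4)"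
  "of_C2 p $ 1 = Re (p$1)" "of_C2 p $ 2 = Im (p$1)"
  "of_C2 p $ 3 = Re (p$2)" "of_C2 p $ 4 = Im (p$2)"
  by (simp_all add: to_C2_def of_C2_def)

lemma X_coords:
  "X1 x = vector [- x$3, x$4, x$1, - x$2]"
  "X2 x = vector [- x$4, - x$3, x$2, x$1]"
  "X3 x = vector [- x$2, x$1, - x$4, x$3]"
  by (simp_all add: vec_eq_iff forall_4 X1_def X2_def X3_def)

lemma inner_4: "(v::real^4) \<bullet> w = v$1 * w$1 + v$2 * w$2 + v$3 * w$3 + v$4 * w$4"
  by (simp add: inner_vec_def sum_4)

lemma hopf_map_coords:
  "hopf_map x = (1 / (x \<bullet> x)) *\<^sub>R (Complex (x$1 * x$3 + x$2 * x$4) (x$2 * x$3 - x$1 * x$4),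
     (x$1 * x$1 + x$2 * x$2 - x$3 * x$3 - x$4 * x$4) / 2)"
  unfolding hopf_map_def Let_def C2_coords cmod_power2
  by (simp add: complex_eq_iff power2_eq_square algebra_simps diff_divide_distrib add_divide_distrib)

lemma hopf_map_in_sphere:
  assumes "x \<noteq> 0"
  shows "norm (hopf_map x) = 1/2"
proof -
  define q :: "complex \<times> real" where
    "q = (Complex (x$1 * x$3 + x$2 * x$4) (x$2 * x$3 - x$1 * x$4),
     (x$1 * x$1 + x$2 * x$2 - x$3 * x$3 - x$4 * x$4) / 2)"
  have "q \<bullet> q = ((x \<bullet> x) / 2)\<^sup>2"
    by (simp add: q_def inner_prod_def inner_complex_def inner_4 power2_eq_square field_simps)
  then have "norm q = (x \<bullet> x) / 2"
    by (simp add: norm_eq_sqrt_inner)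
  then show ?thesis
    using assms by (simp add: hopf_map_coords q_def[symmetric])
qed

lemma hopf_map_derivative:
  assumes "x \<noteq> 0"
  shows "(hopf_map has_derivative (\<lambda>v.
     (- 2 * (x \<bullet> v) / (x \<bullet> x)\<^sup>2) *\<^sub>R (Complex (x$1 * x$3 + x$2 * x$4) (x$2 * x$3 - x$1 * x$4),
       (x$1 * x$1 + x$2 * x$2 - x$3 * x$3 - x$4 * x$4) / 2)
     + (1 / (x \<bullet> x)) *\<^sub>R (Complex (x$1 * v$3 + v$1 * x$3 + x$2 * v$4 + v$2 * x$4)
         (x$2 * v$3 + v$2 * x$3 - x$1 * v$4 - v$1 * x$4),
         x$1 * v$1 + x$2 * v$2 - x$3 * v$3 - x$4 * v$4))) (at x)"
proof -
  have coord: "((\<lambda>y::real^4. y $ i) has_derivative (\<lambda>v. v $ i)) (at x)" for i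
    by (rule bounded_linear_imp_has_derivative[OF bounded_linear_vec_nth])
  have cplx: "Complex a b = of_real a + \<i> * of_real b" for a b
    by (simp add: complex_eq_iff)
  have N: "((\<lambda>y. 1 / (y \<bullet> y)) has_derivative (\<lambda>v. - 2 * (x \<bullet> v) / (x \<bullet> x)\<^sup>2)) (at x)"
  proof -
    have "((\<lambda>y. y \<bullet> y) has_derivative (\<lambda>v. 2 * (x \<bullet> v))) (at x)"
      using has_derivative_inner[OF has_derivative_ident has_derivative_ident, of x UNIV]
      by (simp add: inner_commute)
    then have "((\<lambda>y. inverse (y \<bullet> y)) has_derivative
        (\<lambda>v. - (inverse (x \<bullet> x) * (2 * (x \<bullet> v)) * inverse (x \<bullet> x)))) (at x)"
      using assms by (intro Deriv.has_derivative_inverse) simp_all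
    then show ?thesis
      by (simp add: divide_inverse power2_eq_square ac_simps)
  qed
  have Re_part: "((\<lambda>y::real^4. y$1 * y$3 + y$2 * y$4) has_derivative
      (\<lambda>v. x$1 * v$3 + v$1 * x$3 + x$2 * v$4 + v$2 * x$4)) (at x)"
    by (rule derivative_eq_intros coord refl)+ (simp add: fun_eq_iff)
  have Im_part: "((\<lambda>y::real^4. y$2 * y$3 - y$1 * y$4) has_derivative
      (\<lambda>v. x$2 * v$3 + v$2 * x$3 - x$1 * v$4 - v$1 * x$4)) (at x)"
    by (rule derivative_eq_intros coord refl)+ (simp add: fun_eq_iff)
  have snd_part: "((\<lambda>y::real^4. (y$1 * y$1 + y$2 * y$2 - y$3 * y$3 - y$4 * y$4) / 2) has_derivative
      (\<lambda>v. x$1 * v$1 + x$2 * v$2 - x$3 * v$3 - x$4 * v$4)) (at x)"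
    by (rule derivative_eq_intros coord refl | simp)+ (simp add: fun_eq_iff field_simps)
  have h: "((\<lambda>y::real^4. (Complex (y$1 * y$3 + y$2 * y$4) (y$2 * y$3 - y$1 * y$4),
       (y$1 * y$1 + y$2 * y$2 - y$3 * y$3 - y$4 * y$4) / 2)) has_derivative
     (\<lambda>v. (Complex (x$1 * v$3 + v$1 * x$3 + x$2 * v$4 + v$2 * x$4)
         (x$2 * v$3 + v$2 * x$3 - x$1 * v$4 - v$1 * x$4),
         x$1 * v$1 + x$2 * v$2 - x$3 * v$3 - x$4 * v$4))) (at x)"
    unfolding cplx
    by (intro has_derivative_Pair has_derivative_add has_derivative_of_real has_derivative_mult_right
        Re_part Im_part snd_part)
  show ?thesis
    unfolding hopf_map_coords
    using has_derivative_scaleR[OF N h] by (simp only: add.commute)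
qed

lemma frame_identity:
  "(x \<bullet> x) * (v \<bullet> w) =
     (x \<bullet> v) * (x \<bullet> w) + (X1 x \<bullet> v) * (X1 x \<bullet> w) + (X2 x \<bullet> v) * (X2 x \<bullet> w) + (X3 x \<bullet> v) * (X3 x \<bullet> w)"
  by (simp add: X_coords inner_4 algebra_simps)

lemma hopf_pullback_eq:
  assumes "x \<noteq> 0"
  shows "hopf_pullback x v w = \<sigma>1 x v * \<sigma>1 x w + \<sigma>2 x v * \<sigma>2 x w"
proof -
  define h :: "complex \<times> real" where
    "h = (Complex (x$1 * x$3 + x$2 * x$4) (x$2 * x$3 - x$1 * x$4),
       (x$1 * x$1 + x$2 * x$2 - x$3 * x$3 - x$4 * x$4) / 2)"
  define D :: "real^4 \<Rightarrow> complex \<times> real" where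
    "D v = (Complex (x$1 * v$3 + v$1 * x$3 + x$2 * v$4 + v$2 * x$4)
         (x$2 * v$3 + v$2 * x$3 - x$1 * v$4 - v$1 * x$4),
         x$1 * v$1 + x$2 * v$2 - x$3 * v$3 - x$4 * v$4)" for v
  define N where "N = x \<bullet> x"
  have N: "N \<noteq> 0" using assms by (simp add: N_def)
  define r where "r = 1 / N"
  have rN: "r * N = 1" using N by (simp add: r_def)
  have der: "frechet_derivative hopf_map (at x) v = (- 2 * (x \<bullet> v) * (r * r)) *\<^sub>R h + r *\<^sub>R D v" for v
    using frechet_derivative_at[OF hopf_map_derivative[OF assms], symmetric]
    by (simp add: h_def D_def N_def r_def power2_eq_square)
  have hh: "h \<bullet> h = N * N / 4"
    by (simp add: h_def N_def inner_prod_def inner_complex_def inner_4 power2_eq_square field_simps)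
  have hD: "h \<bullet> D v = N * (x \<bullet> v) / 2" for v
    by (simp add: h_def D_def N_def inner_prod_def inner_complex_def inner_4 field_simps)
  have DD: "D v \<bullet> D w = (x \<bullet> v) * (x \<bullet> w) + (X1 x \<bullet> v) * (X1 x \<bullet> w) + (X2 x \<bullet> v) * (X2 x \<bullet> w)"
    by (simp add: D_def X_coords inner_prod_def inner_complex_def inner_4 algebra_simps)
  have "hopf_pullback x v w = (2 * (x \<bullet> v) * (r * r)) * (2 * (x \<bullet> w) * (r * r)) * (h \<bullet> h)
      - (2 * (x \<bullet> v) * (r * r)) * r * (h \<bullet> D w) - (2 * (x \<bullet> w) * (r * r)) * r * (h \<bullet> D v)
      + r * r * (D v \<bullet> D w)"
    unfolding hopf_pullback_def der inner_add_left inner_add_right inner_scaleR_left inner_scaleR_right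
      inner_commute[of "D v" h]
    by algebra
  also have "\<dots> = (r * r) * ((X1 x \<bullet> v) * (X1 x \<bullet> w) + (X2 x \<bullet> v) * (X2 x \<bullet> w))"
  proof -
    have "(2 * p * (r * r)) * (2 * q * (r * r)) * (N * N / 4) - (2 * p * (r * r)) * r * (N * q / 2)
        - (2 * q * (r * r)) * r * (N * p / 2) + r * r * (p * q + y + z) = (r * r) * (y + z)"
      for p q y z
    proof -
      have e1: "(2 * p * (r * r)) * (2 * q * (r * r)) * (N * N / 4) = p * q * (r * r) * (r * N) * (r * N)"
        and e2: "(2 * p * (r * r)) * r * (N * q / 2) = p * q * (r * r) * (r * N)"
        and e3: "(2 * q * (r * r)) * r * (N * p / 2) = p * q * (r * r) * (r * N)"
        by simp_all
      show ?thesis unfolding e1 e2 e3 rN by (simp add: algebra_simps)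
    qed
    from this[of "x \<bullet> v" "x \<bullet> w" "(X1 x \<bullet> v) * (X1 x \<bullet> w)" "(X2 x \<bullet> v) * (X2 x \<bullet> w)"]
    show ?thesis unfolding hh hD DD by (simp only: add.assoc)
  qed
  also have "\<dots> = \<sigma>1 x v * \<sigma>1 x w + \<sigma>2 x v * \<sigma>2 x w"
    by (simp add: \<sigma>1_def \<sigma>2_def N_def r_def add_divide_distrib)
  finally show ?thesis .
qed

lemma taub_nut_closed_form:
  assumes "\<mu> > 0"
  shows "taub_nut \<mu> p = (\<chi> i j. ((p \<bullet> p) + 2 / \<mu>) / 4 * (if i = j then 1 else 0)
     - ((p \<bullet> p) + 4 / \<mu>) / (4 * ((p \<bullet> p) + 2 / \<mu>)) * X3 p $ i * X3 p $ j)"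
proof (cases "p = 0")
  case True
  then have "X3 p = 0"
    by (simp add: X_coords vec_eq_iff forall_4)
  with True show ?thesis
    by (auto simp: taub_nut_def Let_def vec_eq_iff inner_axis_axis divide_simps)
next
  case False
  define N where "N = p \<bullet> p"
  define k where "k = 1 / \<mu>"
  have N: "N > 0" using False by (simp add: N_def)
  have k: "k > 0" using assms by (simp add: k_def)
  have "(nut_coord has_derivative (\<lambda>v. 2 * (p \<bullet> v))) (at p)"
    unfolding nut_coord_def
    by (rule derivative_eq_intros refl)+ (simp add: fun_eq_iff inner_commute)
  then have dx: "frechet_derivative nut_coord (at p) = (\<lambda>v. 2 * (p \<bullet> v))"
    by (rule frechet_derivative_at[symmetric])
  have main: "(1/16) * (1 + 2 * k / N) * (2 * (p \<bullet> v) * (2 * (p \<bullet> w)))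
           + N\<^sup>2 / 4 * (1 + 2 * k / N) * hopf_pullback p v w
           + k\<^sup>2 / (1 + 2 * k / N) * (\<sigma>3 p v * \<sigma>3 p w)
      = (N + 2 * k) / 4 * (v \<bullet> w)
        - (N + 4 * k) / (4 * (N + 2 * k)) * (X3 p \<bullet> v) * (X3 p \<bullet> w)" for v w
  proof -
    define P where "P = (X3 p \<bullet> v) * (X3 p \<bullet> w)"
    have hp: "hopf_pullback p v w = (N * (v \<bullet> w) - (p \<bullet> v) * (p \<bullet> w) - P) / N\<^sup>2"
      using frame_identity[of p v w]
      by (simp add: hopf_pullback_eq[OF False] \<sigma>1_def \<sigma>2_def N_def P_def power2_eq_square
          add_divide_distrib[symmetric])
    have s3: "\<sigma>3 p v * \<sigma>3 p w = P / N\<^sup>2"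
      by (simp add: \<sigma>3_def N_def P_def power2_eq_square)
    have V: "1 + 2 * k / N = (N + 2 * k) / N"
      using N by (simp add: field_simps)
    have nz: "N \<noteq> 0" "N + 2 * k \<noteq> 0" using N k by auto
    have c: "k\<^sup>2 / ((N + 2 * k) / N) * (P / N\<^sup>2) = k\<^sup>2 * P / (N * (N + 2 * k))"
      using nz by (simp add: power2_eq_square ac_simps)
    have "(1/16) * ((N + 2 * k) / N) * (2 * (p \<bullet> v) * (2 * (p \<bullet> w)))
           + N\<^sup>2 / 4 * ((N + 2 * k) / N) * ((N * (v \<bullet> w) - (p \<bullet> v) * (p \<bullet> w) - P) / N\<^sup>2)
         = (N + 2 * k) / 4 * (v \<bullet> w) - (N + 2 * k) / (4 * N) * P"
      using nz by (simp add: divide_simps) (simp add: algebra_simps)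
    moreover have "(N + 2 * k) / (4 * N) * P - k\<^sup>2 * P / (N * (N + 2 * k))
         = (N + 4 * k) / (4 * (N + 2 * k)) * P"
      using nz by (simp add: divide_simps) (simp add: algebra_simps power2_eq_square)
    ultimately show ?thesis
      unfolding hp s3 V c by (simp add: P_def mult.assoc)
  qed
  have mu: "inverse \<mu> = k" "2 / \<mu> = 2 * k" "4 / \<mu> = 4 * k"
    by (simp_all add: k_def divide_inverse)
  have ax: "axis i 1 \<bullet> axis j (1::real) = (if i = j then 1 else 0)" for i j :: 4
    by (simp add: inner_axis_axis)
  have X: "X3 p \<bullet> axis i 1 = X3 p $ i" for i
    by (simp add: inner_axis)
  have "taub_nut \<mu> p $ i $ j = (N + 2 * k) / 4 * (if i = j then 1 else 0)
        - (N + 4 * k) / (4 * (N + 2 * k)) * X3 p $ i * X3 p $ j" for i j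
    using main[of "axis i 1" "axis j 1"] unfolding ax X
    by (simp only: taub_nut_def Let_def dx nut_coord_def N_def[symmetric] mu vec_lambda_beta False if_False)
  then show ?thesis
    by (simp only: vec_eq_iff vec_lambda_beta N_def[symmetric] mu simp_thms)
qed

end

theory Submission
  imports Defs
begin

text \<open>
  Write $u = c/b$, $w = b_s + u$ and $P = c_s - u^2$. Taub-NUT metrics are characterised by $w = 2$, $P = 0$, and a metric with
  these relations is stationary under the flow. By invariance the flow reduces to a parabolic system for $b$ and $c$ along a ray, in
  a fixed radial coordinate. Ancientness turns maximum principle estimates with initial time $T_0 \to -\infty$ into sharp bounds:
  first $u_s \le 0$, then $w \le 2$ and $P \le 0$. Conversely, the lower bound on $b_s$ makes $w/u$ large where $u$ is small, while
  $b$ is bounded where $u$ is not small because $c$ is; hence the barriers $w > 2\kappa u/(1+\kappa u)$ and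
  $P > -2u/(1+\kappa u)$ survive when $\kappa$ is increased slowly from $1/2$ to any prescribed value over a long time
  interval, and letting $\kappa \to \infty$ gives $w \ge 2$, $P \ge 0$. Finally $(1-u)/c^2$ is constant along the ray; its value
  is the squared mass, and $x \mapsto \psi(|x|)\,x$ with $\psi^2 |x|^2 = 2\mu\, b c$ is an isometry onto the Taub-NUT metric.
\<close>

section \<open>Smooth functions\<close>

text \<open>The equations for \<open>w\<close> and \<open>P\<close> are coupled: the reaction term
  of \<open>w\<close> contains \<open>2 P - P^2 / u^2\<close>, that of \<open>P\<close> contains
  \<open>w^2 - 4\<close>. Hence neither can be bounded alone: the upper bounds come from a
  self-improving pair of estimates, and the lower barriers are tested at the first time at which
  either is touched. With \<open>e = 2 / (1 + \<kappa> u)\<close> these barriers are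
  \<open>w = 2 - e\<close> and \<open>P = - u e\<close>; the slope \<open>2 \<kappa>\<close> of the
  first at \<open>u = 0\<close> is what the growth of \<open>f\<close> beats. The obstacle to every
  comparison is that the reaction terms carry the factor \<open>1 / b^2\<close>, which is lost at
  infinity, and that no initial values are known. Values on the axis are prescribed. Far out, either
  a small multiple of \<open>1 + b^2\<close> dominates, by the curvature bound, or the inequality is
  trivial because \<open>u\<close> is small. Unbounded initial values are absorbed by
  \<open>1 / sqrt (2 (t - T0))\<close>, which is infinite at \<open>T0\<close>. The sign of
  \<open>u_s\<close> is needed early because it gives \<open>c_s \<le> u b_s\<close>, which bounds
  \<open>P\<close> from above and fixes the sign of the gradient terms on the barrier for
  \<open>w\<close>.\<close>

lemma Ck_on_subset: "Ck_on k S f \<Longrightarrow> T \<subseteq> S \<Longrightarrow> Ck_on k T f"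
proof (induction k arbitrary: f)
  case 0 then show ?case by (simp add: continuous_on_subset)
next
  case (Suc k)
  then obtain f' where "\<forall>x\<in>S. (f has_derivative f' x) (at x within S)" "\<forall>v. Ck_on k S (\<lambda>x. f' x v)" by auto
  then have "\<forall>x\<in>T. (f has_derivative f' x) (at x within T)" "\<forall>v. Ck_on k T (\<lambda>x. f' x v)"
    using Suc(1) Suc.prems(2) has_derivative_subset by blast+
  then show ?case by auto
qed

lemma Ck_on_SucD: "Ck_on (Suc k) S f \<Longrightarrow> Ck_on k S f"
proof (induction k arbitrary: f)
  case 0
  then show ?case by (auto simp: continuous_on_eq_continuous_within intro: has_derivative_continuous)
next
  case (Suc k)
  from Suc.prems obtain f' where f': "\<forall>x\<in>S. (f has_derivative f' x) (at x within S)" "\<forall>v. Ck_on (Suc k) S (\<lambda>x. f' x v)"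
    by (subst (asm) Ck_on.simps(2)) blast
  have "Ck_on k S (\<lambda>x. f' x v)" for v using Suc.IH f'(2) by blast
  then show ?case using f'(1) by (subst Ck_on.simps(2)) blast
qed

lemma Ck_on_SucE:
  assumes "Ck_on (Suc k) S f"
  obtains f' where "\<And>x. x \<in> S \<Longrightarrow> (f has_derivative f' x) (at x within S)" "\<And>v. Ck_on k S (\<lambda>x. f' x v)"
proof -
  from assms obtain f' where "\<forall>x\<in>S. (f has_derivative f' x) (at x within S)" "\<forall>v. Ck_on k S (\<lambda>x. f' x v)"
    by (subst (asm) Ck_on.simps(2)) blast
  then show thesis by (intro that[of f']) auto
qed

lemma Ck_on_SucI:
  assumes "\<And>x. x \<in> S \<Longrightarrow> (f has_derivative f' x) (at x within S)" "\<And>v. Ck_on k S (\<lambda>x. f' x v)"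
  shows "Ck_on (Suc k) S f"
  by (subst Ck_on.simps(2)) (rule exI[of _ f'], use assms in blast)

lemma Ck_on_cong: "Ck_on k S f \<Longrightarrow> (\<And>x. x \<in> S \<Longrightarrow> f x = g x) \<Longrightarrow> Ck_on k S g"
proof (cases k)
  case 0 assume "Ck_on k S f" "\<And>x. x \<in> S \<Longrightarrow> f x = g x"
  then show ?thesis using 0 continuous_on_cong[of S S f g] by auto
next
  case (Suc n) assume a: "Ck_on k S f" "\<And>x. x \<in> S \<Longrightarrow> f x = g x"
  from a(1)[unfolded Suc] obtain f' where f': "\<And>x. x \<in> S \<Longrightarrow> (f has_derivative f' x) (at x within S)" "\<And>v. Ck_on n S (\<lambda>x. f' x v)"
    by (rule Ck_on_SucE) blast
  have "(g has_derivative f' x) (at x within S)" if "x \<in> S" for x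
    by (rule has_derivative_transform[OF that _ f'(1)[OF that]]) (simp add: a(2))
  then show ?thesis unfolding Suc using f'(2) by (rule Ck_on_SucI)
qed

lemma Ck_on_const: "Ck_on k S (\<lambda>x. c)"
proof (induction k arbitrary: c)
  case (Suc k)
  show ?case by (rule Ck_on_SucI[of _ _ "\<lambda>x v. 0"]) (use Suc in auto)
qed simp

lemma Ck_on_linear: assumes "bounded_linear f" shows "Ck_on k S f"
proof (cases k)
  case 0 then show ?thesis using assms by (simp add: linear_continuous_on)
next
  case (Suc n)
  show ?thesis unfolding Suc
    by (rule Ck_on_SucI[of _ _ "\<lambda>x. f"]) (use assms Ck_on_const bounded_linear_imp_has_derivative in auto)
qed

lemma Ck_on_add: "Ck_on k S f \<Longrightarrow> Ck_on k S g \<Longrightarrow> Ck_on k S (\<lambda>x. f x + g x)"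
proof (induction k arbitrary: f g)
  case 0 then show ?case by (simp add: continuous_on_add)
next
  case (Suc k)
  obtain f' where f': "\<And>x. x \<in> S \<Longrightarrow> (f has_derivative f' x) (at x within S)" "\<And>v. Ck_on k S (\<lambda>x. f' x v)"
    using Ck_on_SucE[OF Suc.prems(1)] by metis
  obtain g' where g': "\<And>x. x \<in> S \<Longrightarrow> (g has_derivative g' x) (at x within S)" "\<And>v. Ck_on k S (\<lambda>x. g' x v)"
    using Ck_on_SucE[OF Suc.prems(2)] by metis
  show ?case
    by (rule Ck_on_SucI[of _ _ "\<lambda>x v. f' x v + g' x v"])
      (simp_all add: has_derivative_add f' g' Suc.IH)
qed

lemma Ck_on_bilinear:
  assumes "bounded_bilinear B"
  shows "Ck_on k S f \<Longrightarrow> Ck_on k S g \<Longrightarrow> Ck_on k S (\<lambda>x. B (f x) (g x))"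
proof (induction k arbitrary: f g)
  case 0 then show ?case by (simp add: bounded_bilinear.continuous_on[OF assms])
next
  case (Suc k)
  obtain f' where f': "\<And>x. x \<in> S \<Longrightarrow> (f has_derivative f' x) (at x within S)" "\<And>v. Ck_on k S (\<lambda>x. f' x v)"
    using Ck_on_SucE[OF Suc.prems(1)] by metis
  obtain g' where g': "\<And>x. x \<in> S \<Longrightarrow> (g has_derivative g' x) (at x within S)" "\<And>v. Ck_on k S (\<lambda>x. g' x v)"
    using Ck_on_SucE[OF Suc.prems(2)] by metis
  show ?case
  proof (rule Ck_on_SucI)
    show "((\<lambda>x. B (f x) (g x)) has_derivative (\<lambda>v. B (f x) (g' x v) + B (f' x v) (g x))) (at x within S)" if "x \<in> S" for x
      by (rule bounded_bilinear.FDERIV[OF assms f'(1) g'(1)]) (use that in auto)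
    show "Ck_on k S (\<lambda>x. B (f x) (g' x v) + B (f' x v) (g x))" for v
      by (intro Ck_on_add Suc.IH f' g' Ck_on_SucD[OF Suc.prems(1)] Ck_on_SucD[OF Suc.prems(2)])
  qed
qed

lemmas Ck_on_mult = Ck_on_bilinear[OF bounded_bilinear_mult]
  and Ck_on_scaleR = Ck_on_bilinear[OF bounded_bilinear_scaleR]

lemma Ck_on_linear_comp: "bounded_linear L \<Longrightarrow> Ck_on k S f \<Longrightarrow> Ck_on k S (\<lambda>x. L (f x))"
proof (induction k arbitrary: f)
  case 0 then show ?case by (simp add: bounded_linear.continuous_on)
next
  case (Suc k)
  obtain f' where f': "\<And>x. x \<in> S \<Longrightarrow> (f has_derivative f' x) (at x within S)" "\<And>v. Ck_on k S (\<lambda>x. f' x v)"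
    using Ck_on_SucE[OF Suc.prems(2)] by metis
  show ?case
    by (rule Ck_on_SucI[of _ _ "\<lambda>x v. L (f' x v)"])
      (simp_all add: bounded_linear.has_derivative[OF Suc.prems(1)] f' Suc.IH[OF Suc.prems(1)])
qed

text \<open>The inner map has the constant derivative \<open>L\<close>, so the derivative of the
  composition in direction \<open>v\<close> is \<open>f' (L x + p) (L v)\<close>, again a
  composition with the same affine map, and the induction closes. Restriction to a ray is of this
  kind.\<close>

lemma Ck_on_comp_affine:
  assumes "bounded_linear L" "(\<lambda>x. L x + p) ` S \<subseteq> T"
  shows "Ck_on k T f \<Longrightarrow> Ck_on k S (\<lambda>x. f (L x + p))"
proof (induction k arbitrary: f)
  case 0
  have "continuous_on S (\<lambda>x. L x + p)" using assms by (intro continuous_intros linear_continuous_on)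
  with 0 show ?case using continuous_on_compose2[of T f S "\<lambda>x. L x + p"] assms by simp
next
  case (Suc k)
  obtain f' where f': "\<And>x. x \<in> T \<Longrightarrow> (f has_derivative f' x) (at x within T)" "\<And>v. Ck_on k T (\<lambda>x. f' x v)"
    using Ck_on_SucE[OF Suc.prems] by metis
  show ?case
  proof (rule Ck_on_SucI)
    fix x assume x: "x \<in> S"
    have d: "((\<lambda>x. L x + p) has_derivative L) (at x within S)"
      by (rule has_derivative_add_const[OF bounded_linear_imp_has_derivative[OF assms(1)]])
    have "L x + p \<in> T" using assms(2) x by auto
    then have "(f has_derivative f' (L x + p)) (at (L x + p) within (\<lambda>x. L x + p) ` S)"
      by (rule has_derivative_subset[OF f'(1) assms(2)])
    from diff_chain_within[OF d this]
    show "((\<lambda>x. f (L x + p)) has_derivative (\<lambda>v. f' (L x + p) (L v))) (at x within S)" by (simp only: o_def)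
  next
    show "Ck_on k S (\<lambda>x. f' (L x + p) (L v))" for v by (rule Suc.IH[OF f'(2)])
  qed
qed

lemma Ck_on_realI:
  assumes "\<And>x. x \<in> S \<Longrightarrow> (f has_real_derivative g x) (at x within S)" "Ck_on k S g"
  shows "Ck_on (Suc k) S f"
proof (rule Ck_on_SucI)
  show "(f has_derivative (\<lambda>v. g x * v)) (at x within S)" if "x \<in> S" for x
    using assms(1)[OF that] unfolding has_field_derivative_def .
  show "Ck_on k S (\<lambda>x. g x * v)" for v by (rule Ck_on_mult[OF assms(2) Ck_on_const])
qed

section \<open>Composition with functions of one real variable\<close>

lemma Ck_on_realD:
  assumes "Ck_on (Suc k) S (f :: real \<Rightarrow> real)"
  obtains g where "\<And>x. x \<in> S \<Longrightarrow> (f has_real_derivative g x) (at x within S)" "Ck_on k S g"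
proof -
  obtain f' where f': "\<And>x. x \<in> S \<Longrightarrow> (f has_derivative f' x) (at x within S)" "\<And>v. Ck_on k S (\<lambda>x. f' x v)"
    using Ck_on_SucE[OF assms] by metis
  show thesis
  proof (rule that)
    fix x assume "x \<in> S"
    then have d: "(f has_derivative f' x) (at x within S)" by (rule f'(1))
    have "f' x v = f' x 1 * v" for v
      using linear_scale[OF has_derivative_linear[OF d], of v 1] by simp
    then have "f' x = (*) (f' x 1)" by (rule ext)
    with d show "(f has_real_derivative f' x 1) (at x within S)" unfolding has_field_derivative_def by simp
  next
    show "Ck_on k S (\<lambda>x. f' x 1)" by (rule f'(2))
  qed
qed

text \<open>For an outer function of one variable the chain rule gives the product of
  \<open>g (h x)\<close> and \<open>h' x v\<close>; the first factor is a composition of the same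
  kind one order lower, so product rule and induction suffice.\<close>

lemma Ck_on_comp_real:
  fixes f :: "real \<Rightarrow> real"
  assumes "h ` S \<subseteq> T"
  shows "Ck_on k T f \<Longrightarrow> Ck_on k S h \<Longrightarrow> Ck_on k S (\<lambda>x. f (h x))"
proof (induction k arbitrary: f)
  case 0 then show ?case using continuous_on_compose2[of T f S h] assms by auto
next
  case (Suc k)
  obtain g where g: "\<And>x. x \<in> T \<Longrightarrow> (f has_real_derivative g x) (at x within T)" "Ck_on k T g"
    using Ck_on_realD[OF Suc.prems(1)] by metis
  obtain h' where h': "\<And>x. x \<in> S \<Longrightarrow> (h has_derivative h' x) (at x within S)" "\<And>v. Ck_on k S (\<lambda>x. h' x v)"
    using Ck_on_SucE[OF Suc.prems(2)] by metis
  show ?case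
  proof (rule Ck_on_SucI)
    fix x assume x: "x \<in> S"
    then have "h x \<in> T" using assms by auto
    then have "(f has_derivative (*) (g (h x))) (at (h x) within h ` S)"
      using has_derivative_subset[OF g(1)[unfolded has_field_derivative_def] assms] by blast
    from diff_chain_within[OF h'(1)[OF x] this]
    show "((\<lambda>x. f (h x)) has_derivative (\<lambda>v. g (h x) * h' x v)) (at x within S)" by (simp only: o_def)
  next
    show "Ck_on k S (\<lambda>x. g (h x) * h' x v)" for v
      by (rule Ck_on_mult[OF Suc.IH[OF g(2) Ck_on_SucD[OF Suc.prems(2)]] h'(2)])
  qed
qed

text \<open>The derivative is minus the square of the function itself, so each order follows from
  the one before.\<close>

lemma Ck_on_inverse: "Ck_on k (- {0}) (inverse :: real \<Rightarrow> real)"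
proof (induction k)
  case 0 show ?case by (auto intro!: continuous_intros)
next
  case (Suc k)
  show ?case
  proof (rule Ck_on_realI)
    show "(inverse has_real_derivative (-1) * (inverse x * inverse x)) (at x within - {0})" if "x \<in> - {0}" for x :: real
      using has_field_derivative_at_within[OF DERIV_inverse[of x]] that by (simp add: power2_eq_square)
    show "Ck_on k (- {0}) (\<lambda>x. (-1) * (inverse x * inverse x :: real))"
      by (intro Ck_on_mult Ck_on_const Suc)
  qed
qed

lemma Ck_on_sqrt: "Ck_on k {0<..} sqrt"
proof (induction k)
  case 0 show ?case by (auto intro!: continuous_intros)
next
  case (Suc k)
  show ?case
  proof (rule Ck_on_realI)
    show "(sqrt has_real_derivative inverse (sqrt x) * (1/2)) (at x within {0<..})" if "x \<in> {0<..}" for x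
      using has_field_derivative_at_within[OF DERIV_real_sqrt[of x]] that by simp
    show "Ck_on k {0<..} (\<lambda>x. inverse (sqrt x) * (1/2))"
      by (rule Ck_on_mult[OF Ck_on_comp_real[OF _ Ck_on_inverse Suc] Ck_on_const]) auto
  qed
qed

section \<open>Closure properties of smooth maps\<close>

lemma smooth_on_Ck: "smooth_on S f \<Longrightarrow> Ck_on k S f" by (simp add: smooth_on_def)

named_theorems smooth

lemma smooth_on_subset: "smooth_on S f \<Longrightarrow> T \<subseteq> S \<Longrightarrow> smooth_on T f"
  by (auto simp: smooth_on_def intro: Ck_on_subset)

lemma smooth_on_const [smooth]: "smooth_on S (\<lambda>x. c)"
  by (simp add: smooth_on_def Ck_on_const)

lemma smooth_on_linear: "bounded_linear f \<Longrightarrow> smooth_on S f"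
  by (simp add: smooth_on_def Ck_on_linear)

lemma smooth_on_id [smooth]: "smooth_on S (\<lambda>x. x)"
  by (rule smooth_on_linear) simp

lemma smooth_on_fst [smooth]: "smooth_on S fst"
  by (simp add: smooth_on_linear bounded_linear_fst)

lemma smooth_on_add [smooth]: "smooth_on S f \<Longrightarrow> smooth_on S g \<Longrightarrow> smooth_on S (\<lambda>x. f x + g x)"
  by (simp add: smooth_on_def Ck_on_add)

lemma smooth_on_mult [smooth]: fixes f g :: "_ \<Rightarrow> real"
  shows "smooth_on S f \<Longrightarrow> smooth_on S g \<Longrightarrow> smooth_on S (\<lambda>x. f x * g x)"
  by (simp add: smooth_on_def Ck_on_mult)

lemma smooth_on_minus [smooth]: fixes f g :: "_ \<Rightarrow> real"
  shows "smooth_on S f \<Longrightarrow> smooth_on S (\<lambda>x. - f x)"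
  using smooth_on_mult[OF smooth_on_const[of S "-1"], of f] by simp

lemma smooth_on_diff [smooth]: fixes f g :: "_ \<Rightarrow> real"
  shows "smooth_on S f \<Longrightarrow> smooth_on S g \<Longrightarrow> smooth_on S (\<lambda>x. f x - g x)"
  using smooth_on_add[OF _ smooth_on_minus, of S f g] by simp

lemma smooth_on_scaleR [smooth]: "smooth_on S f \<Longrightarrow> smooth_on S g \<Longrightarrow> smooth_on S (\<lambda>x. f x *\<^sub>R g x)"
  by (simp add: smooth_on_def Ck_on_scaleR)

lemma smooth_on_linear_comp: "bounded_linear L \<Longrightarrow> smooth_on S f \<Longrightarrow> smooth_on S (\<lambda>x. L (f x))"
  by (simp add: smooth_on_def Ck_on_linear_comp)

lemma smooth_on_vec_nth [smooth]: "smooth_on S f \<Longrightarrow> smooth_on S (\<lambda>x. f x $ i)"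
  by (rule smooth_on_linear_comp[OF bounded_linear_vec_nth])

lemma smooth_on_comp_affine:
  "bounded_linear L \<Longrightarrow> smooth_on T f \<Longrightarrow> (\<lambda>x. L x + p) ` S \<subseteq> T \<Longrightarrow> smooth_on S (\<lambda>x. f (L x + p))"
  by (simp add: smooth_on_def Ck_on_comp_affine)

lemma smooth_on_comp_real:
  fixes f :: "real \<Rightarrow> real"
  shows "smooth_on T f \<Longrightarrow> smooth_on S h \<Longrightarrow> h ` S \<subseteq> T \<Longrightarrow> smooth_on S (\<lambda>x. f (h x))"
  by (simp add: smooth_on_def Ck_on_comp_real)

lemma smooth_on_inverse [smooth]: "smooth_on S h \<Longrightarrow> (\<And>x. x \<in> S \<Longrightarrow> h x \<noteq> 0) \<Longrightarrow> smooth_on S (\<lambda>x. inverse (h x :: real))"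
  by (rule smooth_on_comp_real[where f = inverse and T = "-{0}"]) (auto simp: smooth_on_def Ck_on_inverse)

lemma smooth_on_divide [smooth]: "smooth_on S f \<Longrightarrow> smooth_on S h \<Longrightarrow> (\<And>x. x \<in> S \<Longrightarrow> h x \<noteq> 0) \<Longrightarrow> smooth_on S (\<lambda>x. f x / h x :: real)"
  unfolding divide_inverse by (intro smooth_on_mult smooth_on_inverse) auto

lemma smooth_on_sqrt [smooth]: "smooth_on S h \<Longrightarrow> (\<And>x. x \<in> S \<Longrightarrow> h x > 0) \<Longrightarrow> smooth_on S (\<lambda>x. sqrt (h x))"
  by (rule smooth_on_comp_real[where f = sqrt and T = "{0<..}"]) (auto simp: smooth_on_def Ck_on_sqrt)

text \<open>The derivative asserted by \<open>Ck_on\<close> may depend on the order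
  \<open>k\<close>; uniqueness identifies all of them with \<open>deriv f\<close>.\<close>

lemma smooth_on_realD:
  assumes "smooth_on UNIV (f :: real \<Rightarrow> real)"
  shows "(f has_real_derivative deriv f x) (at x)" "smooth_on UNIV (deriv f)"
proof -
  have d: "(f has_real_derivative deriv f x) (at x)" for x
  proof -
    obtain g where "(f has_real_derivative g x) (at x)"
      using Ck_on_realD[OF smooth_on_Ck[OF assms, of "Suc 0"]] by auto
    then show ?thesis by (simp add: DERIV_imp_deriv)
  qed
  then show "(f has_real_derivative deriv f x) (at x)" .
  show "smooth_on UNIV (deriv f)"
    unfolding smooth_on_def
  proof
    fix k
    obtain g where g: "\<And>x. (f has_real_derivative g x) (at x)" "Ck_on k UNIV g"
      using Ck_on_realD[OF smooth_on_Ck[OF assms, of "Suc k"]] by auto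
    have "deriv f = g" using DERIV_imp_deriv[OF g(1)] by auto
    with g(2) show "Ck_on k UNIV (deriv f)" by simp
  qed
qed

lemma smooth_on_continuous_on: "smooth_on S f \<Longrightarrow> continuous_on S f"
  using smooth_on_Ck[of S f 0] by simp

text \<open>The moments of \<open>F''\<close> along segments give \<open>F' r / r\<close> as a smooth function (division with remainder).\<close>

lemma smooth_on_moment:
  assumes "smooth_on UNIV (h :: real \<Rightarrow> real)"
  shows "smooth_on UNIV (\<lambda>r. integral {0..1} (\<lambda>u. u ^ j * h (u * r)))"
proof -
  \<comment> \<open>Differentiation under the integral turns the moment of order \<open>j\<close> of
    \<open>h\<close> into that of order \<open>Suc j\<close> of \<open>deriv h\<close>; hence all
    orders and all functions are treated in one induction.\<close>
  have d: "((\<lambda>r. integral {0..1} (\<lambda>u. u ^ j * h (u * r))) has_real_derivative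
      integral {0..1} (\<lambda>u. u ^ Suc j * deriv h (u * r))) (at r)" if "smooth_on UNIV h" for h :: "real \<Rightarrow> real" and r j
  proof -
    have c: "continuous_on S h" "continuous_on S (deriv h)" for S
      using smooth_on_continuous_on[OF that] smooth_on_continuous_on[OF smooth_on_realD(2)[OF that]]
      by (auto intro: continuous_on_subset)
    have "((\<lambda>r. integral (cbox 0 1) (\<lambda>u. u ^ j * h (u * r))) has_field_derivative
      integral (cbox 0 1) (\<lambda>u. u ^ Suc j * deriv h (u * r))) (at r within UNIV)"
    proof (rule leibniz_rule_field_derivative)
      show "((\<lambda>r. u ^ j * h (u * r)) has_real_derivative u ^ Suc j * deriv h (u * r)) (at r within UNIV)" for r u :: real
        by (rule derivative_eq_intros DERIV_chain2[OF smooth_on_realD(1)[OF that]] refl)+ simp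
      show "(\<lambda>u. u ^ j * h (u * r)) integrable_on cbox 0 1" for r
        by (intro integrable_continuous continuous_intros continuous_on_compose2[OF c(1)[of UNIV]]) auto
      show "continuous_on (UNIV \<times> cbox 0 1) (\<lambda>(r, u). u ^ Suc j * deriv h (u * r))"
        unfolding case_prod_beta' by (intro continuous_intros continuous_on_compose2[OF c(2)[of UNIV]]) auto
    qed auto
    then show ?thesis by simp
  qed
  have "Ck_on k UNIV (\<lambda>r. integral {0..1} (\<lambda>u. u ^ j * h (u * r)))" if "smooth_on UNIV h" for k j and h :: "real \<Rightarrow> real"
    using that
  proof (induction k arbitrary: h j)
    case 0
    show ?case unfolding Ck_on.simps by (intro continuous_at_imp_continuous_on ballI DERIV_isCont[OF d[OF 0]])
  next
    case (Suc k)
    show ?case using Suc.IH[OF smooth_on_realD(2)[OF Suc.prems], of "Suc j"] d[OF Suc.prems]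
      by (intro Ck_on_realI) auto
  qed
  then show ?thesis using assms by (simp add: smooth_on_def)
qed

section \<open>Even and odd functions, radial functions, inverse functions\<close>

lemma deriv_even:
  assumes "smooth_on UNIV (F :: real \<Rightarrow> real)" "\<And>r. F (- r) = F r"
  shows "deriv F (- r) = - deriv F r"
proof -
  have "((\<lambda>r. F (- r)) has_real_derivative - deriv F (- r)) (at r)"
  proof -
    have "(uminus has_real_derivative - 1) (at r)" by (auto intro!: derivative_eq_intros)
    from DERIV_chain2[OF smooth_on_realD(1)[OF assms(1)] this] show ?thesis by simp
  qed
  then have "(F has_real_derivative - deriv F (- r)) (at r)" using assms(2) by simp
  with smooth_on_realD(1)[OF assms(1), of r] show ?thesis using DERIV_unique by fastforce
qed

lemma deriv_odd:
  assumes "smooth_on UNIV (F :: real \<Rightarrow> real)" "\<And>r. F (- r) = - F r"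
  shows "deriv F (- r) = deriv F r"
proof -
  have "((\<lambda>r. F (- r)) has_real_derivative - deriv F (- r)) (at r)"
  proof -
    have "(uminus has_real_derivative - 1) (at r)" by (auto intro!: derivative_eq_intros)
    from DERIV_chain2[OF smooth_on_realD(1)[OF assms(1)] this] show ?thesis by simp
  qed
  then have "((\<lambda>r. - F r) has_real_derivative - deriv F (- r)) (at r)" using assms(2) by simp
  with DERIV_minus[OF smooth_on_realD(1)[OF assms(1), of r]] show ?thesis using DERIV_unique by fastforce
qed

text \<open>Hadamard's formula: since \<open>F 0 = 0\<close>, \<open>F r = r * G r\<close> with
  \<open>G r\<close> the mean of \<open>F'\<close> over the segment from \<open>0\<close> to
  \<open>r\<close>. As \<open>F'\<close> is even, so is \<open>G\<close>.\<close>

lemma odd_quotient: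
  assumes F: "smooth_on UNIV (F :: real \<Rightarrow> real)" "\<And>r. F (- r) = - F r"
  obtains G where "smooth_on UNIV G" "\<And>r. G (- r) = G r" "\<And>r. F r = r * G r"
proof -
  define G where "G r = integral {0..1} (\<lambda>u. u ^ 0 * deriv F (u * r))" for r
  have F0: "F 0 = 0" using F(2)[of 0] by simp
  have "F r = r * G r" for r
  proof -
    have "((\<lambda>u. r * deriv F (u * r)) has_integral F (1 * r) - F (0 * r)) {0..1}"
    proof (rule fundamental_theorem_of_calculus)
      fix u :: real
      have "((\<lambda>u. F (u * r)) has_real_derivative deriv F (u * r) * r) (at u)"
        by (rule DERIV_chain2[OF smooth_on_realD(1)[OF F(1)]]) (auto intro!: derivative_eq_intros)
      then show "((\<lambda>u. F (u * r)) has_vector_derivative r * deriv F (u * r)) (at u within {0..1})"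
        by (simp add: has_real_derivative_iff_has_vector_derivative[symmetric] mult.commute has_field_derivative_at_within)
    qed simp
    from integral_unique[OF this] show ?thesis using F0 by (simp add: G_def)
  qed
  moreover have "smooth_on UNIV G"
    unfolding G_def by (rule smooth_on_moment[OF smooth_on_realD(2)[OF F(1)]])
  moreover have "G (- r) = G r" for r using deriv_odd[OF F] by (simp add: G_def)
  ultimately show thesis using that by blast
qed

text \<open>Away from \<open>0\<close> the gradient of \<open>F (norm x)\<close> is
  \<open>(F' r / r) x\<close>. For even \<open>F\<close> the quotient \<open>F' r / r\<close> is
  again smooth and even, so the gradient extends over the origin and the induction repeats with
  \<open>G\<close> in place of \<open>F\<close>.\<close>

lemma smooth_on_even_norm:
  assumes "smooth_on UNIV (F :: real \<Rightarrow> real)" "\<And>r. F (- r) = F r"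
  shows "smooth_on UNIV (\<lambda>x :: 'a::euclidean_space. F (norm x))"
proof -
  have "Ck_on k UNIV (\<lambda>x :: 'a. F (norm x))" if "smooth_on UNIV F" "\<And>r. F (- r) = F r" for k and F :: "real \<Rightarrow> real"
    using that
  proof (induction k arbitrary: F)
    case 0
    then show ?case using continuous_on_compose2[OF smooth_on_continuous_on[OF 0(1)] continuous_on_norm_id] by auto
  next
    case (Suc k)
    obtain G where G: "smooth_on UNIV G" "\<And>r. G (- r) = G r" "\<And>r. deriv F r = r * G r"
      using odd_quotient[OF smooth_on_realD(2)[OF Suc.prems(1)] deriv_even[OF Suc.prems]] by blast
    have "((\<lambda>x. F (norm x)) has_derivative (\<lambda>v. G (norm x) * (x \<bullet> v))) (at x)" for x :: 'a
    proof (cases "x = 0")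
      case True
      \<comment> \<open>An even function has derivative zero at the origin, so the difference
        quotient with respect to \<open>norm h\<close> tends to zero from every direction.\<close>
      have "(F has_real_derivative 0) (at 0)" using smooth_on_realD(1)[OF Suc.prems(1), of 0] G(3)[of 0] by simp
      then have "((\<lambda>h. (F h - F 0) / h) \<longlongrightarrow> 0) (at 0)" by (simp add: DERIV_def)
      moreover have "filterlim norm (at 0) (at (0 :: 'a))"
        by (intro filterlim_atI tendsto_norm_zero) (auto simp: eventually_at_filter)
      ultimately have "((\<lambda>h::'a. (F (norm h) - F 0) / norm h) \<longlongrightarrow> 0) (at 0)"
        by (rule filterlim_compose)
      then have "((\<lambda>h::'a. norm ((F (norm h) - F 0) / norm h)) \<longlongrightarrow> 0) (at 0)"
        by (rule tendsto_norm_zero)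
      then show ?thesis using True by (auto simp: has_derivative_iff_norm)
    next
      case False
      then have n: "(norm has_derivative (\<lambda>v. x \<bullet> v / norm x)) (at x)"
        using has_derivative_norm[OF False] by (simp add: sgn_div_norm inner_commute divide_inverse mult.commute)
      have "((\<lambda>x. F (norm x)) has_derivative (\<lambda>v. deriv F (norm x) * (x \<bullet> v / norm x))) (at x)"
        using diff_chain_at[OF n, of F "(*) (deriv F (norm x))"] smooth_on_realD(1)[OF Suc.prems(1), of "norm x"]
        by (auto simp: o_def has_field_derivative_def)
      then show ?thesis using False by (simp add: G(3))
    qed
    moreover have "Ck_on k UNIV (\<lambda>x::'a. G (norm x) * (x \<bullet> v))" for v
      by (intro Ck_on_mult Suc.IH G Ck_on_linear bounded_linear_inner_left)
    ultimately show ?case by (intro Ck_on_SucI[of _ _ "\<lambda>x v. G (norm x) * (x \<bullet> v)"]) auto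
  qed
  then show ?thesis using assms by (simp add: smooth_on_def)
qed

text \<open>The derivative of \<open>R\<close> is \<open>1 / h' (R y)\<close>: it is as regular as
  \<open>R\<close> itself, so regularity bootstraps from continuity.\<close>

lemma smooth_on_inverse_function:
  fixes h R :: "real \<Rightarrow> real"
  assumes h: "smooth_on UNIV h" "\<And>x. deriv h x > 0" and R: "\<And>y. h (R y) = y"
  shows "smooth_on UNIV R"
proof -
  have mono: "strict_mono h"
    using DERIV_pos_imp_increasing[of _ _ h] smooth_on_realD(1)[OF h(1)] h(2) by (intro strict_monoI) blast
  have Rh: "R (h x) = x" for x using strict_mono_eq[OF mono] R by blast
  have d: "(R has_real_derivative inverse (deriv h (R y))) (at y)" for y
  proof (rule DERIV_inverse_function[where f = h and a = "y - 1" and b = "y + 1"])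
    have "isCont R (h (R y))"
    proof (rule isCont_inverse_function[of 1 "R y" R h])
      show "R (h z) = z" for z using Rh by simp
      show "isCont h z" for z using smooth_on_realD(1)[OF h(1)] DERIV_isCont by blast
    qed simp
    then show "isCont R y" using R by simp
  qed (use smooth_on_realD(1)[OF h(1)] h(2)[of "R y"] R in auto)
  have "Ck_on k UNIV R" for k
  proof (induction k)
    case 0 show ?case unfolding Ck_on.simps by (intro continuous_at_imp_continuous_on ballI DERIV_isCont[OF d])
  next
    case (Suc k)
    have "Ck_on k UNIV (\<lambda>y. deriv h (R y))"
      by (rule Ck_on_comp_real[where T = UNIV]) (use smooth_on_Ck[OF smooth_on_realD(2)[OF h(1)]] Suc in auto)
    then have "Ck_on k UNIV (\<lambda>y. inverse (deriv h (R y)))"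
      by (rule Ck_on_comp_real[where T = "-{0}", rotated 2]) (use h(2) Ck_on_inverse in \<open>auto simp: less_imp_neq[symmetric]\<close>)
    then show ?case using d by (intro Ck_on_realI) auto
  qed
  then show ?thesis by (simp add: smooth_on_def)
qed

section \<open>Riemannian distance\<close>

lemma ip_sum: "ip g x v w = (\<Sum>i\<in>UNIV. v $ i * (\<Sum>j\<in>UNIV. g x $ i $ j * w $ j))"
  by (simp add: ip_def inner_vec_def matrix_vector_mult_def)

lemma continuous_on_ip:
  assumes "continuous_on UNIV g" "continuous_on S x" "continuous_on S v" "continuous_on S w"
  shows "continuous_on S (\<lambda>u. ip g (x u) (v u) (w u))"
proof -
  have "continuous_on S (\<lambda>u. g (x u))" by (rule continuous_on_compose2[OF assms(1,2)]) simp
  then show ?thesis unfolding ip_sum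
    by (intro continuous_on_sum continuous_on_mult bounded_linear.continuous_on[OF bounded_linear_vec_nth] assms)
qed

lemma ip_scale: "ip g x (a *\<^sub>R v) (b *\<^sub>R w) = a * b * ip g x v w"
  by (simp add: ip_def matrix_vector_mult_scaleR)

lemma C1E:
  assumes "\<gamma> C1_differentiable_on {0..1 :: real}"
  obtains D where "\<And>u. 0 \<le> u \<Longrightarrow> u \<le> 1 \<Longrightarrow> (\<gamma> has_vector_derivative D u) (at u)" "continuous_on {0..1} D"
    "\<And>u. 0 \<le> u \<Longrightarrow> u \<le> 1 \<Longrightarrow> vector_derivative \<gamma> (at u) = D u" "continuous_on {0..1} \<gamma>"
proof -
  obtain D where D: "\<forall>u\<in>{0..1}. (\<gamma> has_vector_derivative D u) (at u)" "continuous_on {0..1} D"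
    using assms unfolding C1_differentiable_on_def by blast
  show thesis
  proof (rule that[of D])
    show "continuous_on {0..1} \<gamma>"
      using D(1) by (intro continuous_at_imp_continuous_on ballI has_vector_derivative_continuous) blast
  qed (use D in \<open>auto simp: vector_derivative_at\<close>)
qed

definition speed :: "'n::finite metric \<Rightarrow> (real \<Rightarrow> real^'n) \<Rightarrow> real \<Rightarrow> real" where
  "speed g \<gamma> u = sqrt (ip g (\<gamma> u) (vector_derivative \<gamma> (at u)) (vector_derivative \<gamma> (at u)))"

definition curves :: "real^'n::finite \<Rightarrow> real^'n \<Rightarrow> (real \<Rightarrow> real^'n) set" where
  "curves p q = {\<gamma>. \<gamma> C1_differentiable_on {0..1} \<and> \<gamma> 0 = p \<and> \<gamma> 1 = q}"

lemma riem_dist_eq: "riem_dist g p q = Inf (curve_length g ` curves p q)"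
  unfolding riem_dist_def curves_def by (rule arg_cong[where f = Inf]) blast

lemma curve_length_eq: "curve_length g \<gamma> = integral {0..1} (speed g \<gamma>)"
  unfolding curve_length_def speed_def ..

lemma continuous_on_speed:
  assumes "continuous_on UNIV g" "\<gamma> C1_differentiable_on {0..1}"
  shows "continuous_on {0..1} (speed g \<gamma>)"
proof -
  obtain D where D: "\<And>u. 0 \<le> u \<Longrightarrow> u \<le> 1 \<Longrightarrow> (\<gamma> has_vector_derivative D u) (at u)" "continuous_on {0..1} D"
    "\<And>u. 0 \<le> u \<Longrightarrow> u \<le> 1 \<Longrightarrow> vector_derivative \<gamma> (at u) = D u" "continuous_on {0..1} \<gamma>"
    using C1E[OF assms(2)] by blast
  have "continuous_on {0..1} (\<lambda>u. sqrt (ip g (\<gamma> u) (D u) (D u)))"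
    by (intro continuous_on_real_sqrt continuous_on_ip assms D)
  then show ?thesis
    by (rule continuous_on_eq) (simp add: speed_def D(3))
qed

section \<open>The metric space axioms for the Riemannian distance\<close>

locale riemannian =
  fixes g :: "'n::finite metric"
  assumes g: "riemannian_metric g"
begin

lemma cont_g: "continuous_on UNIV g"
  using g by (simp add: riemannian_metric_def smooth_on_continuous_on)

lemma ip_nonneg: "ip g x v v \<ge> 0"
  using g by (cases "v = 0") (auto simp: riemannian_metric_def ip_def less_imp_le)

lemma ip_pos: "v \<noteq> 0 \<Longrightarrow> ip g x v v > 0"
  using g by (simp add: riemannian_metric_def)

lemma speed_nonneg: "speed g \<gamma> u \<ge> 0"
  by (simp add: speed_def ip_nonneg)

lemma speed_integrable:
  assumes "\<gamma> C1_differentiable_on {0..1}" "{a..b} \<subseteq> {0..1}"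
  shows "speed g \<gamma> integrable_on {a..b}"
  by (intro integrable_continuous_real continuous_on_subset[OF continuous_on_speed[OF cont_g assms(1)] assms(2)])

lemma curve_length_nonneg: "\<gamma> C1_differentiable_on {0..1} \<Longrightarrow> curve_length g \<gamma> \<ge> 0"
  unfolding curve_length_eq by (intro integral_nonneg speed_integrable) (auto simp: speed_nonneg)

lemma line_C1: "(\<lambda>u. p + u *\<^sub>R v) C1_differentiable_on {0..1 :: real}"
  unfolding C1_differentiable_on_def
  by (intro exI[of _ "\<lambda>u. v"]) (auto intro!: derivative_eq_intros)

lemma curves_nonempty: "curves p (q :: real^'n) \<noteq> {}"
proof -
  have "(\<lambda>u. p + u *\<^sub>R (q - p)) \<in> curves p q" by (simp add: curves_def line_C1)
  then show ?thesis by blast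
qed

lemma bdd_lengths: "bdd_below (curve_length g ` curves p q)"
  unfolding bdd_below_def using curve_length_nonneg by (auto simp: curves_def)

lemma dist_le: "\<gamma> \<in> curves p q \<Longrightarrow> riem_dist g p q \<le> curve_length g \<gamma>"
  unfolding riem_dist_eq by (intro cInf_lower bdd_lengths) simp

lemma dist_nonneg: "riem_dist g p q \<ge> 0"
  unfolding riem_dist_eq using curves_nonempty curve_length_nonneg
  by (intro cInf_greatest) (auto simp: curves_def)

lemma dist_approx: assumes "riem_dist g p q < a" obtains \<gamma> where "\<gamma> \<in> curves p q" "curve_length g \<gamma> < a"
  using cInf_lessD[of "curve_length g ` curves p q" a] assms curves_nonempty unfolding riem_dist_eq by blast

lemma dist_self: "riem_dist g p p = 0"
proof -
  have c: "(\<lambda>u. p + u *\<^sub>R 0) \<in> curves p p" using line_C1[of p 0] by (simp add: curves_def)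
  have "vector_derivative (\<lambda>u. p + u *\<^sub>R (0 :: real^'n)) (at u) = 0" for u :: real by simp
  then have "curve_length g (\<lambda>u. p + u *\<^sub>R 0) = 0" by (simp add: curve_length_def ip_def)
  with dist_le[OF c] dist_nonneg[of p p] show ?thesis by simp
qed

lemma dist_sym_le: "riem_dist g q p \<le> riem_dist g p q"
proof (rule field_le_epsilon)
  fix e :: real assume e: "e > 0"
  obtain \<gamma> where \<gamma>: "\<gamma> \<in> curves p q" "curve_length g \<gamma> < riem_dist g p q + e"
    by (rule dist_approx[of p q "riem_dist g p q + e"]) (use e in simp)
  then have C1: "\<gamma> C1_differentiable_on {0..1}" by (simp add: curves_def)
  obtain D where D: "\<And>u. 0 \<le> u \<Longrightarrow> u \<le> 1 \<Longrightarrow> (\<gamma> has_vector_derivative D u) (at u)" "continuous_on {0..1} D"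
    "\<And>u. 0 \<le> u \<Longrightarrow> u \<le> 1 \<Longrightarrow> vector_derivative \<gamma> (at u) = D u" "continuous_on {0..1} \<gamma>"
    using C1E[OF C1] by blast
  define \<eta> where "\<eta> u = \<gamma> (1 - u)" for u
  have \<eta>': "(\<eta> has_vector_derivative - D (1 - u)) (at u)" if "u \<in> {0..1}" for u
  proof -
    have "((\<lambda>u. 1 - u) has_real_derivative -1) (at u)" by (rule derivative_eq_intros refl)+ simp
    then have "((\<lambda>u. 1 - u) has_vector_derivative -1) (at u)"
      by (simp only: has_real_derivative_iff_has_vector_derivative)
    moreover have "(\<gamma> has_vector_derivative D (1 - u)) (at (1 - u))" using D(1)[of "1 - u"] that by simp
    ultimately have "((\<gamma> \<circ> (\<lambda>u. 1 - u)) has_vector_derivative (-1) *\<^sub>R D (1 - u)) (at u)"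
      by (rule vector_diff_chain_at)
    then show ?thesis by (simp add: \<eta>_def[abs_def] o_def)
  qed
  have cD: "continuous_on {0..1} (\<lambda>u. - D (1 - u))"
    by (intro continuous_intros continuous_on_compose2[OF D(2)]) auto
  have "\<eta> C1_differentiable_on {0..1}"
    unfolding C1_differentiable_on_def by (intro exI[of _ "\<lambda>u. - D (1 - u)"] conjI ballI \<eta>' cD)
  then have "\<eta> \<in> curves q p" using \<gamma>(1) by (simp add: curves_def \<eta>_def)
  moreover have "curve_length g \<eta> = curve_length g \<gamma>"
  proof -
    have "speed g \<eta> u = speed g \<gamma> (1 - u)" if "u \<in> {0..1}" for u
    proof -
      have "ip g (\<gamma> (1 - u)) (- D (1 - u)) (- D (1 - u)) = ip g (\<gamma> (1 - u)) (D (1 - u)) (D (1 - u))"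
        using ip_scale[of g "\<gamma> (1 - u)" "-1" "D (1 - u)" "-1" "D (1 - u)"] by simp
      moreover have "vector_derivative \<gamma> (at (1 - u)) = D (1 - u)" using D(3)[of "1 - u"] that by simp
      ultimately show ?thesis unfolding speed_def vector_derivative_at[OF \<eta>'[OF that]] \<eta>_def by simp
    qed
    then have "integral {0..1} (speed g \<eta>) = integral {0..1} (\<lambda>u. speed g \<gamma> (1 - u))"
      by (intro integral_cong) auto
    also have "\<dots> = integral {0..1} (speed g \<gamma>)"
    proof -
      have "((\<lambda>u. -1 *\<^sub>R speed g \<gamma> (1 - u)) has_integral integral {1 - 0..1 - 1} (speed g \<gamma>) - integral {1 - 1..1 - 0} (speed g \<gamma>)) {0..1}"
      proof (rule has_integral_substitution_general[of "{}" 0 1 "\<lambda>u. 1 - u" 0 1])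
        show "continuous_on {0..1} (speed g \<gamma>)" by (rule continuous_on_speed[OF cont_g C1])
        show "((\<lambda>u. 1 - u) has_real_derivative - 1) (at x within {0..1})" for x :: real
          by (rule derivative_eq_intros refl)+ simp
      qed (auto intro!: continuous_intros)
      then have "((\<lambda>u. - speed g \<gamma> (1 - u)) has_integral - integral {0..1} (speed g \<gamma>)) {0..1}" by simp
      from has_integral_neg[OF this] show ?thesis by (simp add: integral_unique)
    qed
    finally show ?thesis by (simp add: curve_length_eq)
  qed
  ultimately show "riem_dist g q p \<le> riem_dist g p q + e" using dist_le[of \<eta> q p] \<gamma>(2) by simp
qed

lemma dist_sym: "riem_dist g p q = riem_dist g q p"
  using dist_sym_le[of p q] dist_sym_le[of q p] by simp

end

text \<open>The truncated square, the basic C1 spline: its derivative is continuous and vanishes on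
  one side of the knot.\<close>

definition plus_sq :: "real \<Rightarrow> real" where "plus_sq x = (max 0 x)\<^sup>2"

lemma plus_sq_deriv: "(plus_sq has_real_derivative 2 * max 0 x) (at x)"
proof -
  consider "x < 0" | "x > 0" | "x = 0" by linarith
  then show ?thesis
  proof cases
    case 1
    have "((\<lambda>x. 0) has_real_derivative 2 * max 0 x) (at x)" using 1 by (auto intro!: derivative_eq_intros)
    then show ?thesis
      by (rule has_field_derivative_transform_within_open[of _ _ _ "{..<0}"]) (use 1 in \<open>auto simp: plus_sq_def max_def\<close>)
  next
    case 2
    have "((\<lambda>x. x\<^sup>2) has_real_derivative 2 * max 0 x) (at x)" using 2 by (auto intro!: derivative_eq_intros)
    then show ?thesis
      by (rule has_field_derivative_transform_within_open[of _ _ _ "{0<..}"]) (use 2 in \<open>auto simp: plus_sq_def max_def\<close>)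
  next
    case 3
    have "((\<lambda>h. (plus_sq (0 + h) - plus_sq 0) / h) \<longlongrightarrow> 0) (at 0)"
    proof (rule Lim_null_comparison)
      show "((\<lambda>h. \<bar>h\<bar>) \<longlongrightarrow> 0) (at (0::real))" by (rule tendsto_rabs_zero) (rule tendsto_ident_at)
      show "\<forall>\<^sub>F h in at 0. norm ((plus_sq (0 + h) - plus_sq 0) / h) \<le> \<bar>h\<bar>"
        by (intro always_eventually allI) (auto simp: plus_sq_def max_def power2_eq_square)
    qed
    then show ?thesis using 3 by (simp add: DERIV_def)
  qed
qed

text \<open>A \<open>C1\<close> step from 0 to 1; precomposing with it makes the concatenation of two \<open>C1\<close> curves \<open>C1\<close>.\<close>

definition step :: "real \<Rightarrow> real" where
  "step x = 2 * plus_sq x - 4 * plus_sq (x - 1/2) + 2 * plus_sq (x - 1)"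

definition dstep :: "real \<Rightarrow> real" where
  "dstep x = 4 * max 0 x - 8 * max 0 (x - 1/2) + 4 * max 0 (x - 1)"

lemma step_deriv: "(step has_real_derivative dstep x) (at x)"
  unfolding step_def[abs_def] dstep_def
  by (rule derivative_eq_intros DERIV_chain2[OF plus_sq_deriv] refl)+ simp

lemma dstep_nonneg: "dstep x \<ge> 0" and dstep_0: "x \<le> 0 \<Longrightarrow> dstep x = 0" and dstep_1: "x \<ge> 1 \<Longrightarrow> dstep x = 0"
  by (auto simp: dstep_def max_def)

lemma step_0: "x \<le> 0 \<Longrightarrow> step x = 0" and step_1: "x \<ge> 1 \<Longrightarrow> step x = 1"
  by (auto simp: step_def plus_sq_def max_def power2_eq_square algebra_simps)

lemma step_mono: "x \<le> y \<Longrightarrow> step x \<le> step y"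
  by (rule DERIV_nonneg_imp_nondecreasing) (use step_deriv dstep_nonneg in blast)+

lemma step_range: "0 \<le> step x" "step x \<le> 1"
  using step_mono[of "min x 0" x] step_0[of "min x 0"] step_mono[of x "max x 1"] step_1[of "max x 1"] by auto

lemma dstep_cont: "continuous_on S (\<lambda>x. dstep (h x))" if "continuous_on S h"
  unfolding dstep_def by (intro continuous_intros that)

context riemannian
begin

text \<open>Competing curves are C1, not piecewise C1, so a concatenation has to come to rest at the
  junction. Reparametrising both pieces by \<open>step\<close> achieves this without changing their
  lengths.\<close>

lemma dist_triangle: "riem_dist g p r \<le> riem_dist g p q + riem_dist g q r"
proof (rule field_le_epsilon)
  fix e :: real assume e: "e > 0"
  obtain \<gamma>1 where \<gamma>1: "\<gamma>1 \<in> curves p q" "curve_length g \<gamma>1 < riem_dist g p q + e / 2"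
    by (rule dist_approx[of p q "riem_dist g p q + e / 2"]) (use e in simp)
  obtain \<gamma>2 where \<gamma>2: "\<gamma>2 \<in> curves q r" "curve_length g \<gamma>2 < riem_dist g q r + e / 2"
    by (rule dist_approx[of q r "riem_dist g q r + e / 2"]) (use e in simp)
  have C1: "\<gamma>1 C1_differentiable_on {0..1}" "\<gamma>2 C1_differentiable_on {0..1}"
    and ends: "\<gamma>1 0 = p" "\<gamma>1 1 = q" "\<gamma>2 0 = q" "\<gamma>2 1 = r" using \<gamma>1 \<gamma>2 by (auto simp: curves_def)
  obtain D1 where D1: "\<And>u. 0 \<le> u \<Longrightarrow> u \<le> 1 \<Longrightarrow> (\<gamma>1 has_vector_derivative D1 u) (at u)" "continuous_on {0..1} D1"
    "\<And>u. 0 \<le> u \<Longrightarrow> u \<le> 1 \<Longrightarrow> vector_derivative \<gamma>1 (at u) = D1 u" "continuous_on {0..1} \<gamma>1"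
    using C1E[OF C1(1)] by blast
  obtain D2 where D2: "\<And>u. 0 \<le> u \<Longrightarrow> u \<le> 1 \<Longrightarrow> (\<gamma>2 has_vector_derivative D2 u) (at u)" "continuous_on {0..1} D2"
    "\<And>u. 0 \<le> u \<Longrightarrow> u \<le> 1 \<Longrightarrow> vector_derivative \<gamma>2 (at u) = D2 u" "continuous_on {0..1} \<gamma>2"
    using C1E[OF C1(2)] by blast
  define a where "a u = step (2 * u)" for u
  define a' where "a' u = 2 * dstep (2 * u)" for u
  define b where "b u = step (2 * u - 1)" for u
  define b' where "b' u = 2 * dstep (2 * u - 1)" for u
  have lin: "((\<lambda>u. 2 * u) has_real_derivative 2) (at u)" "((\<lambda>u. 2 * u - 1) has_real_derivative 2) (at u)" for u :: real
    by (auto intro!: derivative_eq_intros)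
  have ad: "(a has_real_derivative a' u) (at u)" "(b has_real_derivative b' u) (at u)" for u
    using DERIV_chain2[OF step_deriv lin(1)[of u]] DERIV_chain2[OF step_deriv lin(2)[of u]]
    unfolding a_def[abs_def] a'_def b_def[abs_def] b'_def by (simp_all only: mult.commute)
  have rng: "0 \<le> a u" "a u \<le> 1" "0 \<le> b u" "b u \<le> 1" "0 \<le> a' u" "0 \<le> b' u" for u
    by (auto simp: a_def b_def a'_def b'_def step_range dstep_nonneg)
  have ca: "continuous_on S a" "continuous_on S b" for S
    using ad by (auto intro!: continuous_at_imp_continuous_on DERIV_isCont)
  have ca': "continuous_on S a'" "continuous_on S b'" for S
    unfolding a'_def[abs_def] b'_def[abs_def] by (intro continuous_intros dstep_cont)+
  \<comment> \<open>One formula instead of a case distinction: on the first half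
    \<open>\<gamma>2\<close> rests at \<open>q\<close>, on the second half \<open>\<gamma>1\<close>
    does, and the resting curve is cancelled by \<open>- q\<close>.\<close>
  define \<eta> where "\<eta> u = \<gamma>1 (a u) + \<gamma>2 (b u) - q" for u
  define E where "E u = a' u *\<^sub>R D1 (a u) + b' u *\<^sub>R D2 (b u)" for u
  have \<eta>': "(\<eta> has_vector_derivative E u) (at u)" for u
  proof -
    have "((\<gamma>1 \<circ> a) has_vector_derivative a' u *\<^sub>R D1 (a u)) (at u)" "((\<gamma>2 \<circ> b) has_vector_derivative b' u *\<^sub>R D2 (b u)) (at u)"
      using ad rng by (auto intro!: vector_diff_chain_at D1 D2 simp: has_real_derivative_iff_has_vector_derivative[symmetric])
    then have "((\<lambda>u. \<gamma>1 (a u) + \<gamma>2 (b u) - q) has_vector_derivative a' u *\<^sub>R D1 (a u) + b' u *\<^sub>R D2 (b u) - 0) (at u)"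
      unfolding o_def by (intro has_vector_derivative_diff has_vector_derivative_add has_vector_derivative_const)
    then show ?thesis by (simp add: \<eta>_def[abs_def] E_def)
  qed
  have cE: "continuous_on {0..1} E"
    unfolding E_def
    by (intro continuous_intros ca ca' continuous_on_compose2[OF D1(2)] continuous_on_compose2[OF D2(2)]) (use rng in auto)
  have "\<eta> \<in> curves p r"
    unfolding curves_def C1_differentiable_on_def using \<eta>' cE
    by (auto simp: \<eta>_def a_def b_def step_0 step_1 ends intro!: exI[of _ E])
  moreover have "curve_length g \<eta> = curve_length g \<gamma>1 + curve_length g \<gamma>2"
  proof -
    have sub1: "((\<lambda>u. a' u *\<^sub>R speed g \<gamma>1 (a u)) has_integral integral {a 0..a (1/2)} (speed g \<gamma>1)) {0..1/2}"
    proof (rule has_integral_substitution[where c = 0 and d = 1])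
      show "continuous_on {0..1} (speed g \<gamma>1)" by (rule continuous_on_speed[OF cont_g C1(1)])
      show "(a has_real_derivative a' u) (at u within {0..1/2})" for u
        by (rule has_field_derivative_at_within[OF ad(1)])
    qed (use rng in \<open>auto simp: a_def step_0 step_1\<close>)
    have sub2: "((\<lambda>u. b' u *\<^sub>R speed g \<gamma>2 (b u)) has_integral integral {b (1/2)..b 1} (speed g \<gamma>2)) {1/2..1}"
    proof (rule has_integral_substitution[where c = 0 and d = 1])
      show "continuous_on {0..1} (speed g \<gamma>2)" by (rule continuous_on_speed[OF cont_g C1(2)])
      show "(b has_real_derivative b' u) (at u within {1/2..1})" for u
        by (rule has_field_derivative_at_within[OF ad(2)])
    qed (use rng in \<open>auto simp: b_def step_0 step_1\<close>)
    have s1: "speed g \<eta> u = a' u *\<^sub>R speed g \<gamma>1 (a u)" if "u \<in> {0..1/2}" for u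
    proof -
      have "b' u = 0" "b u = 0" using that by (auto simp: b'_def b_def dstep_0 step_0)
      then have "\<eta> u = \<gamma>1 (a u)" "E u = a' u *\<^sub>R D1 (a u)" by (auto simp: \<eta>_def E_def ends)
      then show ?thesis
        using vector_derivative_at[OF \<eta>'[of u]] D1(3)[of "a u"] rng
        by (simp add: speed_def ip_scale real_sqrt_mult)
    qed
    have s2: "speed g \<eta> u = b' u *\<^sub>R speed g \<gamma>2 (b u)" if "u \<in> {1/2..1}" for u
    proof -
      have "a' u = 0" "a u = 1" using that by (auto simp: a'_def a_def dstep_1 step_1)
      then have "\<eta> u = \<gamma>2 (b u)" "E u = b' u *\<^sub>R D2 (b u)" by (auto simp: \<eta>_def E_def ends)
      then show ?thesis
        using vector_derivative_at[OF \<eta>'[of u]] D2(3)[of "b u"] rng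
        by (simp add: speed_def ip_scale real_sqrt_mult)
    qed
    have "(speed g \<eta> has_integral integral {0..1} (speed g \<gamma>1)) {0..1/2}"
      using has_integral_eq[OF s1[symmetric] sub1] by (simp add: a_def step_0 step_1)
    moreover have "(speed g \<eta> has_integral integral {0..1} (speed g \<gamma>2)) {1/2..1}"
      using has_integral_eq[OF s2[symmetric] sub2] by (simp add: b_def step_0 step_1)
    ultimately have "(speed g \<eta> has_integral integral {0..1} (speed g \<gamma>1) + integral {0..1} (speed g \<gamma>2)) {0..1}"
      by (intro has_integral_combine[of 0 "1/2" 1]) auto
    then show ?thesis by (simp add: curve_length_eq integral_unique)
  qed
  ultimately show "riem_dist g p r \<le> riem_dist g p q + riem_dist g q r + e"
    using dist_le[of \<eta> p r] \<gamma>1(2) \<gamma>2(2) by simp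
qed

text \<open>On a compact Euclidean ball around \<open>x\<close> the metric dominates a multiple
  \<open>l\<close> of the Euclidean one, and a curve to \<open>y\<close> has to cross that ball. Its
  length up to the exit time already has a positive lower bound.\<close>

lemma dist_pos: assumes "x \<noteq> y" shows "riem_dist g x y > 0"
proof -
  define d where "d = norm (y - x)"
  have d: "d > 0" using assms by (simp add: d_def)
  have "compact (cball x d \<times> sphere (0 :: real^'n) 1)" by (intro compact_Times compact_cball compact_sphere)
  moreover have "cball x d \<times> sphere (0 :: real^'n) 1 \<noteq> {}"
    using d vector_choose_size[of 1] by (auto simp: sphere_def)
  moreover have "continuous_on (cball x d \<times> sphere (0 :: real^'n) 1) (\<lambda>p. ip g (fst p) (snd p) (snd p))"
    by (intro continuous_on_ip cont_g continuous_intros)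
  ultimately obtain p where p: "p \<in> cball x d \<times> sphere (0 :: real^'n) 1"
    "\<And>p'. p' \<in> cball x d \<times> sphere 0 1 \<Longrightarrow> ip g (fst p) (snd p) (snd p) \<le> ip g (fst p') (snd p') (snd p')"
    using continuous_attains_inf[of "cball x d \<times> sphere (0 :: real^'n) 1" "\<lambda>p. ip g (fst p) (snd p) (snd p)"] by blast
  define l where "l = sqrt (ip g (fst p) (snd p) (snd p))"
  have "snd p \<noteq> 0" using p(1) by auto
  then have l: "l > 0" using ip_pos[of "snd p"] by (simp add: l_def)
  have lb: "l * norm v \<le> sqrt (ip g z v v)" if "z \<in> cball x d" for z v
  proof (cases "v = 0")
    case False
    define n where "n = (1 / norm v) *\<^sub>R v"
    have n: "norm n = 1" "v = norm v *\<^sub>R n" using False by (auto simp: n_def)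
    have "ip g (fst p) (snd p) (snd p) \<le> ip g z n n" using p(2)[of "(z, n)"] that n by auto
    moreover have "ip g z v v = (norm v)\<^sup>2 * ip g z n n"
      by (subst (1 2) n(2)) (simp add: ip_scale power2_eq_square)
    ultimately have "sqrt (ip g z v v) = norm v * sqrt (ip g z n n)" "l \<le> sqrt (ip g z n n)"
      by (simp_all add: l_def real_sqrt_mult)
    moreover from this(2) have "norm v * l \<le> norm v * sqrt (ip g z n n)" by (rule mult_left_mono) simp
    ultimately show ?thesis by (simp add: mult.commute[of l])
  qed (simp add: ip_def)
  have "l * d \<le> riem_dist g x y"
    unfolding riem_dist_eq
  proof (rule cInf_greatest)
    show "curve_length g ` curves x y \<noteq> {}" using curves_nonempty by simp
    fix L assume "L \<in> curve_length g ` curves x y"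
    then obtain \<gamma> where \<gamma>: "\<gamma> C1_differentiable_on {0..1}" "\<gamma> 0 = x" "\<gamma> 1 = y" "L = curve_length g \<gamma>"
      by (auto simp: curves_def)
    obtain D where D: "\<And>u. 0 \<le> u \<Longrightarrow> u \<le> 1 \<Longrightarrow> (\<gamma> has_vector_derivative D u) (at u)" "continuous_on {0..1} D"
      "\<And>u. 0 \<le> u \<Longrightarrow> u \<le> 1 \<Longrightarrow> vector_derivative \<gamma> (at u) = D u" "continuous_on {0..1} \<gamma>"
      using C1E[OF \<gamma>(1)] by blast
    \<comment> \<open>The least element of \<open>S\<close> is the exit time from the ball.\<close>
    define S where "S = {u \<in> {0..1}. d \<le> norm (\<gamma> u - x)}"
    have "closed S" unfolding S_def
      by (intro continuous_on_closed_Collect_le continuous_intros D closed_atLeastAtMost)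
    moreover have "bounded S" by (rule bounded_subset[of "{0..1}"]) (auto simp: S_def)
    ultimately have "compact S" by (simp add: compact_eq_bounded_closed)
    moreover have "1 \<in> S" by (simp add: S_def \<gamma> d_def)
    ultimately obtain T where T: "T \<in> S" "\<And>u. u \<in> S \<Longrightarrow> T \<le> u"
      using compact_attains_inf[of S] by auto
    have T01: "0 \<le> T" "T \<le> 1" "d \<le> norm (\<gamma> T - x)" using T(1) by (auto simp: S_def)
    have cb: "l * norm (D u) \<le> speed g \<gamma> u" if "u \<in> {0..T}" for u
    \<comment> \<open>At the exit time itself the curve is still in the closed ball, by continuity
      from earlier times, so the first case is void.\<close>
    proof (cases "u = T \<and> norm (\<gamma> T - x) > d")
      case True
      have "T \<noteq> 0" using T01 \<gamma> d by auto
      then have "T > 0" using T01 by simp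
      have "closure {0..<T} = {0..T}" using \<open>T > 0\<close> by simp
      moreover have "norm (\<gamma> u - x) \<le> d" if "u \<in> {0..<T}" for u
        using T(2)[of u] that T01 by (force simp: S_def)
      ultimately have "norm (\<gamma> T - x) \<le> d"
        by (intro continuous_le_on_closure[of "{0..<T}" "\<lambda>u. norm (\<gamma> u - x)" T d])
          (use T01 in \<open>auto intro!: continuous_intros continuous_on_subset[OF D(4)]\<close>)
      with True show ?thesis by simp
    next
      case False
      then have "norm (\<gamma> u - x) \<le> d" using T(2)[of u] that T01 by (force simp: S_def)
      then have "\<gamma> u \<in> cball x d" by (simp add: dist_norm norm_minus_commute)
      from lb[OF this, of "D u"] show ?thesis using that T01 D(3)[of u] by (simp add: speed_def)
    qed
    have sub: "{0..T} \<subseteq> {0..1}" using T01 by auto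
    have "(D has_integral \<gamma> T - \<gamma> 0) {0..T}"
      by (rule fundamental_theorem_of_calculus) (use T01 D(1) in \<open>auto intro: has_vector_derivative_at_within\<close>)
    then have "norm (\<gamma> T - x) = norm (integral {0..T} D)" using \<gamma> by (simp add: integral_unique)
    also have "\<dots> \<le> integral {0..T} (\<lambda>u. speed g \<gamma> u / l)"
    proof (rule integral_norm_bound_integral)
      show "D integrable_on {0..T}" by (intro integrable_continuous_real continuous_on_subset[OF D(2) sub])
      show "(\<lambda>u. speed g \<gamma> u / l) integrable_on {0..T}"
        using l by (intro integrable_continuous_real continuous_intros
            continuous_on_subset[OF continuous_on_speed[OF cont_g \<gamma>(1)] sub]) auto
      show "norm (D u) \<le> speed g \<gamma> u / l" if "u \<in> {0..T}" for u
        using cb[OF that] l by (simp add: field_simps)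
    qed
    also have "\<dots> = integral {0..T} (speed g \<gamma>) / l" by (rule integral_divide)
    finally have "l * norm (\<gamma> T - x) \<le> integral {0..T} (speed g \<gamma>)" using l by (simp add: field_simps)
    moreover have "l * d \<le> l * norm (\<gamma> T - x)" using T01(3) l by simp
    ultimately have "l * d \<le> integral {0..T} (speed g \<gamma>)" by linarith
    also have "\<dots> \<le> integral {0..1} (speed g \<gamma>)"
      by (intro integral_subset_le sub speed_integrable \<gamma>) (auto simp: speed_nonneg)
    finally show "l * d \<le> L" by (simp add: \<gamma> curve_length_eq)
  qed
  then show ?thesis using l d by (meson less_le_trans mult_pos_pos)
qed

lemma metric_space: "Metric_space UNIV (riem_dist g)"
proof
  show "0 \<le> riem_dist g x y" for x y by (rule dist_nonneg)
  show "riem_dist g x y = riem_dist g y x" for x y by (rule dist_sym)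
  show "riem_dist g x y = 0 \<longleftrightarrow> x = y" for x y using dist_self dist_pos[of x y] by fastforce
  show "riem_dist g x z \<le> riem_dist g x y + riem_dist g y z" for x y z by (rule dist_triangle)
qed

end

section \<open>Radial structure of warped Berger metrics\<close>

abbreviation "e1 \<equiv> axis 1 1 :: real^4"

lemma axis_nth_if: "axis k (1::real) $ i = (if i = k then 1 else 0)"
  by (simp add: axis_def)

text \<open>Left multiplication by the unit quaternion \<open>p\<close>.\<close>

definition Q :: "real^4 \<Rightarrow> real^4 \<Rightarrow> real^4" where
  "Q p v = v $ 1 *\<^sub>R p + v $ 2 *\<^sub>R X3 p + v $ 3 *\<^sub>R X1 p + v $ 4 *\<^sub>R X2 p"

lemma Q_coords: "Q p v = vector [v$1 * p$1 - v$2 * p$2 - v$3 * p$3 - v$4 * p$4,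
   v$1 * p$2 + v$2 * p$1 + v$3 * p$4 - v$4 * p$3, v$1 * p$3 - v$2 * p$4 + v$3 * p$1 + v$4 * p$2,
   v$1 * p$4 + v$2 * p$3 - v$3 * p$2 + v$4 * p$1]"
  by (simp add: Q_def X_coords vec_eq_iff forall_4)

text \<open>Identifies the quaternion multiplications with the action of SU(2). As
  \<open>Q p\<close> maps \<open>e1\<close> to \<open>p\<close>, the group is transitive on spheres,
  and all invariant data can be read off on the ray through \<open>e1\<close>.\<close>

lemma Q_su2:
  assumes "p \<bullet> p = 1"
  obtains A where "A \<in> SU2" "\<And>v. su2_action A v = Q p v"
proof -
  define A :: "complex^2^2" where
    "A = vector [vector [Complex (p$1) (p$2), - cnj (Complex (p$3) (p$4))],
                 vector [Complex (p$3) (p$4), cnj (Complex (p$1) (p$2))]]"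
  have A: "A $ 1 $ 1 = Complex (p$1) (p$2)" "A $ 1 $ 2 = - cnj (Complex (p$3) (p$4))"
    "A $ 2 $ 1 = Complex (p$3) (p$4)" "A $ 2 $ 2 = cnj (Complex (p$1) (p$2))"
    by (simp_all add: A_def vector_2)
  have p: "p$1 * p$1 + p$2 * p$2 + p$3 * p$3 + p$4 * p$4 = 1" using assms by (simp add: inner_4)
  have "A \<in> SU2"
    unfolding SU2_def using p
    by (simp add: vec_eq_iff forall_2 matrix_matrix_mult_def sum_2 det_2 A mat_def complex_eq_iff algebra_simps)
  moreover have "su2_action A v = Q p v" for v
    by (simp add: su2_action_def Q_coords vec_eq_iff forall_4 matrix_vector_mult_def sum_2 A algebra_simps)
  ultimately show thesis using that by blast
qed

lemma Q_linear: "bounded_linear (Q p)"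
  unfolding Q_def
  by (intro bounded_linear_add bounded_linear_compose[OF bounded_linear_scaleR_left bounded_linear_vec_nth])

lemma Q_e1: "Q p (r *\<^sub>R e1) = r *\<^sub>R p"
  by (simp add: Q_def axis_def)

lemma Q_conj: assumes "p \<bullet> p = 1" shows "Q (vector [p$1, - p$2, - p$3, - p$4]) (r *\<^sub>R p) = r *\<^sub>R e1"
proof -
  have p: "p$1 * p$1 + p$2 * p$2 + p$3 * p$3 + p$4 * p$4 = 1" using assms by (simp add: inner_4)
  have "r * (p$1 * p$1) + r * (p$2 * p$2) + r * (p$3 * p$3) + r * (p$4 * p$4) = r"
    unfolding distrib_left[symmetric] p by simp
  then show ?thesis by (simp add: Q_coords vec_eq_iff forall_4 axis_def algebra_simps)
qed

lemma X_e1: "X1 (r *\<^sub>R e1) \<bullet> v = r * v $ 3" "X2 (r *\<^sub>R e1) \<bullet> v = r * v $ 4" "X3 (r *\<^sub>R e1) \<bullet> v = r * v $ 2"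
  "(r *\<^sub>R e1) \<bullet> v = r * v $ 1" "X3 (r *\<^sub>R e1) $ i = (if i = 2 then r else 0)"
  by (simp_all add: X_coords inner_4 axis_def) (use exhaust_4[of i] in \<open>auto simp: X_coords axis_def\<close>)

lemma X_self: "X1 x \<bullet> x = 0" "X2 x \<bullet> x = 0" "X3 x \<bullet> x = 0"
  by (simp_all add: X_coords inner_4)

locale berger_metric = riemannian g for g :: "4 metric" +
  fixes b c :: "real \<Rightarrow> real"
  assumes U2: "U2_invariant g" and form: "has_berger_form g b c"
    and complete: "Metric_space.mcomplete UNIV (riem_dist g)"
begin

lemma ip_Q: "p \<bullet> p = 1 \<Longrightarrow> ip g (Q p x) (Q p v) (Q p w) = ip g x v w"
  using U2 Q_su2[of p] unfolding U2_invariant_def by metis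

text \<open>Mapping a competing curve by \<open>Q p\<close> keeps its length. One inequality is
  enough, because the conjugate quaternion supplies the other.\<close>

lemma dist_Q_le: assumes "p \<bullet> p = 1" shows "riem_dist g (Q p x) (Q p y) \<le> riem_dist g x y"
proof (rule field_le_epsilon)
  fix e :: real assume e: "e > 0"
  obtain \<gamma> where \<gamma>: "\<gamma> \<in> curves x y" "curve_length g \<gamma> < riem_dist g x y + e"
    by (rule dist_approx[of x y "riem_dist g x y + e"]) (use e in simp)
  then have C1: "\<gamma> C1_differentiable_on {0..1}" by (simp add: curves_def)
  obtain D where D: "\<And>u. 0 \<le> u \<Longrightarrow> u \<le> 1 \<Longrightarrow> (\<gamma> has_vector_derivative D u) (at u)" "continuous_on {0..1} D"
    "\<And>u. 0 \<le> u \<Longrightarrow> u \<le> 1 \<Longrightarrow> vector_derivative \<gamma> (at u) = D u" "continuous_on {0..1} \<gamma>"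
    using C1E[OF C1] by blast
  have d: "((\<lambda>u. Q p (\<gamma> u)) has_vector_derivative Q p (D u)) (at u)" if "u \<in> {0..1}" for u
    by (rule bounded_linear.has_vector_derivative[OF Q_linear D(1)]) (use that in auto)
  have "(\<lambda>u. Q p (\<gamma> u)) C1_differentiable_on {0..1}"
    unfolding C1_differentiable_on_def
    by (intro exI[of _ "\<lambda>u. Q p (D u)"] conjI ballI d bounded_linear.continuous_on[OF Q_linear D(2)])
  then have "(\<lambda>u. Q p (\<gamma> u)) \<in> curves (Q p x) (Q p y)" using \<gamma>(1) by (simp add: curves_def)
  moreover have "curve_length g (\<lambda>u. Q p (\<gamma> u)) = curve_length g \<gamma>"
    unfolding curve_length_eq
  proof (rule integral_cong)
    fix u :: real assume u: "u \<in> {0..1}"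
    then have "vector_derivative \<gamma> (at u) = D u" using D(3) by simp
    then show "speed g (\<lambda>u. Q p (\<gamma> u)) u = speed g \<gamma> u"
      unfolding speed_def vector_derivative_at[OF d[OF u]] by (simp add: ip_Q[OF assms])
  qed
  ultimately show "riem_dist g (Q p x) (Q p y) \<le> riem_dist g x y + e"
    using dist_le[of "\<lambda>u. Q p (\<gamma> u)" "Q p x" "Q p y"] \<gamma>(2) by simp
qed

section \<open>The distance from the origin as a function of the Euclidean radius\<close>

definition "rho r = riem_dist g 0 (r *\<^sub>R e1)"

text \<open>Transitivity on spheres: multiplication by \<open>x / norm x\<close> and by its
  conjugate compare the distance of \<open>x\<close> with that of the point of the same norm on the
  ray.\<close>

lemma dist_rho: "riem_dist g 0 x = rho (norm x)"
proof (cases "x = 0")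
  case False
  define p where "p = (1 / norm x) *\<^sub>R x"
  have n: "p \<bullet> p = 1" using False by (simp add: p_def power2_norm_eq_inner[symmetric] power2_eq_square)
  have x: "x = norm x *\<^sub>R p" using False by (simp add: p_def)
  have Q0: "Q q 0 = 0" for q by (simp add: Q_def)
  have n': "vector [p$1, - p$2, - p$3, - p$4] \<bullet> (vector [p$1, - p$2, - p$3, - p$4] :: real^4) = 1"
    using n by (simp add: inner_4)
  have "riem_dist g 0 x \<le> rho (norm x)"
    using dist_Q_le[OF n, of 0 "norm x *\<^sub>R e1"] x by (simp add: Q0 Q_e1 rho_def)
  moreover have "rho (norm x) \<le> riem_dist g 0 x"
  proof -
    have "Q (vector [p$1, - p$2, - p$3, - p$4]) x = norm x *\<^sub>R e1" by (subst x) (rule Q_conj[OF n])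
    then show ?thesis using dist_Q_le[OF n', of 0 x] by (simp add: Q0 rho_def)
  qed
  ultimately show ?thesis by simp
qed (simp add: rho_def)

lemma rho_deriv_exists: assumes "r > 0" shows "(rho has_real_derivative deriv rho r) (at r)"
proof -
  have "r *\<^sub>R e1 \<noteq> 0" using assms by (simp add: axis_eq_0_iff)
  then have "riem_dist g 0 differentiable (at (r *\<^sub>R e1))"
    using form unfolding has_berger_form_def by blast
  then obtain D where "(riem_dist g 0 has_derivative D) (at (r *\<^sub>R e1))" by (auto simp: differentiable_def)
  moreover have "((\<lambda>r. r *\<^sub>R e1) has_derivative (\<lambda>r. r *\<^sub>R e1)) (at r)"
    by (rule bounded_linear_imp_has_derivative) (rule bounded_linear_scaleR_left)
  ultimately have "((riem_dist g 0 \<circ> (\<lambda>r. r *\<^sub>R e1)) has_derivative (D \<circ> (\<lambda>r. r *\<^sub>R e1))) (at r)"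
    by (intro diff_chain_at)
  moreover have "riem_dist g 0 \<circ> (\<lambda>r. r *\<^sub>R e1) = rho" by (auto simp: rho_def)
  ultimately have "rho differentiable (at r)" by (auto simp: differentiable_def)
  then show ?thesis by (simp add: DERIV_deriv_iff_real_differentiable)
qed

lemma frechet_dist:
  assumes "x \<noteq> 0"
  shows "frechet_derivative (riem_dist g 0) (at x) v = deriv rho (norm x) * ((x \<bullet> v) / norm x)"
proof -
  have n: "(norm has_derivative (\<lambda>v. x \<bullet> v / norm x)) (at x)"
    using has_derivative_norm[OF assms] by (simp add: sgn_div_norm inner_commute divide_inverse mult.commute)
  have r: "(rho has_derivative (*) (deriv rho (norm x))) (at (norm x))"
    using rho_deriv_exists[of "norm x"] assms by (simp add: has_field_derivative_def)
  have e: "rho \<circ> norm = riem_dist g 0" by (auto simp: dist_rho)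
  have "(riem_dist g 0 has_derivative (\<lambda>v. deriv rho (norm x) * (x \<bullet> v / norm x))) (at x)"
    using diff_chain_at[OF n r] unfolding e by (simp add: o_def)
  from frechet_derivative_at[OF this, symmetric] show ?thesis by simp
qed

section \<open>Metric entries along the ray\<close>

text \<open>At \<open>r *\<^sub>R e1\<close> the coordinate axes are the invariant frame: axis 1 is
  radial, axis 2 is the Hopf direction \<open>X3\<close>, axes 3 and 4 are the horizontal directions
  \<open>X1\<close> and \<open>X2\<close>. The metric is diagonal there, and its diagonal is smooth
  in \<open>r\<close> also across the origin.\<close>

definition "E (i :: 4) r = g (r *\<^sub>R e1) $ i $ i"

lemma ip_axis: "ip g x (axis i 1) (axis j 1) = g x $ i $ j"
  by (simp add: ip_def matrix_vector_mult_basis inner_axis' column_def)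

lemma ip_form:
  assumes "x \<noteq> 0"
  shows "ip g x v w = (deriv rho (norm x))\<^sup>2 * ((x \<bullet> v) * (x \<bullet> w)) / (norm x)\<^sup>2
    + (b (rho (norm x)))\<^sup>2 * ((X1 x \<bullet> v) * (X1 x \<bullet> w) + (X2 x \<bullet> v) * (X2 x \<bullet> w)) / (norm x)^4
    + (c (rho (norm x)))\<^sup>2 * ((X3 x \<bullet> v) * (X3 x \<bullet> w)) / (norm x)^4"
proof -
  have x: "x \<bullet> x = (norm x)\<^sup>2" by (simp add: power2_norm_eq_inner)
  have h: "hopf_pullback x v w = ((X1 x \<bullet> v) * (X1 x \<bullet> w) + (X2 x \<bullet> v) * (X2 x \<bullet> w)) / (norm x)^4"
    "\<sigma>3 x v * \<sigma>3 x w = ((X3 x \<bullet> v) * (X3 x \<bullet> w)) / (norm x)^4"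
    unfolding hopf_pullback_eq[OF assms] \<sigma>1_def \<sigma>2_def \<sigma>3_def x
    by (simp_all add: power2_eq_square power4_eq_xxxx add_divide_distrib mult.assoc)
  have "ip g x v w = frechet_derivative (riem_dist g 0) (at x) v * frechet_derivative (riem_dist g 0) (at x) w
           + (b (riem_dist g 0 x))\<^sup>2 * hopf_pullback x v w
           + (c (riem_dist g 0 x))\<^sup>2 * (\<sigma>3 x v * \<sigma>3 x w)"
    using form assms unfolding has_berger_form_def by blast
  then show ?thesis unfolding frechet_dist[OF assms] dist_rho[of x] h
    by (simp add: power2_eq_square)
qed

lemma E_vals:
  assumes "r > 0"
  shows "E 1 r = (deriv rho r)\<^sup>2" "E 2 r = (c (rho r))\<^sup>2 / r\<^sup>2" "E 3 r = (b (rho r))\<^sup>2 / r\<^sup>2" "E 4 r = (b (rho r))\<^sup>2 / r\<^sup>2"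
proof -
  have nz: "r *\<^sub>R e1 \<noteq> 0" using assms by (simp add: axis_eq_0_iff)
  have "E i r = ip g (r *\<^sub>R e1) (axis i 1) (axis i 1)" for i by (simp add: E_def ip_axis)
  then show "E 1 r = (deriv rho r)\<^sup>2" "E 2 r = (c (rho r))\<^sup>2 / r\<^sup>2" "E 3 r = (b (rho r))\<^sup>2 / r\<^sup>2" "E 4 r = (b (rho r))\<^sup>2 / r\<^sup>2"
    using assms unfolding ip_form[OF nz] X_e1
    by (simp_all add: norm_axis_1) (simp_all add: axis_def power2_eq_square power4_eq_xxxx)
qed

text \<open>\<open>frame_identity\<close> eliminates \<open>X1\<close> and \<open>X2\<close>, so the
  whole metric is recovered from \<open>E 1\<close>, \<open>E 2\<close>, \<open>E 3\<close> and the
  two vector fields \<open>x\<close> and \<open>X3 x\<close>.\<close>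

lemma metric_formula:
  assumes "x \<noteq> 0"
  shows "g x $ i $ j = E 3 (norm x) * (if i = j then 1 else 0)
     + (E 1 (norm x) - E 3 (norm x)) / (norm x)\<^sup>2 * (x $ i * x $ j)
     + (E 2 (norm x) - E 3 (norm x)) / (norm x)\<^sup>2 * (X3 x $ i * X3 x $ j)"
proof -
  have n: "norm x > 0" using assms by simp
  have fr: "(X1 x \<bullet> axis i 1) * (X1 x \<bullet> axis j 1) + (X2 x \<bullet> axis i 1) * (X2 x \<bullet> axis j 1)
    = (norm x)\<^sup>2 * (if i = j then 1 else 0) - x $ i * x $ j - X3 x $ i * X3 x $ j"
    using frame_identity[of x "axis i 1" "axis j 1"]
    by (auto simp: power2_norm_eq_inner inner_axis axis_nth_if)
  define B where "B = (b (rho (norm x)))\<^sup>2"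
  define C where "C = (c (rho (norm x)))\<^sup>2"
  define D where "D = (deriv rho (norm x))\<^sup>2"
  define N where "N = (norm x)\<^sup>2"
  have N: "N > 0" "(norm x)^4 = N * N" using n by (auto simp: N_def power2_eq_square power4_eq_xxxx)
  have "g x $ i $ j = D * (x $ i * x $ j) / N + B * (N * (if i = j then 1 else 0) - x $ i * x $ j - X3 x $ i * X3 x $ j) / (N * N)
     + C * (X3 x $ i * X3 x $ j) / (N * N)"
    using ip_form[OF assms, of "axis i 1" "axis j 1"] unfolding ip_axis fr N(2)
    by (simp add: B_def C_def D_def N_def inner_axis)
  also have "\<dots> = B / N * (if i = j then 1 else 0) + (D - B / N) / N * (x $ i * x $ j) + (C / N - B / N) / N * (X3 x $ i * X3 x $ j)"
    using N by (simp add: field_simps)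
  finally show ?thesis unfolding E_vals[OF n] B_def C_def D_def N_def .
qed

lemma E_smooth: "smooth_on UNIV (E i)"
proof -
  have "smooth_on UNIV (\<lambda>r. g (r *\<^sub>R e1 + 0) $ i $ i)"
    using g unfolding riemannian_metric_def
    by (intro smooth_on_vec_nth smooth_on_comp_affine[where L = "\<lambda>r. r *\<^sub>R e1" and p = 0 and T = UNIV] bounded_linear_scaleR_left) auto
  then show ?thesis by (simp add: E_def[abs_def])
qed

lemma E_pos: "E i r > 0"
  using ip_pos[of "axis i 1" "r *\<^sub>R e1"] by (simp add: ip_axis E_def axis_eq_0_iff)

text \<open>Evenness holds because \<open>metric_formula\<close> depends on the norm and on
  quadratic expressions only. The values at \<open>0\<close> agree by continuity of the metric
  there: along axis 2 the Hopf direction is \<open>- axis 1\<close>, so \<open>E 2\<close> is the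
  entry (1,1) on that ray; along axis 3 the first axis is horizontal, so \<open>E 3\<close>
  is.\<close>

lemma E_even: "E i (- r) = E i r" and E4: "E 4 r = E 3 r" and E_0: "E 2 0 = E 1 0" "E 3 0 = E 1 0"
proof -
  have nz: "s *\<^sub>R axis k 1 \<noteq> (0 :: real^4)" if "s \<noteq> 0" for s k using that by (simp add: axis_eq_0_iff)
  have E34: "E 4 r = E 3 r" if "r > 0" for r using E_vals[OF that] by simp
  have even': "E i (- r) = E i r" if "r > 0" for r i
    using metric_formula[OF nz[of "-r" 1], of i i] that E34[of r] exhaust_4[of i]
    by (auto simp: E_def[of _ "-r"] norm_axis_1 X_coords axis_nth_if power2_eq_square)
  show "E i (- r) = E i r"
    using even'[of r i] even'[of "-r" i] by (cases r "0::real" rule: linorder_cases) auto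
  have lim: "((\<lambda>r. g (r *\<^sub>R v) $ i $ i) \<longlongrightarrow> g 0 $ i $ i) (at_right 0)" for v i
  proof -
    have "continuous_on UNIV (\<lambda>r::real. g (r *\<^sub>R v) $ i $ i)"
      by (intro bounded_linear.continuous_on[OF bounded_linear_vec_nth] continuous_on_compose2[OF cont_g] continuous_intros) auto
    then have "((\<lambda>r. g (r *\<^sub>R v) $ i $ i) \<longlongrightarrow> g (0 *\<^sub>R v) $ i $ i) (at 0)"
      by (metis (no_types, lifting) UNIV_I continuous_on_def open_UNIV at_within_open)
    then show ?thesis by (simp add: filterlim_at_split)
  qed
  have uniq: "g 0 $ j $ j = g 0 $ i $ i" if "\<And>r. r > 0 \<Longrightarrow> g (r *\<^sub>R v) $ i $ i = E j r" for v i j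
  proof (rule tendsto_unique[OF _ lim[of e1 j]])
    have "\<forall>\<^sub>F r in at_right 0. g (r *\<^sub>R v) $ i $ i = g (r *\<^sub>R e1) $ j $ j"
      unfolding eventually_at_right_field using that by (auto simp: E_def intro!: exI[of _ 1])
    with lim[of v i] show "((\<lambda>r. g (r *\<^sub>R e1) $ j $ j) \<longlongrightarrow> g 0 $ i $ i) (at_right 0)"
      by (simp cong: tendsto_cong)
  qed simp
  show "E 2 0 = E 1 0"
    unfolding E_def scaleR_zero_left
  proof (rule uniq[of "axis 2 1" 1 2])
    fix r :: real assume "r > 0"
    then show "g (r *\<^sub>R axis 2 1) $ 1 $ 1 = E 2 r"
      using metric_formula[OF nz[of r 2], of 1 1] by (simp add: norm_axis_1 X_coords axis_nth_if power2_eq_square)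
  qed
  show "E 3 0 = E 1 0"
    unfolding E_def scaleR_zero_left
  proof (rule uniq[of "axis 3 1" 1 3])
    fix r :: real assume "r > 0"
    then show "g (r *\<^sub>R axis 3 1) $ 1 $ 1 = E 3 r"
      using metric_formula[OF nz[of r 3], of 1 1] by (simp add: norm_axis_1 X_coords axis_nth_if power2_eq_square)
  qed
  have "E 4 0 = E 3 0"
    unfolding E_def scaleR_zero_left
  proof (rule uniq[of e1 3 4])
    fix r :: real assume "r > 0"
    then show "g (r *\<^sub>R e1) $ 3 $ 3 = E 4 r" using E34 by (simp add: E_def)
  qed
  then show "E 4 r = E 3 r"
    using E34[of r] E34[of "-r"] even'[of "-r" 3] even'[of "-r" 4] by (cases r "0::real" rule: linorder_cases) auto
qed

section \<open>Monotonicity and range of the radial distance\<close>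

lemma rho_0: "rho 0 = 0" by (simp add: rho_def dist_self)

lemma rho_nonneg: "rho r \<ge> 0" by (simp add: rho_def dist_nonneg)

lemma rho_line: assumes "0 \<le> r" "r \<le> s"
  shows "riem_dist g (r *\<^sub>R e1) (s *\<^sub>R e1) \<le> integral {r..s} (\<lambda>x. sqrt (E 1 x))"
proof -
  define \<gamma> where "\<gamma> u = r *\<^sub>R e1 + u *\<^sub>R ((s - r) *\<^sub>R e1)" for u
  have \<gamma>: "\<gamma> \<in> curves (r *\<^sub>R e1) (s *\<^sub>R e1)"
    using line_C1[of "r *\<^sub>R e1" "(s - r) *\<^sub>R e1"] by (simp add: curves_def \<gamma>_def[abs_def] scaleR_left_diff_distrib)
  have d: "(\<gamma> has_vector_derivative (s - r) *\<^sub>R e1) (at u)" for u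
    unfolding \<gamma>_def[abs_def] by (auto intro!: derivative_eq_intros)
  have sp: "speed g \<gamma> u = (s - r) *\<^sub>R sqrt (E 1 (r + u * (s - r)))" for u
  proof -
    have "\<gamma> u = (r + u * (s - r)) *\<^sub>R e1" by (simp add: \<gamma>_def scaleR_left_distrib)
    then show ?thesis unfolding speed_def vector_derivative_at[OF d] ip_scale ip_axis
      using assms by (simp add: E_def real_sqrt_mult)
  qed
  have "((\<lambda>u. (s - r) *\<^sub>R sqrt (E 1 (r + u * (s - r)))) has_integral integral {r + 0 * (s - r)..r + 1 * (s - r)} (\<lambda>x. sqrt (E 1 x))) {0..1}"
  proof (rule has_integral_substitution[where c = r and d = s])
    show "continuous_on {r..s} (\<lambda>x. sqrt (E 1 x))"
      by (intro continuous_intros continuous_on_subset[OF smooth_on_continuous_on[OF E_smooth]]) auto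
    show "((\<lambda>u. r + u * (s - r)) has_real_derivative s - r) (at u within {0..1})" for u
      by (auto intro!: derivative_eq_intros)
    show "(\<lambda>u. r + u * (s - r)) ` {0..1} \<subseteq> {r..s}"
    proof safe
      fix u :: real assume "u \<in> {0..1}"
      then have "0 \<le> u * (s - r)" using assms by simp
      moreover have "u * (s - r) \<le> 1 * (s - r)" using \<open>u \<in> {0..1}\<close> assms by (intro mult_right_mono) auto
      ultimately show "r + u * (s - r) \<in> {r..s}" by simp
    qed
  qed (use assms in auto)
  then have "curve_length g \<gamma> = integral {r..s} (\<lambda>x. sqrt (E 1 x))"
    unfolding curve_length_eq sp[abs_def] by (intro integral_unique) simp
  with dist_le[OF \<gamma>] show ?thesis by simp
qed

lemma rho_small: assumes "e > 0" obtains d where "d > 0" "\<And>r. 0 < r \<Longrightarrow> r < d \<Longrightarrow> rho r < e"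
proof -
  have "continuous_on {0..1} (\<lambda>x. sqrt (E 1 x))"
    by (intro continuous_intros continuous_on_subset[OF smooth_on_continuous_on[OF E_smooth]]) auto
  then have c: "continuous_on {0..1} (\<lambda>r. integral {0..r} (\<lambda>x. sqrt (E 1 x)))"
    by (intro indefinite_integral_continuous_1 integrable_continuous_real)
  then obtain d where d: "d > 0" "\<And>r. r \<in> {0..1} \<Longrightarrow> dist r 0 < d \<Longrightarrow> dist (integral {0..r} (\<lambda>x. sqrt (E 1 x))) (integral {0..0} (\<lambda>x. sqrt (E 1 x))) < e"
    using assms unfolding continuous_on_iff by (metis atLeastAtMost_iff order_refl zero_le_one)
  show thesis
  proof (rule that[of "min d 1"])
    fix r :: real assume "0 < r" "r < min d 1"
    then have "integral {0..r} (\<lambda>x. sqrt (E 1 x)) < e" using d(2)[of r] by (auto simp: dist_real_def)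
    then show "rho r < e" using rho_line[of 0 r] \<open>0 < r\<close> by (simp add: rho_def)
  qed (use d in auto)
qed

text \<open>The square of \<open>rho'\<close> is \<open>E 1 > 0\<close>, so by Rolle
  \<open>rho\<close> is injective on the open ray, hence monotone. It cannot decrease, since it is
  positive and tends to \<open>0\<close> at the origin.\<close>

lemma rho_mono: assumes "0 < r" "r < s" shows "rho r < rho s"
proof (rule ccontr)
  assume n: "\<not> rho r < rho s"
  have nd: "deriv rho x \<noteq> 0" if "x > 0" for x using E_vals(1)[OF that] E_pos[of 1 x] by auto
  have cont: "continuous_on {a..x} rho" if "a > 0" for a x
    using that by (intro continuous_at_imp_continuous_on ballI DERIV_isCont[OF rho_deriv_exists]) auto
  have neq: "rho x \<noteq> rho y" if xy: "0 < x" "x < y" for x y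
  proof
    assume e: "rho x = rho y"
    have "\<exists>z. x < z \<and> z < y \<and> (rho has_real_derivative 0) (at z)"
    proof (rule Rolle[OF xy(2) e cont[OF xy(1)]])
      fix z assume "x < z" "z < y"
      then have "z > 0" using xy by simp
      then show "rho differentiable (at z)" using rho_deriv_exists real_differentiable_def by blast
    qed
    then obtain z where z: "x < z" "(rho has_real_derivative 0) (at z)" by blast
    from DERIV_imp_deriv[OF z(2)] show False using nd[of z] z(1) xy by simp
  qed
  have inj: "inj_on rho {a..x}" if "a > 0" for a x
    using neq that by (intro inj_onI) (metis atLeastAtMost_iff linorder_cases order_less_le_trans)
  have lt: "rho s < rho r" using n neq[OF assms] by simp
  have big: "rho s < rho a" if "0 < a" "a < r" for a
    using continuous_inj_imp_mono[OF that(2) assms(2) cont[OF that(1)] inj[OF that(1)]] lt by auto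
  have s0: "rho s \<ge> 0" by (rule rho_nonneg)
  have "rho s > 0 \<or> rho s = 0" using s0 by auto
  then show False
  proof
    assume "rho s > 0"
    then obtain d where d: "d > 0" "\<And>r. 0 < r \<Longrightarrow> r < d \<Longrightarrow> rho r < rho s" by (rule rho_small) blast
    define a where "a = min (d / 2) (r / 2)"
    have "0 < a" "a < d" "a < r" using d(1) assms by (auto simp: a_def min_def)
    then show False using big[of a] d(2)[of a] by simp
  next
    assume "rho s = 0"
    have "s *\<^sub>R e1 \<noteq> 0" using assms by (simp add: axis_eq_0_iff)
    then show False using dist_pos[of 0 "s *\<^sub>R e1"] \<open>rho s = 0\<close> by (simp add: rho_def)
  qed
qed

lemma rho_pos: "r > 0 \<Longrightarrow> rho r > 0"
  using dist_pos[of 0 "r *\<^sub>R e1"] by (simp add: rho_def axis_eq_0_iff)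

lemma rho_deriv: assumes "r > 0" shows "(rho has_real_derivative sqrt (E 1 r)) (at r)"
proof -
  have "deriv rho r \<ge> 0"
  proof (rule ccontr)
    assume "\<not> deriv rho r \<ge> 0"
    then obtain d where "d > 0" "\<And>h. 0 < h \<Longrightarrow> h < d \<Longrightarrow> rho (r + h) < rho r"
      using DERIV_neg_dec_right[OF rho_deriv_exists[OF assms]] by auto
    then show False using rho_mono[OF assms, of "r + d/2"] by (metis add_strict_increasing assms half_gt_zero_iff less_add_same_cancel1 less_asym field_sum_of_halves)
  qed
  then have "deriv rho r = sqrt (E 1 r)" using E_vals(1)[OF assms] by simp
  with rho_deriv_exists[OF assms] show ?thesis by simp
qed

lemma rho_diff: assumes "0 < r" "r \<le> s" shows "riem_dist g (r *\<^sub>R e1) (s *\<^sub>R e1) \<le> rho s - rho r"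
proof -
  have "((\<lambda>x. sqrt (E 1 x)) has_integral rho s - rho r) {r..s}"
    by (rule fundamental_theorem_of_calculus)
      (use assms rho_deriv in \<open>auto simp: has_real_derivative_iff_has_vector_derivative[symmetric] intro: has_field_derivative_at_within\<close>)
  then show ?thesis using rho_line[of r s] assms by (simp add: integral_unique)
qed

text \<open>Here completeness enters. If \<open>rho\<close> were bounded, the points
  \<open>n e1\<close> would be a Cauchy sequence, because their mutual distances are at most
  differences of \<open>rho\<close>. Its limit \<open>p\<close> would be at distance
  \<open>rho (norm p)\<close> from the origin, which the sequence exceeds as soon as
  \<open>n > norm p\<close>.\<close>

lemma rho_unbounded: "\<exists>r>0. rho r > S"
proof (rule ccontr)
  assume "\<not> ?thesis"
  then have bd: "\<And>r. r > 0 \<Longrightarrow> rho r \<le> S" by (meson not_less)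
  interpret Metric_space UNIV "riem_dist g" by (rule metric_space)
  define x where "x n = real (Suc n) *\<^sub>R e1" for n
  have inc: "rho (real (Suc n)) \<le> rho (real (Suc m))" if "n \<le> m" for n m
    using rho_mono[of "real (Suc n)" "real (Suc m)"] that by (cases "n = m") auto
  have "incseq (\<lambda>n. rho (real (Suc n)))" using inc by (simp add: incseq_def)
  moreover have "Bseq (\<lambda>n. rho (real (Suc n)))"
    by (rule BseqI'[of _ S]) (use bd rho_nonneg in auto)
  ultimately have conv: "convergent (\<lambda>n. rho (real (Suc n)))" by (rule Bseq_monoseq_convergent[OF _ incseq_imp_monoseq, rotated])
  then have C: "Cauchy (\<lambda>n. rho (real (Suc n)))" by (rule convergent_Cauchy)
  have dx: "riem_dist g (x n) (x m) \<le> \<bar>rho (real (Suc n)) - rho (real (Suc m))\<bar>" for n m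
    using rho_diff[of "real (Suc n)" "real (Suc m)"] rho_diff[of "real (Suc m)" "real (Suc n)"]
      dist_sym[of "x n" "x m"] unfolding x_def by (cases "n \<le> m") auto
  have "MCauchy x"
    unfolding MCauchy_def
  proof (intro conjI allI impI)
    fix e :: real assume "e > 0"
    then obtain N where "\<And>m n. m \<ge> N \<Longrightarrow> n \<ge> N \<Longrightarrow> \<bar>rho (real (Suc m)) - rho (real (Suc n))\<bar> < e"
      using C unfolding Cauchy_def dist_real_def by blast
    then show "\<exists>N. \<forall>n n'. N \<le> n \<longrightarrow> N \<le> n' \<longrightarrow> riem_dist g (x n) (x n') < e"
      using dx order_le_less_trans by blast
  qed simp
  then obtain p where "limitin mtopology x p sequentially" using complete unfolding mcomplete_def by blast
  then have lim: "(\<lambda>n. riem_dist g (x n) p) \<longlonglongrightarrow> 0" by (simp add: limitin_metric_dist_null)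
  have le: "rho (real (Suc n)) \<le> riem_dist g 0 p + riem_dist g (x n) p" for n
    using dist_triangle[of 0 "x n" p] dist_sym[of p "x n"] by (simp add: x_def rho_def)
  define q where "q = nat \<lceil>norm p\<rceil> + 1"
  have "rho (real (Suc q)) \<le> riem_dist g 0 p"
  proof (rule LIMSEQ_le_const)
    show "(\<lambda>n. riem_dist g 0 p + riem_dist g (x n) p) \<longlonglongrightarrow> riem_dist g 0 p"
      using tendsto_add[OF tendsto_const[of "riem_dist g 0 p"] lim] by simp
    show "\<exists>N. \<forall>n\<ge>N. rho (real (Suc q)) \<le> riem_dist g 0 p + riem_dist g (x n) p"
      using le inc order_trans by blast
  qed
  also have "\<dots> = rho (norm p)" by (rule dist_rho)
  also have "\<dots> < rho (real (Suc q))"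
  proof (cases "p = 0")
    case False
    have "norm p < real (Suc q)" unfolding q_def by linarith
    then show ?thesis using rho_mono[of "norm p" "real (Suc q)"] False by simp
  next
    case True then show ?thesis using rho_0 rho_pos[of "real (Suc q)"] by simp
  qed
  finally show False by simp
qed

lemma rho_inverse: assumes "s > 0" obtains r where "r > 0" "rho r = s"
proof -
  obtain d where d: "d > 0" "\<And>r. 0 < r \<Longrightarrow> r < d \<Longrightarrow> rho r < s" using rho_small[OF assms] by blast
  obtain R where R: "R > 0" "rho R > s" using rho_unbounded by blast
  have dR: "d / 2 \<le> R"
  proof (rule ccontr)
    assume "\<not> d / 2 \<le> R"
    then have "rho R < s" using d R by simp
    then show False using R by simp
  qed
  have d2: "rho (d / 2) < s" using d by simp
  have "\<exists>x\<ge>d / 2. x \<le> R \<and> rho x = s"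
  proof (rule IVT')
    show "continuous_on {d/2..R} rho"
      using d by (intro continuous_at_imp_continuous_on ballI DERIV_isCont[OF rho_deriv]) auto
    show "rho (d / 2) \<le> s" "s \<le> rho R" "d / 2 \<le> R" using d2 R dR by auto
  qed
  then obtain x where "x \<ge> d / 2" "rho x = s" by blast
  then show thesis using that[of x] d(1) by simp
qed

lemma at_within_pos: "s > 0 \<Longrightarrow> at s within {0..} = at (s :: real)"
  by (rule at_within_open_subset[of s "{0<..}"]) auto

text \<open>The change of variable \<open>s = rho r\<close>: derivatives in arclength are radial
  derivatives divided by \<open>sqrt (E 1 r)\<close>. The inverse of \<open>rho\<close> is
  constructed on the way.\<close>

lemma ds_rho:
  assumes F: "(F has_real_derivative F') (at r)" "\<And>r. r > 0 \<Longrightarrow> h (rho r) = F r" and r: "r > 0"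
  shows "ds h (rho r) = F' / sqrt (E 1 r)"
proof -
  define R where "R s = (SOME r. r > 0 \<and> rho r = s)" for s
  have R: "R s > 0" "rho (R s) = s" if "s > 0" for s
    using someI_ex[of "\<lambda>r. r > 0 \<and> rho r = s"] rho_inverse[OF that] unfolding R_def by blast+
  have Rrho: "R (rho r) = r" if "r > 0" for r
    using R[OF rho_pos[OF that]] rho_mono[of r "R (rho r)"] rho_mono[of "R (rho r)" r] that
    by (cases "R (rho r)" r rule: linorder_cases) auto
  have "(R has_real_derivative inverse (sqrt (E 1 r))) (at (rho r))"
  proof (rule DERIV_inverse_function[where f = rho and a = 0 and b = "rho r + 1"])
    show "(rho has_real_derivative sqrt (E 1 r)) (at (R (rho r)))" using rho_deriv[OF r] Rrho[OF r] by simp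
    show "isCont R (rho r)"
    proof (rule isCont_inverse_function[of "r / 2" r R rho])
      show "R (rho z) = z" if "\<bar>z - r\<bar> \<le> r / 2" for z using that r by (intro Rrho) (auto simp: abs_if split: if_splits)
      show "isCont rho z" if "\<bar>z - r\<bar> \<le> r / 2" for z using that r by (intro DERIV_isCont[OF rho_deriv]) (auto simp: abs_if split: if_splits)
    qed (use r in simp)
  qed (use E_pos[of 1 r] rho_pos[OF r] R in auto)
  then have "((\<lambda>s. F (R s)) has_real_derivative F' * inverse (sqrt (E 1 r))) (at (rho r))"
    using F(1) Rrho[OF r] by (intro DERIV_chain2[where f = F]) simp_all
  then have "(h has_real_derivative F' * inverse (sqrt (E 1 r))) (at (rho r))"
  proof (rule has_field_derivative_transform_within_open[of _ _ _ "{0<..}"])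
    show "F (R s) = h s" if "s \<in> {0<..}" for s using F(2)[OF R(1)[of s]] R(2)[of s] that by simp
  qed (use rho_pos[OF r] in auto)
  then show ?thesis
    unfolding ds_def at_within_pos[OF rho_pos[OF r]]
    by (simp add: has_real_derivative_iff_has_vector_derivative vector_derivative_at divide_inverse)
qed

lemma coefficients:
  assumes "r > 0"
  shows "b (rho r) = r * sqrt (E 3 r)" "c (rho r) = r * sqrt (E 2 r)"
proof -
  have "b (rho r) > 0" "c (rho r) > 0" using form rho_pos[OF assms] by (auto simp: has_berger_form_def)
  then show "b (rho r) = r * sqrt (E 3 r)" "c (rho r) = r * sqrt (E 2 r)"
    unfolding E_vals[OF assms] using assms by (simp_all add: real_sqrt_divide)
qed

end

section \<open>Curvature along a ray\<close>

abbreviation dl :: "4 \<Rightarrow> 4 \<Rightarrow> real" where "dl i j \<equiv> (if i = j then 1 else 0)"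

text \<open>The matrix of multiplication by the imaginary unit on C^2, that is, of the linear field
  \<open>X3\<close>.\<close>

definition JJ :: "4 \<Rightarrow> 4 \<Rightarrow> real" where "JJ i k = X3 (axis k 1) $ i"

lemma JJ_simps:
  "JJ 1 1 = 0" "JJ 1 2 = -1" "JJ 1 3 = 0" "JJ 1 4 = 0" "JJ 2 1 = 1" "JJ 2 2 = 0" "JJ 2 3 = 0" "JJ 2 4 = 0"
  "JJ 3 1 = 0" "JJ 3 2 = 0" "JJ 3 3 = 0" "JJ 3 4 = -1" "JJ 4 1 = 0" "JJ 4 2 = 0" "JJ 4 3 = 1" "JJ 4 4 = 0"
  by (simp_all add: JJ_def X_coords axis_nth_if)

lemma X3_linear: "bounded_linear X3"
proof -
  have "linear X3" by (rule linearI) (simp_all add: X_coords vec_eq_iff forall_4)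
  then show ?thesis by (rule linear_conv_bounded_linear[THEN iffD1])
qed

lemma X3_nth_deriv: "((\<lambda>x. X3 x $ i) has_derivative (\<lambda>v. X3 v $ i)) (at x)"
  by (rule bounded_linear_imp_has_derivative)
    (rule bounded_linear_compose[OF bounded_linear_vec_nth X3_linear])

lemma nth_deriv: "((\<lambda>x::real^4. x $ i) has_derivative (\<lambda>v. v $ i)) (at x)"
  by (rule bounded_linear_imp_has_derivative[OF bounded_linear_vec_nth])

lemma radial_deriv:
  assumes "(F has_real_derivative norm x * F1) (at (norm x))" "(x :: real^4) \<noteq> 0"
  shows "((\<lambda>x. F (norm x)) has_derivative (\<lambda>v. F1 * (x \<bullet> v))) (at x)"
proof -
  have n: "(norm has_derivative (\<lambda>v. x \<bullet> v / norm x)) (at x)"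
    using has_derivative_norm[OF assms(2)] by (simp add: sgn_div_norm inner_commute divide_inverse mult.commute)
  have "(F has_derivative (*) (norm x * F1)) (at (norm x))" using assms(1) by (simp add: has_field_derivative_def)
  from diff_chain_at[OF n this] assms(2) show ?thesis by (simp add: o_def mult.commute mult.left_commute)
qed

text \<open>The matrix field with eigenvalues \<open>f1 |x|\<close>, \<open>f2 |x|\<close>, \<open>f3 |x|\<close> in the directions \<open>x\<close>, \<open>X3 x\<close> and their complement.\<close>

definition MF :: "(real \<Rightarrow> real) \<Rightarrow> (real \<Rightarrow> real) \<Rightarrow> (real \<Rightarrow> real) \<Rightarrow> 4 \<Rightarrow> 4 \<Rightarrow> real^4 \<Rightarrow> real" where
  "MF f1 f2 f3 i j x = f3 (norm x) * dl i j + (f1 (norm x) - f3 (norm x)) / (norm x)\<^sup>2 * (x $ i * x $ j)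
     + (f2 (norm x) - f3 (norm x)) / (norm x)\<^sup>2 * (X3 x $ i * X3 x $ j)"

text \<open>\<open>qt1\<close> and \<open>qt2\<close> arise from \<open>qt\<close> by applying
  \<open>(1/n) d/dn\<close> once and twice. As the gradient of \<open>F (norm x)\<close> is
  \<open>(F' n / n) x\<close>, this operator keeps all derivatives of the matrix field polynomial in
  \<open>x\<close> with radial coefficients.\<close>

definition qt where "qt d n = d n / n\<^sup>2" for d :: "real \<Rightarrow> real"
definition qt1 where "qt1 d d' n = d' n / n^3 - 2 * d n / n^4" for d d' :: "real \<Rightarrow> real"
definition qt2 where "qt2 d d' d'' n = d'' n / n^4 - 5 * d' n / n^5 + 8 * d n / n^6" for d d' d'' :: "real \<Rightarrow> real"

lemma qt_deriv: assumes "(d has_real_derivative d' n) (at n)" "n > 0"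
  shows "(qt d has_real_derivative n * qt1 d d' n) (at n)"
  unfolding qt_def[abs_def] qt1_def
  apply (rule derivative_eq_intros assms refl)+
  using assms(2) by (simp_all add: field_simps power2_eq_square power3_eq_cube power4_eq_xxxx)

lemma qt1_deriv: assumes "(d has_real_derivative d' n) (at n)" "(d' has_real_derivative d'' n) (at n)" "n > 0"
  shows "(qt1 d d' has_real_derivative n * qt2 d d' d'' n) (at n)"
proof -
  have nz: "n \<noteq> 0" "n^3 \<noteq> 0" "n^4 \<noteq> 0" using assms by auto
  show ?thesis
    unfolding qt1_def[abs_def] qt2_def
    apply (rule derivative_eq_intros assms nz refl)+
    using nz(1) by (simp add: divide_simps) (simp add: algebra_simps eval_nat_numeral)
qed

lemma MF_qt: "MF f1 f2 f3 i j x = f3 (norm x) * dl i j + qt (\<lambda>n. f1 n - f3 n) (norm x) * (x $ i * x $ j)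
     + qt (\<lambda>n. f2 n - f3 n) (norm x) * (X3 x $ i * X3 x $ j)"
  by (simp add: MF_def qt_def)

text \<open>The partial derivative in direction \<open>k\<close> of the entry \<open>i j\<close> of
  \<open>MF\<close>; \<open>SF\<close> below is the differential of \<open>DF\<close> applied to
  \<open>v\<close>. Closed forms are kept so that both can be evaluated on the ray.\<close>

definition DF where
  "DF f1 f2 f3 f1' f2' f3' k i j x = f3' (norm x) / norm x * (x $ k) * dl i j
    + qt1 (\<lambda>n. f1 n - f3 n) (\<lambda>n. f1' n - f3' n) (norm x) * (x $ k) * (x $ i * x $ j)
    + qt (\<lambda>n. f1 n - f3 n) (norm x) * (dl i k * x $ j + x $ i * dl j k)
    + qt1 (\<lambda>n. f2 n - f3 n) (\<lambda>n. f2' n - f3' n) (norm x) * (x $ k) * (X3 x $ i * X3 x $ j)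
    + qt (\<lambda>n. f2 n - f3 n) (norm x) * (JJ i k * X3 x $ j + X3 x $ i * JJ j k)"
  for f1 f2 f3 f1' f2' f3' :: "real \<Rightarrow> real" and x :: "real^4"

definition SF where
  "SF f1 f2 f3 f1' f2' f3' f1'' f2'' f3'' k i j x v =
    (f3'' (norm x) / (norm x)\<^sup>2 - f3' (norm x) / (norm x)^3) * (x \<bullet> v) * (x $ k) * dl i j + f3' (norm x) / norm x * v $ k * dl i j
    + qt2 (\<lambda>n. f1 n - f3 n) (\<lambda>n. f1' n - f3' n) (\<lambda>n. f1'' n - f3'' n) (norm x) * (x \<bullet> v) * (x $ k) * (x $ i * x $ j)
    + qt1 (\<lambda>n. f1 n - f3 n) (\<lambda>n. f1' n - f3' n) (norm x) * (v $ k * (x $ i * x $ j) + x $ k * (v $ i * x $ j) + x $ k * (x $ i * v $ j))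
    + qt1 (\<lambda>n. f1 n - f3 n) (\<lambda>n. f1' n - f3' n) (norm x) * (x \<bullet> v) * (dl i k * x $ j + x $ i * dl j k)
    + qt (\<lambda>n. f1 n - f3 n) (norm x) * (dl i k * v $ j + v $ i * dl j k)
    + qt2 (\<lambda>n. f2 n - f3 n) (\<lambda>n. f2' n - f3' n) (\<lambda>n. f2'' n - f3'' n) (norm x) * (x \<bullet> v) * (x $ k) * (X3 x $ i * X3 x $ j)
    + qt1 (\<lambda>n. f2 n - f3 n) (\<lambda>n. f2' n - f3' n) (norm x) * (v $ k * (X3 x $ i * X3 x $ j) + x $ k * (X3 v $ i * X3 x $ j) + x $ k * (X3 x $ i * X3 v $ j))
    + qt1 (\<lambda>n. f2 n - f3 n) (\<lambda>n. f2' n - f3' n) (norm x) * (x \<bullet> v) * (JJ i k * X3 x $ j + X3 x $ i * JJ j k)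
    + qt (\<lambda>n. f2 n - f3 n) (norm x) * (JJ i k * X3 v $ j + X3 v $ i * JJ j k)"
  for f1 f2 f3 f1' f2' f3' f1'' f2'' f3'' :: "real \<Rightarrow> real" and x v :: "real^4"

lemma MF_deriv:
  assumes f: "\<And>n. n > 0 \<Longrightarrow> (f1 has_real_derivative f1' n) (at n)" "\<And>n. n > 0 \<Longrightarrow> (f2 has_real_derivative f2' n) (at n)"
    "\<And>n. n > 0 \<Longrightarrow> (f3 has_real_derivative f3' n) (at n)" and x: "x \<noteq> 0"
  shows "(MF f1 f2 f3 i j has_derivative (\<lambda>v. f3' (norm x) / norm x * (x \<bullet> v) * dl i j
    + qt1 (\<lambda>n. f1 n - f3 n) (\<lambda>n. f1' n - f3' n) (norm x) * (x \<bullet> v) * (x $ i * x $ j)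
    + qt (\<lambda>n. f1 n - f3 n) (norm x) * (v $ i * x $ j + x $ i * v $ j)
    + qt1 (\<lambda>n. f2 n - f3 n) (\<lambda>n. f2' n - f3' n) (norm x) * (x \<bullet> v) * (X3 x $ i * X3 x $ j)
    + qt (\<lambda>n. f2 n - f3 n) (norm x) * (X3 v $ i * X3 x $ j + X3 x $ i * X3 v $ j))) (at x)"
proof -
  have n: "norm x > 0" using x by simp
  have r3: "((\<lambda>x. f3 (norm x)) has_derivative (\<lambda>v. f3' (norm x) / norm x * (x \<bullet> v))) (at x)"
    by (rule radial_deriv[OF _ x]) (use f(3)[OF n] n in simp)
  have r1: "((\<lambda>x. qt (\<lambda>n. f1 n - f3 n) (norm x)) has_derivative (\<lambda>v. qt1 (\<lambda>n. f1 n - f3 n) (\<lambda>n. f1' n - f3' n) (norm x) * (x \<bullet> v))) (at x)"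
    by (rule radial_deriv[OF qt_deriv x]) (intro DERIV_diff f n)+
  have r2: "((\<lambda>x. qt (\<lambda>n. f2 n - f3 n) (norm x)) has_derivative (\<lambda>v. qt1 (\<lambda>n. f2 n - f3 n) (\<lambda>n. f2' n - f3' n) (norm x) * (x \<bullet> v))) (at x)"
    by (rule radial_deriv[OF qt_deriv x]) (intro DERIV_diff f n)+
  show ?thesis
    unfolding MF_qt[abs_def]
    by (rule has_derivative_eq_rhs, rule has_derivative_add[OF has_derivative_add[OF has_derivative_mult_left[OF r3]
        has_derivative_mult[OF r1 has_derivative_mult[OF nth_deriv nth_deriv]]]
        has_derivative_mult[OF r2 has_derivative_mult[OF X3_nth_deriv X3_nth_deriv]]])
      (simp add: fun_eq_iff algebra_simps)
qed

lemma pd_eq: "(f has_derivative f') (at x) \<Longrightarrow> pd k f x = f' (axis k 1)"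
  unfolding pd_def using frechet_derivative_at by metis

lemma MF_pd:
  assumes f: "\<And>n. n > 0 \<Longrightarrow> (f1 has_real_derivative f1' n) (at n)" "\<And>n. n > 0 \<Longrightarrow> (f2 has_real_derivative f2' n) (at n)"
    "\<And>n. n > 0 \<Longrightarrow> (f3 has_real_derivative f3' n) (at n)" and x: "x \<noteq> 0"
  shows "pd k (MF f1 f2 f3 i j) x = DF f1 f2 f3 f1' f2' f3' k i j x"
  by (subst pd_eq, rule MF_deriv[OF f x], assumption+)
    (auto simp: DF_def axis_nth_if inner_axis JJ_def[symmetric])

lemma DF_deriv:
  assumes f: "\<And>n. n > 0 \<Longrightarrow> (f1 has_real_derivative f1' n) (at n)" "\<And>n. n > 0 \<Longrightarrow> (f2 has_real_derivative f2' n) (at n)"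
    "\<And>n. n > 0 \<Longrightarrow> (f3 has_real_derivative f3' n) (at n)"
    and f': "\<And>n. n > 0 \<Longrightarrow> (f1' has_real_derivative f1'' n) (at n)" "\<And>n. n > 0 \<Longrightarrow> (f2' has_real_derivative f2'' n) (at n)"
    "\<And>n. n > 0 \<Longrightarrow> (f3' has_real_derivative f3'' n) (at n)" and x: "x \<noteq> 0"
  shows "(DF f1 f2 f3 f1' f2' f3' k i j has_derivative SF f1 f2 f3 f1' f2' f3' f1'' f2'' f3'' k i j x) (at x)"
proof -
  have n: "norm x > 0" using x by simp
  have "((\<lambda>n. f3' n / n) has_real_derivative norm x * (f3'' (norm x) / (norm x)\<^sup>2 - f3' (norm x) / (norm x)^3)) (at (norm x))"
    apply (rule derivative_eq_intros f' n refl)+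
    using n by (simp_all add: field_simps power2_eq_square power3_eq_cube)
  from radial_deriv[OF this x]
  have r3: "((\<lambda>x. f3' (norm x) / norm x) has_derivative (\<lambda>v. (f3'' (norm x) / (norm x)\<^sup>2 - f3' (norm x) / (norm x)^3) * (x \<bullet> v))) (at x)" .
  have r1: "((\<lambda>x. qt (\<lambda>n. f1 n - f3 n) (norm x)) has_derivative (\<lambda>v. qt1 (\<lambda>n. f1 n - f3 n) (\<lambda>n. f1' n - f3' n) (norm x) * (x \<bullet> v))) (at x)"
    by (rule radial_deriv[OF qt_deriv x]) (intro DERIV_diff f n)+
  have r2: "((\<lambda>x. qt (\<lambda>n. f2 n - f3 n) (norm x)) has_derivative (\<lambda>v. qt1 (\<lambda>n. f2 n - f3 n) (\<lambda>n. f2' n - f3' n) (norm x) * (x \<bullet> v))) (at x)"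
    by (rule radial_deriv[OF qt_deriv x]) (intro DERIV_diff f n)+
  have r1': "((\<lambda>x. qt1 (\<lambda>n. f1 n - f3 n) (\<lambda>n. f1' n - f3' n) (norm x)) has_derivative
     (\<lambda>v. qt2 (\<lambda>n. f1 n - f3 n) (\<lambda>n. f1' n - f3' n) (\<lambda>n. f1'' n - f3'' n) (norm x) * (x \<bullet> v))) (at x)"
    by (rule radial_deriv[OF qt1_deriv x]) (intro DERIV_diff f f' n)+
  have r2': "((\<lambda>x. qt1 (\<lambda>n. f2 n - f3 n) (\<lambda>n. f2' n - f3' n) (norm x)) has_derivative
     (\<lambda>v. qt2 (\<lambda>n. f2 n - f3 n) (\<lambda>n. f2' n - f3' n) (\<lambda>n. f2'' n - f3'' n) (norm x) * (x \<bullet> v))) (at x)"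
    by (rule radial_deriv[OF qt1_deriv x]) (intro DERIV_diff f f' n)+
  show ?thesis
    unfolding DF_def[abs_def]
    by (rule has_derivative_eq_rhs, rule has_derivative_add[OF has_derivative_add[OF has_derivative_add[OF has_derivative_add[OF
        has_derivative_mult_left[OF has_derivative_mult[OF r3 nth_deriv]]
        has_derivative_mult[OF has_derivative_mult[OF r1' nth_deriv] has_derivative_mult[OF nth_deriv nth_deriv]]]
        has_derivative_mult[OF r1 has_derivative_add[OF has_derivative_mult_right[OF nth_deriv] has_derivative_mult_left[OF nth_deriv]]]]
        has_derivative_mult[OF has_derivative_mult[OF r2' nth_deriv] has_derivative_mult[OF X3_nth_deriv X3_nth_deriv]]]
        has_derivative_mult[OF r2 has_derivative_add[OF has_derivative_mult_right[OF X3_nth_deriv] has_derivative_mult_left[OF X3_nth_deriv]]]])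
      (simp only: SF_def[abs_def] fun_eq_iff, simp add: algebra_simps)
qed

text \<open>If the metric is diagonal at \<open>x\<close>, the derivative of the inverse matrix needs only the diagonal entries.\<close>

lemma riemann_diagonal:
  fixes g :: "4 metric"
  assumes U: "open U" "x \<in> U"
    and D: "\<And>y k i j. y \<in> U \<Longrightarrow> pd k (\<lambda>y. g y $ i $ j) y = D k i j y"
    and S: "\<And>k i j. (D k i j has_derivative S k i j) (at x)"
    and G: "\<And>y i j. y \<in> U \<Longrightarrow> matrix_inv (g y) $ i $ j = G i j y" "\<And>i j. (G i j has_derivative G' i j) (at x)"
    and Gd: "\<And>i j. G i j x = Gd i * dl i j" "\<And>i j k. G' i j (axis k 1) = - Gd i * Gd j * D k i j x"
  defines "F i j p \<equiv> (D i j p x + D j i p x - D p i j x) / 2"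
  shows "riemann g l i j k x =
    Gd l * ((S j k l (axis i 1) + S k j l (axis i 1) - S l j k (axis i 1)) / 2 - (\<Sum>m\<in>UNIV. Gd m * D i l m x * F j k m))
    - Gd l * ((S i k l (axis j 1) + S k i l (axis j 1) - S l i k (axis j 1)) / 2 - (\<Sum>m\<in>UNIV. Gd m * D j l m x * F i k m))
    + (\<Sum>p\<in>UNIV. (Gd p * F j k p) * (Gd l * F i p l) - (Gd p * F i k p) * (Gd l * F j p l))"
proof -
  have chr: "christoffel g l j k y = (1/2) * (\<Sum>m\<in>UNIV. G l m y * (D j k m y + D k j m y - D m j k y))" if "y \<in> U" for l j k y
    unfolding christoffel_def using that by (simp add: D G)
  have chr0: "christoffel g l j k x = Gd l * F j k l" for l j k
    unfolding chr[OF U(2)] Gd(1) F_def by (simp add: if_distrib[where f = "\<lambda>x. x * _"] if_distrib[where f = "\<lambda>x. _ * x"] sum.delta' cong: if_cong)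
  have pdc: "pd i (christoffel g l j k) x = Gd l * ((S j k l (axis i 1) + S k j l (axis i 1) - S l j k (axis i 1)) / 2
     - (\<Sum>m\<in>UNIV. Gd m * D i l m x * F j k m))" for i l j k
  proof -
    have "((\<lambda>y. (1/2) * (\<Sum>m\<in>UNIV. G l m y * (D j k m y + D k j m y - D m j k y))) has_derivative
      (\<lambda>v. (1/2) * (\<Sum>m\<in>UNIV. G l m x * (S j k m v + S k j m v - S m j k v) + G' l m v * (D j k m x + D k j m x - D m j k x)))) (at x)"
      by (intro has_derivative_mult_right has_derivative_sum has_derivative_mult G(2) has_derivative_diff has_derivative_add S)
    then have "(christoffel g l j k has_derivative
      (\<lambda>v. (1/2) * (\<Sum>m\<in>UNIV. G l m x * (S j k m v + S k j m v - S m j k v) + G' l m v * (D j k m x + D k j m x - D m j k x)))) (at x)"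
      by (rule has_derivative_transform_within_open[OF _ U]) (simp add: chr)
    from frechet_derivative_at[OF this, symmetric]
    have "pd i (christoffel g l j k) x = (1/2) * (\<Sum>m\<in>UNIV. G l m x * (S j k m (axis i 1) + S k j m (axis i 1) - S m j k (axis i 1))
       + G' l m (axis i 1) * (D j k m x + D k j m x - D m j k x))" by (simp add: pd_def)
    also have "\<dots> = (1/2) * (\<Sum>m\<in>UNIV. G l m x * (S j k m (axis i 1) + S k j m (axis i 1) - S m j k (axis i 1)))
       - Gd l * (\<Sum>m\<in>UNIV. Gd m * D i l m x * F j k m)"
    proof -
      have F2: "D j k m x + D k j m x - D m j k x = 2 * F j k m" for m by (simp add: F_def)
      have "(\<Sum>m\<in>UNIV. G' l m (axis i 1) * (D j k m x + D k j m x - D m j k x)) = - 2 * (Gd l * (\<Sum>m\<in>UNIV. Gd m * D i l m x * F j k m))"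
        unfolding Gd(2) F2 sum_distrib_left by (rule sum.cong) simp_all
      then show ?thesis by (simp add: sum.distrib)
    qed
    also have "(\<Sum>m\<in>UNIV. G l m x * (S j k m (axis i 1) + S k j m (axis i 1) - S m j k (axis i 1)))
      = Gd l * (S j k l (axis i 1) + S k j l (axis i 1) - S l j k (axis i 1))"
      unfolding Gd(1) by (simp add: if_distrib[where f = "\<lambda>x. x * _"] if_distrib[where f = "\<lambda>x. _ * x"] sum.delta' cong: if_cong)
    finally show ?thesis by (simp add: right_diff_distrib)
  qed
  show ?thesis unfolding riemann_def pdc chr0 by simp
qed

text \<open>The vectors \<open>x\<close> and \<open>X3 x\<close> are orthogonal with the same
  squared length, so the mixed products of the rank-one terms vanish. Three scalar identities
  \<open>e\<close> remain, which say that the eigenvalues are reciprocal.\<close>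

lemma MF_inverse:
  assumes x: "x \<noteq> 0" and f: "f1 (norm x) \<noteq> 0" "f2 (norm x) \<noteq> 0" "f3 (norm x) \<noteq> 0"
  shows "(\<Sum>m\<in>UNIV. MF f1 f2 f3 i m x * MF (\<lambda>n. 1 / f1 n) (\<lambda>n. 1 / f2 n) (\<lambda>n. 1 / f3 n) m j x) = dl i j"
proof -
  define n where "n = (norm x)\<^sup>2"
  have n: "n > 0" using x by (simp add: n_def)
  define A p h a q k where "A = f3 (norm x)" and "p = (f1 (norm x) - f3 (norm x)) / n" and "h = (f2 (norm x) - f3 (norm x)) / n"
    and "a = 1 / f3 (norm x)" and "q = (1 / f1 (norm x) - 1 / f3 (norm x)) / n" and "k = (1 / f2 (norm x) - 1 / f3 (norm x)) / n"
  have xx: "x \<bullet> x = n" "X3 x \<bullet> X3 x = n" "x \<bullet> X3 x = 0"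
    by (simp_all add: n_def power2_norm_eq_inner X_coords inner_4)
  have sums: "(\<Sum>m\<in>UNIV. x $ m * x $ m) = n" "(\<Sum>m\<in>UNIV. X3 x $ m * X3 x $ m) = n" "(\<Sum>m\<in>UNIV. x $ m * X3 x $ m) = 0"
    using xx by (simp_all add: inner_vec_def)
  have e: "A * a = 1" "A * q + p * a + p * q * n = 0" "A * k + h * a + h * k * n = 0"
    using n f by (simp_all add: A_def p_def h_def a_def q_def k_def field_simps)
  have "(\<Sum>m\<in>UNIV. MF f1 f2 f3 i m x * MF (\<lambda>n. 1 / f1 n) (\<lambda>n. 1 / f2 n) (\<lambda>n. 1 / f3 n) m j x)
    = (\<Sum>m\<in>UNIV. (A * dl i m + p * (x $ i * x $ m) + h * (X3 x $ i * X3 x $ m)) * (a * dl m j + q * (x $ m * x $ j) + k * (X3 x $ m * X3 x $ j)))"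
    by (simp add: MF_def A_def p_def h_def a_def q_def k_def n_def)
  also have "\<dots> = (\<Sum>m\<in>UNIV. (A * a) * (dl i m * dl m j)) + (\<Sum>m\<in>UNIV. (A * q * x $ j) * (dl i m * x $ m)) + (\<Sum>m\<in>UNIV. (A * k * X3 x $ j) * (dl i m * X3 x $ m))
     + (\<Sum>m\<in>UNIV. (p * a * x $ i) * (x $ m * dl m j)) + (\<Sum>m\<in>UNIV. (p * q * x $ i * x $ j) * (x $ m * x $ m)) + (\<Sum>m\<in>UNIV. (p * k * x $ i * X3 x $ j) * (x $ m * X3 x $ m))
     + (\<Sum>m\<in>UNIV. (h * a * X3 x $ i) * (X3 x $ m * dl m j)) + (\<Sum>m\<in>UNIV. (h * q * X3 x $ i * x $ j) * (x $ m * X3 x $ m)) + (\<Sum>m\<in>UNIV. (h * k * X3 x $ i * X3 x $ j) * (X3 x $ m * X3 x $ m))"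
    unfolding sum.distrib[symmetric] by (rule sum.cong) (simp_all only: algebra_simps)
  also have "\<dots> = (A * a) * dl i j + (A * q * x $ j) * x $ i + (A * k * X3 x $ j) * X3 x $ i
     + (p * a * x $ i) * x $ j + (p * q * x $ i * x $ j) * n + 0 + (h * a * X3 x $ i) * X3 x $ j + 0 + (h * k * X3 x $ i * X3 x $ j) * n"
    unfolding sum_distrib_left[symmetric] sums
    by (simp add: if_distrib[where f = "\<lambda>x. x * _"] if_distrib[where f = "\<lambda>x. _ * x"] sum.delta' sum.delta cong: if_cong)
  also have "\<dots> = (A * a) * dl i j + (A * q + p * a + p * q * n) * (x $ i * x $ j) + (A * k + h * a + h * k * n) * (X3 x $ i * X3 x $ j)"
    by (simp add: algebra_simps)
  finally show ?thesis unfolding e by simp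
qed

lemma e1_norm: "norm (r *\<^sub>R e1) = \<bar>r\<bar>" by (simp add: norm_axis_1)

lemma e1_nth: "(r *\<^sub>R e1) $ i = (if i = 1 then r else 0)"
  by (simp add: axis_nth_if)

text \<open>On the ray a radial derivative changes only the eigenvalues, while a transverse
  derivative only rotates the eigenframe and so produces differences of eigenvalues divided by
  \<open>r\<close>.\<close>

lemma DF_axis:
  assumes "r > 0"
  shows "DF f1 f2 f3 f1' f2' f3' k i j (r *\<^sub>R e1) =
    (if k = 1 then (if i = j then (if i = 1 then f1' r else if i = 2 then f2' r else f3' r) else 0)
     else if k = 2 then (if (i = 1 \<and> j = 2) \<or> (i = 2 \<and> j = 1) then (f1 r - f2 r) / r else 0)
     else if (i = 1 \<and> j = k) \<or> (i = k \<and> j = 1) then (f1 r - f3 r) / r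
     else if k = 3 \<and> ((i = 2 \<and> j = 4) \<or> (i = 4 \<and> j = 2)) then (f2 r - f3 r) / r
     else if k = 4 \<and> ((i = 2 \<and> j = 3) \<or> (i = 3 \<and> j = 2)) then - (f2 r - f3 r) / r else 0)"
proof -
  have "norm (r *\<^sub>R e1) = r" using assms e1_norm by simp
  then show ?thesis
    using exhaust_4[of i] exhaust_4[of j] exhaust_4[of k] assms unfolding DF_def qt_def qt1_def
    by (elim disjE) (simp_all add: X_e1 e1_nth JJ_simps power2_eq_square power3_eq_cube power4_eq_xxxx field_simps del: vector_scaleR_component)
qed

lemma matrix_inv_eqI:
  fixes A B :: "real^'n^'n"
  assumes "A ** B = mat 1"
  shows "matrix_inv A = B"
proof -
  have BA: "B ** A = mat 1" using assms matrix_left_right_inverse by blast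
  have "A ** matrix_inv A = mat 1 \<and> matrix_inv A ** A = mat 1"
    unfolding matrix_inv_def by (rule someI[of _ B]) (use assms BA in blast)
  then have "matrix_inv A = matrix_inv A ** (A ** B)" using assms by simp
  also have "\<dots> = B" using \<open>_ \<and> _\<close> by (simp add: matrix_mul_assoc)
  finally show ?thesis .
qed

text \<open>The rule that the derivative of an inverse matrix is \<open>- A^-1 A' A^-1\<close>,
  checked entrywise where the metric is diagonal.\<close>

lemma DF_axis_inverse:
  assumes r: "r > 0" and f: "f1 r \<noteq> 0" "f2 r \<noteq> 0" "f3 r \<noteq> 0"
    and G: "a = (if i = 1 then 1 / f1 r else if i = 2 then 1 / f2 r else 1 / f3 r)"
      "b = (if j = 1 then 1 / f1 r else if j = 2 then 1 / f2 r else 1 / f3 r)"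
  shows "DF (\<lambda>n. 1 / f1 n) (\<lambda>n. 1 / f2 n) (\<lambda>n. 1 / f3 n) (\<lambda>n. - f1' n / (f1 n)\<^sup>2) (\<lambda>n. - f2' n / (f2 n)\<^sup>2) (\<lambda>n. - f3' n / (f3 n)\<^sup>2) k i j (r *\<^sub>R e1)
    = - a * b * DF f1 f2 f3 f1' f2' f3' k i j (r *\<^sub>R e1)"
proof -
  have q: "(1 / x - 1 / y) / r = - (1 / x) * (1 / y) * ((x - y) / r)" if "x \<noteq> 0" "y \<noteq> 0" for x y
    using that r by (simp add: divide_simps)
  have q': "- d / x\<^sup>2 = - (1 / x) * (1 / x) * d" for d x :: real
    by (simp add: power2_eq_square)
  note q = q[OF f(1,2)] q[OF f(1,3)] q[OF f(2,3)] minus_divide_left[symmetric]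
  consider "k = 1" | "k = 2" | "k = 3" | "k = 4" using exhaust_4[of k] by blast
  then show ?thesis
  proof cases
    case 1 then show ?thesis unfolding DF_axis[OF r] q' G by auto
  next
    case 2 then show ?thesis unfolding DF_axis[OF r] q G by auto
  next
    case 3 then show ?thesis unfolding DF_axis[OF r] q G by auto
  next
    case 4 then show ?thesis unfolding DF_axis[OF r] q G by auto
  qed
qed

lemma has_frechet_derivative: "(f has_derivative f') (at x) \<Longrightarrow> (f has_derivative frechet_derivative f (at x)) (at x)"
  using frechet_derivative_works unfolding differentiable_def by blast

section \<open>Sectional curvatures along the ray\<close>

context berger_metric
begin

definition "E' i = deriv (E i)"
definition "E'' i = deriv (E' i)"

lemma E_d: "(E i has_real_derivative E' i r) (at r)" "(E' i has_real_derivative E'' i r) (at r)"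
  unfolding E'_def E''_def
  by (intro smooth_on_realD E_smooth)+

lemma g_MF: "x \<noteq> 0 \<Longrightarrow> g x $ i $ j = MF (E 1) (E 2) (E 3) i j x"
  by (simp add: metric_formula MF_def)

lemma g_inv: assumes "x \<noteq> 0"
  shows "matrix_inv (g x) $ i $ j = MF (\<lambda>n. 1 / E 1 n) (\<lambda>n. 1 / E 2 n) (\<lambda>n. 1 / E 3 n) i j x"
proof -
  define B :: "real^4^4" where "B = (\<chi> i j. MF (\<lambda>n. 1 / E 1 n) (\<lambda>n. 1 / E 2 n) (\<lambda>n. 1 / E 3 n) i j x)"
  have "E i n \<noteq> 0" for i n using E_pos[of i n] by simp
  then have "g x ** B = mat 1"
    using assms by (simp add: vec_eq_iff matrix_matrix_mult_def B_def g_MF MF_inverse mat_def)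
  from matrix_inv_eqI[OF this] show ?thesis by (simp add: B_def)
qed

abbreviation "Dg \<equiv> DF (E 1) (E 2) (E 3) (E' 1) (E' 2) (E' 3)"
abbreviation "Sg \<equiv> SF (E 1) (E 2) (E 3) (E' 1) (E' 2) (E' 3) (E'' 1) (E'' 2) (E'' 3)"

lemma riemann_axis:
  assumes r: "r > 0"
  defines "x \<equiv> r *\<^sub>R e1" and "Gd \<equiv> \<lambda>i. 1 / E i r"
  defines "F \<equiv> \<lambda>i j p. (Dg i j p x + Dg j i p x - Dg p i j x) / 2"
  shows "riemann g l i j k x =
    Gd l * ((Sg j k l x (axis i 1) + Sg k j l x (axis i 1) - Sg l j k x (axis i 1)) / 2 - (\<Sum>m\<in>UNIV. Gd m * Dg i l m x * F j k m))
    - Gd l * ((Sg i k l x (axis j 1) + Sg k i l x (axis j 1) - Sg l i k x (axis j 1)) / 2 - (\<Sum>m\<in>UNIV. Gd m * Dg j l m x * F i k m))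
    + (\<Sum>p\<in>UNIV. (Gd p * F j k p) * (Gd l * F i p l) - (Gd p * F i k p) * (Gd l * F j p l))"
proof -
  have x: "x \<noteq> 0" using r by (simp add: x_def axis_eq_0_iff)
  have nx: "norm x = r" using r by (simp add: x_def e1_norm)
  have nz: "E i n \<noteq> 0" for i n using E_pos[of i n] by simp
  have dinv: "((\<lambda>n. 1 / E i n) has_real_derivative - E' i n / (E i n)\<^sup>2) (at n)" for i n
    by (rule DERIV_cong[OF DERIV_inverse'[OF E_d(1)[of i n] nz[of i n], unfolded inverse_eq_divide]])
      (simp add: power2_eq_square)
  let ?G = "MF (\<lambda>n. 1 / E 1 n) (\<lambda>n. 1 / E 2 n) (\<lambda>n. 1 / E 3 n)"
  have Gder: "(?G i j has_derivative frechet_derivative (?G i j) (at x)) (at x)" for i j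
    by (rule has_frechet_derivative[OF MF_deriv[OF dinv[of 1] dinv[of 2] dinv[of 3] x]])
  have Gpd: "frechet_derivative (?G i j) (at x) (axis k 1) = DF (\<lambda>n. 1 / E 1 n) (\<lambda>n. 1 / E 2 n) (\<lambda>n. 1 / E 3 n)
     (\<lambda>n. - E' 1 n / (E 1 n)\<^sup>2) (\<lambda>n. - E' 2 n / (E 2 n)\<^sup>2) (\<lambda>n. - E' 3 n / (E 3 n)\<^sup>2) k i j x" for i j k
    using MF_pd[OF dinv[of 1] dinv[of 2] dinv[of 3] x, of k i j] unfolding pd_def .
  show ?thesis
    unfolding F_def
  proof (rule riemann_diagonal[of "- {0}" x g Dg "\<lambda>k i j. Sg k i j x" ?G "\<lambda>i j. frechet_derivative (?G i j) (at x)" Gd])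
    show "open (- {0 :: real^4})" by auto
    show "x \<in> - {0}" using x by simp
    show "pd k (\<lambda>y. g y $ i $ j) y = Dg k i j y" if "y \<in> - {0}" for y k i j
    proof -
      have y: "y \<noteq> 0" using that by simp
      have d: "(MF (E 1) (E 2) (E 3) i j has_derivative frechet_derivative (MF (E 1) (E 2) (E 3) i j) (at y)) (at y)"
        by (rule has_frechet_derivative[OF MF_deriv[OF E_d(1)[of 1] E_d(1)[of 2] E_d(1)[of 3] y]])
      have "((\<lambda>y. g y $ i $ j) has_derivative frechet_derivative (MF (E 1) (E 2) (E 3) i j) (at y)) (at y)"
        by (rule has_derivative_transform_within_open[OF d, of "- {0}"]) (use y in \<open>auto simp: g_MF\<close>)
      then have "pd k (\<lambda>y. g y $ i $ j) y = pd k (MF (E 1) (E 2) (E 3) i j) y"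
        unfolding pd_def by (rule arg_cong[where f = "\<lambda>h. h (axis k 1)", OF frechet_derivative_at[symmetric]])
      also have "\<dots> = Dg k i j y" by (rule MF_pd[OF E_d(1)[of 1] E_d(1)[of 2] E_d(1)[of 3] y])
      finally show ?thesis .
    qed
    show "(Dg k i j has_derivative Sg k i j x) (at x)" for k i j
      by (rule DF_deriv[OF E_d(1)[of 1] E_d(1)[of 2] E_d(1)[of 3] E_d(2)[of 1] E_d(2)[of 2] E_d(2)[of 3] x])
    show "matrix_inv (g y) $ i $ j = ?G i j y" if "y \<in> - {0}" for y i j
      using that by (simp add: g_inv)
    show "(?G i j has_derivative frechet_derivative (?G i j) (at x)) (at x)" for i j by (rule Gder)
    show "?G i j x = Gd i * dl i j" for i j
      using exhaust_4[of i] exhaust_4[of j] r unfolding MF_def nx Gd_def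
      by (elim disjE) (simp_all add: x_def X_e1 e1_nth E4 power2_eq_square del: vector_scaleR_component)
    show "frechet_derivative (?G i j) (at x) (axis k 1) = - Gd i * Gd j * Dg k i j x" for i j k
      unfolding Gpd unfolding x_def by (rule DF_axis_inverse[OF r]) (use nz exhaust_4[of i] exhaust_4[of j] E4[of r] in \<open>auto simp: Gd_def\<close>)
  qed
qed

lemma SF_axis:
  assumes r: "r > 0"
  shows "Sg 1 2 2 (r *\<^sub>R e1) (axis 1 1) = E'' 2 r"
    "Sg 1 3 3 (r *\<^sub>R e1) (axis 1 1) = E'' 3 r"
    "Sg 1 4 4 (r *\<^sub>R e1) (axis 1 1) = E'' 3 r"
    "Sg 2 1 1 (r *\<^sub>R e1) (axis 2 1) = E' 1 r / r - 2 * (E 1 r - E 2 r) / r\<^sup>2"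
    "Sg 3 1 1 (r *\<^sub>R e1) (axis 3 1) = E' 1 r / r - 2 * (E 1 r - E 3 r) / r\<^sup>2"
    "Sg 4 1 1 (r *\<^sub>R e1) (axis 4 1) = E' 1 r / r - 2 * (E 1 r - E 3 r) / r\<^sup>2"
    "Sg 2 1 2 (r *\<^sub>R e1) (axis 1 1) = (E' 1 r - E' 2 r) / r - (E 1 r - E 2 r) / r\<^sup>2"
    "Sg 2 2 1 (r *\<^sub>R e1) (axis 1 1) = (E' 1 r - E' 2 r) / r - (E 1 r - E 2 r) / r\<^sup>2"
    "Sg 1 1 2 (r *\<^sub>R e1) (axis 2 1) = (E' 1 r - E' 2 r) / r - (E 1 r - E 2 r) / r\<^sup>2"
    "Sg 1 2 1 (r *\<^sub>R e1) (axis 2 1) = (E' 1 r - E' 2 r) / r - (E 1 r - E 2 r) / r\<^sup>2"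
    "Sg 3 1 3 (r *\<^sub>R e1) (axis 1 1) = (E' 1 r - E' 3 r) / r - (E 1 r - E 3 r) / r\<^sup>2"
    "Sg 3 3 1 (r *\<^sub>R e1) (axis 1 1) = (E' 1 r - E' 3 r) / r - (E 1 r - E 3 r) / r\<^sup>2"
    "Sg 1 1 3 (r *\<^sub>R e1) (axis 3 1) = (E' 1 r - E' 3 r) / r - (E 1 r - E 3 r) / r\<^sup>2"
    "Sg 1 3 1 (r *\<^sub>R e1) (axis 3 1) = (E' 1 r - E' 3 r) / r - (E 1 r - E 3 r) / r\<^sup>2"
    "Sg 4 1 4 (r *\<^sub>R e1) (axis 1 1) = (E' 1 r - E' 3 r) / r - (E 1 r - E 3 r) / r\<^sup>2"
    "Sg 4 4 1 (r *\<^sub>R e1) (axis 1 1) = (E' 1 r - E' 3 r) / r - (E 1 r - E 3 r) / r\<^sup>2"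
    "Sg 1 1 4 (r *\<^sub>R e1) (axis 4 1) = (E' 1 r - E' 3 r) / r - (E 1 r - E 3 r) / r\<^sup>2"
    "Sg 1 4 1 (r *\<^sub>R e1) (axis 4 1) = (E' 1 r - E' 3 r) / r - (E 1 r - E 3 r) / r\<^sup>2"
    "Sg 3 2 2 (r *\<^sub>R e1) (axis 3 1) = E' 2 r / r - 2 * (E 2 r - E 3 r) / r\<^sup>2"
    "Sg 2 3 3 (r *\<^sub>R e1) (axis 2 1) = E' 3 r / r"
    "Sg 3 2 3 (r *\<^sub>R e1) (axis 2 1) = (E 1 r - E 3 r) / r\<^sup>2"
    "Sg 3 3 2 (r *\<^sub>R e1) (axis 2 1) = (E 1 r - E 3 r) / r\<^sup>2"
    "Sg 2 2 3 (r *\<^sub>R e1) (axis 3 1) = (E 1 r - E 3 r) / r\<^sup>2"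
    "Sg 2 3 2 (r *\<^sub>R e1) (axis 3 1) = (E 1 r - E 3 r) / r\<^sup>2"
    "Sg 4 2 2 (r *\<^sub>R e1) (axis 4 1) = E' 2 r / r - 2 * (E 2 r - E 3 r) / r\<^sup>2"
    "Sg 2 4 4 (r *\<^sub>R e1) (axis 2 1) = E' 3 r / r"
    "Sg 4 2 4 (r *\<^sub>R e1) (axis 2 1) = (E 1 r - E 3 r) / r\<^sup>2"
    "Sg 4 4 2 (r *\<^sub>R e1) (axis 2 1) = (E 1 r - E 3 r) / r\<^sup>2"
    "Sg 2 2 4 (r *\<^sub>R e1) (axis 4 1) = (E 1 r - E 3 r) / r\<^sup>2"
    "Sg 2 4 2 (r *\<^sub>R e1) (axis 4 1) = (E 1 r - E 3 r) / r\<^sup>2"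
    "Sg 4 3 3 (r *\<^sub>R e1) (axis 4 1) = E' 3 r / r + 2 * (E 2 r - E 3 r) / r\<^sup>2"
    "Sg 3 4 4 (r *\<^sub>R e1) (axis 3 1) = E' 3 r / r + 2 * (E 2 r - E 3 r) / r\<^sup>2"
    "Sg 3 3 4 (r *\<^sub>R e1) (axis 4 1) = (E 1 r - E 2 r) / r\<^sup>2"
    "Sg 3 4 3 (r *\<^sub>R e1) (axis 4 1) = (E 1 r - E 2 r) / r\<^sup>2"
    "Sg 4 3 4 (r *\<^sub>R e1) (axis 3 1) = (E 1 r - E 2 r) / r\<^sup>2"
    "Sg 4 4 3 (r *\<^sub>R e1) (axis 3 1) = (E 1 r - E 2 r) / r\<^sup>2"
proof -
  note S = SF_def e1_norm X_e1 e1_nth axis_nth_if JJ_def[symmetric] JJ_simps qt_def qt1_def qt2_def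
  show "Sg 1 2 2 (r *\<^sub>R e1) (axis 1 1) = E'' 2 r"
    "Sg 1 3 3 (r *\<^sub>R e1) (axis 1 1) = E'' 3 r"
    "Sg 1 4 4 (r *\<^sub>R e1) (axis 1 1) = E'' 3 r"
    "Sg 2 1 1 (r *\<^sub>R e1) (axis 2 1) = E' 1 r / r - 2 * (E 1 r - E 2 r) / r\<^sup>2"
    "Sg 3 1 1 (r *\<^sub>R e1) (axis 3 1) = E' 1 r / r - 2 * (E 1 r - E 3 r) / r\<^sup>2"
    "Sg 4 1 1 (r *\<^sub>R e1) (axis 4 1) = E' 1 r / r - 2 * (E 1 r - E 3 r) / r\<^sup>2"
    "Sg 2 1 2 (r *\<^sub>R e1) (axis 1 1) = (E' 1 r - E' 2 r) / r - (E 1 r - E 2 r) / r\<^sup>2"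
    "Sg 2 2 1 (r *\<^sub>R e1) (axis 1 1) = (E' 1 r - E' 2 r) / r - (E 1 r - E 2 r) / r\<^sup>2"
    "Sg 1 1 2 (r *\<^sub>R e1) (axis 2 1) = (E' 1 r - E' 2 r) / r - (E 1 r - E 2 r) / r\<^sup>2"
    "Sg 1 2 1 (r *\<^sub>R e1) (axis 2 1) = (E' 1 r - E' 2 r) / r - (E 1 r - E 2 r) / r\<^sup>2"
    "Sg 3 1 3 (r *\<^sub>R e1) (axis 1 1) = (E' 1 r - E' 3 r) / r - (E 1 r - E 3 r) / r\<^sup>2"
    "Sg 3 3 1 (r *\<^sub>R e1) (axis 1 1) = (E' 1 r - E' 3 r) / r - (E 1 r - E 3 r) / r\<^sup>2"
    "Sg 1 1 3 (r *\<^sub>R e1) (axis 3 1) = (E' 1 r - E' 3 r) / r - (E 1 r - E 3 r) / r\<^sup>2"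
    "Sg 1 3 1 (r *\<^sub>R e1) (axis 3 1) = (E' 1 r - E' 3 r) / r - (E 1 r - E 3 r) / r\<^sup>2"
    "Sg 4 1 4 (r *\<^sub>R e1) (axis 1 1) = (E' 1 r - E' 3 r) / r - (E 1 r - E 3 r) / r\<^sup>2"
    "Sg 4 4 1 (r *\<^sub>R e1) (axis 1 1) = (E' 1 r - E' 3 r) / r - (E 1 r - E 3 r) / r\<^sup>2"
    "Sg 1 1 4 (r *\<^sub>R e1) (axis 4 1) = (E' 1 r - E' 3 r) / r - (E 1 r - E 3 r) / r\<^sup>2"
    "Sg 1 4 1 (r *\<^sub>R e1) (axis 4 1) = (E' 1 r - E' 3 r) / r - (E 1 r - E 3 r) / r\<^sup>2"
    "Sg 3 2 2 (r *\<^sub>R e1) (axis 3 1) = E' 2 r / r - 2 * (E 2 r - E 3 r) / r\<^sup>2"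
    "Sg 2 3 3 (r *\<^sub>R e1) (axis 2 1) = E' 3 r / r"
    "Sg 3 2 3 (r *\<^sub>R e1) (axis 2 1) = (E 1 r - E 3 r) / r\<^sup>2"
    "Sg 3 3 2 (r *\<^sub>R e1) (axis 2 1) = (E 1 r - E 3 r) / r\<^sup>2"
    "Sg 2 2 3 (r *\<^sub>R e1) (axis 3 1) = (E 1 r - E 3 r) / r\<^sup>2"
    "Sg 2 3 2 (r *\<^sub>R e1) (axis 3 1) = (E 1 r - E 3 r) / r\<^sup>2"
    "Sg 4 2 2 (r *\<^sub>R e1) (axis 4 1) = E' 2 r / r - 2 * (E 2 r - E 3 r) / r\<^sup>2"
    "Sg 2 4 4 (r *\<^sub>R e1) (axis 2 1) = E' 3 r / r"
    "Sg 4 2 4 (r *\<^sub>R e1) (axis 2 1) = (E 1 r - E 3 r) / r\<^sup>2"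
    "Sg 4 4 2 (r *\<^sub>R e1) (axis 2 1) = (E 1 r - E 3 r) / r\<^sup>2"
    "Sg 2 2 4 (r *\<^sub>R e1) (axis 4 1) = (E 1 r - E 3 r) / r\<^sup>2"
    "Sg 2 4 2 (r *\<^sub>R e1) (axis 4 1) = (E 1 r - E 3 r) / r\<^sup>2"
    "Sg 4 3 3 (r *\<^sub>R e1) (axis 4 1) = E' 3 r / r + 2 * (E 2 r - E 3 r) / r\<^sup>2"
    "Sg 3 4 4 (r *\<^sub>R e1) (axis 3 1) = E' 3 r / r + 2 * (E 2 r - E 3 r) / r\<^sup>2"
    "Sg 3 3 4 (r *\<^sub>R e1) (axis 4 1) = (E 1 r - E 2 r) / r\<^sup>2"
    "Sg 3 4 3 (r *\<^sub>R e1) (axis 4 1) = (E 1 r - E 2 r) / r\<^sup>2"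
    "Sg 4 3 4 (r *\<^sub>R e1) (axis 3 1) = (E 1 r - E 2 r) / r\<^sup>2"
    "Sg 4 4 3 (r *\<^sub>R e1) (axis 3 1) = (E 1 r - E 2 r) / r\<^sup>2"
    using r by (simp_all add: S del: vector_scaleR_component) (simp_all add: field_simps eval_nat_numeral)
qed

lemma metric_axis: "r > 0 \<Longrightarrow> g (r *\<^sub>R e1) $ i $ j = E i r * dl i j"
  using exhaust_4[of i] exhaust_4[of j]
  by (elim disjE) (simp_all add: metric_formula[of "r *\<^sub>R e1"] axis_eq_0_iff e1_norm X_e1 e1_nth E4[of r] power2_eq_square del: vector_scaleR_component)

text \<open>The entries are rewritten with arclength derivatives \<open>y\<close>, \<open>z\<close>,
  \<open>y2\<close>, \<open>z2\<close> of \<open>b\<close> and \<open>c\<close>, where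
  \<open>\<phi>\<close> stands for \<open>ds/dr\<close>. The factors in front of \<open>E\<close>
  are the sectional curvatures: \<open>- c_ss / c\<close> and \<open>- b_ss / b\<close> for radial
  planes, \<open>c^2 / b^4 - b_s c_s / (b c)\<close> for planes spanned by the Hopf and a horizontal
  direction, and \<open>(4 - b_s^2) / b^2 - 3 c^2 / b^4\<close> for the horizontal plane, where
  \<open>4\<close> is the curvature of the base and the last term is O'Neill's.\<close>

lemma curvature_axis:
  fixes \<phi> \<phi>' bb cc y z y2 z2 r :: real
  assumes r: "r > 0" and pos: "\<phi> > 0" "bb > 0" "cc > 0"
    and E: "E 1 r = \<phi>\<^sup>2" "E 2 r = cc\<^sup>2 / r\<^sup>2" "E 3 r = bb\<^sup>2 / r\<^sup>2"
    and E': "E' 1 r = 2 * \<phi> * \<phi>'" "E' 2 r = 2 * cc * \<phi> * z / r\<^sup>2 - 2 * cc\<^sup>2 / r^3" "E' 3 r = 2 * bb * \<phi> * y / r\<^sup>2 - 2 * bb\<^sup>2 / r^3"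
    and E'': "E'' 2 r = (2 * \<phi>\<^sup>2 * z\<^sup>2 + 2 * cc * (\<phi>' * z + \<phi>\<^sup>2 * z2)) / r\<^sup>2 - 8 * cc * \<phi> * z / r^3 + 6 * cc\<^sup>2 / r^4"
      "E'' 3 r = (2 * \<phi>\<^sup>2 * y\<^sup>2 + 2 * bb * (\<phi>' * y + \<phi>\<^sup>2 * y2)) / r\<^sup>2 - 8 * bb * \<phi> * y / r^3 + 6 * bb\<^sup>2 / r^4"
  shows "riemann g 1 1 2 2 (r *\<^sub>R e1) = - z2 / cc * E 2 r" "riemann g 2 2 1 1 (r *\<^sub>R e1) = - z2 / cc * E 1 r"
    "riemann g 1 1 3 3 (r *\<^sub>R e1) = - y2 / bb * E 3 r" "riemann g 3 3 1 1 (r *\<^sub>R e1) = - y2 / bb * E 1 r"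
    "riemann g 4 4 1 1 (r *\<^sub>R e1) = - y2 / bb * E 1 r"
    "riemann g 2 2 3 3 (r *\<^sub>R e1) = (cc\<^sup>2 / bb^4 - y * z / (bb * cc)) * E 3 r"
    "riemann g 3 3 2 2 (r *\<^sub>R e1) = (cc\<^sup>2 / bb^4 - y * z / (bb * cc)) * E 2 r"
    "riemann g 4 4 2 2 (r *\<^sub>R e1) = (cc\<^sup>2 / bb^4 - y * z / (bb * cc)) * E 2 r"
    "riemann g 4 4 3 3 (r *\<^sub>R e1) = ((4 - y\<^sup>2) / bb\<^sup>2 - 3 * cc\<^sup>2 / bb^4) * E 3 r"
proof -
  note ev = riemann_axis[OF r] sum_4 DF_axis[OF r] E4 SF_axis[OF r]
  show "riemann g 1 1 2 2 (r *\<^sub>R e1) = - z2 / cc * E 2 r"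
    unfolding ev using r pos
    by (simp add: E E' E'' divide_simps) algebra
  show "riemann g 2 2 1 1 (r *\<^sub>R e1) = - z2 / cc * E 1 r"
    unfolding ev using r pos
    by (simp add: E E' E'' divide_simps) algebra
  show "riemann g 1 1 3 3 (r *\<^sub>R e1) = - y2 / bb * E 3 r"
    unfolding ev using r pos
    by (simp add: E E' E'' divide_simps) algebra
  show "riemann g 3 3 1 1 (r *\<^sub>R e1) = - y2 / bb * E 1 r"
    unfolding ev using r pos
    by (simp add: E E' E'' divide_simps) algebra
  show "riemann g 4 4 1 1 (r *\<^sub>R e1) = - y2 / bb * E 1 r"
    unfolding ev using r pos
    by (simp add: E E' E'' divide_simps) algebra
  show "riemann g 2 2 3 3 (r *\<^sub>R e1) = (cc\<^sup>2 / bb^4 - y * z / (bb * cc)) * E 3 r"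
    unfolding ev using r pos
    by (simp add: E E' E'' divide_simps) algebra
  show "riemann g 3 3 2 2 (r *\<^sub>R e1) = (cc\<^sup>2 / bb^4 - y * z / (bb * cc)) * E 2 r"
    unfolding ev using r pos
    by (simp add: E E' E'' divide_simps) algebra
  show "riemann g 4 4 2 2 (r *\<^sub>R e1) = (cc\<^sup>2 / bb^4 - y * z / (bb * cc)) * E 2 r"
    unfolding ev using r pos
    by (simp add: E E' E'' divide_simps) algebra
  show "riemann g 4 4 3 3 (r *\<^sub>R e1) = ((4 - y\<^sup>2) / bb\<^sup>2 - 3 * cc\<^sup>2 / bb^4) * E 3 r"
    unfolding ev using r pos
    by (simp add: E E' E'' divide_simps) algebra
qed

lemma riemann_same: "riemann g l i i k x = 0"
  by (simp add: riemann_def)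

lemma ricci_axis:
  "ricci g x $ 1 $ 1 = riemann g 2 2 1 1 x + riemann g 3 3 1 1 x + riemann g 4 4 1 1 x"
  "ricci g x $ 2 $ 2 = riemann g 1 1 2 2 x + riemann g 3 3 2 2 x + riemann g 4 4 2 2 x"
  "ricci g x $ 3 $ 3 = riemann g 1 1 3 3 x + riemann g 2 2 3 3 x + riemann g 4 4 3 3 x"
  by (simp_all add: ricci_def sum_4 riemann_same)

lemma inverse_axis: "r > 0 \<Longrightarrow> matrix_inv (g (r *\<^sub>R e1)) $ i $ j = 1 / E i r * dl i j"
proof -
  assume r: "r > 0"
  have "g (r *\<^sub>R e1) ** (\<chi> i j. 1 / E i r * dl i j) = mat 1"
    using E_pos[of _ r] metric_axis[OF r]
    by (simp add: vec_eq_iff matrix_matrix_mult_def mat_def if_distrib[where f = "\<lambda>x. _ * x"] if_distrib[where f = "\<lambda>x. x * _"] sum.delta sum.delta' cong: if_cong)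
      (metis less_irrefl)
  from matrix_inv_eqI[OF this] show ?thesis by simp
qed

lemma sum_single: "(\<And>k'. k' \<noteq> k \<Longrightarrow> h k' = 0) \<Longrightarrow> (\<Sum>k'\<in>(UNIV :: 4 set). h k') = (h k :: real)"
  by (subst sum.remove[of UNIV k]) auto

text \<open>For a diagonal metric the full contraction is a sum of nonnegative terms
  \<open>T\<close>, so each sectional curvature is controlled by the norm.\<close>

lemma curvature_norm_axis:
  assumes r: "r > 0"
  shows "\<bar>riemann g i i j j (r *\<^sub>R e1)\<bar> / E j r \<le> curvature_norm g (r *\<^sub>R e1)"
proof -
  let ?x = "r *\<^sub>R e1"
  define T where "T l i j k = E l r / (E i r * E j r * E k r) * (riemann g l i j k ?x)\<^sup>2" for l i j k
  have T0: "T l i j k \<ge> 0" for l i j k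
    using E_pos[of l r] E_pos[of i r] E_pos[of j r] E_pos[of k r] by (simp add: T_def)
  have "(\<Sum>l'\<in>UNIV. \<Sum>i'\<in>UNIV. \<Sum>j'\<in>UNIV. \<Sum>k'\<in>UNIV.
        g ?x $ l $ l' * matrix_inv (g ?x) $ i $ i' * matrix_inv (g ?x) $ j $ j' *
        matrix_inv (g ?x) $ k $ k' * riemann g l i j k ?x * riemann g l' i' j' k' ?x) = T l i j k" for l i j k
  proof -
    define A where "A l' i' j' k' = E l r * dl l l' * (1 / E i r * dl i i') * (1 / E j r * dl j j') * (1 / E k r * dl k k')
       * riemann g l i j k ?x * riemann g l' i' j' k' ?x" for l' i' j' k'
    have A0: "A l' i' j' k' = 0" if "l' \<noteq> l \<or> i' \<noteq> i \<or> j' \<noteq> j \<or> k' \<noteq> k" for l' i' j' k'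
      using that by (auto simp: A_def)
    have "(\<Sum>l'\<in>UNIV. \<Sum>i'\<in>UNIV. \<Sum>j'\<in>UNIV. \<Sum>k'\<in>UNIV. A l' i' j' k') = (\<Sum>i'\<in>UNIV. \<Sum>j'\<in>UNIV. \<Sum>k'\<in>UNIV. A l i' j' k')"
      by (rule sum_single) (auto intro!: sum.neutral A0)
    also have "\<dots> = (\<Sum>j'\<in>UNIV. \<Sum>k'\<in>UNIV. A l i j' k')" by (rule sum_single) (auto intro!: sum.neutral A0)
    also have "\<dots> = (\<Sum>k'\<in>UNIV. A l i j k')" by (rule sum_single) (auto intro!: sum.neutral A0)
    also have "\<dots> = A l i j k" by (rule sum_single) (auto intro!: A0)
    finally have "(\<Sum>l'\<in>UNIV. \<Sum>i'\<in>UNIV. \<Sum>j'\<in>UNIV. \<Sum>k'\<in>UNIV.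
        g ?x $ l $ l' * matrix_inv (g ?x) $ i $ i' * matrix_inv (g ?x) $ j $ j' *
        matrix_inv (g ?x) $ k $ k' * riemann g l i j k ?x * riemann g l' i' j' k' ?x) = A l i j k"
      unfolding metric_axis[OF r] inverse_axis[OF r] A_def .
    moreover have "A l i j k = T l i j k" by (simp add: T_def A_def power2_eq_square)
    ultimately show ?thesis by simp
  qed
  then have "curvature_norm g ?x = sqrt (\<Sum>l\<in>UNIV. \<Sum>i\<in>UNIV. \<Sum>j\<in>UNIV. \<Sum>k\<in>UNIV. T l i j k)"
    unfolding curvature_norm_def by simp
  moreover have "T i i j j \<le> (\<Sum>l\<in>UNIV. \<Sum>i\<in>UNIV. \<Sum>j\<in>UNIV. \<Sum>k\<in>UNIV. T l i j k)"
  proof -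
    have "T i i j j \<le> (\<Sum>k\<in>UNIV. T i i j k)" by (rule member_le_sum) (auto intro: T0)
    also have "\<dots> \<le> (\<Sum>j\<in>UNIV. \<Sum>k\<in>UNIV. T i i j k)" by (rule member_le_sum) (auto intro!: sum_nonneg T0)
    also have "\<dots> \<le> (\<Sum>i'\<in>UNIV. \<Sum>j\<in>UNIV. \<Sum>k\<in>UNIV. T i i' j k)"
      by (rule member_le_sum[of i UNIV "\<lambda>i'. \<Sum>j\<in>UNIV. \<Sum>k\<in>UNIV. T i i' j k"]) (auto intro!: sum_nonneg T0)
    also have "\<dots> \<le> (\<Sum>l\<in>UNIV. \<Sum>i'\<in>UNIV. \<Sum>j\<in>UNIV. \<Sum>k\<in>UNIV. T l i' j k)"
      by (rule member_le_sum[of i UNIV "\<lambda>l. \<Sum>i'\<in>UNIV. \<Sum>j\<in>UNIV. \<Sum>k\<in>UNIV. T l i' j k"]) (auto intro!: sum_nonneg T0)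
    finally show ?thesis .
  qed
  moreover have "T i i j j = (\<bar>riemann g i i j j ?x\<bar> / E j r)\<^sup>2"
    using E_pos[of i r] by (simp add: T_def power_divide power2_eq_square)
  ultimately show ?thesis using E_pos[of j r] by (simp add: real_le_rsqrt)
qed

end

section \<open>Maximum principle estimates\<close>

text \<open>The second-derivative test for the operator \<open>(1/p) d/dr\<close>: since
  \<open>p\<close> is positive, signs are the same as for ordinary derivatives, and no derivative of
  \<open>p\<close> has to be taken.\<close>

lemma interior_minimum_derivatives:
  fixes h h1 :: "real \<Rightarrow> real"
  assumes r: "r > 0" and phi: "p r > 0"
    and h: "\<And>x. x > 0 \<Longrightarrow> (h has_real_derivative p x * h1 x) (at x)"
    and h1: "(h1 has_real_derivative p r * h2) (at r)"
    and p: "\<And>x. x > 0 \<Longrightarrow> p x > 0"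
    and min: "\<And>x. x > 0 \<Longrightarrow> h r \<le> h x"
  shows "h1 r = 0" "h2 \<ge> 0"
proof -
  have "p r * h1 r = 0"
    by (rule DERIV_local_min[OF h[OF r] r]) (use min r in auto)
  then show h10: "h1 r = 0" using phi by simp
  show "h2 \<ge> 0"
  proof (rule ccontr)
    assume "\<not> h2 \<ge> 0"
    then have "p r * h2 < 0" using phi by (simp add: mult_pos_neg)
    from DERIV_neg_dec_right[OF h1 this] obtain d where d: "d > 0" "\<And>x. 0 < x \<Longrightarrow> x < d \<Longrightarrow> h1 (r + x) < h1 r"
      by auto
    have "h (r + d/2) < h r"
    proof (rule DERIV_neg_imp_decreasing_open[of r "r + d/2" h])
      show "r < r + d/2" using d by simp
      show "\<exists>y. (h has_real_derivative y) (at x) \<and> y < 0" if x: "r < x" "x < r + d/2" for x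
      proof -
        have "h1 x < 0" using d(2)[of "x - r"] x d(1) h10 by auto
        then show ?thesis
          using h[of x] p[of x] x r by (intro exI[of _ "p x * h1 x"]) (auto simp: mult_pos_neg)
      qed
      show "continuous_on {r..r + d/2} h"
        by (intro continuous_at_imp_continuous_on ballI DERIV_isCont[OF h]) (use r in auto)
    qed
    with min[of "r + d/2"] r d show False by auto
  qed
qed

lemma left_minimum_derivative:
  fixes h :: "real \<Rightarrow> real"
  assumes "(h has_real_derivative d) (at t)" "t0 < t" "\<And>x. t0 \<le> x \<Longrightarrow> x < t \<Longrightarrow> h x \<ge> h t"
  shows "d \<le> 0"
proof (rule ccontr)
  assume "\<not> d \<le> 0"
  with DERIV_pos_inc_left[OF assms(1)] obtain e where e: "e > 0" "\<And>x. 0 < x \<Longrightarrow> x < e \<Longrightarrow> h (t - x) < h t"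
    by auto
  define x where "x = min (e/2) (t - t0)"
  have "0 < x" "x < e" "t0 \<le> t - x" "t - x < t" using e assms(2) by (auto simp: x_def)
  with e(2)[of x] assms(3)[of "t - x"] show False by auto
qed

text \<open>The points with \<open>H \<le> 0\<close> lie in a compact rectangle by
  \<open>far\<close>, so there is one of least time. It is neither initial nor on the axis, and
  there \<open>H\<close> vanishes at a spatial minimum.\<close>

lemma first_touching:
  fixes H :: "real \<Rightarrow> real \<Rightarrow> real"
  assumes cont: "continuous_on ({0..} \<times> {t0..t1}) (\<lambda>(r,t). H r t)"
    and init: "\<And>r. r \<ge> 0 \<Longrightarrow> H r t0 > 0"
    and axis: "\<And>t. t0 \<le> t \<Longrightarrow> t \<le> t1 \<Longrightarrow> H 0 t > 0"
    and far: "\<And>r t. r \<ge> R \<Longrightarrow> t0 \<le> t \<Longrightarrow> t \<le> t1 \<Longrightarrow> H r t > 0"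
    and touch: "\<And>r t. r > 0 \<Longrightarrow> t0 < t \<Longrightarrow> t \<le> t1 \<Longrightarrow> H r t = 0 \<Longrightarrow> (\<And>r'. r' \<ge> 0 \<Longrightarrow> H r' t \<ge> 0)
       \<Longrightarrow> (\<And>t'. t0 \<le> t' \<Longrightarrow> t' < t \<Longrightarrow> H r t' > 0) \<Longrightarrow> False"
    and rt: "r \<ge> 0" "t0 \<le> t" "t \<le> t1"
  shows "H r t > 0"
proof (rule ccontr)
  assume neg: "\<not> H r t > 0"
  define S where "S = {p \<in> {0..R} \<times> {t0..t1}. H (fst p) (snd p) \<le> 0}"
  have rR: "r \<le> R" using far[of r t] rt neg by force
  have "(r,t) \<in> S" using neg rt rR by (auto simp: S_def)
  have cS: "compact S"
  proof -
    have "continuous_on ({0..R} \<times> {t0..t1}) (\<lambda>(r,t). H r t)"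
      by (rule continuous_on_subset[OF cont]) auto
    then have "continuous_on ({0..R} \<times> {t0..t1}) (\<lambda>p. H (fst p) (snd p))"
      by (simp add: case_prod_beta')
    then have "closed S" unfolding S_def
      by (intro continuous_on_closed_Collect_le continuous_on_const closed_Times closed_atLeastAtMost) auto
    moreover have "bounded S"
      by (rule bounded_subset[OF bounded_Times[of "{0..R}" "{t0..t1}"]]) (auto simp: S_def)
    ultimately show ?thesis by (simp add: compact_eq_bounded_closed)
  qed
  obtain p where p: "p \<in> S" "\<And>p'. p' \<in> S \<Longrightarrow> snd p \<le> snd p'"
    using continuous_attains_inf[OF cS _ continuous_on_snd[OF continuous_on_id]] \<open>(r,t) \<in> S\<close> by force
  obtain r1 s where ps: "p = (r1,s)" by fastforce
  have r1: "0 \<le> r1" "r1 \<le> R" "t0 \<le> s" "s \<le> t1" "H r1 s \<le> 0" using p(1) by (auto simp: S_def ps)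
  have s0: "t0 < s" using r1 init[of r1] by (cases "s = t0") auto
  have before: "H r' t' > 0" if "r' \<ge> 0" "t0 \<le> t'" "t' < s" for r' t'
  proof (rule ccontr)
    assume n: "\<not> H r' t' > 0"
    have "r' \<le> R" using far[of r' t'] that r1 n by force
    then have "(r',t') \<in> S" using n that r1 by (auto simp: S_def)
    with p(2)[of "(r',t')"] that ps show False by auto
  qed
  \<comment> \<open>A negative value at the touching time would force a zero strictly earlier on the
    same vertical line, by the intermediate value theorem.\<close>
  have nonneg: "H r' s \<ge> 0" if "r' \<ge> 0" for r'
  proof -
    have c: "continuous_on {t0..s} (H r')"
      using continuous_on_compose2[OF cont, of "{t0..s}" "\<lambda>t. (r',t)"] that r1
      by (force intro!: continuous_intros)
    show ?thesis
    proof (rule ccontr)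
      assume "\<not> H r' s \<ge> 0"
      then have "H r' s \<le> 0" "0 \<le> H r' t0" using init[of r'] that by (auto simp: less_imp_le)
      moreover have "0 < H r' t0" using init that by auto
      moreover have c': "continuous_on {t0..s} (\<lambda>x. - H r' x)" using c by (intro continuous_intros)
      ultimately obtain x where "x \<ge> t0" "x \<le> s" "- H r' x = 0"
        using IVT'[of "\<lambda>x. - H r' x" t0 0 s] s0 by auto
      then have "x = s" using before[of r' x] that by force
      then show False using \<open>\<not> H r' s \<ge> 0\<close> \<open>- H r' x = 0\<close> by auto
    qed
  qed
  have "H r1 s = 0" using nonneg[of r1] r1 by auto
  moreover have "r1 > 0" using axis[of s] r1 s0 by (cases "r1 = 0") auto
  ultimately show False using touch[of r1 s] s0 r1 nonneg before by auto
qed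

lemma positive_lower_bound:
  fixes f :: "real \<Rightarrow> real"
  assumes "continuous_on {1..} f" "\<And>x. x \<ge> 1 \<Longrightarrow> f x > 0" "filterlim f at_top at_top"
  obtains l where "l > 0" "\<And>x. x \<ge> 1 \<Longrightarrow> f x \<ge> l"
proof -
  obtain N where N: "\<And>x. x \<ge> N \<Longrightarrow> f x \<ge> 1"
    using assms(3) by (auto simp: filterlim_at_top eventually_at_top_linorder)
  have "compact {1..max 1 N}" "{1..max 1 N} \<noteq> {}" "continuous_on {1..max 1 N} f"
    using continuous_on_subset[OF assms(1), of "{1..max 1 N}"] by auto
  from continuous_attains_inf[OF this] obtain x where x: "x \<ge> 1" "\<And>y. y \<in> {1..max 1 N} \<Longrightarrow> f x \<le> f y"
    by auto
  show thesis
  proof (rule that[of "min 1 (f x)"])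
    show "min 1 (f x) > 0" using assms(2)[OF x(1)] by simp
    show "f y \<ge> min 1 (f x)" if "y \<ge> 1" for y
    proof (cases "y \<ge> N")
      case True then show ?thesis using N[of y] by simp
    next
      case False then show ?thesis using x(2)[of y] that by auto
    qed
  qed
qed

text \<open>
  Here \<open>r\<close> is a fixed coordinate in which $\partial_s = \varphi^{-1}\partial_r$; \<open>y\<close>, \<open>y2\<close>, \<open>y3\<close> are the
  $s$-derivatives of \<open>b\<close>, and \<open>z\<close>, \<open>z2\<close>, \<open>z3\<close> those of \<open>c\<close>; \<open>v\<close> is the $s$-derivative of $\log u$.
  In the evolution equations of \<open>y\<close> and \<open>z\<close> the commutator of $\partial_t$ and $\partial_s$ is included.
\<close>

locale berger_pde =
  fixes \<phi> b c u v y z y2 z2 y3 z3 :: "real \<Rightarrow> real \<Rightarrow> real" and f :: "real \<Rightarrow> real" and M K :: real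
  assumes pos: "\<And>r t. r > 0 \<Longrightarrow> t < 0 \<Longrightarrow> \<phi> r t > 0" "\<And>r t. r > 0 \<Longrightarrow> t < 0 \<Longrightarrow> b r t > 0"
      "\<And>r t. r > 0 \<Longrightarrow> t < 0 \<Longrightarrow> c r t > 0"
    and b_r: "\<And>r t. r > 0 \<Longrightarrow> t < 0 \<Longrightarrow> ((\<lambda>r. b r t) has_real_derivative \<phi> r t * y r t) (at r)"
    and y_r: "\<And>r t. r > 0 \<Longrightarrow> t < 0 \<Longrightarrow> ((\<lambda>r. y r t) has_real_derivative \<phi> r t * y2 r t) (at r)"
    and y2_r: "\<And>r t. r > 0 \<Longrightarrow> t < 0 \<Longrightarrow> ((\<lambda>r. y2 r t) has_real_derivative \<phi> r t * y3 r t) (at r)"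
    and c_r: "\<And>r t. r > 0 \<Longrightarrow> t < 0 \<Longrightarrow> ((\<lambda>r. c r t) has_real_derivative \<phi> r t * z r t) (at r)"
    and z_r: "\<And>r t. r > 0 \<Longrightarrow> t < 0 \<Longrightarrow> ((\<lambda>r. z r t) has_real_derivative \<phi> r t * z2 r t) (at r)"
    and z2_r: "\<And>r t. r > 0 \<Longrightarrow> t < 0 \<Longrightarrow> ((\<lambda>r. z2 r t) has_real_derivative \<phi> r t * z3 r t) (at r)"
    and b_t: "\<And>r t. r > 0 \<Longrightarrow> t < 0 \<Longrightarrow> ((\<lambda>t. b r t) has_real_derivative
        y2 r t + z r t * y r t / c r t + (y r t)\<^sup>2 / b r t + (2 * (u r t)\<^sup>2 - 4) / b r t) (at t)"
    and c_t: "\<And>r t. r > 0 \<Longrightarrow> t < 0 \<Longrightarrow> ((\<lambda>t. c r t) has_real_derivative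
        z2 r t + 2 * y r t * z r t / b r t - 2 * (u r t)^3 / b r t) (at t)"
    and y_t: "\<And>r t. r > 0 \<Longrightarrow> t < 0 \<Longrightarrow> ((\<lambda>t. y r t) has_real_derivative
        y3 r t + z r t / c r t * y2 r t - (z r t)\<^sup>2 * y r t / (c r t)\<^sup>2 - (y r t)^3 / (b r t)\<^sup>2
        + (4 - 6 * (u r t)\<^sup>2) * y r t / (b r t)\<^sup>2 + 4 * u r t * z r t / (b r t)\<^sup>2) (at t)"
    and z_t: "\<And>r t. r > 0 \<Longrightarrow> t < 0 \<Longrightarrow> ((\<lambda>t. z r t) has_real_derivative
        z3 r t + (2 * y r t / b r t - z r t / c r t) * z2 r t - 2 * (y r t)\<^sup>2 * z r t / (b r t)\<^sup>2
        - 6 * (u r t)\<^sup>2 * z r t / (b r t)\<^sup>2 + 8 * (u r t)^3 * y r t / (b r t)\<^sup>2) (at t)"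
    and u_eq: "\<And>r t. r > 0 \<Longrightarrow> t < 0 \<Longrightarrow> u r t = c r t / b r t"
    and v_eq: "\<And>r t. r > 0 \<Longrightarrow> t < 0 \<Longrightarrow> v r t = z r t / c r t - y r t / b r t"
    and cont: "continuous_on ({0..} \<times> {..<0}) (\<lambda>(r,t). b r t)"
      "continuous_on ({0..} \<times> {..<0}) (\<lambda>(r,t). y r t)"
      "continuous_on ({0..} \<times> {..<0}) (\<lambda>(r,t). z r t)"
      "continuous_on ({0..} \<times> {..<0}) (\<lambda>(r,t). u r t)"
      "continuous_on ({0..} \<times> {..<0}) (\<lambda>(r,t). v r t)"
    and axis: "\<And>t. t < 0 \<Longrightarrow> b 0 t = 0" "\<And>t. t < 0 \<Longrightarrow> y 0 t = 1" "\<And>t. t < 0 \<Longrightarrow> z 0 t = 1"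
      "\<And>t. t < 0 \<Longrightarrow> u 0 t = 1" "\<And>t. t < 0 \<Longrightarrow> v 0 t = 0"
    and u_le: "\<And>r t. r > 0 \<Longrightarrow> t < 0 \<Longrightarrow> u r t \<le> 1"
    and z_ge: "\<And>r t. r > 0 \<Longrightarrow> t < 0 \<Longrightarrow> z r t \<ge> 0"
    and c_le: "\<And>r t. r > 0 \<Longrightarrow> t < 0 \<Longrightarrow> c r t \<le> M"
    and f_pos: "\<And>x. x \<ge> 1 \<Longrightarrow> f x > 0" and f_cont: "continuous_on {1..} f"
    and f_lim: "filterlim f at_top at_top"
    and y_ge: "\<And>r t. r > 0 \<Longrightarrow> t < 0 \<Longrightarrow> y r t \<ge> u r t * f (1 / u r t)"
    and K: "K \<ge> 0"
    and curv1: "\<And>r t. r > 0 \<Longrightarrow> t < 0 \<Longrightarrow> (y r t)\<^sup>2 \<le> 4 + K * (b r t)\<^sup>2"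
    and curv2: "\<And>r t. r > 0 \<Longrightarrow> t < 0 \<Longrightarrow> y r t * z r t / (b r t * c r t) \<le> K + 1 / (b r t)\<^sup>2"
    and b_lim: "\<And>t. t < 0 \<Longrightarrow> filterlim (\<lambda>r. b r t) at_top at_top"
begin

section \<open>Evolution equations of the ratio, of the two defects and of the logarithmic
  derivative\<close>

text \<open>\<open>us\<close>, \<open>uss\<close> and, below, \<open>vs\<close>, \<open>vss\<close>
  are the first two arclength derivatives of \<open>u\<close> and \<open>v\<close>, expressed by
  those of \<open>b\<close> and \<open>c\<close>.\<close>

definition us where "us r t = (z r t - u r t * y r t) / b r t"
definition uss where "uss r t = (z2 r t - us r t * y r t - u r t * y2 r t) / b r t - us r t * y r t / b r t"
definition "w r t = y r t + u r t"
definition "P r t = z r t - (u r t)\<^sup>2"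
definition "vs r t = z2 r t / c r t - (z r t)\<^sup>2 / (c r t)\<^sup>2 - y2 r t / b r t + (y r t)\<^sup>2 / (b r t)\<^sup>2"
definition "vss r t = z3 r t / c r t - 3 * z r t * z2 r t / (c r t)\<^sup>2 + 2 * (z r t)^3 / (c r t)^3
   - y3 r t / b r t + 3 * y r t * y2 r t / (b r t)\<^sup>2 - 2 * (y r t)^3 / (b r t)^3"

lemma u_pos: "r \<ge> 0 \<Longrightarrow> t < 0 \<Longrightarrow> u r t > 0"
  using pos[of r t] u_eq[of r t] axis(4)[of t] by (cases "r = 0") auto

lemma M_pos: "M > 0"
  using pos(3)[of 1 "-1"] c_le[of 1 "-1"] by auto

lemma u_le1: "r \<ge> 0 \<Longrightarrow> t < 0 \<Longrightarrow> u r t \<le> 1"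
  using u_le[of r t] axis(4)[of t] by (cases "r = 0") auto

lemma c_eq: "r > 0 \<Longrightarrow> t < 0 \<Longrightarrow> c r t = u r t * b r t"
  using u_eq[of r t] pos[of r t] by simp

lemma b_le: "r > 0 \<Longrightarrow> t < 0 \<Longrightarrow> b r t \<le> M / u r t"
  using c_eq[of r t] c_le[of r t] u_pos[of r t] by (simp add: field_simps)

lemma y_pos: "r > 0 \<Longrightarrow> t < 0 \<Longrightarrow> y r t > 0"
  using y_ge[of r t] u_pos[of r t] u_le1[of r t] f_pos[of "1 / u r t"]
  by (smt (verit) less_divide_eq_1_pos divide_le_eq_1_pos le_divide_eq_1_pos mult_pos_pos)

lemma u_r: assumes "r > 0" "t < 0"
  shows "((\<lambda>r. u r t) has_real_derivative \<phi> r t * us r t) (at r)"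
proof -
  have nz: "b r t \<noteq> 0" "c r t \<noteq> 0" "(b r t)\<^sup>2 \<noteq> 0" "(c r t)\<^sup>2 \<noteq> 0" "\<phi> r t \<noteq> 0"
    using pos[OF assms] by auto
  have "((\<lambda>r. c r t / b r t) has_real_derivative \<phi> r t * us r t) (at r)"
    by (rule derivative_eq_intros b_r c_r assms nz refl)+
      (use nz u_eq[OF assms] in \<open>simp add: us_def divide_simps algebra_simps\<close>)
  then show ?thesis
    by (rule has_field_derivative_transform_within_open[of _ _ _ "{0<..}"]) (use assms u_eq in auto)
qed

lemma us_r: assumes "r > 0" "t < 0"
  shows "((\<lambda>r. us r t) has_real_derivative \<phi> r t * uss r t) (at r)"
proof -
  have nz: "b r t \<noteq> 0" "c r t \<noteq> 0" "(b r t)\<^sup>2 \<noteq> 0" "(c r t)\<^sup>2 \<noteq> 0" "\<phi> r t \<noteq> 0"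
    using pos[OF assms] by auto
  show ?thesis
    unfolding us_def
    apply (rule derivative_eq_intros b_r y_r z_r u_r assms nz refl)+
    using nz by (simp add: us_def uss_def divide_simps) algebra
qed

lemma u_t: assumes "r > 0" "t < 0"
  shows "((\<lambda>t. u r t) has_real_derivative
     uss r t + 3 * y r t / b r t * us r t + 4 * u r t * (1 - (u r t)\<^sup>2) / (b r t)\<^sup>2) (at t)"
proof -
  have p: "b r t > 0" "u r t > 0" "c r t > 0" using pos u_pos assms by auto
  have "((\<lambda>t. c r t / b r t) has_real_derivative
     ((z2 r t + 2 * y r t * z r t / b r t - 2 * (u r t)^3 / b r t) * b r t - c r t *
     (y2 r t + z r t * y r t / c r t + (y r t)\<^sup>2 / b r t + (2 * (u r t)\<^sup>2 - 4) / b r t)) / (b r t * b r t)) (at t)"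
    by (rule DERIV_divide[OF c_t[OF assms] b_t[OF assms]]) (use p in auto)
  also have "((z2 r t + 2 * y r t * z r t / b r t - 2 * (u r t)^3 / b r t) * b r t - c r t *
     (y2 r t + z r t * y r t / c r t + (y r t)\<^sup>2 / b r t + (2 * (u r t)\<^sup>2 - 4) / b r t)) / (b r t * b r t)
     = uss r t + 3 * y r t / b r t * us r t + 4 * u r t * (1 - (u r t)\<^sup>2) / (b r t)\<^sup>2"
    using p unfolding c_eq[OF assms] uss_def us_def
    by (simp add: divide_simps) (simp add: algebra_simps power2_eq_square power3_eq_cube)
  finally show ?thesis
    by (rule has_field_derivative_transform_within_open[of _ _ _ "{..<0}"]) (use assms u_eq in auto)
qed

lemma w_r: assumes "r > 0" "t < 0"
  shows "((\<lambda>r. w r t) has_real_derivative \<phi> r t * (y2 r t + us r t)) (at r)"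
  unfolding w_def by (rule derivative_eq_intros y_r u_r assms refl)+ (simp add: algebra_simps)

lemma ws_r: assumes "r > 0" "t < 0"
  shows "((\<lambda>r. y2 r t + us r t) has_real_derivative \<phi> r t * (y3 r t + uss r t)) (at r)"
  by (rule derivative_eq_intros y2_r us_r assms refl)+ (simp add: algebra_simps)

text \<open>Since \<open>y2 + us\<close> is \<open>w_s\<close>, all terms with derivatives of
  \<open>w\<close> form a linear operator and the rest is a pure reaction term. It vanishes at
  \<open>w = 2\<close>, \<open>P = 0\<close> and couples to \<open>P\<close> only through
  \<open>2 P - P^2 / u^2\<close>.\<close>

lemma w_t: assumes "r > 0" "t < 0"
  shows "((\<lambda>t. w r t) has_real_derivative
     y3 r t + uss r t + z r t / c r t * (y2 r t + us r t)
     + w r t / (b r t)\<^sup>2 * (4 - (w r t)\<^sup>2 + 2 * P r t - (P r t)\<^sup>2 / (u r t)\<^sup>2)) (at t)"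
  unfolding w_def[abs_def]
  apply (rule derivative_eq_intros y_t u_t assms refl)+
  using pos(2)[OF assms] u_pos[of r t] assms
  unfolding c_eq[OF assms] P_def us_def
  by (simp add: divide_simps) algebra

lemma P_r: assumes "r > 0" "t < 0"
  shows "((\<lambda>r. P r t) has_real_derivative \<phi> r t * (z2 r t - 2 * u r t * us r t)) (at r)"
  unfolding P_def by (rule derivative_eq_intros z_r u_r assms refl)+ (simp add: algebra_simps)

lemma Ps_r: assumes "r > 0" "t < 0"
  shows "((\<lambda>r. z2 r t - 2 * u r t * us r t) has_real_derivative
     \<phi> r t * (z3 r t - 2 * (us r t)\<^sup>2 - 2 * u r t * uss r t)) (at r)"
  by (rule derivative_eq_intros z2_r u_r us_r assms refl)+ (simp add: algebra_simps power2_eq_square)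

text \<open>\<open>z2 - 2 u us\<close> is \<open>P_s\<close>. The reaction term damps
  \<open>P\<close> and has the source \<open>2 u^2 (w^2 - 4)\<close>, which has the sign of
  \<open>w - 2\<close>.\<close>

lemma P_t: assumes "r > 0" "t < 0"
  shows "((\<lambda>t. P r t) has_real_derivative
     z3 r t - 2 * (us r t)\<^sup>2 - 2 * u r t * uss r t + (2 * y r t / b r t - z r t / c r t) * (z2 r t - 2 * u r t * us r t)
     + 1 / (b r t)\<^sup>2 * (- 2 * ((w r t)\<^sup>2 + 2 * (u r t)\<^sup>2) * P r t + 2 * (u r t)\<^sup>2 * ((w r t)\<^sup>2 - 4))) (at t)"
  unfolding P_def[abs_def]
  apply (rule derivative_eq_intros z_t u_t assms refl)+
  using pos(2)[OF assms] u_pos[of r t] assms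
  unfolding c_eq[OF assms] w_def us_def
  by (simp add: divide_simps) algebra

lemma v_r: assumes "r > 0" "t < 0"
  shows "((\<lambda>r. v r t) has_real_derivative \<phi> r t * vs r t) (at r)"
proof -
  have nz: "b r t \<noteq> 0" "c r t \<noteq> 0" "(b r t)\<^sup>2 \<noteq> 0" "(c r t)\<^sup>2 \<noteq> 0" "\<phi> r t \<noteq> 0"
    using pos[OF assms] by auto
  have "((\<lambda>r. z r t / c r t - y r t / b r t) has_real_derivative \<phi> r t * vs r t) (at r)"
    apply (rule derivative_eq_intros b_r c_r y_r z_r assms nz refl)+
    using nz by (simp add: vs_def divide_simps) algebra
  then show ?thesis
    by (rule has_field_derivative_transform_within_open[of _ _ _ "{0<..}"]) (use assms v_eq in auto)
qed

lemma vs_r: assumes "r > 0" "t < 0"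
  shows "((\<lambda>r. vs r t) has_real_derivative \<phi> r t * vss r t) (at r)"
proof -
  have nz: "b r t \<noteq> 0" "c r t \<noteq> 0" "(b r t)\<^sup>2 \<noteq> 0" "(c r t)\<^sup>2 \<noteq> 0" "\<phi> r t \<noteq> 0"
    using pos[OF assms] by auto
  show ?thesis
    unfolding vs_def
    apply (rule derivative_eq_intros b_r c_r y_r z_r y2_r z2_r assms nz refl)+
    using nz by (simp add: vss_def divide_simps) algebra
qed

text \<open>For \<open>v > 0\<close> every term of order zero is nonpositive, by
  \<open>u \<le> 1\<close> and \<open>y > 0\<close>; the cubic term alone forces decay at a rate
  independent of the initial value.\<close>

lemma v_t: assumes "r > 0" "t < 0"
  shows "((\<lambda>t. v r t) has_real_derivative vss r t + (2 * y r t / b r t + z r t / c r t) * vs r t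
    - (v r t)^3 - 2 * (v r t)\<^sup>2 * y r t / b r t - (3 * (y r t)\<^sup>2 + 8 * (u r t)\<^sup>2) * v r t / (b r t)\<^sup>2
    - 8 * (1 - (u r t)\<^sup>2) * y r t / (b r t)^3) (at t)"
proof -
  have p: "b r t > 0" "u r t > 0" "c r t > 0" using pos u_pos assms by auto
  have nz: "b r t \<noteq> 0" "c r t \<noteq> 0" "(b r t)\<^sup>2 \<noteq> 0" "(c r t)\<^sup>2 \<noteq> 0" "\<phi> r t \<noteq> 0"
    using pos[OF assms] by auto
  have "((\<lambda>t. z r t / c r t - y r t / b r t) has_real_derivative vss r t + (2 * y r t / b r t + z r t / c r t) * vs r t
    - (v r t)^3 - 2 * (v r t)\<^sup>2 * y r t / b r t - (3 * (y r t)\<^sup>2 + 8 * (u r t)\<^sup>2) * v r t / (b r t)\<^sup>2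
    - 8 * (1 - (u r t)\<^sup>2) * y r t / (b r t)^3) (at t)"
    apply (rule derivative_eq_intros b_t c_t y_t z_t assms nz refl)+
    using p unfolding vs_def vss_def v_eq[OF assms] c_eq[OF assms]
    by (simp_all add: divide_simps) algebra
  then show ?thesis
    by (rule has_field_derivative_transform_within_open[of _ _ _ "{..<0}"]) (use assms v_eq in auto)
qed

end

section \<open>Minimum principle and behaviour at infinity\<close>

context berger_pde
begin

lemma minimum_principle:
  fixes H Hs Hss Ht :: "real \<Rightarrow> real \<Rightarrow> real"
  assumes cont: "continuous_on ({0..} \<times> {t0..t1}) (\<lambda>(r,t). H r t)"
    and t1: "t1 < 0"
    and init: "\<And>r. r \<ge> 0 \<Longrightarrow> H r t0 > 0"
    and axis: "\<And>t. t0 \<le> t \<Longrightarrow> t \<le> t1 \<Longrightarrow> H 0 t > 0"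
    and far: "\<And>r t. r \<ge> R \<Longrightarrow> t0 \<le> t \<Longrightarrow> t \<le> t1 \<Longrightarrow> H r t > 0"
    and H_r: "\<And>r t. r > 0 \<Longrightarrow> t0 < t \<Longrightarrow> t \<le> t1 \<Longrightarrow> ((\<lambda>r. H r t) has_real_derivative \<phi> r t * Hs r t) (at r)"
    and Hs_r: "\<And>r t. r > 0 \<Longrightarrow> t0 < t \<Longrightarrow> t \<le> t1 \<Longrightarrow> ((\<lambda>r. Hs r t) has_real_derivative \<phi> r t * Hss r t) (at r)"
    and H_t: "\<And>r t. r > 0 \<Longrightarrow> t0 < t \<Longrightarrow> t \<le> t1 \<Longrightarrow> ((\<lambda>t. H r t) has_real_derivative Ht r t) (at t)"
    and touch: "\<And>r t. r > 0 \<Longrightarrow> t0 < t \<Longrightarrow> t \<le> t1 \<Longrightarrow> H r t = 0 \<Longrightarrow> Hs r t = 0 \<Longrightarrow> Hss r t \<ge> 0 \<Longrightarrow> Ht r t \<le> 0 \<Longrightarrow> False"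
    and rt: "r \<ge> 0" "t0 \<le> t" "t \<le> t1"
  shows "H r t > 0"
proof (rule first_touching[OF cont init axis far _ rt])
  fix r t :: real
  assume *: "r > 0" "t0 < t" "t \<le> t1" "H r t = 0" "\<And>r'. r' \<ge> 0 \<Longrightarrow> H r' t \<ge> 0"
    "\<And>t'. t0 \<le> t' \<Longrightarrow> t' < t \<Longrightarrow> H r t' > 0"
  have t: "t < 0" using * t1 by simp
  have "Hs r t = 0" "Hss r t \<ge> 0"
    by (rule interior_minimum_derivatives[of r "\<lambda>r. \<phi> r t" "\<lambda>r. H r t" "\<lambda>r. Hs r t" "Hss r t"];
        use * t pos H_r Hs_r in simp)+
  moreover have "Ht r t \<le> 0"
    by (rule left_minimum_derivative[OF H_t, of r t t0]) (use * in \<open>auto intro: less_imp_le\<close>)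
  ultimately show False using touch * by auto
qed auto

lemma cont_rect:
  assumes "t1 < 0"
  shows "continuous_on ({0..} \<times> {t0..t1}) (\<lambda>p. b (fst p) (snd p))"
    "continuous_on ({0..} \<times> {t0..t1}) (\<lambda>p. u (fst p) (snd p))"
    "continuous_on ({0..} \<times> {t0..t1}) (\<lambda>p. v (fst p) (snd p))"
    "continuous_on ({0..} \<times> {t0..t1}) (\<lambda>p. w (fst p) (snd p))"
    "continuous_on ({0..} \<times> {t0..t1}) (\<lambda>p. P (fst p) (snd p))"
  unfolding w_def P_def
  by (intro continuous_intros continuous_on_subset[OF cont(1)[unfolded case_prod_beta']]
      continuous_on_subset[OF cont(2)[unfolded case_prod_beta']] continuous_on_subset[OF cont(3)[unfolded case_prod_beta']]
      continuous_on_subset[OF cont(4)[unfolded case_prod_beta']] continuous_on_subset[OF cont(5)[unfolded case_prod_beta']];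
      use assms in auto)+

lemma b_nonneg: "r \<ge> 0 \<Longrightarrow> t < 0 \<Longrightarrow> b r t \<ge> 0"
  using pos(2)[of r t] axis(1)[of t] by (cases "r = 0") auto

lemma b_mono: assumes "0 < r" "r \<le> r'" "t < 0" shows "b r t \<le> b r' t"
proof (rule DERIV_nonneg_imp_nondecreasing[OF assms(2)])
  fix x assume "r \<le> x" "x \<le> r'"
  then have x: "x > 0" using assms by simp
  show "\<exists>y. ((\<lambda>r. b r t) has_real_derivative y) (at x) \<and> 0 \<le> y"
    using b_r[OF x assms(3)] pos(1)[OF x assms(3)] y_pos[OF x assms(3)]
    by (intro exI[of _ "\<phi> x t * y x t"]) auto
qed

lemma c_mono: assumes "0 < r" "r \<le> r'" "t < 0" shows "c r t \<le> c r' t"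
proof (rule DERIV_nonneg_imp_nondecreasing[OF assms(2)])
  fix x assume "r \<le> x" "x \<le> r'"
  then have x: "x > 0" using assms by simp
  show "\<exists>y. ((\<lambda>r. c r t) has_real_derivative y) (at x) \<and> 0 \<le> y"
    using c_r[OF x assms(3)] pos(1)[OF x assms(3)] z_ge[OF x assms(3)]
    by (intro exI[of _ "\<phi> x t * z x t"]) auto
qed

text \<open>Divergence of \<open>b\<close> is known only for each time separately. Monotonicity in
  \<open>r\<close> makes it uniform on compact time intervals, as in Dini's theorem: along a
  convergent sequence of exceptional times a fixed radius already gives the contradiction.\<close>

lemma b_far:
  assumes "t1 < 0"
  obtains R where "R > 0" "\<And>r t. r \<ge> R \<Longrightarrow> t0 \<le> t \<Longrightarrow> t \<le> t1 \<Longrightarrow> b r t > B"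
proof -
  have "\<exists>R>0. \<forall>r\<ge>R. \<forall>t. t0 \<le> t \<longrightarrow> t \<le> t1 \<longrightarrow> b r t > B"
  proof (rule ccontr)
    assume n: "\<not> ?thesis"
    have "\<exists>t. t0 \<le> t \<and> t \<le> t1 \<and> b (real (Suc n)) t \<le> B" for n
    proof -
      have "\<not> (\<forall>r\<ge>real (Suc n). \<forall>t. t0 \<le> t \<longrightarrow> t \<le> t1 \<longrightarrow> b r t > B)"
        using n of_nat_0_less_iff by blast
      then obtain r t where "r \<ge> real (Suc n)" "t0 \<le> t" "t \<le> t1" "b r t \<le> B"
        by (auto simp: not_less)
      then show ?thesis using b_mono[of "real (Suc n)" r t] assms by (intro exI[of _ t]) auto
    qed
    then have "\<exists>T. \<forall>n. t0 \<le> T n \<and> T n \<le> t1 \<and> b (real (Suc n)) (T n) \<le> B"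
      by (intro choice) auto
    then obtain T where T: "\<And>n. T n \<in> {t0..t1}" "\<And>n. b (real (Suc n)) (T n) \<le> B"
      by auto
    obtain s h where s: "s \<in> {t0..t1}" "strict_mono h" "(T \<circ> h) \<longlonglongrightarrow> s"
      using compact_Icc[of t0 t1, unfolded compact_def] T(1) by blast
    have s0: "s < 0" using s assms by auto
    obtain r0 where r0: "\<And>r. r \<ge> r0 \<Longrightarrow> b r s > B"
      using b_lim[OF s0] unfolding filterlim_at_top_dense eventually_at_top_linorder by blast
    define r where "r = max r0 1"
    have br: "b r s > B" "r > 0" using r0[of r] by (auto simp: r_def)
    have "isCont (b r) s" using DERIV_isCont[OF b_t[OF br(2) s0]] by simp
    then have lim: "(\<lambda>n. b r (T (h n))) \<longlonglongrightarrow> b r s"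
      using isCont_tendsto_compose[OF _ s(3)] by (simp add: o_def)
    have "\<forall>\<^sub>F n in sequentially. b r (T (h n)) \<le> B"
    proof (rule eventually_sequentiallyI[of "nat \<lceil>r\<rceil>"])
      fix n assume "nat \<lceil>r\<rceil> \<le> n"
      then have "r \<le> real (Suc (h n))"
        using seq_suble[OF s(2), of n] by linarith
      then show "b r (T (h n)) \<le> B"
        using b_mono[OF br(2), of "real (Suc (h n))" "T (h n)"] T(2)[of "h n"] T(1)[of "h n"] assms by auto
    qed
    then have "b r s \<le> B" using tendsto_upperbound[OF lim] by simp
    with br show False by simp
  qed
  then show thesis using that by blast
qed

lemma c_lower:
  assumes "t1 < 0"
  obtains m where "m > 0" "\<And>r t. r \<ge> 1 \<Longrightarrow> t0 \<le> t \<Longrightarrow> t \<le> t1 \<Longrightarrow> c r t \<ge> m"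
proof (cases "t0 \<le> t1")
  case True
  have "continuous_on {t0..t1} (c 1)"
    using assms by (intro continuous_at_imp_continuous_on ballI DERIV_isCont[OF c_t]) auto
  then obtain s where s: "s \<in> {t0..t1}" "\<And>t. t \<in> {t0..t1} \<Longrightarrow> c 1 s \<le> c 1 t"
    using continuous_attains_inf[of "{t0..t1}" "c 1"] True by auto
  show thesis
  proof (rule that[of "c 1 s"])
    show "c 1 s > 0" using pos(3)[of 1 s] s assms by auto
    fix r t :: real assume "r \<ge> 1" "t0 \<le> t" "t \<le> t1"
    then show "c r t \<ge> c 1 s" using c_mono[of 1 r t] s(2)[of t] assms by auto
  qed
qed (use that[of 1] in auto)

lemma u_small: assumes "r > 0" "t < 0" "u r t \<ge> d" "d > 0" shows "b r t \<le> M / d"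
proof -
  have "M / u r t \<le> M / d" using assms M_pos by (intro divide_left_mono) auto
  then show ?thesis using b_le[OF assms(1,2)] by simp
qed

lemma bounded_rect:
  fixes h :: "real \<Rightarrow> real \<Rightarrow> real" and R T0 t1 :: real
  assumes "t1 < 0" "continuous_on ({0..} \<times> {T0..t1}) (\<lambda>p. h (fst p) (snd p) :: real)"
  obtains V where "V > 0" "\<And>r t. 0 \<le> r \<Longrightarrow> r \<le> R \<Longrightarrow> T0 \<le> t \<Longrightarrow> t \<le> t1 \<Longrightarrow> h r t \<le> V"
proof -
  have "compact ((\<lambda>p. h (fst p) (snd p)) ` ({0..R} \<times> {T0..t1}))"
    by (intro compact_continuous_image continuous_on_subset[OF assms(2)] compact_Times compact_Icc) auto
  then obtain V where V: "V > 0" "\<forall>x \<in> (\<lambda>p. h (fst p) (snd p)) ` ({0..R} \<times> {T0..t1}). norm x \<le> V"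
    using compact_imp_bounded bounded_pos by metis
  show thesis
  proof (rule that[OF V(1)])
    fix r t :: real assume "0 \<le> r" "r \<le> R" "T0 \<le> t" "t \<le> t1"
    then have "h r t \<in> (\<lambda>p. h (fst p) (snd p)) ` ({0..R} \<times> {T0..t1})"
      by (intro image_eqI[of _ _ "(r,t)"]) auto
    with V(2) have "norm (h r t) \<le> V" by blast
    then show "h r t \<le> V" by simp
  qed
qed

lemma f_large: obtains X where "X \<ge> 1" "\<And>x. x \<ge> X \<Longrightarrow> f x \<ge> L"
proof -
  obtain X where "\<And>x. x \<ge> X \<Longrightarrow> f x \<ge> L"
    using f_lim unfolding filterlim_at_top eventually_at_top_linorder by blast
  then show thesis using that[of "max X 1"] by auto
qed

text \<open>The curvature of the mixed planes bounds \<open>y z\<close> by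
  \<open>b c (K + 1 / b^2)\<close>, and far out \<open>y \<ge> u L\<close> with \<open>L\<close> as
  large as desired. Dividing by \<open>u\<close> leaves \<open>L z \<le> K b^2 + 1\<close>, while
  \<open>v \<le> z / c\<close> and \<open>c\<close> is bounded below.\<close>

lemma v_far:
  assumes "t1 < 0" "e > 0"
  obtains R where "R > 0" "\<And>r t. r \<ge> R \<Longrightarrow> t0 \<le> t \<Longrightarrow> t \<le> t1 \<Longrightarrow> v r t < e * (1 + (b r t)\<^sup>2)"
proof -
  obtain m where m: "m > 0" "\<And>r t. r \<ge> 1 \<Longrightarrow> t0 \<le> t \<Longrightarrow> t \<le> t1 \<Longrightarrow> c r t \<ge> m"
    using c_lower[OF assms(1)] by blast
  \<comment> \<open>Chosen so that \<open>(K + 1) / L\<close> is smaller than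
    \<open>m e\<close>.\<close>
  define L where "L = (K + 1) / (m * e) + 1"
  have L: "L > 0" "(K + 1) < m * e * L" using K m assms by (auto simp: L_def field_simps intro!: add_pos_nonneg)
  obtain X where X: "X \<ge> 1" "\<And>x. x \<ge> X \<Longrightarrow> f x \<ge> L" using f_large by blast
  obtain R where R: "R > 0" "\<And>r t. r \<ge> R \<Longrightarrow> t0 \<le> t \<Longrightarrow> t \<le> t1 \<Longrightarrow> b r t > M * X"
    using b_far[OF assms(1)] by blast
  show thesis
  proof (rule that[of "max R 1"])
    fix r t :: real assume "r \<ge> max R 1" and t: "t0 \<le> t" "t \<le> t1"
    then have r: "r \<ge> R" "r \<ge> 1" "r > 0" "t < 0" using assms by auto
    note p = pos[OF r(3,4)] y_pos[OF r(3,4)]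
    have u: "u r t > 0" using u_pos r by simp
    have "X \<le> b r t / M" using R(2)[OF r(1) t] M_pos by (simp add: field_simps)
    also have "\<dots> \<le> 1 / u r t" using b_le[OF r(3,4)] u M_pos by (simp add: field_simps)
    finally have f: "f (1 / u r t) \<ge> L" using X by simp
    have "y r t \<ge> u r t * L" using y_ge[OF r(3,4)] f u by (meson mult_left_mono less_imp_le order_trans)
    then have "u r t * L * z r t \<le> y r t * z r t" using z_ge[OF r(3,4)] by (simp add: mult_right_mono)
    also have "y r t * z r t = y r t * z r t / (b r t * c r t) * (b r t * c r t)" using p by simp
    also have "\<dots> \<le> (K + 1 / (b r t)\<^sup>2) * (b r t * c r t)"
      using curv2[OF r(3,4)] p by (intro mult_right_mono) auto
    also have "\<dots> = u r t * (K * (b r t)\<^sup>2 + 1)"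
      using p(2) unfolding c_eq[OF r(3,4)] by (simp add: algebra_simps power2_eq_square)
    finally have "L * z r t \<le> K * (b r t)\<^sup>2 + 1" using u by (simp add: mult.assoc)
    also have "\<dots> \<le> (K + 1) * (1 + (b r t)\<^sup>2)" using K by (simp add: algebra_simps)
    also have "\<dots> < m * e * L * (1 + (b r t)\<^sup>2)"
      using L p by (intro mult_strict_right_mono) (auto simp: add_pos_nonneg)
    finally have "L * z r t < L * (m * (e * (1 + (b r t)\<^sup>2)))" by (simp add: ac_simps)
    then have z: "z r t < m * (e * (1 + (b r t)\<^sup>2))" using L by simp

    have "v r t \<le> z r t / c r t" using v_eq[OF r(3,4)] p by simp
    also have "\<dots> \<le> z r t / m" using m(2)[OF r(2) t] m(1) p z_ge[OF r(3,4)] by (simp add: frac_le)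
    also have "\<dots> < e * (1 + (b r t)\<^sup>2)" using z m by (simp add: field_simps)
    finally show "v r t < e * (1 + (b r t)\<^sup>2)" .
  qed auto
qed

section \<open>Monotonicity of the ratio c/b\<close>

lemma inv_sqrt_deriv:
  assumes "T0 < t"
  shows "((\<lambda>t. 1 / sqrt (2 * (t - T0))) has_real_derivative (- ((1 / sqrt (2 * (t - T0)))^3))) (at t)"
proof -
  define s where "s = sqrt (2 * (t - T0))"
  have s: "s > 0" "s\<^sup>2 = 2 * (t - T0)" using assms by (auto simp: s_def)
  have "((\<lambda>t. 2 * (t - T0)) has_real_derivative 2) (at t)"
    by (auto intro!: derivative_eq_intros)
  from DERIV_chain2[OF DERIV_real_sqrt this]
  have sq: "((\<lambda>t. sqrt (2 * (t - T0))) has_real_derivative inverse s) (at t)"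
    using assms by (simp add: s_def)
  show ?thesis
    using DERIV_inverse'[OF sq, unfolded s_def[symmetric]] s
    unfolding s_def[symmetric] by (simp add: inverse_eq_divide power3_eq_cube)
qed

text \<open>$1/\sqrt{2(t-T_0)}$ solves $h' = -h^3$, which absorbs the initial values; the last term controls infinity.\<close>

lemma v_nonpos_aux:
  assumes "t1 < 0" "T0 < t1" "e > 0" "r > 0"
  shows "v r t1 \<le> 1 / sqrt (2 * (t1 - T0)) + e * exp ((24 + 4 * K) * (t1 - T0)) * (1 + (b r t1)\<^sup>2)"
proof -
  \<comment> \<open>The heat-type operator of the \<open>v\<close>-equation applied to
    \<open>b^2\<close> is at least \<open>- (4 y^2 + 8)\<close>, and the curvature bound gives
    \<open>4 y^2 + 8 \<le> 24 + 4 K b^2\<close>; an exponential factor with this rate compensates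
    it.\<close>
  define k where "k = 24 + 4 * K"
  obtain R where R: "R > 0" "\<And>r t. r \<ge> R \<Longrightarrow> T0 \<le> t \<Longrightarrow> t \<le> t1 \<Longrightarrow> v r t < e * (1 + (b r t)\<^sup>2)"
    using v_far[OF assms(1,3)] by blast
  obtain V where V: "V > 0" "\<And>r t. 0 \<le> r \<Longrightarrow> r \<le> R \<Longrightarrow> T0 \<le> t \<Longrightarrow> t \<le> t1 \<Longrightarrow> v r t \<le> V"
    using bounded_rect[OF assms(1) cont_rect(3)[OF assms(1)]] by blast
  \<comment> \<open>At time \<open>T0 + h\<close> the singular term is at least \<open>V + 1\<close>
    and so exceeds \<open>v\<close> on the compact part \<open>r \<le> R\<close>. The comparison
    therefore starts there instead of at \<open>T0\<close>, where that term is infinite.\<close>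
  define h where "h = min (t1 - T0) (1 / (2 * (V + 1)\<^sup>2))"
  have h: "h > 0" "T0 + h \<le> t1" using assms V by (auto simp: h_def)
  have "2 * h \<le> 1 / (V + 1)\<^sup>2" using V by (auto simp: h_def min_def field_simps)
  then have "sqrt (2 * h) \<le> 1 / (V + 1)" using V by (intro real_le_lsqrt) (auto simp: power_divide)
  then have "V + 1 \<le> 1 / sqrt (2 * h)" using h V(1) by (simp add: field_simps)
  then have hV: "V < 1 / sqrt (2 * h)" by simp
  define H where "H r t = 1 / sqrt (2 * (t - T0)) + e * exp (k * (t - T0)) * (1 + (b r t)\<^sup>2) - v r t" for r t
  have "H r t1 > 0"
  proof (rule minimum_principle[of "T0 + h" t1 H R
      "\<lambda>r t. e * exp (k * (t - T0)) * (2 * b r t * y r t) - vs r t"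
      "\<lambda>r t. e * exp (k * (t - T0)) * (2 * (y r t)\<^sup>2 + 2 * b r t * y2 r t) - vss r t"
      "\<lambda>r t. (- ((1 / sqrt (2 * (t - T0)))^3)) + e * exp (k * (t - T0)) * (k * (1 + (b r t)\<^sup>2)
        + 2 * b r t * (y2 r t + z r t * y r t / c r t + (y r t)\<^sup>2 / b r t + (2 * (u r t)\<^sup>2 - 4) / b r t))
        - (vss r t + (2 * y r t / b r t + z r t / c r t) * vs r t
    - (v r t)^3 - 2 * (v r t)\<^sup>2 * y r t / b r t - (3 * (y r t)\<^sup>2 + 8 * (u r t)\<^sup>2) * v r t / (b r t)\<^sup>2
    - 8 * (1 - (u r t)\<^sup>2) * y r t / (b r t)^3)"])
    show "continuous_on ({0..} \<times> {T0 + h..t1}) (\<lambda>(r, t). H r t)"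
      unfolding H_def case_prod_beta'
      by (intro continuous_intros cont_rect assms) (use h in auto)
    show "t1 < 0" "0 \<le> r" "t1 \<le> t1" "T0 + h \<le> t1" using assms h by auto
    have exp1: "1 \<le> exp (k * (t - T0))" if "T0 \<le> t" for t using that K by (simp add: k_def)
    have far: "H r t > 0" if "r \<ge> R" "T0 + h \<le> t" "t \<le> t1" for r t
    proof -
      have "e * 1 * (1 + (b r t)\<^sup>2) \<le> e * exp (k * (t - T0)) * (1 + (b r t)\<^sup>2)"
        using exp1[of t] that h assms by (intro mult_right_mono mult_left_mono) auto
      then show ?thesis using R(2)[of r t] that h divide_nonneg_nonneg[of 1 "sqrt (2 * (t - T0))"]
        assms(1) that h unfolding H_def by (smt (verit) real_sqrt_ge_zero)
    qed
    then show "\<And>r t. r \<ge> R \<Longrightarrow> T0 + h \<le> t \<Longrightarrow> t \<le> t1 \<Longrightarrow> H r t > 0" .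
    show "H r (T0 + h) > 0" if "r \<ge> 0" for r
    proof (cases "r \<ge> R")
      case False
      have "0 \<le> e * exp (k * (T0 + h - T0)) * (1 + (b r (T0 + h))\<^sup>2)" using assms by simp
      moreover have "v r (T0 + h) \<le> V" using V(2)[of r "T0 + h"] False that h by auto
      ultimately show ?thesis using hV by (simp add: H_def)
    qed (use far[of r "T0 + h"] h in auto)
    show "H 0 t > 0" if "T0 + h \<le> t" "t \<le> t1" for t
      using that assms axis h unfolding H_def by (auto intro!: add_nonneg_pos)
    fix r t :: real assume r: "r > 0" and t: "T0 + h < t" "t \<le> t1"
    then have t': "t < 0" "T0 < t" using assms h by auto
    note rt = r t'(1)
    show "((\<lambda>r. H r t) has_real_derivative \<phi> r t * (e * exp (k * (t - T0)) * (2 * b r t * y r t) - vs r t)) (at r)"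
      unfolding H_def by (rule derivative_eq_intros b_r v_r rt refl)+ (simp add: algebra_simps)
    show "((\<lambda>r. e * exp (k * (t - T0)) * (2 * b r t * y r t) - vs r t) has_real_derivative
       \<phi> r t * (e * exp (k * (t - T0)) * (2 * (y r t)\<^sup>2 + 2 * b r t * y2 r t) - vss r t)) (at r)"
      by (rule derivative_eq_intros b_r y_r vs_r rt refl)+ (simp add: algebra_simps power2_eq_square)
    show "(H r has_real_derivative (- ((1 / sqrt (2 * (t - T0)))^3)) + e * exp (k * (t - T0)) * (k * (1 + (b r t)\<^sup>2)
        + 2 * b r t * (y2 r t + z r t * y r t / c r t + (y r t)\<^sup>2 / b r t + (2 * (u r t)\<^sup>2 - 4) / b r t))
        - (vss r t + (2 * y r t / b r t + z r t / c r t) * vs r t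
    - (v r t)^3 - 2 * (v r t)\<^sup>2 * y r t / b r t - (3 * (y r t)\<^sup>2 + 8 * (u r t)\<^sup>2) * v r t / (b r t)\<^sup>2
    - 8 * (1 - (u r t)\<^sup>2) * y r t / (b r t)^3)) (at t)"
      unfolding H_def[abs_def]
      by (rule derivative_eq_intros b_t v_t inv_sqrt_deriv rt t' refl)+ (simp add: algebra_simps)
    assume H0: "H r t = 0"
      and s0: "e * exp (k * (t - T0)) * (2 * b r t * y r t) - vs r t = 0"
      and ss: "0 \<le> e * exp (k * (t - T0)) * (2 * (y r t)\<^sup>2 + 2 * b r t * y2 r t) - vss r t"
      and tt: "(- ((1 / sqrt (2 * (t - T0)))^3)) + e * exp (k * (t - T0)) * (k * (1 + (b r t)\<^sup>2)
        + 2 * b r t * (y2 r t + z r t * y r t / c r t + (y r t)\<^sup>2 / b r t + (2 * (u r t)\<^sup>2 - 4) / b r t))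
        - (vss r t + (2 * y r t / b r t + z r t / c r t) * vs r t
    - (v r t)^3 - 2 * (v r t)\<^sup>2 * y r t / b r t - (3 * (y r t)\<^sup>2 + 8 * (u r t)\<^sup>2) * v r t / (b r t)\<^sup>2
    - 8 * (1 - (u r t)\<^sup>2) * y r t / (b r t)^3) \<le> 0"
    define E where "E = e * exp (k * (t - T0))"
    define \<beta> where "\<beta> = 1 / sqrt (2 * (t - T0))"
    have E: "E > 0" and \<beta>: "\<beta> > 0" using assms t' by (auto simp: E_def \<beta>_def)
    note p = pos[OF rt] y_pos[OF rt]
    have u: "u r t > 0" "u r t \<le> 1" using u_pos u_le rt by auto
    have veq: "v r t = \<beta> + E * (1 + (b r t)\<^sup>2)" using H0 by (simp add: H_def E_def \<beta>_def)
    have v: "v r t \<ge> \<beta>" "v r t > 0" using E \<beta> veq by (auto simp: add_pos_nonneg)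
    have v3: "\<beta>^3 \<le> (v r t)^3" using v \<beta> by (simp add: power_mono)
    have n1: "0 \<le> 2 * (v r t)\<^sup>2 * y r t / b r t" and n1': "0 \<le> (3 * (y r t)\<^sup>2 + 8 * (u r t)\<^sup>2) * v r t / (b r t)\<^sup>2"
      using p v by auto
    have n2: "0 \<le> 8 * (1 - (u r t)\<^sup>2) * y r t / (b r t)^3"
      using p u by (auto simp: power_le_one)
    \<comment> \<open>The operator of the \<open>v\<close>-equation applied to \<open>b^2\<close>:
      time derivative minus second derivative minus drift. The \<open>b_ss\<close> terms
      cancel.\<close>
    have "2 * b r t * (y2 r t + z r t * y r t / c r t + (y r t)\<^sup>2 / b r t + (2 * (u r t)\<^sup>2 - 4) / b r t)
        - (2 * (y r t)\<^sup>2 + 2 * b r t * y2 r t) - (2 * y r t / b r t + z r t / c r t) * (2 * b r t * y r t)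
        = - 4 * (y r t)\<^sup>2 - 8 + 4 * (u r t)\<^sup>2" (is "?A - ?B - ?D = _")
      using p by (simp add: field_simps power2_eq_square)
    moreover have "k * (1 + (b r t)\<^sup>2) > 4 * (y r t)\<^sup>2 + 8"
    proof -
      have "k * (1 + (b r t)\<^sup>2) = 24 + 4 * K + 24 * (b r t)\<^sup>2 + 4 * K * (b r t)\<^sup>2" by (simp add: k_def algebra_simps)
      then show ?thesis using curv1[OF rt] K zero_less_power[OF p(2), of 2] mult_nonneg_nonneg[OF K zero_le_power2[of "b r t"]] by linarith
    qed
    ultimately have "k * (1 + (b r t)\<^sup>2) + ?A - ?B - ?D > 0" using zero_le_power2[of "u r t"] by linarith
    then have X: "E * (k * (1 + (b r t)\<^sup>2) + ?A) - E * ?B - E * ?D > 0"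
      using E by (simp add: right_diff_distrib[symmetric])
    have D: "(2 * y r t / b r t + z r t / c r t) * vs r t = E * ?D" using s0 by (simp add: E_def)
    \<comment> \<open>With every nonlinear expression replaced by a variable, the contradiction is a
      linear one.\<close>
    have lin: False if "0 < x1 - x2 - x3" "- b3 + x1 - (x4 + d - v3 - m1 - m2 - m3) \<le> 0" "0 \<le> x2 - x4"
      "b3 \<le> v3" "0 \<le> m1" "0 \<le> m2" "0 \<le> m3" "d = x3" for x1 x2 x3 x4 b3 v3 m1 m2 m3 d :: real
      using that by linarith
    show False
      by (rule lin[OF X tt[folded E_def, folded \<beta>_def] ss[folded E_def] v3 n1 n1' n2 D])
  qed
  then show ?thesis by (simp add: H_def k_def)
qed

text \<open>A positive value \<open>v\<close> is refuted by starting at the \<open>T0\<close> for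
  which \<open>1 / sqrt (2 (t - T0)) = v / 2\<close>. For this fixed \<open>T0\<close> the term
  controlling infinity can be made as small as \<open>v / 4\<close>.\<close>

lemma v_nonpos: assumes "r > 0" "t < 0" shows "v r t \<le> 0"
proof (rule ccontr)
  assume n: "\<not> v r t \<le> 0"
  define T0 where "T0 = t - 2 / (v r t)\<^sup>2"
  define E where "E = exp ((24 + 4 * K) * (t - T0)) * (1 + (b r t)\<^sup>2)"
  have T0: "T0 < t" using n by (simp add: T0_def)
  have E: "E > 0" by (simp add: E_def add_pos_nonneg)
  have "2 * (t - T0) = (2 / v r t)\<^sup>2" by (simp add: T0_def power_divide)
  then have sq: "sqrt (2 * (t - T0)) = 2 / v r t" using n by simp
  have "v r t \<le> v r t / 2 + e * E" if "e > 0" for e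
    using v_nonpos_aux[OF assms(2) T0 that assms(1)] unfolding sq E_def by (simp add: mult.assoc)
  from this[of "v r t / (4 * E)"] n E show False by (simp add: field_simps)
qed

end

section \<open>Reaction terms on the barriers\<close>

text \<open>At a contact with the barrier \<open>w = 2 - e\<close> the total reaction is
  \<open>(2 - e) / b^2\<close> times the left-hand side; a positive lower bound lets the barrier
  move. The bracket with \<open>y - \<zeta>\<close> is nonnegative by
  \<open>\<zeta> \<le> y\<close>, and the remaining quadratic is worst for the smallest admissible
  \<open>\<zeta>\<close>, which is \<open>u - e\<close> or \<open>0\<close>.\<close>

lemma barrier_reaction_w:
  fixes u e y \<zeta> d l :: real
  assumes u: "u \<le> 1" and \<zeta>: "0 \<le> \<zeta>" "\<zeta> \<le> u" "\<zeta> \<le> y" "u - \<zeta> \<le> e"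
    and y: "y = 2 - e - u" "d \<le> y" and d: "0 < d" "d \<le> 1" and l: "0 < l" "l \<le> u" "l \<le> e"
  shows "e * (2 - e + 2 * u\<^sup>2 + (y - \<zeta>) * ((3 * y - \<zeta>) - (2 - e) * (y - \<zeta>)) / 2) - 2 * (u - \<zeta>) * u - (u - \<zeta>)\<^sup>2
     \<ge> l * d\<^sup>2 / 9"
proof -
  have eq: "(3 * y - \<zeta>) - (2 - e) * (y - \<zeta>) = (1 + e) * (y - \<zeta>) + 2 * \<zeta>" by (simp add: algebra_simps)
  have "0 \<le> (1 + e) * (y - \<zeta>)" using \<zeta> l by simp
  then have "0 \<le> (y - \<zeta>) * ((3 * y - \<zeta>) - (2 - e) * (y - \<zeta>)) / 2" unfolding eq using \<zeta> by simp
  then have h: "e * (2 - e + 2 * u\<^sup>2) \<le> e * (2 - e + 2 * u\<^sup>2 + (y - \<zeta>) * ((3 * y - \<zeta>) - (2 - e) * (y - \<zeta>)) / 2)"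
    using l by simp
  \<comment> \<open>Used with \<open>x = e\<close> when \<open>e \<le> u\<close>, and with
    \<open>x = u\<close>, from \<open>\<zeta> \<ge> 0\<close>, otherwise.\<close>
  have mono: "2 * (u - \<zeta>) * u + (u - \<zeta>)\<^sup>2 \<le> 2 * x * u + x\<^sup>2" if "u - \<zeta> \<le> x" for x
  proof -
    have "(u - \<zeta>) * u \<le> x * u" using that l by (simp add: mult_right_mono)
    moreover have "(u - \<zeta>)\<^sup>2 \<le> x\<^sup>2" using that \<zeta> by (simp add: power_mono)
    ultimately show ?thesis by linarith
  qed
  have "e * (2 - e + 2 * u\<^sup>2) - (2 * (u - \<zeta>) * u + (u - \<zeta>)\<^sup>2) \<ge> l * d\<^sup>2 / 9"
  proof (cases "e \<le> u")
    case True
    have "e * (2 - e + 2 * u\<^sup>2) - (2 * e * u + e\<^sup>2) = 2 * e * ((1 - u)\<^sup>2 + (u - e))"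
      by (simp add: algebra_simps power2_eq_square)
    \<comment> \<open>Since \<open>y = 2 (1 - u) + (u - e) \<ge> d\<close>, one of
      \<open>1 - u\<close> and \<open>u - e\<close> is at least \<open>d / 3\<close>.\<close>
    moreover have "d\<^sup>2 / 9 \<le> (1 - u)\<^sup>2 + (u - e)"
    proof (cases "d / 3 \<le> 1 - u")
      case t: True
      then have "(d / 3)\<^sup>2 \<le> (1 - u)\<^sup>2" using d by (intro power_mono) auto
      then show ?thesis using True by (simp add: power_divide)
    next
      case False
      then have "u - e \<ge> d / 3" using y by linarith
      moreover have "d\<^sup>2 \<le> d" using d by (simp add: power2_eq_square mult_left_le)
      ultimately show ?thesis using zero_le_power2[of "1 - u"] d by linarith
    qed
    then have "2 * e * (d\<^sup>2 / 9) \<le> 2 * e * ((1 - u)\<^sup>2 + (u - e))" using l by (intro mult_left_mono) auto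
    moreover have "l * (d\<^sup>2 / 9) \<le> 2 * e * (d\<^sup>2 / 9)" using l by (intro mult_right_mono) auto
    ultimately show ?thesis using mono[OF \<zeta>(4)] by linarith
  next
    case False
    have "e * (2 - e + 2 * u\<^sup>2) - (2 * u * u + u\<^sup>2) = (e - u) * y + 2 * u * ((1 - u)\<^sup>2 + u * (e - u))"
      unfolding y by (simp add: algebra_simps power2_eq_square power3_eq_cube)
    moreover have "(e - u) * y \<ge> 0" "u * (e - u) \<ge> 0" using False y d l by auto
    moreover have "d\<^sup>2 / 9 \<le> (1 - u)\<^sup>2"
    proof -
      have "d / 3 \<le> 1 - u" using False y d by linarith
      then have "(d / 3)\<^sup>2 \<le> (1 - u)\<^sup>2" using d by (intro power_mono) auto
      then show ?thesis by (simp add: power_divide)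
    qed
    then have "2 * u * (d\<^sup>2 / 9) \<le> 2 * u * ((1 - u)\<^sup>2 + u * (e - u))"
      using l calculation(3) by (intro mult_left_mono) auto
    moreover have "l * (d\<^sup>2 / 9) \<le> 2 * u * (d\<^sup>2 / 9)" using l by (intro mult_right_mono) auto
    ultimately show ?thesis using mono[of u] \<zeta> by simp
  qed
  with h show ?thesis by linarith
qed

text \<open>At a contact with \<open>P = - u e\<close> one has \<open>\<zeta> = u - e\<close>, and
  the reaction is \<open>u e / b^2\<close> times the left-hand side. As a function \<open>G\<close>
  of \<open>w\<close> it grows at least like \<open>3/2 w^2\<close> from \<open>p = 2 - e\<close>
  on, and \<open>G p\<close> is a sum of three nonnegative terms; these and the growth cannot all be
  small.\<close>

lemma barrier_reaction_P:
  fixes u e w d :: real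
  defines "\<zeta> \<equiv> u - e" and "y \<equiv> w - u"
  assumes u: "u \<le> 1" and e: "0 < e" "e \<le> u" and w: "2 - e \<le> w" "u + d \<le> w" and d: "0 < d" "d \<le> 1"
  shows "2 * (w\<^sup>2 + 2 * u\<^sup>2) - 2 * u * (4 - w\<^sup>2) / e + e / 2 * (4 - 4 * u\<^sup>2 + \<zeta>\<^sup>2 - y\<^sup>2)
     + e * (2 - e) / 2 * (\<zeta> - y)\<^sup>2 \<ge> d\<^sup>2 / 4"
proof -
  define G where "G w = 2 * (w\<^sup>2 + 2 * u\<^sup>2) - 2 * u * (4 - w\<^sup>2) / e + e / 2 * (4 - 4 * u\<^sup>2 + \<zeta>\<^sup>2 - (w - u)\<^sup>2)
     + e * (2 - e) / 2 * (\<zeta> - (w - u))\<^sup>2" for w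
  define p where "p = 2 - e"
  have "u * (4 - p\<^sup>2) / e = u * (4 - e)"
    using e by (simp add: p_def power2_eq_square field_simps)
  then have "2 * u * (4 - p\<^sup>2) / e = 2 * (u * (4 - e))" by simp
  then have "G p = 2 * (p\<^sup>2 + 2 * u\<^sup>2) - 2 * (u * (4 - e)) + e / 2 * (4 - 4 * u\<^sup>2 + \<zeta>\<^sup>2 - (p - u)\<^sup>2)
     + e * (2 - e) / 2 * (\<zeta> - (p - u))\<^sup>2" by (simp only: G_def)
  then have G0: "G p = 4 * (1 - u)\<^sup>2 + 2 * e * (1 - u) + 2 * (1 - e) * (2 - e - e * u * (1 - u))"
    unfolding \<zeta>_def by (simp add: p_def power2_eq_square field_simps)
  have "e * u \<le> 1 * 1" using e u by (intro mult_mono) auto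
  then have "e * u * (1 - u) \<le> 1 * 1" using e u by (intro mult_mono) auto
  moreover have "u * (1 - u) \<le> 1/4" using zero_le_power2[of "u - 1/2"] by (simp add: power2_eq_square algebra_simps)
  then have "e * (u * (1 - u)) \<le> 1 * (1/4)" using e u by (intro mult_mono) auto
  then have q: "2 - e - e * u * (1 - u) \<ge> 3/4" using e u by (simp add: mult.assoc)
  have d2: "d\<^sup>2 \<le> d" using d by (simp add: power2_eq_square mult_left_le)
  have n: "0 \<le> 4 * (1 - u)\<^sup>2" "0 \<le> 2 * e * (1 - u)" "0 \<le> 2 * (1 - e) * (2 - e - e * u * (1 - u))"
    using e u q by auto
  have wp: "w\<^sup>2 - p\<^sup>2 = (w - p) * (w + p)" by (simp add: power2_eq_square algebra_simps)
  have inc: "G w - G p \<ge> 3/2 * (w\<^sup>2 - p\<^sup>2)"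
  proof -
    have wp0: "w\<^sup>2 - p\<^sup>2 \<ge> 0" unfolding wp using w e u by (intro mult_nonneg_nonneg) (auto simp: p_def)
    have "(w - u)\<^sup>2 - (p - u)\<^sup>2 = (w - p) * (w + p - 2 * u)" by (simp add: power2_eq_square algebra_simps)
    also have "\<dots> \<le> (w - p) * (w + p)" using w e by (intro mult_left_mono) (auto simp: p_def)
    finally have a: "(w - u)\<^sup>2 - (p - u)\<^sup>2 \<le> w\<^sup>2 - p\<^sup>2" by (simp add: wp)
    have "e / 2 * ((w - u)\<^sup>2 - (p - u)\<^sup>2) \<le> e / 2 * (w\<^sup>2 - p\<^sup>2)" using a e by (intro mult_left_mono) auto
    also have "\<dots> \<le> 1 / 2 * (w\<^sup>2 - p\<^sup>2)" using wp0 e u by (intro mult_right_mono) auto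
    finally have a': "e / 2 * ((w - u)\<^sup>2 - (p - u)\<^sup>2) \<le> 1 / 2 * (w\<^sup>2 - p\<^sup>2)" .
    have "(p - u - \<zeta>)\<^sup>2 \<le> (w - u - \<zeta>)\<^sup>2" using w u by (intro power_mono) (auto simp: p_def \<zeta>_def)
    then have "e * (2 - e) / 2 * (\<zeta> - (p - u))\<^sup>2 \<le> e * (2 - e) / 2 * (\<zeta> - (w - u))\<^sup>2"
      using e u by (intro mult_left_mono) (auto simp: power2_commute)
    moreover have "2 * u * (4 - w\<^sup>2) / e \<le> 2 * u * (4 - p\<^sup>2) / e"
      using wp0 e by (intro divide_right_mono mult_left_mono) auto
    moreover have "e / 2 * (4 - 4 * u\<^sup>2 + \<zeta>\<^sup>2 - (w - u)\<^sup>2) - e / 2 * (4 - 4 * u\<^sup>2 + \<zeta>\<^sup>2 - (p - u)\<^sup>2)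
      = - (e / 2 * ((w - u)\<^sup>2 - (p - u)\<^sup>2))" by (simp add: algebra_simps)
    moreover have "3/2 * (x1 - x2) \<le> (2 * (x1 + m) - a1 + b1 + c1) - (2 * (x2 + m) - a2 + b2 + c2)"
      if "c2 \<le> c1" "a1 \<le> a2" "b1 - b2 = - n" "n \<le> 1/2 * (x1 - x2)" for x1 x2 m a1 a2 b1 b2 c1 c2 n :: real
    proof -
      have "n * 2 \<le> x1 - x2" using that(4) by simp
      with that(1-3) show ?thesis by simp
    qed
    ultimately show ?thesis using a' unfolding G_def by blast
  qed
  have "G w \<ge> d\<^sup>2 / 4"
  proof (cases "d / 4 \<le> 1 - e")
    case True
    have "2 * (1 - e) * (2 - e - e * u * (1 - u)) \<ge> 2 * (d / 4) * (3/4)"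
      using True q d by (intro mult_mono) auto
    moreover have "3/2 * (w\<^sup>2 - p\<^sup>2) \<ge> 0" unfolding wp using w e u by (auto simp: p_def)
    ultimately show ?thesis using inc G0 n d2 d by linarith
  next
    case 1: False
    show ?thesis
    proof (cases "d / 4 \<le> 1 - u")
      case True
      have "(d / 4)\<^sup>2 \<le> (1 - u)\<^sup>2" using True d by (intro power_mono) auto
      moreover have "3/2 * (w\<^sup>2 - p\<^sup>2) \<ge> 0" unfolding wp using w e u by (auto simp: p_def)
      ultimately show ?thesis using inc G0 n by (simp add: power_divide)
    next
      case False
      \<comment> \<open>Now \<open>1 - e\<close> and \<open>1 - u\<close> are both below
        \<open>d / 4\<close>, so \<open>w - p \<ge> d - (1 - u) - (1 - e) > d / 2\<close>, while
        \<open>w + p \<ge> 1\<close>.\<close>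
      have "d / 2 * 1 \<le> (w - p) * (w + p)" using 1 False w d e u by (intro mult_mono) (auto simp: p_def)
      moreover have "G p \<ge> 0" using G0 n by linarith
      ultimately show ?thesis using inc d2 d unfolding wp by linarith
    qed
  qed
  then show ?thesis by (simp add: G_def y_def)
qed

section \<open>Upper bounds for the two defects\<close>

context berger_pde
begin

text \<open>This is \<open>b c_s / c\<close>, the counterpart of \<open>b_s\<close> for the fibre.
  In it \<open>v \<le> 0\<close> reads \<open>\<zeta> \<le> y\<close>, and
  \<open>P = u (\<zeta> - u)\<close>, so that at contact points everything is a rational function of
  \<open>u\<close>, \<open>y\<close>, \<open>\<zeta>\<close> divided by a power of
  \<open>b\<close>.\<close>

definition "\<zeta> r t = z r t / u r t"

lemma zeta: assumes "r > 0" "t < 0"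
  shows "z r t = u r t * \<zeta> r t" "0 \<le> \<zeta> r t" "\<zeta> r t \<le> y r t" "z r t / c r t = \<zeta> r t / b r t"
    "us r t = u r t * (\<zeta> r t - y r t) / b r t" "P r t = u r t * (\<zeta> r t - u r t)"
proof -
  have u: "u r t > 0" using u_pos assms by auto
  show 1: "z r t = u r t * \<zeta> r t" using u by (simp add: \<zeta>_def)
  show "0 \<le> \<zeta> r t" using u z_ge assms by (simp add: \<zeta>_def)
  show 2: "z r t / c r t = \<zeta> r t / b r t" unfolding c_eq[OF assms] 1 using u by simp
  show "\<zeta> r t \<le> y r t" using v_nonpos[OF assms] pos(2)[OF assms] unfolding v_eq[OF assms] 2
    by (simp add: divide_le_cancel)
  show "us r t = u r t * (\<zeta> r t - y r t) / b r t" by (simp add: us_def 1 algebra_simps)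
  show "P r t = u r t * (\<zeta> r t - u r t)" by (simp add: P_def 1 algebra_simps power2_eq_square)
qed

lemma w_pos: "r \<ge> 0 \<Longrightarrow> t < 0 \<Longrightarrow> w r t > 0"
  using y_pos[of r t] u_pos[of r t] axis[of t] by (cases "r = 0") (auto simp: w_def)

text \<open>The curvature bound on the horizontal planes allows at most linear growth in
  \<open>b\<close>, which any positive multiple of \<open>b^2\<close> dominates at infinity.\<close>

lemma w_growth: assumes "r > 0" "t < 0" shows "w r t \<le> 3 + sqrt K * b r t"
proof -
  have "(y r t)\<^sup>2 \<le> (2 + sqrt K * b r t)\<^sup>2"
  proof -
    have "(2 + sqrt K * b r t)\<^sup>2 = 4 + K * (b r t)\<^sup>2 + 4 * (sqrt K * b r t)"
      using K by (simp add: power2_sum power_mult_distrib)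
    moreover have "0 \<le> sqrt K * b r t" using K pos(2)[OF assms] by simp
    ultimately show ?thesis using curv1[OF assms] by linarith
  qed
  then have "y r t \<le> 2 + sqrt K * b r t"
    by (rule power2_le_imp_le) (use K pos(2)[OF assms] in auto)
  then show ?thesis using u_le[OF assms] by (simp add: w_def)
qed

text \<open>The value \<open>sqrt (4 + al)\<close> is the equilibrium of the reaction once the
  coupling is bounded by \<open>al\<close>. Because the reaction carries \<open>1 / b^2\<close>, the
  excess decays only on the time scale \<open>b^2\<close>; this is why the singular function of time
  is multiplied by \<open>b\<close>.\<close>

lemma w_upper_aux:
  assumes al: "al \<ge> 0" "\<And>r t. r > 0 \<Longrightarrow> t < 0 \<Longrightarrow> 2 * P r t - (P r t)\<^sup>2 / (u r t)\<^sup>2 \<le> al"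
    and t1: "t1 < 0" "T0 < t1" "e > 0" "r > 0"
  shows "w r t1 \<le> sqrt (4 + al) + 1 / sqrt (2 * (t1 - T0)) * b r t1 + e * (1 + (b r t1)\<^sup>2 + 8 * (t1 - T0))"
proof -
  define a where "a = sqrt (4 + al)"
  have a: "a \<ge> 2" "a\<^sup>2 = 4 + al"
    using al real_le_rsqrt[of 2 "4 + al"] by (auto simp: a_def)
  obtain R where R: "R > 0" "\<And>r t. r \<ge> R \<Longrightarrow> T0 \<le> t \<Longrightarrow> t \<le> t1 \<Longrightarrow> b r t > (3 + sqrt K) / e + 1"
    using b_far[OF t1(1)] by blast
  obtain V where V: "V > 0" "\<And>r t. 0 \<le> r \<Longrightarrow> r \<le> R \<Longrightarrow> T0 \<le> t \<Longrightarrow> t \<le> t1 \<Longrightarrow> w r t \<le> V"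
    using bounded_rect[OF t1(1) cont_rect(4)[OF t1(1)]] by blast
  \<comment> \<open>Near the axis \<open>w\<close> is close to \<open>2 \<le> a\<close>. On the
    compact set where it exceeds \<open>a + e\<close>, \<open>b\<close> has a positive minimum, so
    there \<open>w\<close> is at most a multiple of \<open>b\<close>; this determines the starting
    time \<open>T0 + h\<close>.\<close>
  define C where "C = {p \<in> {0..R} \<times> {T0..t1}. w (fst p) (snd p) \<ge> a + e}"
  have cC: "compact C"
  proof -
    have "closed C" unfolding C_def
      by (intro continuous_on_closed_Collect_le continuous_on_const closed_Times closed_atLeastAtMost
          continuous_on_subset[OF cont_rect(4)[OF t1(1)]]) auto
    moreover have "bounded C"
      by (rule bounded_subset[OF bounded_Times[of "{0..R}" "{T0..t1}"]]) (auto simp: C_def)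
    ultimately show ?thesis by (simp add: compact_eq_bounded_closed)
  qed
  have "\<exists>N\<ge>0. \<forall>r t. 0 \<le> r \<longrightarrow> r \<le> R \<longrightarrow> T0 \<le> t \<longrightarrow> t \<le> t1 \<longrightarrow> w r t < a + e + (N + 1) * b r t \<or> (w r t < a + e)"
  proof (cases "C = {}")
    case True
    then have "w r t < a + e" if "0 \<le> r" "r \<le> R" "T0 \<le> t" "t \<le> t1" for r t
      using that by (force simp: C_def)
    then show ?thesis by (intro exI[of _ 0]) auto
  next
    case False
    have "continuous_on C (\<lambda>p. b (fst p) (snd p))"
      by (rule continuous_on_subset[OF cont_rect(1)[OF t1(1)]]) (auto simp: C_def)
    then obtain p where p: "p \<in> C" "\<And>p'. p' \<in> C \<Longrightarrow> b (fst p) (snd p) \<le> b (fst p') (snd p')"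
      using continuous_attains_inf[OF cC False] by blast
    have "fst p \<noteq> 0" using p(1) a t1 axis[of "snd p"] by (auto simp: C_def w_def)
    then have b0: "b (fst p) (snd p) > 0" using pos(2)[of "fst p" "snd p"] p(1) t1 by (auto simp: C_def)
    show ?thesis
    proof (intro exI[of _ "V / b (fst p) (snd p)"] conjI allI impI)
      show "0 \<le> V / b (fst p) (snd p)" using V b0 by simp
      fix r t assume rt: "0 \<le> r" "r \<le> R" "T0 \<le> t" "t \<le> t1"
      show "w r t < a + e + (V / b (fst p) (snd p) + 1) * b r t \<or> w r t < a + e"
      proof (rule disjCI)
        assume "\<not> w r t < a + e"
        then have "(r,t) \<in> C" using rt by (auto simp: C_def)
        then have "b (fst p) (snd p) \<le> b r t" using p(2) by fastforce
        then have "V / b (fst p) (snd p) * b (fst p) (snd p) \<le> V / b (fst p) (snd p) * b r t"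
          using V b0 by (intro mult_left_mono) auto
        then have "V \<le> V / b (fst p) (snd p) * b r t" using b0 by simp
        moreover have "w r t \<le> V" using V rt by auto
        moreover have "b r t \<ge> 0" using b_nonneg rt t1 by auto
        ultimately show "w r t < a + e + (V / b (fst p) (snd p) + 1) * b r t"
          using a t1 by (simp add: distrib_right)
      qed
    qed
  qed
  then obtain N where N: "N \<ge> 0" "\<And>r t. 0 \<le> r \<Longrightarrow> r \<le> R \<Longrightarrow> T0 \<le> t \<Longrightarrow> t \<le> t1 \<Longrightarrow>
    w r t < a + e + (N + 1) * b r t \<or> w r t < a + e" by blast
  define h where "h = min (t1 - T0) (1 / (2 * (N + 1)\<^sup>2))"
  have h: "h > 0" "T0 + h \<le> t1" using t1 N by (auto simp: h_def)
  have "2 * h \<le> 1 / (N + 1)\<^sup>2" using N by (auto simp: h_def min_def field_simps)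
  then have "sqrt (2 * h) \<le> 1 / (N + 1)" using N by (intro real_le_lsqrt) (auto simp: power_divide)
  then have hN: "N + 1 \<le> 1 / sqrt (2 * h)" using h N(1) by (simp add: field_simps)
  \<comment> \<open>The summand \<open>8 (t - T0)\<close> offsets the constant \<open>- 8\<close>
    left when the operator of the \<open>w\<close>-equation acts on \<open>b^2\<close>.\<close>
  define H where "H r t = a + 1 / sqrt (2 * (t - T0)) * b r t + e * (1 + (b r t)\<^sup>2 + 8 * (t - T0)) - w r t" for r t
  have "H r t1 > 0"
  proof (rule minimum_principle[of "T0 + h" t1 H R
      "\<lambda>r t. 1 / sqrt (2 * (t - T0)) * y r t + e * (2 * b r t * y r t) - (y2 r t + us r t)"
      "\<lambda>r t. 1 / sqrt (2 * (t - T0)) * y2 r t + e * (2 * (y r t)\<^sup>2 + 2 * b r t * y2 r t) - (y3 r t + uss r t)"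
      "\<lambda>r t. (- ((1 / sqrt (2 * (t - T0)))^3)) * b r t + 1 / sqrt (2 * (t - T0)) *
         (y2 r t + z r t * y r t / c r t + (y r t)\<^sup>2 / b r t + (2 * (u r t)\<^sup>2 - 4) / b r t)
         + e * (2 * b r t * (y2 r t + z r t * y r t / c r t + (y r t)\<^sup>2 / b r t + (2 * (u r t)\<^sup>2 - 4) / b r t) + 8)
        - (y3 r t + uss r t + z r t / c r t * (y2 r t + us r t)
     + w r t / (b r t)\<^sup>2 * (4 - (w r t)\<^sup>2 + 2 * P r t - (P r t)\<^sup>2 / (u r t)\<^sup>2))"])
    show "continuous_on ({0..} \<times> {T0 + h..t1}) (\<lambda>(r, t). H r t)"
      unfolding H_def case_prod_beta'
      by (intro continuous_intros cont_rect t1) (use h in auto)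
    show "t1 < 0" "0 \<le> r" "t1 \<le> t1" "T0 + h \<le> t1" using t1 h by auto
    have far: "H r t > 0" if "r \<ge> R" "T0 + h \<le> t" "t \<le> t1" for r t
    proof -
      have r: "r > 0" "t < 0" using that R t1 by auto
      have b: "b r t > (3 + sqrt K) / e + 1" using R(2)[of r t] that h by auto
      have K0: "(3 + sqrt K) / e \<ge> 0" "sqrt K \<ge> 0" using K t1 by auto
      have "3 + sqrt K * b r t \<le> (3 + sqrt K) * b r t" using b K0 by (simp add: distrib_right)
      also have "\<dots> \<le> (e * b r t) * b r t"
        using b K0 t1 pos(2)[OF r] by (intro mult_right_mono) (auto simp: field_simps)
      finally have "w r t \<le> e * (b r t)\<^sup>2" using w_growth[OF r] by (simp add: power2_eq_square mult.assoc)
      moreover have "1 / sqrt (2 * (t - T0)) * b r t \<ge> 0" using pos(2)[OF r] that h by simp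
      moreover have "e * (8 * (t - T0)) \<ge> 0" using that h t1 by simp
      ultimately show ?thesis using a t1 unfolding H_def by (simp add: distrib_left)
    qed
    then show "\<And>r t. r \<ge> R \<Longrightarrow> T0 + h \<le> t \<Longrightarrow> t \<le> t1 \<Longrightarrow> H r t > 0" .
    show "H r (T0 + h) > 0" if "r \<ge> 0" for r
    proof (cases "r \<ge> R")
      case False
      have b: "b r (T0 + h) \<ge> 0" using b_nonneg that h t1 by auto
      have "(N + 1) * b r (T0 + h) \<le> 1 / sqrt (2 * h) * b r (T0 + h)" using hN b by (intro mult_right_mono)
      moreover have "0 \<le> (N + 1) * b r (T0 + h)" using b N by simp
      ultimately have "w r (T0 + h) < a + e + 1 / sqrt (2 * h) * b r (T0 + h)"
        using N(2)[of r "T0 + h"] False that h by auto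
      moreover have "0 \<le> e * ((b r (T0 + h))\<^sup>2 + 8 * h)" using t1 h by simp
      ultimately show ?thesis by (simp add: H_def distrib_left)
    qed (use far[of r "T0 + h"] h in auto)
    show "H 0 t > 0" if "T0 + h \<le> t" "t \<le> t1" for t
    proof -
      have "e * (1 + 8 * (t - T0)) > 0" using t1 h that by simp
      then show ?thesis using that t1 axis[of t] a by (simp add: H_def w_def)
    qed
    fix r t :: real assume r: "r > 0" and t: "T0 + h < t" "t \<le> t1"
    then have t': "t < 0" "T0 < t" using t1 h by auto
    note rt = r t'(1)
    show "((\<lambda>r. H r t) has_real_derivative \<phi> r t * (1 / sqrt (2 * (t - T0)) * y r t + e * (2 * b r t * y r t) - (y2 r t + us r t))) (at r)"
      unfolding H_def by (rule derivative_eq_intros b_r w_r rt refl)+ (simp add: algebra_simps)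
    show "((\<lambda>r. 1 / sqrt (2 * (t - T0)) * y r t + e * (2 * b r t * y r t) - (y2 r t + us r t)) has_real_derivative
       \<phi> r t * (1 / sqrt (2 * (t - T0)) * y2 r t + e * (2 * (y r t)\<^sup>2 + 2 * b r t * y2 r t) - (y3 r t + uss r t))) (at r)"
      by (rule derivative_eq_intros b_r y_r ws_r rt refl)+ (simp add: algebra_simps power2_eq_square)
    show "(H r has_real_derivative (- ((1 / sqrt (2 * (t - T0)))^3)) * b r t + 1 / sqrt (2 * (t - T0)) *
         (y2 r t + z r t * y r t / c r t + (y r t)\<^sup>2 / b r t + (2 * (u r t)\<^sup>2 - 4) / b r t)
         + e * (2 * b r t * (y2 r t + z r t * y r t / c r t + (y r t)\<^sup>2 / b r t + (2 * (u r t)\<^sup>2 - 4) / b r t) + 8)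
        - (y3 r t + uss r t + z r t / c r t * (y2 r t + us r t)
     + w r t / (b r t)\<^sup>2 * (4 - (w r t)\<^sup>2 + 2 * P r t - (P r t)\<^sup>2 / (u r t)\<^sup>2))) (at t)"
      unfolding H_def[abs_def]
      by (rule derivative_eq_intros b_t w_t inv_sqrt_deriv rt t' refl)+ (simp add: algebra_simps)
    assume H0: "H r t = 0"
      and s0: "1 / sqrt (2 * (t - T0)) * y r t + e * (2 * b r t * y r t) - (y2 r t + us r t) = 0"
      and ss: "0 \<le> 1 / sqrt (2 * (t - T0)) * y2 r t + e * (2 * (y r t)\<^sup>2 + 2 * b r t * y2 r t) - (y3 r t + uss r t)"
      and tt: "(- ((1 / sqrt (2 * (t - T0)))^3)) * b r t + 1 / sqrt (2 * (t - T0)) *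
         (y2 r t + z r t * y r t / c r t + (y r t)\<^sup>2 / b r t + (2 * (u r t)\<^sup>2 - 4) / b r t)
         + e * (2 * b r t * (y2 r t + z r t * y r t / c r t + (y r t)\<^sup>2 / b r t + (2 * (u r t)\<^sup>2 - 4) / b r t) + 8)
        - (y3 r t + uss r t + z r t / c r t * (y2 r t + us r t)
     + w r t / (b r t)\<^sup>2 * (4 - (w r t)\<^sup>2 + 2 * P r t - (P r t)\<^sup>2 / (u r t)\<^sup>2)) \<le> 0"
    define B where "B = 1 / sqrt (2 * (t - T0))"
    have B: "B > 0" using t' by (auto simp: B_def)
    note p = pos[OF rt] y_pos[OF rt]
    have u: "u r t > 0" "u r t \<le> 1" using u_pos u_le rt by auto
    have wpos: "w r t > 0" using w_pos rt by auto
    have w: "w r t = a + B * b r t + e * (1 + (b r t)\<^sup>2 + 8 * (t - T0))" using H0 by (simp add: H_def B_def)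
    have "0 \<le> e * (1 + (b r t)\<^sup>2 + 8 * (t - T0))" using t1 t' by simp
    then have w1: "w r t \<ge> a + B * b r t" using w by simp
    have Bb: "B * b r t > 0" using B p by simp
    \<comment> \<open>Two of the three nonnegative terms of the expanded cubic are kept: the linear
      one beats the loss \<open>4 B / b\<close> from the evolution of \<open>b\<close>, the cubic
      one beats the derivative \<open>- B^3\<close> of \<open>B\<close>.\<close>
    have "w r t * (a\<^sup>2 - (w r t)\<^sup>2) \<le> - (8 * B * b r t + B^3 * (b r t)^3)"
    proof -
      have "(a + B * b r t) * ((a + B * b r t)\<^sup>2 - a\<^sup>2) \<le> w r t * ((w r t)\<^sup>2 - a\<^sup>2)"
        using w1 a Bb by (intro mult_mono diff_right_mono power_mono) (auto simp: power2_sum intro!: add_nonneg_nonneg)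
      moreover have "(a + B * b r t) * ((a + B * b r t)\<^sup>2 - a\<^sup>2) = 2 * a\<^sup>2 * (B * b r t) + 3 * a * (B * b r t)\<^sup>2 + (B * b r t)^3"
        by (simp add: power2_eq_square power3_eq_cube algebra_simps)
      moreover have "8 * (B * b r t) \<le> 2 * a\<^sup>2 * (B * b r t)" using a al Bb by (intro mult_right_mono) auto
      moreover have "0 \<le> 3 * a * (B * b r t)\<^sup>2" using a by simp
      moreover have "w r t * (a\<^sup>2 - (w r t)\<^sup>2) = - (w r t * ((w r t)\<^sup>2 - a\<^sup>2))" by (simp add: algebra_simps)
      moreover have "(B * b r t)^3 = B^3 * (b r t)^3" "8 * (B * b r t) = 8 * B * b r t" by (simp_all add: power_mult_distrib)
      moreover have "x1 \<le> - (x2 + x3)" if "x4 \<le> x5" "x4 = x6 + x7 + x3'" "x2' \<le> x6" "0 \<le> x7" "x1 = - x5" "x3' = x3" "x2' = x2"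
        for x1 x2 x3 x2' x3' x4 x5 x6 x7 :: real using that by linarith
      ultimately show ?thesis by blast
    qed
    then have "w r t / (b r t)\<^sup>2 * (a\<^sup>2 - (w r t)\<^sup>2) \<le> - (8 * B * b r t + B^3 * (b r t)^3) / (b r t)\<^sup>2"
      using p by (simp add: divide_right_mono)
    also have "\<dots> = - (8 * B / b r t) - B^3 * b r t"
      using p by (simp add: field_simps power2_eq_square power3_eq_cube)
    finally have R1: "w r t / (b r t)\<^sup>2 * (a\<^sup>2 - (w r t)\<^sup>2) \<le> - (8 * B / b r t) - B^3 * b r t" .
    have R2: "w r t / (b r t)\<^sup>2 * (4 - (w r t)\<^sup>2 + 2 * P r t - (P r t)\<^sup>2 / (u r t)\<^sup>2) \<le> w r t / (b r t)\<^sup>2 * (a\<^sup>2 - (w r t)\<^sup>2)"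
      using al(2)[OF rt] a wpos by (intro mult_left_mono) auto
    define bt where "bt = y2 r t + z r t * y r t / c r t + (y r t)\<^sup>2 / b r t + (2 * (u r t)\<^sup>2 - 4) / b r t"
    define zc where "zc = z r t / c r t"
    have bt: "bt = y2 r t + zc * y r t + (y r t)\<^sup>2 / b r t + (2 * (u r t)\<^sup>2 - 4) / b r t"
      by (simp add: bt_def zc_def)
    have q1: "2 * b r t * bt + 8 - (2 * (y r t)\<^sup>2 + 2 * b r t * y2 r t) - zc * (2 * b r t * y r t) = 4 * (u r t)\<^sup>2"
      using p unfolding bt by (simp add: field_simps power2_eq_square)
    have q2: "bt - y2 r t - zc * y r t = (y r t)\<^sup>2 / b r t + (2 * (u r t)\<^sup>2 - 4) / b r t" unfolding bt by simp
    have "- 4 / b r t \<le> (y r t)\<^sup>2 / b r t + (2 * (u r t)\<^sup>2 - 4) / b r t"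
      unfolding add_divide_distrib[symmetric] using p by (intro divide_right_mono) auto
    then have "B * (- 4 / b r t) \<le> B * (bt - y2 r t - zc * y r t)" unfolding q2 using B by (intro mult_left_mono) auto
    then have q3: "B * bt - B * y2 r t - zc * (B * y r t) \<ge> - (4 * B / b r t)" by (simp add: algebra_simps)
    have q4: "e * (2 * b r t * bt + 8) - e * (2 * (y r t)\<^sup>2 + 2 * b r t * y2 r t) - zc * (e * (2 * b r t * y r t)) \<ge> 0"
    proof -
      have "0 \<le> e * (2 * b r t * bt + 8 - (2 * (y r t)\<^sup>2 + 2 * b r t * y2 r t) - zc * (2 * b r t * y r t))"
        unfolding q1 using t1 by simp
      then show ?thesis by (simp add: algebra_simps)
    qed
    have s1: "zc * (y2 r t + us r t) = zc * (B * y r t) + zc * (e * (2 * b r t * y r t))"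
      using s0 unfolding B_def[symmetric] by (simp add: distrib_left[symmetric])
    have "B / b r t > 0" using B p by simp
    then have R3: "8 * B / b r t > 4 * B / b r t" by simp
    have lin: False if "x1 \<le> - x8 - x3" "x2 \<le> x1" "p1 - p2 - p3 \<ge> - x4" "q1 - q2 - q3 \<ge> 0" "d = p3 + q3"
      "- x3 + p1 + q1 - (h + d + x2) \<le> 0" "0 \<le> p2 + q2 - h" "x4 < x8" for x1 x2 x3 x4 x8 p1 p2 p3 q1 q2 q3 d h :: real
      using that by linarith
    show False
      by (rule lin[OF R1 R2 q3 q4 s1 tt[folded B_def, folded bt_def, folded zc_def, unfolded mult_minus_left] ss[folded B_def] R3])
  qed
  then show ?thesis by (simp add: H_def a_def)
qed

text \<open>For a tolerance \<open>x\<close> the start \<open>T0\<close> is chosen with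
  \<open>b / sqrt (2 (t - T0)) = x / 2\<close>, and \<open>e\<close> so that the remaining term is
  \<open>x / 2\<close>.\<close>

lemma w_upper:
  assumes al: "al \<ge> 0" "\<And>r t. r > 0 \<Longrightarrow> t < 0 \<Longrightarrow> 2 * P r t - (P r t)\<^sup>2 / (u r t)\<^sup>2 \<le> al"
    and rt: "r > 0" "t < 0"
  shows "w r t \<le> sqrt (4 + al)"
proof (rule field_le_epsilon)
  fix x :: real assume x: "x > 0"
  have b: "b r t > 0" using pos rt by auto
  define T0 where "T0 = t - 2 * (b r t / x)\<^sup>2"
  have T0: "T0 < t" using x b by (simp add: T0_def)
  define E where "E = 1 + (b r t)\<^sup>2 + 8 * (t - T0)"
  have E: "E > 0" using T0 by (simp add: E_def add_pos_nonneg)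
  have "2 * (t - T0) = (2 * b r t / x)\<^sup>2" by (simp add: T0_def power_divide power_mult_distrib)
  then have sq: "sqrt (2 * (t - T0)) = 2 * b r t / x" using x b by simp
  have "w r t \<le> sqrt (4 + al) + 1 / (2 * b r t / x) * b r t + x / (2 * E) * E"
    using w_upper_aux[OF al rt(2) T0 _ rt(1), of "x / (2 * E)"] x E unfolding sq E_def by simp
  also have "\<dots> = sqrt (4 + al) + x" using x b E by simp
  finally show "w r t \<le> sqrt (4 + al) + x" .
qed

text \<open>The reaction equals \<open>- 2 w^2 P - 2 u^2 (2 P - (w^2 - 4))\<close>, negative for
  \<open>P > al / 2\<close>. It is uniformly so where \<open>P\<close> exceeds a tolerance:
  \<open>P \<le> u y \<le> u W\<close> keeps \<open>u\<close> away from zero there, and the bound on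
  \<open>c\<close> then bounds \<open>b\<close>. The excess decays exponentially, over an
  arbitrarily long past.\<close>

lemma P_upper:
  assumes al: "al \<ge> 0" "\<And>r t. r > 0 \<Longrightarrow> t < 0 \<Longrightarrow> (w r t)\<^sup>2 \<le> 4 + al"
    and rt: "r > 0" "t1 < 0"
  shows "P r t1 \<le> al / 2"
proof (rule field_le_epsilon)
  fix x :: real assume x: "x > 0"
  define W where "W = sqrt (4 + al)"
  have W: "W > 0" using al by (simp add: W_def)
  have wW: "w r t \<le> W" if "r > 0" "t < 0" for r t
    unfolding W_def by (rule real_le_rsqrt) (use al that in auto)
  define e where "e = x / 2"
  have e: "e > 0" using x by (simp add: e_def)
  have Pu: "P r t \<le> u r t * W" "P r t \<le> W" if "r > 0" "t < 0" for r t
  proof -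
    have y: "y r t \<le> W" using wW[OF that] u_pos[of r t] that by (simp add: w_def)
    have u: "u r t > 0" "u r t \<le> 1" using u_pos u_le that by auto
    have "P r t \<le> u r t * y r t"
      using zeta[OF that] u by (simp add: algebra_simps) (smt (verit) mult_left_mono mult_nonneg_nonneg)
    also have "\<dots> \<le> u r t * W" using y u by simp
    finally show "P r t \<le> u r t * W" .
    also have "\<dots> \<le> 1 * W" using u W by (intro mult_right_mono) auto
    finally show "P r t \<le> W" by simp
  qed
  \<comment> \<open>\<open>B\<close> bounds \<open>b\<close> where \<open>P \<ge> e\<close>, because
    \<open>u \<ge> e / W\<close> there; \<open>g\<close> is the decay rate which these two bounds
    guarantee.\<close>
  define B where "B = M * W / e"
  have B: "B > 0" using M_pos W e by (simp add: B_def)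
  define g where "g = 2 * (e / W)\<^sup>2 / B\<^sup>2"
  have g: "g > 0" using e W B by (simp add: g_def)
  \<comment> \<open>With this start \<open>g (t1 - T0) = W / e\<close>, and
    \<open>exp x \<ge> x\<close> makes \<open>W exp (- g (t1 - T0)) \<le> e\<close>.\<close>
  define T0 where "T0 = t1 - W / (e * g)"
  have T0: "T0 < t1" using W e g by (simp add: T0_def)
  obtain R where R: "R > 0" "\<And>r t. r \<ge> R \<Longrightarrow> T0 \<le> t \<Longrightarrow> t \<le> t1 \<Longrightarrow> b r t > B"
    using b_far[OF rt(2)] by blast
  define H where "H r t = al / 2 + e + W * exp (- g * (t - T0)) - P r t" for r t
  have "H r t1 > 0"
  proof (rule minimum_principle[of T0 t1 H R "\<lambda>r t. - (z2 r t - 2 * u r t * us r t)"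
      "\<lambda>r t. - (z3 r t - 2 * (us r t)\<^sup>2 - 2 * u r t * uss r t)"
      "\<lambda>r t. - g * (W * exp (- g * (t - T0))) - (z3 r t - 2 * (us r t)\<^sup>2 - 2 * u r t * uss r t
       + (2 * y r t / b r t - z r t / c r t) * (z2 r t - 2 * u r t * us r t)
     + 1 / (b r t)\<^sup>2 * (- 2 * ((w r t)\<^sup>2 + 2 * (u r t)\<^sup>2) * P r t + 2 * (u r t)\<^sup>2 * ((w r t)\<^sup>2 - 4)))"])
    show "continuous_on ({0..} \<times> {T0..t1}) (\<lambda>(r, t). H r t)"
      unfolding H_def case_prod_beta' by (intro continuous_intros cont_rect rt)
    show "t1 < 0" "0 \<le> r" "t1 \<le> t1" "T0 \<le> t1" using rt T0 by auto
    have P0: "P 0 t = 0" if "t < 0" for t using axis that by (simp add: P_def)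
    show "H r T0 > 0" if "r \<ge> 0" for r
      using Pu[of r T0] P0[of T0] that T0 rt W al e by (cases "r = 0") (auto simp: H_def)
    show "H 0 t > 0" if "T0 \<le> t" "t \<le> t1" for t
      using P0[of t] that rt al e W by (auto simp: H_def intro!: add_nonneg_pos)
    have small: "P r t \<ge> e \<Longrightarrow> u r t \<ge> e / W \<and> b r t \<le> B" if "r > 0" "t < 0" for r t
    proof -
      assume "P r t \<ge> e"
      then have "u r t \<ge> e / W" using Pu[OF that] W by (simp add: field_simps)
      moreover from this have "b r t \<le> B" using u_small[OF that, of "e / W"] e W by (simp add: B_def)
      ultimately show ?thesis by simp
    qed
    show "H r t > 0" if "r \<ge> R" "T0 \<le> t" "t \<le> t1" for r t
    proof -
      have "P r t < e" using small[of r t] R(2)[OF that] R(1) that rt by force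
      moreover have "W * exp (- g * (t - T0)) > 0" using W by simp
      ultimately show ?thesis using al by (simp add: H_def)
    qed
    fix r t :: real assume r: "r > 0" and t: "T0 < t" "t \<le> t1"
    then have t': "t < 0" using rt by auto
    note rt' = r t'
    show "((\<lambda>r. H r t) has_real_derivative \<phi> r t * - (z2 r t - 2 * u r t * us r t)) (at r)"
      unfolding H_def by (rule derivative_eq_intros P_r rt' refl)+ (simp add: algebra_simps)
    show "((\<lambda>r. - (z2 r t - 2 * u r t * us r t)) has_real_derivative
       \<phi> r t * - (z3 r t - 2 * (us r t)\<^sup>2 - 2 * u r t * uss r t)) (at r)"
      by (rule DERIV_cong[OF DERIV_minus[OF Ps_r[OF rt']]]) (simp only: mult_minus_right)
    show "(H r has_real_derivative - g * (W * exp (- g * (t - T0))) - (z3 r t - 2 * (us r t)\<^sup>2 - 2 * u r t * uss r t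
       + (2 * y r t / b r t - z r t / c r t) * (z2 r t - 2 * u r t * us r t)
     + 1 / (b r t)\<^sup>2 * (- 2 * ((w r t)\<^sup>2 + 2 * (u r t)\<^sup>2) * P r t + 2 * (u r t)\<^sup>2 * ((w r t)\<^sup>2 - 4)))) (at t)"
      unfolding H_def[abs_def]
      by (rule derivative_eq_intros P_t rt' refl)+ (simp add: algebra_simps)
    assume H0: "H r t = 0" and s0: "- (z2 r t - 2 * u r t * us r t) = 0"
      and ss: "0 \<le> - (z3 r t - 2 * (us r t)\<^sup>2 - 2 * u r t * uss r t)"
      and tt: "- g * (W * exp (- g * (t - T0))) - (z3 r t - 2 * (us r t)\<^sup>2 - 2 * u r t * uss r t
       + (2 * y r t / b r t - z r t / c r t) * (z2 r t - 2 * u r t * us r t)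
     + 1 / (b r t)\<^sup>2 * (- 2 * ((w r t)\<^sup>2 + 2 * (u r t)\<^sup>2) * P r t + 2 * (u r t)\<^sup>2 * ((w r t)\<^sup>2 - 4))) \<le> 0"
    define D where "D = W * exp (- g * (t - T0))"
    have D: "D > 0" using W by (simp add: D_def)
    have P: "P r t = al / 2 + e + D" using H0 by (simp add: H_def D_def)
    then have "P r t \<ge> e" using al D by simp
    from small[OF rt' this] have ub: "u r t \<ge> e / W" "b r t \<le> B" by auto
    have b: "b r t > 0" using pos rt' by auto
    have "2 * ((w r t)\<^sup>2 + 2 * (u r t)\<^sup>2) * P r t - 2 * (u r t)\<^sup>2 * ((w r t)\<^sup>2 - 4)
      = 2 * (w r t)\<^sup>2 * P r t + 2 * (u r t)\<^sup>2 * (2 * P r t - ((w r t)\<^sup>2 - 4))" by (simp add: algebra_simps)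
    moreover have "0 \<le> 2 * (w r t)\<^sup>2 * P r t" using P D e al by simp
    moreover have "2 * (e / W)\<^sup>2 * D < 2 * (u r t)\<^sup>2 * (2 * P r t - ((w r t)\<^sup>2 - 4))"
    proof -
      have "2 * (e / W)\<^sup>2 * D < 2 * (e / W)\<^sup>2 * (2 * P r t - ((w r t)\<^sup>2 - 4))"
        using P al(2)[OF rt'] e W D by (intro mult_strict_left_mono) auto
      also have "\<dots> \<le> 2 * (u r t)\<^sup>2 * (2 * P r t - ((w r t)\<^sup>2 - 4))"
        using P al(2)[OF rt'] e W D ub by (intro mult_right_mono mult_left_mono power_mono) auto
      finally show ?thesis .
    qed
    ultimately have "2 * (e / W)\<^sup>2 * D < 2 * ((w r t)\<^sup>2 + 2 * (u r t)\<^sup>2) * P r t - 2 * (u r t)\<^sup>2 * ((w r t)\<^sup>2 - 4)"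
      by linarith
    then have "2 * (e / W)\<^sup>2 * D / (b r t)\<^sup>2 < (2 * ((w r t)\<^sup>2 + 2 * (u r t)\<^sup>2) * P r t - 2 * (u r t)\<^sup>2 * ((w r t)\<^sup>2 - 4)) / (b r t)\<^sup>2"
      using b by (simp add: divide_strict_right_mono)
    moreover have "g * D \<le> 2 * (e / W)\<^sup>2 * D / (b r t)\<^sup>2"
    proof -
      have "2 * (e / W)\<^sup>2 * D / B\<^sup>2 \<le> 2 * (e / W)\<^sup>2 * D / (b r t)\<^sup>2"
        using D b ub B by (intro divide_left_mono mult_pos_pos power_mono) auto
      then show ?thesis by (simp add: g_def)
    qed
    moreover have "1 / (b r t)\<^sup>2 * (- 2 * ((w r t)\<^sup>2 + 2 * (u r t)\<^sup>2) * P r t + 2 * (u r t)\<^sup>2 * ((w r t)\<^sup>2 - 4))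
      = - ((2 * ((w r t)\<^sup>2 + 2 * (u r t)\<^sup>2) * P r t - 2 * (u r t)\<^sup>2 * ((w r t)\<^sup>2 - 4)) / (b r t)\<^sup>2)"
      by (simp add: divide_inverse algebra_simps)
    moreover have "z2 r t - 2 * u r t * us r t = 0" using s0 by simp
    ultimately show False using tt ss unfolding D_def[symmetric] by simp
  qed
  moreover have "W * exp (- g * (t1 - T0)) \<le> e"
  proof -
    have "W / e \<le> 1 + W / e" by simp
    also have "\<dots> \<le> exp (W / e)" by (rule exp_ge_add_one_self)
    also have "W / e = g * (t1 - T0)" using g by (simp add: T0_def)
    finally have "W / e \<le> exp (g * (t1 - T0))" using e W g by (simp add: T0_def)
    then have "W \<le> e * exp (g * (t1 - T0))" using e by (simp add: field_simps)
    moreover have "W * exp (- g * (t1 - T0)) = W / exp (g * (t1 - T0))"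
      by (simp only: mult_minus_left exp_minus divide_inverse)
    ultimately show ?thesis by (simp add: pos_divide_le_eq)
  qed
  ultimately show "P r t1 \<le> al / 2 + x" by (simp add: H_def e_def)
qed

text \<open>The two preceding estimates improve each other strictly unless \<open>w \<le> 2\<close> and \<open>P \<le> 0\<close>.\<close>

lemma upper_bounds:
  assumes "r > 0" "t < 0"
  shows "w r t \<le> 2" "P r t \<le> 0"
proof -
  \<comment> \<open>The unconditional bound on the coupling term that starts the iteration: it
    yields \<open>w^2 \<le> 5\<close>.\<close>
  have sq_le: "2 * p - p\<^sup>2 / v\<^sup>2 \<le> 1" if "0 < v" "v \<le> 1" for p v :: real
  proof -
    have "p\<^sup>2 * v\<^sup>2 \<le> p\<^sup>2 * 1" using that by (intro mult_left_mono) (auto simp: power_le_one)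
    then have "p\<^sup>2 \<le> p\<^sup>2 / v\<^sup>2" using that by (simp add: field_simps)
    then show ?thesis using zero_le_power2[of "p - 1"] by (simp add: power2_eq_square algebra_simps)
  qed
  define S where "S = (\<lambda>p. (w (fst p) (snd p))\<^sup>2) ` ({0<..} \<times> {..<0})"
  have ne: "S \<noteq> {}" by (auto simp: S_def)
  have "w r t \<le> sqrt (4 + 1)" if "r > 0" "t < 0" for r t
    by (rule w_upper) (use that sq_le u_pos u_le in auto)
  then have "(w r t)\<^sup>2 \<le> 5" if "r > 0" "t < 0" for r t
    using that w_pos[of r t] power_mono[of "w r t" "sqrt 5" 2] by fastforce
  then have bdd: "bdd_above S" by (auto simp: S_def bdd_above_def)
  have leS: "(w r t)\<^sup>2 \<le> Sup S" if "r > 0" "t < 0" for r t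
    by (rule cSup_upper[OF _ bdd]) (use that in \<open>auto simp: S_def intro!: image_eqI[of _ _ "(r,t)"]\<close>)
  define al where "al = max 0 (Sup S - 4)"
  have P: "P r t \<le> al / 2" if "r > 0" "t < 0" for r t
  proof (rule P_upper[OF _ _ that])
    show "(w r t)\<^sup>2 \<le> 4 + al" if "r > 0" "t < 0" for r t using leS[OF that] by (simp add: al_def)
  qed (simp add: al_def)
  have S5: "Sup S \<le> 5" using \<open>\<And>r t. _ \<Longrightarrow> _ \<Longrightarrow> (w r t)\<^sup>2 \<le> 5\<close> by (intro cSup_least[OF ne]) (auto simp: S_def)
  then have al1: "0 \<le> al" "al \<le> 1" by (auto simp: al_def)
  \<comment> \<open>On \<open>P \<le> al / 2 \<le> 1/2\<close> the function \<open>2 P - P^2\<close>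
    is increasing, so the coupling is at most its value at \<open>al / 2\<close>, which is
    \<open>al - al^2 / 4\<close>.\<close>
  have "2 * P r t - (P r t)\<^sup>2 / (u r t)\<^sup>2 \<le> al - al\<^sup>2 / 4" if "r > 0" "t < 0" for r t
  proof -
    have u: "0 < u r t" "u r t \<le> 1" using u_pos u_le that by auto
    have "(P r t)\<^sup>2 * (u r t)\<^sup>2 \<le> (P r t)\<^sup>2 * 1" using u by (intro mult_left_mono) (auto simp: power_le_one)
    then have "(P r t)\<^sup>2 \<le> (P r t)\<^sup>2 / (u r t)\<^sup>2" using u by (simp add: field_simps)
    moreover have "0 \<le> (al / 2 - P r t) * (2 - al / 2 - P r t)" using P[OF that] al1 by (intro mult_nonneg_nonneg) auto
    ultimately show ?thesis by (simp add: power2_eq_square algebra_simps)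
  qed
  moreover have "al * al \<le> 1 * al" using al1 by (intro mult_right_mono) auto
  then have al4: "al - al\<^sup>2 / 4 \<ge> 0" using al1 by (simp add: power2_eq_square)
  ultimately have w: "w r t \<le> sqrt (4 + (al - al\<^sup>2 / 4))" if "r > 0" "t < 0" for r t
    using w_upper[of "al - al\<^sup>2 / 4" r t] that by blast
  have "(w r t)\<^sup>2 \<le> 4 + (al - al\<^sup>2 / 4)" if "r > 0" "t < 0" for r t
    using power_mono[OF w[OF that], of 2] w_pos[of r t] al4 that by simp
  then have "Sup S \<le> 4 + (al - al\<^sup>2 / 4)" by (intro cSup_least[OF ne]) (auto simp: S_def)
  \<comment> \<open>The supremum itself obeys the improved bound, and
    \<open>al \<le> al - al^2 / 4\<close> leaves only \<open>al = 0\<close>.\<close>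
  then have "al \<le> al - al\<^sup>2 / 4 \<or> al = 0" by (auto simp: al_def max_def)
  then have "al = 0" by auto
  then show "w r t \<le> 2" "P r t \<le> 0" using w[OF assms] P[OF assms] by auto
qed

end

section \<open>Lower barriers\<close>

text \<open>The balance at a contact point: drift terms cancel because the spatial derivative
  vanishes, the second-order part \<open>A - x2 + Q\<close> is nonnegative, and the reaction
  \<open>X \<ge> 4 k\<close> exceeds the cost of at most \<open>2 k\<close> caused by the motion of
  the barrier.\<close>

lemma touching_contradiction_w:
  fixes A zy Rw x1 x2 x3 uk Q X q X1 X2 X3 k :: real
  assumes "A + zy + Rw - x1 - uk \<le> 0" "0 \<le> A - x2 + Q" "zy = q * X3"
    "Rw - q * (X1 - X2 - X3) - Q = X" "4 * k \<le> X" "uk \<le> 2 * k" "k > 0" "x1 = q * X1" "x2 = q * X2"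
  shows False
proof -
  have "Rw - (x1 - x2 - zy) - Q = X" unfolding assms(3,8,9) assms(4)[symmetric] by (simp add: algebra_simps)
  then show False using assms(1,2,5,6,7) by linarith
qed

lemma touching_contradiction_P:
  fixes A zy Rw x1 x2 x3 uk Q X q X1 X2 X3 k :: real
  assumes "A + zy + Rw + x1 - uk \<le> 0" "0 \<le> A + x2 - Q" "zy = - (q * X3)"
    "Rw + q * (X1 - X2 - X3) + Q = X" "4 * k \<le> X" "uk \<le> 2 * k" "k > 0" "x1 = q * X1" "x2 = q * X2"
  shows False
proof -
  have "Rw + (x1 - x2 + zy) + Q = X" unfolding assms(3,8,9) assms(4)[symmetric] by (simp add: algebra_simps)
  then show False using assms(1,2,5,6,7) by linarith
qed

context berger_pde
begin

text \<open>
  Both barriers are moved together: \<open>\<kappa>\<close> grows so slowly from \<open>1/2\<close>, where they hold trivially, to \<open>Km\<close> that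
  its time derivative is absorbed by the reaction terms, which are bounded below where \<open>u\<close> is.
\<close>

lemma lower_barrier:
  assumes Km: "Km \<ge> 1/2" and t1: "t1 < 0" and r: "r \<ge> 0"
  shows "w r t1 > 2 * Km * u r t1 / (1 + Km * u r t1) \<and> P r t1 > - (2 * u r t1 / (1 + Km * u r t1))"
proof -
  obtain X where X: "X \<ge> 1" "\<And>x. x \<ge> X \<Longrightarrow> f x \<ge> 2 * Km" using f_large by blast
  \<comment> \<open>Below this threshold both barriers hold without any evolution argument:
    \<open>1 / X\<close> makes \<open>w > 2 Km u\<close>, and \<open>1 / (1 + Km)\<close> gives
    \<open>u (1 + \<kappa> u) < 2\<close>, whence \<open>P \<ge> - u^2\<close> suffices.\<close>
  define u1 where "u1 = min (1 / X) (1 / (1 + Km))"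
  have u1: "0 < u1" "u1 \<le> 1" using X Km by (auto simp: u1_def min_le_iff_disj)
  obtain d0 where d0: "d0 > 0" "\<And>x. x \<ge> 1 \<Longrightarrow> f x \<ge> d0"
    using positive_lower_bound[OF f_cont f_pos f_lim] by blast
  define d where "d = min (d0 * u1) 1"
  have d: "0 < d" "d \<le> 1" using d0 u1 by (auto simp: d_def)
  have yd: "y r t \<ge> d" if "r > 0" "t < 0" "u r t \<ge> u1" for r t
  proof -
    have u: "u r t > 0" "u r t \<le> 1" using u_pos u_le that by auto
    have "f (1 / u r t) \<ge> d0" using d0(2)[of "1 / u r t"] u that u1 by (auto simp: frac_le)
    then have "d0 * u1 \<le> u r t * f (1 / u r t)"
      using that u u1 d0 by (subst mult.commute[of d0]) (intro mult_mono, auto)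
    then show ?thesis using y_ge[OF that(1,2)] by (auto simp: d_def)
  qed
  have ysmall: "w r t > 2 * Km * u r t" if "r > 0" "t < 0" "u r t < u1" for r t
  proof -
    have u: "u r t > 0" "u r t \<le> 1" using u_pos u_le that by auto
    have "X \<le> 1 / u r t" using that u X by (auto simp: u1_def field_simps)
    then have "u r t * (2 * Km) \<le> u r t * f (1 / u r t)" using X u by (intro mult_left_mono) auto
    also have "\<dots> \<le> y r t" by (rule y_ge[OF that(1,2)])
    finally have "u r t * (2 * Km) \<le> y r t" .
    moreover have "2 * Km * u r t = u r t * (2 * Km)" by simp
    ultimately show ?thesis using u(1) unfolding w_def by linarith
  qed
  \<comment> \<open>A common lower bound for \<open>u\<close> and \<open>e\<close> in the region
    \<open>u \<ge> u1\<close>.\<close>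
  define l where "l = min u1 (2 / (1 + Km))"
  have l: "0 < l" "l \<le> u1" "l \<le> 2 / (1 + Km)" "l \<le> 1" using u1 Km by (auto simp: l_def)
  define B where "B = M / u1"
  have B: "B > 0" using M_pos u1 by (simp add: B_def)
  \<comment> \<open>\<open>4 g = (l^2 / 2) (l d^2 / 9)\<close> is what the lower bounds of
    \<open>2 - e\<close> and of \<open>barrier_reaction_w\<close> multiply to; it also lies below
    the bound \<open>l^2 d^2 / 4\<close> for the other barrier.\<close>
  define g where "g = l^3 * d\<^sup>2 / 72"
  have g: "g > 0" using l d by (simp add: g_def)
  define k where "k = g / B\<^sup>2"
  have k: "k > 0" using g B by (simp add: k_def)
  \<comment> \<open>The time at which \<open>\<kappa>\<close>, growing at speed \<open>k\<close> and
    equal to \<open>Km\<close> at \<open>t1\<close>, has the value \<open>1/2\<close>. Such a time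
    exists because the solution is ancient.\<close>
  define T0 where "T0 = t1 - (Km - 1/2) / k"
  define \<kappa> where "\<kappa> t = 1/2 + k * (t - T0)" for t
  have T0: "T0 \<le> t1" using Km k by (simp add: T0_def)
  have kap: "1/2 \<le> \<kappa> t" "\<kappa> t \<le> Km" if "T0 \<le> t" "t \<le> t1" for t
  proof -
    have "k * (t - T0) \<le> k * (t1 - T0)" using that k by simp
    also have "\<dots> = Km - 1/2" using k by (simp add: T0_def)
    finally show "\<kappa> t \<le> Km" by (simp add: \<kappa>_def)
    show "1/2 \<le> \<kappa> t" using that k by (simp add: \<kappa>_def)
  qed
  have kap1: "\<kappa> t1 = Km" using k by (simp add: \<kappa>_def T0_def)
  have kap0: "\<kappa> T0 = 1/2" by (simp add: \<kappa>_def)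
  define D where "D r t = 1 + \<kappa> t * u r t" for r t
  have Dpos: "D r t > 1" if "r \<ge> 0" "T0 \<le> t" "t \<le> t1" for r t
    using u_pos[of r t] kap[of t] that t1 by (simp add: D_def)
  define F where "F r t = w r t - 2 * \<kappa> t * u r t / D r t" for r t
  define G where "G r t = P r t + 2 * u r t / D r t" for r t
  \<comment> \<open>At the first zero of the minimum one barrier is touched while the other still
    holds. The contact with the barrier for \<open>w\<close> uses \<open>P \<ge> - u e\<close>, that
    for \<open>P\<close> uses \<open>w \<ge> 2 - e\<close>.\<close>
  define H where "H r t = min (F r t) (G r t)" for r t
  have Hpos: "H r t > 0" if r: "r > 0" and t: "T0 \<le> t" "t \<le> t1" and a: "w r t > 2 * \<kappa> t * u r t / D r t" "u r t * D r t < 2" for r t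
  proof -
    have u: "u r t > 0" using u_pos r t t1 by auto
    have Dp: "D r t > 1" using Dpos r t by auto
    have "u r t < 2 / D r t" using a Dp by (simp add: field_simps)
    then have "u r t * u r t < u r t * (2 / D r t)" using u by (rule mult_strict_left_mono)
    then have "G r t > 0" using z_ge[of r t] r t t1 by (simp add: G_def P_def power2_eq_square ac_simps)
    then show ?thesis using a by (simp add: H_def F_def)
  qed
  have far: "H r t > 0" if r: "r > 0" and t: "T0 \<le> t" "t \<le> t1" "u r t < u1" for r t
  proof (rule Hpos[OF r t(1,2)])
    have u: "u r t > 0" using u_pos r t t1 by auto
    have "2 * \<kappa> t * u r t / D r t \<le> 2 * \<kappa> t * u r t"
      using Dpos[of r t] r t u kap[OF t(1,2)] by (simp add: divide_le_eq_1 field_simps)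
    also have "\<dots> \<le> 2 * Km * u r t" using kap[OF t(1,2)] u by simp
    also have "\<dots> < w r t" using ysmall r t t1 by auto
    finally show "2 * \<kappa> t * u r t / D r t < w r t" .
    have "u r t < 1 / (1 + Km)" using t by (simp add: u1_def)
    then have uu: "u r t * (1 + Km) < 1" using Km by (simp add: field_simps)
    have "u r t \<le> 1" using u_le r t t1 by auto
    then have "\<kappa> t * u r t \<le> Km * 1" using kap[OF t(1,2)] u by (intro mult_mono) auto
    then have "u r t * D r t \<le> u r t * (1 + Km)" using u by (simp add: D_def)
    with uu show "u r t * D r t < 2" by simp
  qed
  obtain R where R: "R > 0" "\<And>r t. r \<ge> R \<Longrightarrow> T0 \<le> t \<Longrightarrow> t \<le> t1 \<Longrightarrow> b r t > B"
    using b_far[OF t1] by blast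
  have "H r t1 > 0"
  proof (rule first_touching[of T0 t1 H R])
    have Dc: "continuous_on ({0..} \<times> {T0..t1}) (\<lambda>p. D (fst p) (snd p))"
      unfolding D_def \<kappa>_def by (intro continuous_intros cont_rect t1)
    show "continuous_on ({0..} \<times> {T0..t1}) (\<lambda>(r, t). H r t)"
      unfolding H_def F_def G_def case_prod_beta' \<kappa>_def
      by (intro continuous_intros cont_rect t1 Dc ballI) (use Dpos in force)+
    show "0 \<le> r" "t1 \<le> t1" "T0 \<le> t1" using r T0 by auto
    show axisH: "H 0 t > 0" if "T0 \<le> t" "t \<le> t1" for t
    proof -
      have t: "t < 0" using that t1 by simp
      have "F 0 t > 0" "G 0 t > 0" using axis[OF t] kap[OF that]
        by (simp_all add: F_def G_def D_def w_def P_def field_simps)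
      then show ?thesis by (simp add: H_def)
    qed
    show "H r T0 > 0" if r: "r \<ge> 0" for r
    proof (cases "r = 0")
      case False
      then have r0: "r > 0" and t0: "T0 < 0" using r T0 t1 by auto
      have u: "u r T0 > 0" "u r T0 \<le> 1" using u_pos u_le r0 t0 by auto
      show ?thesis
      proof (rule Hpos[OF r0 order_refl T0])
        have "2 * \<kappa> T0 * u r T0 / D r T0 < u r T0" using u by (simp add: D_def kap0 field_simps)
        also have "\<dots> < w r T0" using y_pos[OF r0 t0] by (simp add: w_def)
        finally show "2 * \<kappa> T0 * u r T0 / D r T0 < w r T0" .
        have "u r T0 * D r T0 \<le> 1 * (3/2)" using u by (intro mult_mono) (auto simp: D_def kap0)
        then show "u r T0 * D r T0 < 2" by simp
      qed
    qed (use axisH[of T0] T0 in simp)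
    show "H r t > 0" if "r \<ge> R" "T0 \<le> t" "t \<le> t1" for r t
    proof (rule far)
      show "r > 0" "T0 \<le> t" "t \<le> t1" using that R by auto
      then show "u r t < u1" using R(2)[OF that] u_small[of r t u1] t1 u1 by (force simp: B_def)
    qed
    fix r t assume r: "r > 0" and t: "T0 < t" "t \<le> t1" and H0: "H r t = 0"
      and ge: "\<And>r'. r' \<ge> 0 \<Longrightarrow> H r' t \<ge> 0" and before: "\<And>t'. T0 \<le> t' \<Longrightarrow> t' < t \<Longrightarrow> H r t' > 0"
    have t0: "t < 0" using t t1 by simp
    note rt = r t0
    have ut: "u r t \<ge> u1" using far[of r t] r t H0 by force
    have u: "u r t > 0" "u r t \<le> 1" using u_pos u_le rt by auto
    have b: "b r t > 0" "b r t \<le> B" using pos(2)[OF rt] u_small[OF rt ut u1(1)] by (auto simp: B_def)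
    have K: "1/2 \<le> \<kappa> t" "\<kappa> t \<le> Km" using kap t by auto
    have Dp: "D r t > 1" using Dpos r t by auto
    \<comment> \<open>In terms of \<open>e\<close> the barriers are \<open>w = 2 - e\<close> and
      \<open>P = - u e\<close>, and \<open>\<kappa> u = (2 - e) / e\<close>; this removes
      \<open>\<kappa>\<close> and \<open>D\<close> from the contact identities.\<close>
    define e where "e = 2 / D r t"
    have De: "D r t = 2 / e" and e0: "e > 0" using Dp by (auto simp: e_def)
    have Ke: "\<kappa> t = (2 - e) / (e * u r t)"
    proof -
      have "1 + \<kappa> t * u r t = 2 / e" using De by (simp add: D_def)
      then show ?thesis using e0 u by (simp add: field_simps)
    qed
    have el: "l \<le> e"
    proof -
      have "\<kappa> t * u r t \<le> Km * 1" using K u by (intro mult_mono) auto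
      then have "2 / (1 + Km) \<le> 2 / D r t" using Dp Km by (intro divide_left_mono) (auto simp: D_def)
      then show ?thesis using l by (simp add: e_def)
    qed
    have lu: "l \<le> u r t" using l ut by simp
    have Ph: "2 * \<kappa> t * u r t / D r t = 2 - e" and Th: "2 * u r t / D r t = u r t * e"
      unfolding De Ke using e0 u by simp_all
    have Fge: "F r' t \<ge> 0" and Gge: "G r' t \<ge> 0" if "r' > 0" for r'
      using ge[of r'] that by (auto simp: H_def)
    have wge: "w r t \<ge> 2 - e" using Fge[OF r] by (simp add: F_def Ph)
    have Pge: "P r t \<ge> - (u r t * e)" using Gge[OF r] by (simp add: G_def Th)
    note z = zeta[OF rt]
    have ze: "u r t - \<zeta> r t \<le> e"
    proof -
      have "u r t * (u r t - \<zeta> r t) \<le> u r t * e" using Pge unfolding z(6) by (simp add: algebra_simps)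
      then show ?thesis using u by simp
    qed
    have zu: "\<zeta> r t \<le> u r t"
      using upper_bounds(2)[OF rt] u unfolding z(6) by (simp add: mult_le_0_iff)
    have Dr: "((\<lambda>r. D r t) has_real_derivative \<phi> r t * (\<kappa> t * us r t)) (at r)" if "r > 0" for r
      unfolding D_def by (rule derivative_eq_intros u_r that t0 refl)+ simp
    have Dt: "(D r has_real_derivative k * u r t + \<kappa> t * (uss r t + 3 * y r t / b r t * us r t + 4 * u r t * (1 - (u r t)\<^sup>2) / (b r t)\<^sup>2)) (at t)"
      unfolding D_def[abs_def] \<kappa>_def by (rule derivative_eq_intros u_t rt refl)+ simp
    have kt: "(\<kappa> has_real_derivative k) (at t)"
      unfolding \<kappa>_def[abs_def] by (rule derivative_eq_intros refl)+ simp
    have Dnz: "D r t \<noteq> 0" if "r > 0" for r using Dpos[of r t] that t by force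
    have Dnz2: "(D r t)\<^sup>2 \<noteq> 0" using Dnz[OF r] by simp
    define ut where "ut = uss r t + 3 * y r t / b r t * us r t + 4 * u r t * (1 - (u r t)\<^sup>2) / (b r t)\<^sup>2"
    have Du: "((\<lambda>t. 2 * u r t / D r t) has_real_derivative 2 * ut / (D r t)\<^sup>2 - 2 * (u r t)\<^sup>2 * k / (D r t)\<^sup>2) (at t)"
    proof -
      have "(2 * ut * D r t - 2 * u r t * (k * u r t + \<kappa> t * ut)) / (D r t * D r t)
         = 2 * ut / (D r t)\<^sup>2 - 2 * (u r t)\<^sup>2 * k / (D r t)\<^sup>2"
        unfolding diff_divide_distrib[symmetric] power2_eq_square[of "D r t"] by (simp add: D_def algebra_simps power2_eq_square)
      then show ?thesis
        using DERIV_divide[OF DERIV_cmult[OF u_t[OF rt, folded ut_def], of 2] Dt[folded ut_def] Dnz[OF r]] by simp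
    qed
    have Dku: "((\<lambda>t. 2 * \<kappa> t * u r t / D r t) has_real_derivative 2 * \<kappa> t * ut / (D r t)\<^sup>2 + 2 * u r t * k / (D r t)\<^sup>2) (at t)"
    proof -
      have "((2 * k * u r t + ut * (2 * \<kappa> t)) * D r t - 2 * \<kappa> t * u r t * (k * u r t + \<kappa> t * ut)) / (D r t * D r t)
         = 2 * \<kappa> t * ut / (D r t)\<^sup>2 + 2 * u r t * k / (D r t)\<^sup>2"
        unfolding add_divide_distrib[symmetric] power2_eq_square[of "D r t"] by (simp add: D_def algebra_simps power2_eq_square)
      then show ?thesis
        using DERIV_divide[OF DERIV_mult[OF DERIV_cmult[OF kt, of 2] u_t[OF rt, folded ut_def]] Dt[folded ut_def] Dnz[OF r]] by simp
    qed
    have red: "us r t = u r t * (\<zeta> r t - y r t) / b r t" "z r t / c r t = \<zeta> r t / b r t" using z by auto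
    have bl: "4 * k \<le> x / (b r t)\<^sup>2" if "4 * g \<le> x" for x
    proof -
      have "4 * g / B\<^sup>2 \<le> 4 * g / (b r t)\<^sup>2" using g b by (intro divide_left_mono power_mono) auto
      also have "\<dots> \<le> x / (b r t)\<^sup>2" using that by (intro divide_right_mono) auto
      finally show ?thesis by (simp add: k_def)
    qed
    have D1: "2 * u r t / (D r t)\<^sup>2 \<le> 2" "2 * (u r t)\<^sup>2 / (D r t)\<^sup>2 \<le> 2"
    proof -
      have D2: "1 \<le> (D r t)\<^sup>2" using Dp by simp
      have "2 * u r t \<le> 2 * 1" "2 * (u r t)\<^sup>2 \<le> 2 * 1" using u by (auto simp: power_le_one)
      with D2 show "2 * u r t / (D r t)\<^sup>2 \<le> 2" "2 * (u r t)\<^sup>2 / (D r t)\<^sup>2 \<le> 2"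
        by (auto simp: divide_le_eq intro: order_trans)
    qed
    consider "F r t = 0" | "G r t = 0" using H0 by (auto simp: H_def min_def split: if_splits)
    then show False
    proof cases
      case 1
      define Fs where "Fs r = y2 r t + us r t - 2 * \<kappa> t * us r t / (D r t)\<^sup>2" for r
      have Fr: "((\<lambda>r. F r t) has_real_derivative \<phi> r t * Fs r) (at r)" if "r > 0" for r
        unfolding F_def Fs_def
        apply (rule derivative_eq_intros w_r u_r Dr Dnz that t0 refl)+
        using Dnz[OF that] by (simp add: divide_simps) (simp add: D_def algebra_simps power2_eq_square)
      have Fsr: "(Fs has_real_derivative \<phi> r t * (y3 r t + uss r t - 2 * \<kappa> t * uss r t / (D r t)\<^sup>2
           + 4 * (\<kappa> t)\<^sup>2 * (us r t)\<^sup>2 / (D r t)^3)) (at r)"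
        unfolding Fs_def[abs_def]
        apply (rule derivative_eq_intros y2_r us_r Dr Dnz Dnz2 rt r refl)+
        using Dnz[OF r] by (simp add: divide_simps) algebra
      have Ft: "(F r has_real_derivative
          y3 r t + uss r t + z r t / c r t * (y2 r t + us r t)
     + w r t / (b r t)\<^sup>2 * (4 - (w r t)\<^sup>2 + 2 * P r t - (P r t)\<^sup>2 / (u r t)\<^sup>2)
     - 2 * \<kappa> t * ut / (D r t)\<^sup>2 - 2 * u r t * k / (D r t)\<^sup>2) (at t)"
        unfolding F_def[abs_def]
        by (rule DERIV_cong[OF DERIV_diff[OF w_t[OF rt] Dku]]) (simp only: diff_diff_eq)
      have s0: "Fs r = 0" and ss: "0 \<le> y3 r t + uss r t - 2 * \<kappa> t * uss r t / (D r t)\<^sup>2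
           + 4 * (\<kappa> t)\<^sup>2 * (us r t)\<^sup>2 / (D r t)^3"
        by (rule interior_minimum_derivatives[of r "\<lambda>r. \<phi> r t" "\<lambda>r. F r t" Fs];
            use r t0 pos(1) Fr Fsr Fge 1 in simp)+
      have tt: "y3 r t + uss r t + z r t / c r t * (y2 r t + us r t)
     + w r t / (b r t)\<^sup>2 * (4 - (w r t)\<^sup>2 + 2 * P r t - (P r t)\<^sup>2 / (u r t)\<^sup>2)
     - 2 * \<kappa> t * ut / (D r t)\<^sup>2 - 2 * u r t * k / (D r t)\<^sup>2 \<le> 0"
        by (rule left_minimum_derivative[OF Ft t(1)])
          (use before 1 in \<open>force simp: H_def min_def split: if_splits\<close>)
      have w: "w r t = 2 - e" using 1 by (simp add: F_def Ph)
      have y: "y r t = 2 - e - u r t" using w by (simp add: w_def)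
      define R1 where "R1 = e * (2 - e + 2 * (u r t)\<^sup>2 + (y r t - \<zeta> r t) * ((3 * y r t - \<zeta> r t) - (2 - e) * (y r t - \<zeta> r t)) / 2)
         - 2 * (u r t - \<zeta> r t) * u r t - (u r t - \<zeta> r t)\<^sup>2"
      have R1: "R1 \<ge> l * d\<^sup>2 / 9"
        unfolding R1_def
        by (rule barrier_reaction_w) (use u z(2,3) zu ze y yd[OF rt ut] d l lu el in auto)
      \<comment> \<open>The term with \<open>us^2 / D^3\<close> is the second derivative of the
        concave function \<open>u \<mapsto> 2 \<kappa> u / (1 + \<kappa> u)\<close>, times
        \<open>u_s^2\<close>.\<close>
      have key: "w r t / (b r t)\<^sup>2 * (4 - (w r t)\<^sup>2 + 2 * P r t - (P r t)\<^sup>2 / (u r t)\<^sup>2)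
         - 2 * \<kappa> t / (D r t)\<^sup>2 * (ut - uss r t - z r t / c r t * us r t) - 4 * (\<kappa> t)\<^sup>2 * (us r t)\<^sup>2 / (D r t)^3
         = (2 - e) * R1 / (b r t)\<^sup>2"
        unfolding ut_def R1_def z(6) red w De Ke y
        using b e0 u by (simp add: divide_simps) algebra
      \<comment> \<open>The factor is \<open>\<kappa> u e\<close>, and
        \<open>\<kappa> \<ge> 1/2\<close>.\<close>
      have "2 - e \<ge> l\<^sup>2 / 2"
      proof -
        have "\<kappa> t * u r t * e = 2 - e" unfolding Ke using e0 u by simp
        moreover have "1/2 * l * l \<le> \<kappa> t * u r t * e" using K lu el l by (intro mult_mono) auto
        ultimately show ?thesis by (simp add: power2_eq_square)
      qed
      moreover from this have "0 \<le> 2 - e" using zero_le_power2[of l] by linarith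
      ultimately have "l\<^sup>2 / 2 * (l * d\<^sup>2 / 9) \<le> (2 - e) * R1" using R1 l d by (intro mult_mono) auto
      moreover have "l\<^sup>2 / 2 * (l * d\<^sup>2 / 9) = 4 * g" by (simp add: g_def power2_eq_square power3_eq_cube)
      ultimately have X: "4 * k \<le> (2 - e) * R1 / (b r t)\<^sup>2" by (intro bl) argo
      have zs: "z r t / c r t * (y2 r t + us r t) = 2 * \<kappa> t / (D r t)\<^sup>2 * (z r t / c r t * us r t)"
      proof -
        have e: "y2 r t + us r t = 2 * \<kappa> t / (D r t)\<^sup>2 * us r t" using s0 by (simp add: Fs_def)
        show ?thesis unfolding e by (rule mult.left_commute)
      qed
      have k2: "2 * u r t * k / (D r t)\<^sup>2 \<le> 2 * k"
        using mult_right_mono[OF D1(1), of k] k by simp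
      show False
        by (rule touching_contradiction_w[OF tt ss zs key X k2 k]) (simp_all only: times_divide_eq_left times_divide_eq_right mult.assoc)
    next
      case 2
      define Gs where "Gs r = z2 r t - 2 * u r t * us r t + 2 * us r t / (D r t)\<^sup>2" for r
      have Gr: "((\<lambda>r. G r t) has_real_derivative \<phi> r t * Gs r) (at r)" if "r > 0" for r
        unfolding G_def Gs_def
        apply (rule derivative_eq_intros P_r u_r Dr Dnz that t0 refl)+
        using Dnz[OF that] by (simp add: divide_simps) (simp add: D_def algebra_simps power2_eq_square)
      have Gsr: "(Gs has_real_derivative \<phi> r t * (z3 r t - 2 * (us r t)\<^sup>2 - 2 * u r t * uss r t
           + 2 * uss r t / (D r t)\<^sup>2 - 4 * \<kappa> t * (us r t)\<^sup>2 / (D r t)^3)) (at r)"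
        unfolding Gs_def[abs_def]
        apply (rule derivative_eq_intros z2_r u_r us_r Dr Dnz Dnz2 rt r refl)+
        using Dnz[OF r] by (simp add: divide_simps) algebra
      have Gt: "(G r has_real_derivative
          z3 r t - 2 * (us r t)\<^sup>2 - 2 * u r t * uss r t + (2 * y r t / b r t - z r t / c r t) * (z2 r t - 2 * u r t * us r t)
     + 1 / (b r t)\<^sup>2 * (- 2 * ((w r t)\<^sup>2 + 2 * (u r t)\<^sup>2) * P r t + 2 * (u r t)\<^sup>2 * ((w r t)\<^sup>2 - 4))
     + 2 * ut / (D r t)\<^sup>2 - 2 * (u r t)\<^sup>2 * k / (D r t)\<^sup>2) (at t)"
        unfolding G_def[abs_def]
        by (rule DERIV_cong[OF DERIV_add[OF P_t[OF rt] Du]]) (simp only: add_diff_eq)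
      have s0: "Gs r = 0" and ss: "0 \<le> z3 r t - 2 * (us r t)\<^sup>2 - 2 * u r t * uss r t
           + 2 * uss r t / (D r t)\<^sup>2 - 4 * \<kappa> t * (us r t)\<^sup>2 / (D r t)^3"
        by (rule interior_minimum_derivatives[of r "\<lambda>r. \<phi> r t" "\<lambda>r. G r t" Gs];
            use r t0 pos(1) Gr Gsr Gge 2 in simp)+
      have tt: "z3 r t - 2 * (us r t)\<^sup>2 - 2 * u r t * uss r t + (2 * y r t / b r t - z r t / c r t) * (z2 r t - 2 * u r t * us r t)
     + 1 / (b r t)\<^sup>2 * (- 2 * ((w r t)\<^sup>2 + 2 * (u r t)\<^sup>2) * P r t + 2 * (u r t)\<^sup>2 * ((w r t)\<^sup>2 - 4))
     + 2 * ut / (D r t)\<^sup>2 - 2 * (u r t)\<^sup>2 * k / (D r t)\<^sup>2 \<le> 0"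
        by (rule left_minimum_derivative[OF Gt t(1)])
          (use before 2 in \<open>force simp: H_def min_def split: if_splits\<close>)
      have "P r t = - (u r t * e)" using 2 by (simp add: G_def Th)
      then have "u r t * (\<zeta> r t - u r t + e) = 0" unfolding z(6) by (simp add: algebra_simps)
      then have zz: "\<zeta> r t = u r t - e" using u by simp
      \<comment> \<open>Monotonicity of \<open>c\<close> makes \<open>\<zeta>\<close> nonnegative,
        so the barrier for \<open>P\<close> can be touched only where
        \<open>e \<le> u \<le> 1\<close>, the range of \<open>barrier_reaction_P\<close>.\<close>
      have eu: "e \<le> u r t" using z(2) zz by simp
      have y: "y r t = w r t - u r t" by (simp add: w_def)
      define R2 where "R2 = 2 * ((w r t)\<^sup>2 + 2 * (u r t)\<^sup>2) - 2 * u r t * (4 - (w r t)\<^sup>2) / e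
        + e / 2 * (4 - 4 * (u r t)\<^sup>2 + (u r t - e)\<^sup>2 - (w r t - u r t)\<^sup>2) + e * (2 - e) / 2 * ((u r t - e) - (w r t - u r t))\<^sup>2"
      have R2: "d\<^sup>2 / 4 \<le> R2"
        unfolding R2_def
        by (rule barrier_reaction_P) (use u e0 eu wge yd[OF rt ut] d y in auto)
      have key: "1 / (b r t)\<^sup>2 * (- 2 * ((w r t)\<^sup>2 + 2 * (u r t)\<^sup>2) * P r t + 2 * (u r t)\<^sup>2 * ((w r t)\<^sup>2 - 4))
         + 2 / (D r t)\<^sup>2 * (ut - uss r t - (2 * y r t / b r t - z r t / c r t) * us r t) + 4 * \<kappa> t * (us r t)\<^sup>2 / (D r t)^3
         = u r t * e * R2 / (b r t)\<^sup>2"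
      proof -
        have k1: "2 / (D r t)\<^sup>2 = e\<^sup>2 / 2" unfolding De using e0 by (simp add: power_divide)
        have k2: "ut - uss r t - (2 * y r t / b r t - z r t / c r t) * us r t
          = u r t * ((y r t + \<zeta> r t) * (\<zeta> r t - y r t) + 4 - 4 * (u r t)\<^sup>2) / (b r t)\<^sup>2"
        proof -
          have "3 * y r t / b r t * us r t - (2 * y r t / b r t - \<zeta> r t / b r t) * us r t = (y r t + \<zeta> r t) * (us r t / b r t)"
            using b by (simp add: field_simps)
          also have "us r t / b r t = u r t * (\<zeta> r t - y r t) / (b r t)\<^sup>2" unfolding red by (simp add: power2_eq_square)
          finally have F: "3 * y r t / b r t * us r t - (2 * y r t / b r t - \<zeta> r t / b r t) * us r t
            = (y r t + \<zeta> r t) * (u r t * (\<zeta> r t - y r t) / (b r t)\<^sup>2)" .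
          have "ut - uss r t - (2 * y r t / b r t - z r t / c r t) * us r t =
            (3 * y r t / b r t * us r t - (2 * y r t / b r t - \<zeta> r t / b r t) * us r t) + 4 * u r t * (1 - (u r t)\<^sup>2) / (b r t)\<^sup>2"
            unfolding ut_def red(2) by simp
          also have "\<dots> = (u r t * (y r t + \<zeta> r t) * (\<zeta> r t - y r t) + 4 * u r t * (1 - (u r t)\<^sup>2)) / (b r t)\<^sup>2"
            unfolding F by (simp add: add_divide_distrib ac_simps)
          also have "u r t * (y r t + \<zeta> r t) * (\<zeta> r t - y r t) + 4 * u r t * (1 - (u r t)\<^sup>2)
            = u r t * ((y r t + \<zeta> r t) * (\<zeta> r t - y r t) + 4 - 4 * (u r t)\<^sup>2)" by (simp add: algebra_simps)
          finally show ?thesis .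
        qed
        have k3: "4 * \<kappa> t * (us r t)\<^sup>2 / (D r t)^3 = (u r t * e\<^sup>2 * (2 - e) * (\<zeta> r t - y r t)\<^sup>2 / 2) / (b r t)\<^sup>2"
          unfolding De Ke red using e0 u b by (simp add: field_simps power2_eq_square power3_eq_cube)
        have k4: "u r t * e * R2 = (- 2 * ((w r t)\<^sup>2 + 2 * (u r t)\<^sup>2) * P r t + 2 * (u r t)\<^sup>2 * ((w r t)\<^sup>2 - 4))
          + e\<^sup>2 / 2 * (u r t * ((y r t + \<zeta> r t) * (\<zeta> r t - y r t) + 4 - 4 * (u r t)\<^sup>2))
          + u r t * e\<^sup>2 * (2 - e) * (\<zeta> r t - y r t)\<^sup>2 / 2"
        proof -
          have "e * (2 * u r t * (4 - (w r t)\<^sup>2) / e) = 2 * u r t * (4 - (w r t)\<^sup>2)" using e0 by simp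
          then have "e * R2 = e * (2 * ((w r t)\<^sup>2 + 2 * (u r t)\<^sup>2)) - 2 * u r t * (4 - (w r t)\<^sup>2)
            + e * (e / 2 * (4 - 4 * (u r t)\<^sup>2 + (u r t - e)\<^sup>2 - (w r t - u r t)\<^sup>2))
            + e * (e * (2 - e) / 2 * ((u r t - e) - (w r t - u r t))\<^sup>2)"
            unfolding R2_def by (simp only: distrib_left right_diff_distrib)
          then have "u r t * e * R2 = u r t * (e * (2 * ((w r t)\<^sup>2 + 2 * (u r t)\<^sup>2)) - 2 * u r t * (4 - (w r t)\<^sup>2)
            + e * (e / 2 * (4 - 4 * (u r t)\<^sup>2 + (u r t - e)\<^sup>2 - (w r t - u r t)\<^sup>2))
            + e * (e * (2 - e) / 2 * ((u r t - e) - (w r t - u r t))\<^sup>2))" by (simp only: mult.assoc)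
          then show ?thesis unfolding z(6) zz y by (simp add: field_simps power2_eq_square)
        qed
        show ?thesis unfolding k1 k2 k3 k4 by (simp add: add_divide_distrib)
      qed
      have "l * l * (d\<^sup>2 / 4) \<le> u r t * e * R2" using R2 l lu el d by (intro mult_mono) auto
      moreover have "4 * g \<le> l * l * (d\<^sup>2 / 4)"
      proof -
        have "l * (l * l * d\<^sup>2) \<le> 1 * (l * l * d\<^sup>2)" using l by (intro mult_right_mono) auto
        moreover have "0 \<le> l * l * d\<^sup>2" by simp
        moreover have "4 * g = l * (l * l * d\<^sup>2) / 18" by (simp add: g_def power3_eq_cube)
        ultimately show ?thesis by linarith
      qed
      ultimately have X: "4 * k \<le> u r t * e * R2 / (b r t)\<^sup>2" by (intro bl) linarith
      have zs: "(2 * y r t / b r t - z r t / c r t) * (z2 r t - 2 * u r t * us r t)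
          = - (2 / (D r t)\<^sup>2 * ((2 * y r t / b r t - z r t / c r t) * us r t))"
      proof -
        have "z2 r t - 2 * u r t * us r t = - (2 / (D r t)\<^sup>2 * us r t)" using s0 by (simp add: Gs_def)
        then show ?thesis by (simp only: mult_minus_right) (rule arg_cong[where f = uminus, OF mult.left_commute])
      qed
      have k2: "2 * (u r t)\<^sup>2 * k / (D r t)\<^sup>2 \<le> 2 * k"
        using mult_right_mono[OF D1(2), of k] k by simp
      show False
        by (rule touching_contradiction_P[OF tt ss zs key X k2 k]) (simp_all only: times_divide_eq_left times_divide_eq_right mult.assoc)
    qed
  qed
  then show ?thesis by (simp add: H_def F_def G_def D_def kap1)
qed

theorem rigidity:
  assumes "r > 0" "t < 0"
  shows "y r t = 2 - u r t" "z r t = (u r t)\<^sup>2"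
proof -
  have u: "u r t > 0" using u_pos assms by auto
  have lim: "((\<lambda>K. 2 * u r t / (1 + K * u r t)) \<longlongrightarrow> 0) at_top"
  proof (rule real_tendsto_divide_at_top[OF tendsto_const])
    show "LIM K at_top. 1 + K * u r t :> at_top"
      by (intro filterlim_tendsto_add_at_top[OF tendsto_const] filterlim_at_top_mult_tendsto_pos[OF tendsto_const u]
          filterlim_ident)
  qed
  \<comment> \<open>\<open>2 K u / (1 + K u)\<close> is \<open>2 - 2 / (1 + K u)\<close>, here
    written through the quotient whose limit is already known.\<close>
  have lb: "w r t > 2 - 2 / u r t * (2 * u r t / (1 + K * u r t)) / 2 \<and> P r t > - (2 * u r t / (1 + K * u r t))"
    if "K \<ge> 1/2" for K
  proof -
    have "1 + K * u r t > 0" using u that by (simp add: add_pos_nonneg)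
    then have "2 * K * u r t / (1 + K * u r t) = 2 - 2 / u r t * (2 * u r t / (1 + K * u r t)) / 2"
      using u by (simp add: field_simps)
    then show ?thesis using lower_barrier[OF that assms(2), of r] assms by simp
  qed
  have l2: "((\<lambda>K. 2 - 2 / u r t * (2 * u r t / (1 + K * u r t)) / 2) \<longlongrightarrow> 2 - 2 / u r t * 0 / 2) at_top"
    using u by (intro tendsto_intros lim) auto
  have "w r t \<ge> 2 - 2 / u r t * 0 / 2"
    by (rule tendsto_upperbound[OF l2],
        rule eventually_at_top_linorderI[of "1/2"], rule less_imp_le, erule conjunct1[OF lb]) simp
  moreover have "P r t \<ge> - 0"
    by (rule tendsto_upperbound[OF tendsto_minus[OF lim]],
        rule eventually_at_top_linorderI[of "1/2"], rule less_imp_le, erule conjunct2[OF lb]) simp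
  ultimately show "y r t = 2 - u r t" "z r t = (u r t)\<^sup>2"
    using upper_bounds[OF assms] by (simp_all add: w_def P_def)
qed

end

section \<open>Ancient flows in the class\<close>

text \<open>Negative times form an open set, where time derivatives are two-sided; time zero is
  recovered at the end by continuity. The radius runs over the whole line, so the axis is
  interior.\<close>

abbreviation "past \<equiv> UNIV \<times> {..<0} :: (real \<times> real) set"

lemma open_past: "open past" by (intro open_Times) auto

definition dr :: "(real \<times> real \<Rightarrow> real) \<Rightarrow> real \<times> real \<Rightarrow> real" where
  "dr F p = frechet_derivative F (at p) (1, 0)"

definition dt :: "(real \<times> real \<Rightarrow> real) \<Rightarrow> real \<times> real \<Rightarrow> real" where
  "dt F p = frechet_derivative F (at p) (0, 1)"

lemma smooth_past_derivative:
  assumes "smooth_on past F" "p \<in> past"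
  shows "(F has_derivative frechet_derivative F (at p)) (at p)"
proof -
  obtain F' where F': "\<And>x. x \<in> past \<Longrightarrow> (F has_derivative F' x) (at x within past)" "\<And>v. Ck_on (Suc 0) past (\<lambda>x. F' x v)"
    using Ck_on_SucE[OF smooth_on_Ck[OF assms(1), of "Suc (Suc 0)"]] by blast
  from F'(1)[OF assms(2), unfolded at_within_open[OF assms(2) open_past]]
  have "(F has_derivative F' p) (at p)" .
  then show ?thesis by (rule has_frechet_derivative)
qed

text \<open>On an open set derivatives are unique, so the witnesses of \<open>Ck_on\<close> for all
  orders are the one \<open>frechet_derivative\<close>.\<close>

lemma smooth_past_partial:
  assumes "smooth_on past F"
  shows "smooth_on past (\<lambda>p. frechet_derivative F (at p) v)"
  unfolding smooth_on_def
proof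
  fix k
  obtain F' where F': "\<And>x. x \<in> past \<Longrightarrow> (F has_derivative F' x) (at x within past)" "\<And>v. Ck_on k past (\<lambda>x. F' x v)"
    using Ck_on_SucE[OF smooth_on_Ck[OF assms(1), of "Suc k"]] by blast
  have "F' x = frechet_derivative F (at x)" if "x \<in> past" for x
    by (rule frechet_derivative_at) (use F'(1)[OF that] in \<open>simp only: at_within_open[OF that open_past]\<close>)
  then show "Ck_on k past (\<lambda>p. frechet_derivative F (at p) v)"
    by (intro Ck_on_cong[OF F'(2)]) simp
qed

lemma dr_smooth [smooth]: "smooth_on past F \<Longrightarrow> smooth_on past (dr F)"
  and dt_smooth [smooth]: "smooth_on past F \<Longrightarrow> smooth_on past (dt F)"
  unfolding dr_def[abs_def] dt_def[abs_def] by (intro smooth_past_partial; assumption)+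

lemma dr_D: assumes "smooth_on past F" "t < 0"
  shows "((\<lambda>r. F (r, t)) has_real_derivative dr F (r, t)) (at r)"
proof -
  have "((\<lambda>r. (r, t)) has_derivative (\<lambda>h. (h, 0))) (at r)"
    by (intro has_derivative_Pair has_derivative_ident has_derivative_const)
  from diff_chain_at[OF this smooth_past_derivative[OF assms(1)]] assms(2)
  have d: "((\<lambda>r. F (r, t)) has_derivative (\<lambda>h. frechet_derivative F (at (r, t)) (h, 0))) (at r)" by (simp add: o_def)
  have p: "(r, t) \<in> past" using assms(2) by simp
  have eq: "frechet_derivative F (at (r, t)) (h, 0) = h * dr F (r, t)" for h
  proof -
    have "frechet_derivative F (at (r, t)) (h *\<^sub>R (1, 0)) = h *\<^sub>R frechet_derivative F (at (r, t)) (1, 0)"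
      by (rule linear_scale[OF has_derivative_linear[OF smooth_past_derivative[OF assms(1) p]]])
    moreover have "h *\<^sub>R (1, 0) = (h, 0)" by simp
    ultimately show ?thesis unfolding dr_def real_scaleR_def by (rule subst[rotated])
  qed
  show ?thesis using d unfolding has_field_derivative_def eq mult.commute[of _ "_ F _"] .
qed

lemma dt_D: assumes "smooth_on past F" "t < 0"
  shows "((\<lambda>t. F (r, t)) has_real_derivative dt F (r, t)) (at t)"
proof -
  have "((\<lambda>t. (r, t)) has_derivative (\<lambda>h. (0, h))) (at t)"
    by (intro has_derivative_Pair has_derivative_ident has_derivative_const)
  from diff_chain_at[OF this smooth_past_derivative[OF assms(1)]] assms(2)
  have d: "((\<lambda>t. F (r, t)) has_derivative (\<lambda>h. frechet_derivative F (at (r, t)) (0, h))) (at t)" by (simp add: o_def)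
  have p: "(r, t) \<in> past" using assms(2) by simp
  have eq: "frechet_derivative F (at (r, t)) (0, h) = h * dt F (r, t)" for h
  proof -
    have "frechet_derivative F (at (r, t)) (h *\<^sub>R (0, 1)) = h *\<^sub>R frechet_derivative F (at (r, t)) (0, 1)"
      by (rule linear_scale[OF has_derivative_linear[OF smooth_past_derivative[OF assms(1) p]]])
    moreover have "h *\<^sub>R (0, 1) = (0, h)" by simp
    ultimately show ?thesis unfolding dt_def real_scaleR_def by (rule subst[rotated])
  qed
  show ?thesis using d unfolding has_field_derivative_def eq mult.commute[of _ "_ F _"] .
qed

lemma smooth_past_cont: "smooth_on past F \<Longrightarrow> continuous_on past F"
  by (rule smooth_on_continuous_on)

text \<open>Equality of mixed derivatives by integration: \<open>F\<close> is the time integral of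
  \<open>dt F\<close>; differentiating in \<open>r\<close> under the integral and then in time gives
  \<open>dr (dt F)\<close>.\<close>

lemma dt_dr_commute:
  assumes F: "smooth_on past F" and t: "t < 0"
  shows "dt (dr F) (r, t) = dr (dt F) (r, t)"
proof -
  define a b where "a = t - 1" and "b = t / 2"
  have ab: "a < t" "t < b" "b < 0" using t by (auto simp: a_def b_def)
  have sub: "continuous_on ({a..b}) (\<lambda>\<tau>. G (s, \<tau>))" if "smooth_on past G" for G :: "real \<times> real \<Rightarrow> real" and s
    by (rule continuous_on_compose2[OF smooth_past_cont[OF that]]) (use ab in \<open>auto intro!: continuous_intros\<close>)
  have ftc: "integral {a..t'} (\<lambda>\<tau>. dt F (s, \<tau>)) = F (s, t') - F (s, a)" if "t' \<in> {a..b}" for t' s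
    by (rule integral_unique, rule fundamental_theorem_of_calculus)
      (use that ab dt_D[OF F] in \<open>auto simp: has_real_derivative_iff_has_vector_derivative[symmetric] intro: has_field_derivative_at_within\<close>)
  have eq: "dr F (r, t') = dr F (r, a) + integral {a..t'} (\<lambda>\<tau>. dr (dt F) (r, \<tau>))" if t': "t' \<in> {a..b}" for t'
  proof -
    have "((\<lambda>s. integral (cbox a t') (\<lambda>\<tau>. dt F (s, \<tau>))) has_field_derivative integral (cbox a t') (\<lambda>\<tau>. dr (dt F) (r, \<tau>))) (at r within UNIV)"
    proof (rule leibniz_rule_field_derivative)
      show "((\<lambda>s. dt F (s, \<tau>)) has_real_derivative dr (dt F) (s, \<tau>)) (at s within UNIV)" if "\<tau> \<in> cbox a t'" for s \<tau>
        using dr_D[OF dt_smooth[OF F], of \<tau> s] that t' ab by auto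
      show "(\<lambda>\<tau>. dt F (s, \<tau>)) integrable_on cbox a t'" for s
        using continuous_on_subset[OF sub[OF dt_smooth[OF F], of s], of "{a..t'}"] t' by (auto intro!: integrable_continuous_real)
      show "continuous_on (UNIV \<times> cbox a t') (\<lambda>(s, \<tau>). dr (dt F) (s, \<tau>))"
      proof -
        have "UNIV \<times> cbox a t' \<subseteq> past" using t' ab by auto
        from continuous_on_subset[OF smooth_past_cont[OF dr_smooth[OF dt_smooth[OF F]]] this]
        show ?thesis by (simp only: case_prod_eta)
      qed
    qed auto
    then have "((\<lambda>s. F (s, t') - F (s, a)) has_real_derivative integral {a..t'} (\<lambda>\<tau>. dr (dt F) (r, \<tau>))) (at r)"
      using ftc[OF t'] by simp
    moreover have "((\<lambda>s. F (s, t') - F (s, a)) has_real_derivative dr F (r, t') - dr F (r, a)) (at r)"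
      using t' ab by (intro DERIV_diff dr_D F) auto
    ultimately show ?thesis using DERIV_unique by fastforce
  qed
  have "((\<lambda>t'. integral {a..t'} (\<lambda>\<tau>. dr (dt F) (r, \<tau>))) has_vector_derivative dr (dt F) (r, t)) (at t within {a..b})"
    by (rule integral_has_vector_derivative[OF sub[OF dr_smooth[OF dt_smooth[OF F]]]]) (use ab in auto)
  then have "((\<lambda>t'. integral {a..t'} (\<lambda>\<tau>. dr (dt F) (r, \<tau>))) has_real_derivative dr (dt F) (r, t)) (at t)"
    using ab by (simp add: has_real_derivative_iff_has_vector_derivative at_within_Icc_at)
  then have "((\<lambda>t'. dr F (r, a) + integral {a..t'} (\<lambda>\<tau>. dr (dt F) (r, \<tau>))) has_real_derivative 0 + dr (dt F) (r, t)) (at t)"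
    by (intro DERIV_add DERIV_const)
  then have "((\<lambda>t'. dr F (r, t')) has_real_derivative 0 + dr (dt F) (r, t)) (at t)"
  proof (rule has_field_derivative_transform_within_open)
    show "open {a<..<b}" "t \<in> {a<..<b}" using ab by auto
    show "dr F (r, a) + integral {a..t'} (\<lambda>\<tau>. dr (dt F) (r, \<tau>)) = dr F (r, t')" if "t' \<in> {a<..<b}" for t'
      by (rule eq[symmetric]) (use that in auto)
  qed
  from DERIV_unique[OF this dt_D[OF dr_smooth[OF F] t]] show ?thesis by simp
qed

section \<open>Geometric quantities of a flow along the ray\<close>

locale class_A_flow =
  fixes g :: "real \<Rightarrow> 4 metric" and b c :: "real \<Rightarrow> real \<Rightarrow> real" and f :: "real \<Rightarrow> real" and m :: real
  assumes flow: "ancient_ricci_flow g"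
    and complete: "\<And>t. t \<le> 0 \<Longrightarrow> complete_riemannian_metric (g t)"
    and bounded: "uniformly_bounded_curvature g"
    and warped: "\<And>t. t \<le> 0 \<Longrightarrow> warped_berger_metric (g t) (b t) (c t)"
    and monotone: "\<And>t. t \<le> 0 \<Longrightarrow> monotone_coefficients (b t) (c t)"
    and f: "continuous_on {1..} f" "\<And>z. z \<ge> 1 \<Longrightarrow> f z > 0" "filterlim f at_top at_top"
    and lower: "\<And>t s. t \<le> 0 \<Longrightarrow> s \<ge> 0 \<Longrightarrow> ds (b t) s \<ge> f (bc_ratio (b t) (c t) s) / bc_ratio (b t) (c t) s"
    and upper: "\<And>t s. t \<le> 0 \<Longrightarrow> s \<ge> 0 \<Longrightarrow> c t s \<le> inverse m"
begin

lemma berger: "t \<le> 0 \<Longrightarrow> berger_metric (g t) (b t) (c t)"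
  using complete[of t] warped[of t]
  by (unfold_locales) (auto simp: complete_riemannian_metric_def warped_berger_metric_def)

definition "G i p = g (snd p) (fst p *\<^sub>R e1) $ i $ i" for i :: 4 and p :: "real \<times> real"

lemma G_E: "t \<le> 0 \<Longrightarrow> G i (r, t) = berger_metric.E (g t) i r"
  using berger_metric.E_def[OF berger] by (simp add: G_def)

lemma G_smooth0: "smooth_on (UNIV \<times> {..0}) (G i)"
proof -
  define L where "L p = (fst p *\<^sub>R e1, snd p)" for p :: "real \<times> real"
  have "bounded_linear L"
    unfolding L_def
    by (intro bounded_linear_Pair bounded_linear_compose[OF bounded_linear_scaleR_left bounded_linear_fst] bounded_linear_snd)
  moreover have "smooth_on (UNIV \<times> {..0}) (\<lambda>(x, t). g t x)" using flow by (simp add: ancient_ricci_flow_def)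
  ultimately have "smooth_on (UNIV \<times> {..0}) (\<lambda>p. (\<lambda>(x, t). g t x) (L p + 0))"
    by (rule smooth_on_comp_affine) (auto simp: L_def)
  then have "smooth_on (UNIV \<times> {..0}) (\<lambda>p. g (snd p) (fst p *\<^sub>R e1))" by (simp add: L_def)
  then show ?thesis unfolding G_def by (intro smooth_on_vec_nth)
qed

lemma G_smooth [smooth]: "smooth_on past (G i)"
  by (rule smooth_on_subset[OF G_smooth0]) auto

lemma G_pos: "t \<le> 0 \<Longrightarrow> G i (r, t) > 0"
  using berger_metric.E_pos[OF berger] G_E by simp

lemma G_t: assumes "t < 0"
  shows "((\<lambda>\<tau>. G i (r, \<tau>)) has_real_derivative - 2 * ricci (g t) (r *\<^sub>R e1) $ i $ i) (at t)"
proof -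
  have "((\<lambda>\<tau>. g \<tau> (r *\<^sub>R e1)) has_vector_derivative (- 2) *\<^sub>R ricci (g t) (r *\<^sub>R e1)) (at t within {..0})"
    using flow assms by (simp add: ancient_ricci_flow_def)
  have "((\<lambda>\<tau>. g \<tau> (r *\<^sub>R e1)) has_vector_derivative (- 2) *\<^sub>R ricci (g t) (r *\<^sub>R e1)) (at t)"
  proof -
    have "at t within {..0} = at t" by (rule at_within_open_subset[of t "{..<0}"]) (use assms in auto)
    then show ?thesis using \<open>(_ has_vector_derivative _) (at t within _)\<close> by simp
  qed
  from bounded_linear.has_vector_derivative[OF bounded_linear_vec_nth this]
  have "((\<lambda>\<tau>. g \<tau> (r *\<^sub>R e1) $ i) has_vector_derivative ((- 2) *\<^sub>R ricci (g t) (r *\<^sub>R e1)) $ i) (at t)" .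
  from bounded_linear.has_vector_derivative[OF bounded_linear_vec_nth this]
  show ?thesis by (simp add: G_def has_real_derivative_iff_has_vector_derivative)
qed

text \<open>\<open>\<phi>\<close> is \<open>ds/dr\<close>. The roots \<open>\<beta>\<close> and
  \<open>\<gamma>\<close> are \<open>b / r\<close> and \<open>c / r\<close>; being roots of positive
  smooth functions they are smooth across the axis. Hence so are the odd extensions
  \<open>bb\<close>, \<open>cc\<close> and the ratio \<open>uu\<close>, which requires no division
  by \<open>b\<close> at the origin.\<close>

definition "\<phi> p = sqrt (G 1 p)"
definition "\<beta> p = sqrt (G 3 p)"
definition "\<gamma> p = sqrt (G 2 p)"
definition "bb p = fst p * \<beta> p"
definition "cc p = fst p * \<gamma> p"
definition "yy p = dr bb p / \<phi> p"
definition "zz p = dr cc p / \<phi> p"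
definition "yy2 p = dr yy p / \<phi> p"
definition "zz2 p = dr zz p / \<phi> p"
definition "yy3 p = dr yy2 p / \<phi> p"
definition "zz3 p = dr zz2 p / \<phi> p"
definition "uu p = \<gamma> p / \<beta> p"
definition "vv p = dr uu p / uu p / \<phi> p"

lemma roots_pos: "t \<le> 0 \<Longrightarrow> \<phi> (r, t) > 0" "t \<le> 0 \<Longrightarrow> \<beta> (r, t) > 0" "t \<le> 0 \<Longrightarrow> \<gamma> (r, t) > 0"
  using G_pos by (simp_all add: \<phi>_def \<beta>_def \<gamma>_def)

lemma roots_smooth [smooth]: "smooth_on past \<phi>" "smooth_on past \<beta>" "smooth_on past \<gamma>"
  unfolding \<phi>_def[abs_def] \<beta>_def[abs_def] \<gamma>_def[abs_def]
  using G_pos by (auto intro!: smooth_on_sqrt G_smooth)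

lemma bc_smooth [smooth]: "smooth_on past bb" "smooth_on past cc"
  unfolding bb_def[abs_def] cc_def[abs_def] by (intro smooth)+

lemma phi_quot: "smooth_on past F \<Longrightarrow> smooth_on past (\<lambda>p. F p / \<phi> p)"
proof (intro smooth_on_divide roots_smooth)
  show "\<phi> p \<noteq> 0" if "p \<in> past" for p using roots_pos(1)[of "snd p" "fst p"] that by force
qed

lemma yz_smooth [smooth]: "smooth_on past yy" "smooth_on past zz" "smooth_on past yy2" "smooth_on past zz2"
  "smooth_on past yy3" "smooth_on past zz3"
proof -
  show 1: "smooth_on past yy" "smooth_on past zz"
    unfolding yy_def[abs_def] zz_def[abs_def] by (intro phi_quot dr_smooth bc_smooth)+
  show 2: "smooth_on past yy2" "smooth_on past zz2"
    unfolding yy2_def[abs_def] zz2_def[abs_def] by (intro phi_quot dr_smooth 1)+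
  show "smooth_on past yy3" "smooth_on past zz3"
    unfolding yy3_def[abs_def] zz3_def[abs_def] by (intro phi_quot dr_smooth 2)+
qed

lemma uv_smooth [smooth]: "smooth_on past uu" "smooth_on past vv"
proof -
  have nz: "\<beta> p \<noteq> 0" "uu p \<noteq> 0" if "p \<in> past" for p
    using roots_pos[of "snd p" "fst p"] that by (auto simp: uu_def)
  show u: "smooth_on past uu" unfolding uu_def[abs_def] by (intro smooth_on_divide roots_smooth nz)
  show "smooth_on past vv" unfolding vv_def[abs_def] by (intro phi_quot smooth_on_divide dr_smooth u nz)
qed

lemma phi_dr: assumes "t < 0"
  shows "dr bb (r, t) = \<phi> (r, t) * yy (r, t)" "dr cc (r, t) = \<phi> (r, t) * zz (r, t)"
    "dr yy (r, t) = \<phi> (r, t) * yy2 (r, t)" "dr zz (r, t) = \<phi> (r, t) * zz2 (r, t)"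
    "dr yy2 (r, t) = \<phi> (r, t) * yy3 (r, t)" "dr zz2 (r, t) = \<phi> (r, t) * zz3 (r, t)"
  using roots_pos(1)[of t r] assms by (simp_all add: yy_def zz_def yy2_def zz2_def yy3_def zz3_def)

lemmas r_derivs = dr_D[OF bc_smooth(1)] dr_D[OF bc_smooth(2)] dr_D[OF yz_smooth(1)] dr_D[OF yz_smooth(2)]
  dr_D[OF yz_smooth(3)] dr_D[OF yz_smooth(4)]

lemma bc_pos: assumes "t < 0" "r > 0" shows "bb (r, t) > 0" "cc (r, t) > 0"
  using roots_pos[of t r] assms by (simp_all add: bb_def cc_def)

lemma E_eqs: assumes "t < 0" "r > 0"
  shows "G 1 (r, t) = (\<phi> (r, t))\<^sup>2" "G 2 (r, t) = (cc (r, t))\<^sup>2 / r\<^sup>2" "G 3 (r, t) = (bb (r, t))\<^sup>2 / r\<^sup>2"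
  using G_pos[of t _ r] assms by (auto simp: \<phi>_def bb_def cc_def \<beta>_def \<gamma>_def power_mult_distrib less_imp_le)

text \<open>Brings the radial derivatives of the metric entries into the arclength form required by
  \<open>curvature_axis\<close>.\<close>

lemma G_dr:
  assumes t: "t < 0" and r: "r > 0"
  shows "dr (G 1) (r, t) = 2 * \<phi> (r, t) * dr \<phi> (r, t)"
    "dr (G 2) (r, t) = 2 * cc (r, t) * \<phi> (r, t) * zz (r, t) / r\<^sup>2 - 2 * (cc (r, t))\<^sup>2 / r^3"
    "dr (G 3) (r, t) = 2 * bb (r, t) * \<phi> (r, t) * yy (r, t) / r\<^sup>2 - 2 * (bb (r, t))\<^sup>2 / r^3"
proof -
  have "((\<lambda>r. (\<phi> (r, t))\<^sup>2) has_real_derivative 2 * \<phi> (r, t) * dr \<phi> (r, t)) (at r)"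
    by (rule derivative_eq_intros dr_D[OF roots_smooth(1) t] refl)+ simp
  then have "((\<lambda>r. G 1 (r, t)) has_real_derivative 2 * \<phi> (r, t) * dr \<phi> (r, t)) (at r)"
    by (rule has_field_derivative_transform_within_open[of _ _ _ "{0<..}"]) (use r t E_eqs in auto)
  from DERIV_unique[OF dr_D[OF G_smooth t] this] show "dr (G 1) (r, t) = 2 * \<phi> (r, t) * dr \<phi> (r, t)" .
  have quot: "((\<lambda>r. (h (r, t))\<^sup>2 / r\<^sup>2) has_real_derivative 2 * h (r, t) * \<phi> (r, t) * k / r\<^sup>2 - 2 * (h (r, t))\<^sup>2 / r^3) (at r)"
    if h: "((\<lambda>r. h (r, t)) has_real_derivative \<phi> (r, t) * k) (at r)" for h :: "real \<times> real \<Rightarrow> real" and k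
  proof -
    have nz: "r\<^sup>2 \<noteq> 0" using r by simp
    show ?thesis
      apply (rule derivative_eq_intros h nz refl)+
      using r by (simp add: field_simps power2_eq_square power3_eq_cube)
  qed
  have "((\<lambda>r. G 2 (r, t)) has_real_derivative 2 * cc (r, t) * \<phi> (r, t) * zz (r, t) / r\<^sup>2 - 2 * (cc (r, t))\<^sup>2 / r^3) (at r)"
    by (rule has_field_derivative_transform_within_open[OF quot, of _ _ "{0<..}"])
      (use r t E_eqs r_derivs(2)[OF t] phi_dr[OF t] in auto)
  from DERIV_unique[OF dr_D[OF G_smooth t] this]
  show "dr (G 2) (r, t) = 2 * cc (r, t) * \<phi> (r, t) * zz (r, t) / r\<^sup>2 - 2 * (cc (r, t))\<^sup>2 / r^3" .
  have "((\<lambda>r. G 3 (r, t)) has_real_derivative 2 * bb (r, t) * \<phi> (r, t) * yy (r, t) / r\<^sup>2 - 2 * (bb (r, t))\<^sup>2 / r^3) (at r)"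
    by (rule has_field_derivative_transform_within_open[OF quot, of _ _ "{0<..}"])
      (use r t E_eqs r_derivs(1)[OF t] phi_dr[OF t] in auto)
  from DERIV_unique[OF dr_D[OF G_smooth t] this]
  show "dr (G 3) (r, t) = 2 * bb (r, t) * \<phi> (r, t) * yy (r, t) / r\<^sup>2 - 2 * (bb (r, t))\<^sup>2 / r^3" .
qed

lemma G_drr:
  assumes t: "t < 0" and r: "r > 0"
  shows "dr (dr (G 2)) (r, t) = (2 * (\<phi> (r, t))\<^sup>2 * (zz (r, t))\<^sup>2 + 2 * cc (r, t) * (dr \<phi> (r, t) * zz (r, t) + (\<phi> (r, t))\<^sup>2 * zz2 (r, t))) / r\<^sup>2
     - 8 * cc (r, t) * \<phi> (r, t) * zz (r, t) / r^3 + 6 * (cc (r, t))\<^sup>2 / r^4"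
    "dr (dr (G 3)) (r, t) = (2 * (\<phi> (r, t))\<^sup>2 * (yy (r, t))\<^sup>2 + 2 * bb (r, t) * (dr \<phi> (r, t) * yy (r, t) + (\<phi> (r, t))\<^sup>2 * yy2 (r, t))) / r\<^sup>2
     - 8 * bb (r, t) * \<phi> (r, t) * yy (r, t) / r^3 + 6 * (bb (r, t))\<^sup>2 / r^4"
proof -
  have quot: "((\<lambda>r. 2 * h (r, t) * \<phi> (r, t) * k (r, t) / r\<^sup>2 - 2 * (h (r, t))\<^sup>2 / r^3) has_real_derivative
     (2 * (\<phi> (r, t))\<^sup>2 * (k (r, t))\<^sup>2 + 2 * h (r, t) * (dr \<phi> (r, t) * k (r, t) + (\<phi> (r, t))\<^sup>2 * l)) / r\<^sup>2
     - 8 * h (r, t) * \<phi> (r, t) * k (r, t) / r^3 + 6 * (h (r, t))\<^sup>2 / r^4) (at r)"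
    if h: "((\<lambda>r. h (r, t)) has_real_derivative \<phi> (r, t) * k (r, t)) (at r)" "((\<lambda>r. k (r, t)) has_real_derivative \<phi> (r, t) * l) (at r)"
    for h k :: "real \<times> real \<Rightarrow> real" and l
  proof -
    have nz: "r\<^sup>2 \<noteq> 0" "r^3 \<noteq> 0" using r by simp_all
    show ?thesis
      apply (rule derivative_eq_intros h dr_D[OF roots_smooth(1) t] nz refl)+
      using r by (simp add: divide_simps) (simp add: algebra_simps eval_nat_numeral)
  qed
  have "((\<lambda>r. dr (G 2) (r, t)) has_real_derivative (2 * (\<phi> (r, t))\<^sup>2 * (zz (r, t))\<^sup>2 + 2 * cc (r, t) * (dr \<phi> (r, t) * zz (r, t) + (\<phi> (r, t))\<^sup>2 * zz2 (r, t))) / r\<^sup>2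
     - 8 * cc (r, t) * \<phi> (r, t) * zz (r, t) / r^3 + 6 * (cc (r, t))\<^sup>2 / r^4) (at r)"
    by (rule has_field_derivative_transform_within_open[OF quot, of _ _ _ "{0<..}"])
      (use r t G_dr r_derivs(2)[OF t] r_derivs(4)[OF t] phi_dr[OF t] in auto)
  from DERIV_unique[OF dr_D[OF dr_smooth[OF G_smooth] t] this]
  show "dr (dr (G 2)) (r, t) = (2 * (\<phi> (r, t))\<^sup>2 * (zz (r, t))\<^sup>2 + 2 * cc (r, t) * (dr \<phi> (r, t) * zz (r, t) + (\<phi> (r, t))\<^sup>2 * zz2 (r, t))) / r\<^sup>2
     - 8 * cc (r, t) * \<phi> (r, t) * zz (r, t) / r^3 + 6 * (cc (r, t))\<^sup>2 / r^4" .
  have "((\<lambda>r. dr (G 3) (r, t)) has_real_derivative (2 * (\<phi> (r, t))\<^sup>2 * (yy (r, t))\<^sup>2 + 2 * bb (r, t) * (dr \<phi> (r, t) * yy (r, t) + (\<phi> (r, t))\<^sup>2 * yy2 (r, t))) / r\<^sup>2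
     - 8 * bb (r, t) * \<phi> (r, t) * yy (r, t) / r^3 + 6 * (bb (r, t))\<^sup>2 / r^4) (at r)"
    by (rule has_field_derivative_transform_within_open[OF quot, of _ _ _ "{0<..}"])
      (use r t G_dr r_derivs(1)[OF t] r_derivs(3)[OF t] phi_dr[OF t] in auto)
  from DERIV_unique[OF dr_D[OF dr_smooth[OF G_smooth] t] this]
  show "dr (dr (G 3)) (r, t) = (2 * (\<phi> (r, t))\<^sup>2 * (yy (r, t))\<^sup>2 + 2 * bb (r, t) * (dr \<phi> (r, t) * yy (r, t) + (\<phi> (r, t))\<^sup>2 * yy2 (r, t))) / r\<^sup>2
     - 8 * bb (r, t) * \<phi> (r, t) * yy (r, t) / r^3 + 6 * (bb (r, t))\<^sup>2 / r^4" .
qed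

section \<open>Evolution of the coefficients under the flow\<close>

lemma curvature:
  assumes t: "t < 0" and r: "r > 0"
  shows "riemann (g t) 1 1 2 2 (r *\<^sub>R e1) = - zz2 (r, t) / cc (r, t) * G 2 (r, t)" (is ?thesis1)
    "riemann (g t) 2 2 1 1 (r *\<^sub>R e1) = - zz2 (r, t) / cc (r, t) * G 1 (r, t)" (is ?thesis2)
    "riemann (g t) 1 1 3 3 (r *\<^sub>R e1) = - yy2 (r, t) / bb (r, t) * G 3 (r, t)" (is ?thesis3)
    "riemann (g t) 3 3 1 1 (r *\<^sub>R e1) = - yy2 (r, t) / bb (r, t) * G 1 (r, t)" (is ?thesis4)
    "riemann (g t) 4 4 1 1 (r *\<^sub>R e1) = - yy2 (r, t) / bb (r, t) * G 1 (r, t)" (is ?thesis5)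
    "riemann (g t) 2 2 3 3 (r *\<^sub>R e1) = ((cc (r, t))\<^sup>2 / (bb (r, t))^4 - yy (r, t) * zz (r, t) / (bb (r, t) * cc (r, t))) * G 3 (r, t)" (is ?thesis6)
    "riemann (g t) 3 3 2 2 (r *\<^sub>R e1) = ((cc (r, t))\<^sup>2 / (bb (r, t))^4 - yy (r, t) * zz (r, t) / (bb (r, t) * cc (r, t))) * G 2 (r, t)" (is ?thesis7)
    "riemann (g t) 4 4 2 2 (r *\<^sub>R e1) = ((cc (r, t))\<^sup>2 / (bb (r, t))^4 - yy (r, t) * zz (r, t) / (bb (r, t) * cc (r, t))) * G 2 (r, t)" (is ?thesis8)
    "riemann (g t) 4 4 3 3 (r *\<^sub>R e1) = ((4 - (yy (r, t))\<^sup>2) / (bb (r, t))\<^sup>2 - 3 * (cc (r, t))\<^sup>2 / (bb (r, t))^4) * G 3 (r, t)" (is ?thesis9)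
proof -
  interpret B: berger_metric "g t" "b t" "c t" using berger t by simp
  have EG: "B.E i = (\<lambda>r. G i (r, t))" for i using G_E[of t i] t by auto
  have E': "B.E' i = (\<lambda>r. dr (G i) (r, t))" for i
    unfolding B.E'_def EG using DERIV_imp_deriv[OF dr_D[OF G_smooth t]] by auto
  have E'': "B.E'' i = (\<lambda>r. dr (dr (G i)) (r, t))" for i
    unfolding B.E''_def E' using DERIV_imp_deriv[OF dr_D[OF dr_smooth[OF G_smooth] t]] by auto
  have h: "r > 0" "\<phi> (r, t) > 0" "bb (r, t) > 0" "cc (r, t) > 0" using bc_pos[OF t r] roots_pos[of t r] t r by auto
  note C = B.curvature_axis[OF h, unfolded EG E' E'', OF E_eqs[OF t r] G_dr[OF t r] G_drr[OF t r]]
  show ?thesis1 ?thesis2 ?thesis3 ?thesis4 ?thesis5 ?thesis6 ?thesis7 ?thesis8 ?thesis9 by (rule C)+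
qed

lemma uu_bc: "t < 0 \<Longrightarrow> r > 0 \<Longrightarrow> uu (r, t) = cc (r, t) / bb (r, t)"
  by (simp add: uu_def bb_def cc_def)

lemma sqrt_deriv_t:
  assumes "(h has_real_derivative 2 * h t * k) (at t)" "h t > 0"
  shows "((\<lambda>\<tau>. sqrt (h \<tau>)) has_real_derivative k * sqrt (h t)) (at t)"
proof -
  have "((\<lambda>\<tau>. sqrt (h \<tau>)) has_real_derivative inverse (sqrt (h t)) / 2 * (2 * h t * k)) (at t)"
    by (rule DERIV_chain2[OF DERIV_real_sqrt assms(1)]) (rule assms(2))
  moreover have "inverse (sqrt (h t)) / 2 * (2 * h t * k) = k * sqrt (h t)"
  proof -
    have "inverse (sqrt (h t)) * h t = sqrt (h t)" using assms(2) by (simp add: real_div_sqrt divide_inverse[symmetric] mult.commute)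
    moreover have "i / 2 * (2 * x * k) = i * x * k" for i x :: real by simp
    ultimately show ?thesis by (metis mult.commute)
  qed
  ultimately show ?thesis by (rule DERIV_cong)
qed

text \<open>The radial Ricci curvature is \<open>- 2 b_ss / b - c_ss / c\<close>. The resulting
  change of \<open>\<phi>\<close> is the commutator of time and arclength derivatives.\<close>

lemma phi_t: assumes t: "t < 0" and r: "r > 0"
  shows "((\<lambda>\<tau>. \<phi> (r, \<tau>)) has_real_derivative (2 * yy2 (r, t) / bb (r, t) + zz2 (r, t) / cc (r, t)) * \<phi> (r, t)) (at t)"
proof -
  have "((\<lambda>\<tau>. G 1 (r, \<tau>)) has_real_derivative 2 * G 1 (r, t) * (2 * yy2 (r, t) / bb (r, t) + zz2 (r, t) / cc (r, t))) (at t)"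
    by (rule DERIV_cong[OF G_t[OF t]]) (simp add: berger_metric.ricci_axis[OF berger[OF less_imp_le[OF t]]] curvature[OF t r] algebra_simps)
  from sqrt_deriv_t[OF this] show ?thesis using G_pos[of t] t by (simp add: \<phi>_def)
qed

lemma bb_t: assumes t: "t < 0" and r: "r > 0"
  shows "((\<lambda>\<tau>. bb (r, \<tau>)) has_real_derivative
     yy2 (r, t) + zz (r, t) * yy (r, t) / cc (r, t) + (yy (r, t))\<^sup>2 / bb (r, t) + (2 * (cc (r, t) / bb (r, t))\<^sup>2 - 4) / bb (r, t)) (at t)"
proof -
  define k where "k = yy2 (r, t) / bb (r, t) - (cc (r, t))\<^sup>2 / (bb (r, t))^4 + yy (r, t) * zz (r, t) / (bb (r, t) * cc (r, t))
     - ((4 - (yy (r, t))\<^sup>2) / (bb (r, t))\<^sup>2 - 3 * (cc (r, t))\<^sup>2 / (bb (r, t))^4)"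
  have "((\<lambda>\<tau>. G 3 (r, \<tau>)) has_real_derivative 2 * G 3 (r, t) * k) (at t)"
    by (rule DERIV_cong[OF G_t[OF t]]) (simp add: berger_metric.ricci_axis[OF berger[OF less_imp_le[OF t]]] curvature[OF t r] k_def diff_divide_distrib algebra_simps)
  from DERIV_cmult[OF sqrt_deriv_t[OF this], of r]
  have "((\<lambda>\<tau>. bb (r, \<tau>)) has_real_derivative k * bb (r, t)) (at t)"
    using G_pos[of t] t by (simp add: bb_def \<beta>_def mult.left_commute)
  moreover have "k * bb (r, t) = yy2 (r, t) + zz (r, t) * yy (r, t) / cc (r, t) + (yy (r, t))\<^sup>2 / bb (r, t) + (2 * (cc (r, t) / bb (r, t))\<^sup>2 - 4) / bb (r, t)"
    using bc_pos[OF t r] by (simp add: k_def divide_simps) algebra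
  ultimately show ?thesis by simp
qed

lemma cc_t: assumes t: "t < 0" and r: "r > 0"
  shows "((\<lambda>\<tau>. cc (r, \<tau>)) has_real_derivative
     zz2 (r, t) + 2 * yy (r, t) * zz (r, t) / bb (r, t) - 2 * (cc (r, t) / bb (r, t))^3 / bb (r, t)) (at t)"
proof -
  define k where "k = zz2 (r, t) / cc (r, t) - 2 * ((cc (r, t))\<^sup>2 / (bb (r, t))^4 - yy (r, t) * zz (r, t) / (bb (r, t) * cc (r, t)))"
  have "((\<lambda>\<tau>. G 2 (r, \<tau>)) has_real_derivative 2 * G 2 (r, t) * k) (at t)"
    by (rule DERIV_cong[OF G_t[OF t]]) (simp add: berger_metric.ricci_axis[OF berger[OF less_imp_le[OF t]]] curvature[OF t r] k_def algebra_simps)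
  from DERIV_cmult[OF sqrt_deriv_t[OF this], of r]
  have "((\<lambda>\<tau>. cc (r, \<tau>)) has_real_derivative k * cc (r, t)) (at t)"
    using G_pos[of t] t by (simp add: cc_def \<gamma>_def mult.left_commute)
  moreover have "k * cc (r, t) = zz2 (r, t) + 2 * yy (r, t) * zz (r, t) / bb (r, t) - 2 * (cc (r, t) / bb (r, t))^3 / bb (r, t)"
    using bc_pos[OF t r] by (simp add: k_def divide_simps) algebra
  ultimately show ?thesis by simp
qed

text \<open>Time and radial derivatives commute, so the time derivative of
  \<open>F_s = F_r / \<phi>\<close> is the arclength derivative of \<open>F_t\<close> minus
  \<open>F_s\<close> times the logarithmic rate of \<open>\<phi>\<close>.\<close>

lemma quotient_t:
  assumes t: "t < 0" and r: "r > 0" and F: "smooth_on past F"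
    and Ft: "\<And>r. r > 0 \<Longrightarrow> ((\<lambda>\<tau>. F (r, \<tau>)) has_real_derivative h r) (at t)"
    and hr: "(h has_real_derivative \<phi> (r, t) * h') (at r)"
  shows "((\<lambda>\<tau>. dr F (r, \<tau>) / \<phi> (r, \<tau>)) has_real_derivative
     h' - dr F (r, t) / \<phi> (r, t) * (2 * yy2 (r, t) / bb (r, t) + zz2 (r, t) / cc (r, t))) (at t)"
proof -
  have p: "\<phi> (r, t) > 0" using roots_pos t by simp
  have "dt F (r, t) = h r" if "r > 0" for r using DERIV_unique[OF dt_D[OF F t] Ft[OF that]] .
  then have "((\<lambda>r. dt F (r, t)) has_real_derivative \<phi> (r, t) * h') (at r)"
    by (intro has_field_derivative_transform_within_open[OF hr, of "{0<..}"]) (use r in auto)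
  from DERIV_unique[OF dr_D[OF dt_smooth[OF F] t] this] have "dt (dr F) (r, t) = \<phi> (r, t) * h'"
    by (simp add: dt_dr_commute[OF F t])
  with dt_D[OF dr_smooth[OF F] t, of r] have "((\<lambda>\<tau>. dr F (r, \<tau>)) has_real_derivative \<phi> (r, t) * h') (at t)" by simp
  from DERIV_divide[OF this phi_t[OF t r]] p show ?thesis
    by (simp add: diff_divide_distrib ac_simps)
qed

end

text \<open>The arclength derivative of the speed of \<open>b\<close>, to be inserted into
  \<open>quotient_t\<close>; stated for abstract functions so that it is an identity of rational
  functions.\<close>

lemma b_speed_derivative:
  fixes B C Y Z Y2 Z2 :: "real \<Rightarrow> real"
  assumes d: "(B has_real_derivative p * Y r) (at r)" "(C has_real_derivative p * Z r) (at r)"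
      "(Y has_real_derivative p * Y2 r) (at r)" "(Z has_real_derivative p * Z2 r) (at r)"
      "(Y2 has_real_derivative p * Y3) (at r)"
    and pos: "B r > 0" "C r > 0"
  shows "((\<lambda>r. Y2 r + Z r * Y r / C r + (Y r)\<^sup>2 / B r + (2 * (C r / B r)\<^sup>2 - 4) / B r) has_real_derivative
    p * (Y3 + (Z2 r * Y r + Z r * Y2 r) / C r - (Z r)\<^sup>2 * Y r / (C r)\<^sup>2 + 2 * Y r * Y2 r / B r - (Y r)^3 / (B r)\<^sup>2
      + 4 * C r * Z r / (B r)^3 - 6 * (C r)\<^sup>2 * Y r / (B r)^4 + 4 * Y r / (B r)\<^sup>2)) (at r)"
proof -
  have nz: "B r \<noteq> 0" "C r \<noteq> 0" using pos by auto
  show ?thesis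
    apply (rule derivative_eq_intros d nz refl)+
    using nz by (simp add: divide_simps) algebra
qed

lemma c_speed_derivative:
  fixes B C Y Z Y2 Z2 :: "real \<Rightarrow> real"
  assumes d: "(B has_real_derivative p * Y r) (at r)" "(C has_real_derivative p * Z r) (at r)"
      "(Y has_real_derivative p * Y2 r) (at r)" "(Z has_real_derivative p * Z2 r) (at r)"
      "(Z2 has_real_derivative p * Z3) (at r)"
    and pos: "B r > 0" "C r > 0"
  shows "((\<lambda>r. Z2 r + 2 * Y r * Z r / B r - 2 * (C r / B r)^3 / B r) has_real_derivative
    p * (Z3 + 2 * (Y2 r * Z r + Y r * Z2 r) / B r - 2 * (Y r)\<^sup>2 * Z r / (B r)\<^sup>2
      - 6 * (C r)\<^sup>2 * Z r / (B r)^4 + 8 * (C r)^3 * Y r / (B r)^5)) (at r)"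
proof -
  have nz: "B r \<noteq> 0" "C r \<noteq> 0" using pos by auto
  show ?thesis
    apply (rule derivative_eq_intros d nz refl)+
    using nz by (simp add: divide_simps) algebra
qed

context class_A_flow
begin

lemma r_derivs':
  assumes "t < 0"
  shows "((\<lambda>r. bb (r, t)) has_real_derivative \<phi> (r, t) * yy (r, t)) (at r)"
    "((\<lambda>r. cc (r, t)) has_real_derivative \<phi> (r, t) * zz (r, t)) (at r)"
    "((\<lambda>r. yy (r, t)) has_real_derivative \<phi> (r, t) * yy2 (r, t)) (at r)"
    "((\<lambda>r. zz (r, t)) has_real_derivative \<phi> (r, t) * zz2 (r, t)) (at r)"
    "((\<lambda>r. yy2 (r, t)) has_real_derivative \<phi> (r, t) * yy3 (r, t)) (at r)"
    "((\<lambda>r. zz2 (r, t)) has_real_derivative \<phi> (r, t) * zz3 (r, t)) (at r)"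
  using r_derivs[OF assms] unfolding phi_dr[OF assms] by blast+

lemma yy_t:
  assumes t: "t < 0" and r: "r > 0"
  shows "((\<lambda>\<tau>. yy (r, \<tau>)) has_real_derivative
      yy3 (r, t) + zz (r, t) / cc (r, t) * yy2 (r, t) - (zz (r, t))\<^sup>2 * yy (r, t) / (cc (r, t))\<^sup>2 - (yy (r, t))^3 / (bb (r, t))\<^sup>2
        + (4 - 6 * (uu (r, t))\<^sup>2) * yy (r, t) / (bb (r, t))\<^sup>2 + 4 * uu (r, t) * zz (r, t) / (bb (r, t))\<^sup>2) (at t)"
proof -
  have eq: "Y3 + (Z2 * Y + Z * Y2) / C - Z\<^sup>2 * Y / C\<^sup>2 + 2 * Y * Y2 / B - Y^3 / B\<^sup>2
      + 4 * C * Z / B^3 - 6 * C\<^sup>2 * Y / B^4 + 4 * Y / B\<^sup>2 - Y * (2 * Y2 / B + Z2 / C)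
    = Y3 + Z / C * Y2 - Z\<^sup>2 * Y / C\<^sup>2 - Y^3 / B\<^sup>2 + (4 - 6 * (C / B)\<^sup>2) * Y / B\<^sup>2 + 4 * (C / B) * Z / B\<^sup>2"
    if "B > 0" "C > 0" for B C Y Z Y2 Z2 Y3 :: real
    using that by (simp add: divide_simps) algebra
  show ?thesis
    unfolding yy_def[of "(r, _)"]
    by (rule DERIV_cong[OF quotient_t[OF t r bc_smooth(1) bb_t[OF t]
        b_speed_derivative[where B = "\<lambda>r. bb (r, t)" and C = "\<lambda>r. cc (r, t)" and Y = "\<lambda>r. yy (r, t)" and Z = "\<lambda>r. zz (r, t)"
        and ?Y2.0 = "\<lambda>r. yy2 (r, t)" and ?Z2.0 = "\<lambda>r. zz2 (r, t)" and p = "\<phi> (r, t)" and r = r, OF r_derivs'(1-5)[OF t] bc_pos[OF t r]]]])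
      (simp_all only: uu_bc[OF t r] eq[OF bc_pos[OF t r]] yy_def[symmetric])
qed

lemma zz_t:
  assumes t: "t < 0" and r: "r > 0"
  shows "((\<lambda>\<tau>. zz (r, \<tau>)) has_real_derivative
      zz3 (r, t) + (2 * yy (r, t) / bb (r, t) - zz (r, t) / cc (r, t)) * zz2 (r, t) - 2 * (yy (r, t))\<^sup>2 * zz (r, t) / (bb (r, t))\<^sup>2
        - 6 * (uu (r, t))\<^sup>2 * zz (r, t) / (bb (r, t))\<^sup>2 + 8 * (uu (r, t))^3 * yy (r, t) / (bb (r, t))\<^sup>2) (at t)"
proof -
  have eq: "Z3 + 2 * (Y2 * Z + Y * Z2) / B - 2 * Y\<^sup>2 * Z / B\<^sup>2 - 6 * C\<^sup>2 * Z / B^4 + 8 * C^3 * Y / B^5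
      - Z * (2 * Y2 / B + Z2 / C)
    = Z3 + (2 * Y / B - Z / C) * Z2 - 2 * Y\<^sup>2 * Z / B\<^sup>2 - 6 * (C / B)\<^sup>2 * Z / B\<^sup>2 + 8 * (C / B)^3 * Y / B\<^sup>2"
    if "B > 0" "C > 0" for B C Y Z Y2 Z2 Z3 :: real
    using that by (simp add: divide_simps) algebra
  show ?thesis
    unfolding zz_def[of "(r, _)"]
    by (rule DERIV_cong[OF quotient_t[OF t r bc_smooth(2) cc_t[OF t]
        c_speed_derivative[where B = "\<lambda>r. bb (r, t)" and C = "\<lambda>r. cc (r, t)" and Y = "\<lambda>r. yy (r, t)" and Z = "\<lambda>r. zz (r, t)"
        and ?Y2.0 = "\<lambda>r. yy2 (r, t)" and ?Z2.0 = "\<lambda>r. zz2 (r, t)" and p = "\<phi> (r, t)" and r = r, OF r_derivs'(1-4,6)[OF t] bc_pos[OF t r]]]])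
      (simp_all only: uu_bc[OF t r] eq[OF bc_pos[OF t r]] zz_def[symmetric])
qed

section \<open>The defining conditions of the class in the radial coordinate\<close>

lemma coefficients_bc:
  assumes "t \<le> 0" "r > 0"
  shows "b t (berger_metric.rho (g t) r) = bb (r, t)" "c t (berger_metric.rho (g t) r) = cc (r, t)"
  using berger_metric.coefficients[OF berger[OF assms(1)] assms(2)] G_E[OF assms(1)]
  by (simp_all add: bb_def cc_def \<beta>_def \<gamma>_def)

lemma ds_bc:
  assumes t: "t < 0" and r: "r > 0"
  shows "ds (b t) (berger_metric.rho (g t) r) = yy (r, t)" "ds (c t) (berger_metric.rho (g t) r) = zz (r, t)"
proof -
  have t': "t \<le> 0" using t by simp
  have p: "sqrt (berger_metric.E (g t) 1 r) = \<phi> (r, t)" "\<phi> (r, t) \<noteq> 0"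
    using G_E[OF t', of 1 r] roots_pos(1)[OF t', of r] by (auto simp: \<phi>_def)
  show "ds (b t) (berger_metric.rho (g t) r) = yy (r, t)"
    using berger_metric.ds_rho[OF berger[OF t'] r_derivs'(1)[OF t] coefficients_bc(1)[OF t'] r] p by simp
  show "ds (c t) (berger_metric.rho (g t) r) = zz (r, t)"
    using berger_metric.ds_rho[OF berger[OF t'] r_derivs'(2)[OF t] coefficients_bc(2)[OF t'] r] p by simp
qed

lemma rho_pos: "t \<le> 0 \<Longrightarrow> r > 0 \<Longrightarrow> berger_metric.rho (g t) r > 0"
  using berger_metric.rho_pos[OF berger] .

lemma uu_pos: "t < 0 \<Longrightarrow> uu (r, t) > 0"
  using roots_pos[of t r] by (simp add: uu_def)

lemma uu_le: "t < 0 \<Longrightarrow> r > 0 \<Longrightarrow> uu (r, t) \<le> 1"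
  using warped[of t] rho_pos[of t r] coefficients_bc[of t r] uu_bc[of t r]
  by (auto simp: warped_berger_metric_def)

lemma zz_ge: "t < 0 \<Longrightarrow> r > 0 \<Longrightarrow> zz (r, t) \<ge> 0"
  unfolding ds_bc(2)[symmetric]
  using monotone[of t] rho_pos[of t r] by (simp add: monotone_coefficients_def)

lemma cc_mono:
  assumes "t < 0" "0 < r" "r \<le> r'"
  shows "cc (r, t) \<le> cc (r', t)"
proof (rule DERIV_nonneg_imp_nondecreasing[OF assms(3)])
  fix x assume "r \<le> x" "x \<le> r'"
  then show "\<exists>y. ((\<lambda>r. cc (r, t)) has_real_derivative y) (at x) \<and> 0 \<le> y"
    using r_derivs'(2)[OF assms(1), of x] zz_ge[OF assms(1), of x] roots_pos(1)[of t x] assms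
    by (intro exI[of _ "\<phi> (x, t) * zz (x, t)"]) auto
qed

lemma cc_le: "t < 0 \<Longrightarrow> r > 0 \<Longrightarrow> cc (r, t) \<le> inverse m"
  using upper[of t "berger_metric.rho (g t) r"] rho_pos[of t r] coefficients_bc[of t r] by auto

lemma yy_ge: assumes "t < 0" "r > 0" shows "yy (r, t) \<ge> uu (r, t) * f (1 / uu (r, t))"
proof -
  have r: "bc_ratio (b t) (c t) (berger_metric.rho (g t) r) = 1 / uu (r, t)"
    using rho_pos[of t r] coefficients_bc[of t r] uu_bc[of t r] assms by (simp add: bc_ratio_def)
  show ?thesis
    using lower[of t "berger_metric.rho (g t) r"] rho_pos[of t r] ds_bc[of t r] assms unfolding r by (simp add: mult.commute)
qed

text \<open>At the origin \<open>\<phi> = \<beta> = \<gamma>\<close> by \<open>E_0\<close>, and the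
  derivative of \<open>r h\<close> at \<open>0\<close> is the value of \<open>h\<close> there. Since
  \<open>uu\<close> is even in \<open>r\<close>, its radial derivative vanishes.\<close>

lemma axis_values:
  assumes t: "t < 0"
  shows "bb (0, t) = 0" "yy (0, t) = 1" "zz (0, t) = 1" "uu (0, t) = 1" "vv (0, t) = 0"
proof -
  have t': "t \<le> 0" using t by simp
  have G0: "G 2 (0, t) = G 1 (0, t)" "G 3 (0, t) = G 1 (0, t)"
    using berger_metric.E_0[OF berger[OF t']] G_E[OF t'] by simp_all
  have p: "\<phi> (0, t) > 0" using roots_pos(1)[OF t'] .
  show "bb (0, t) = 0" by (simp add: bb_def)
  show u0: "uu (0, t) = 1" using p by (simp add: uu_def \<beta>_def \<gamma>_def G0 \<phi>_def)
  have d0: "((\<lambda>r. r * h (r, t)) has_real_derivative h (0, t)) (at 0)" if "smooth_on past h" for h :: "real \<times> real \<Rightarrow> real"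
    by (rule derivative_eq_intros dr_D[OF that t] refl)+ simp
  have "dr bb (0, t) = \<beta> (0, t)"
    using DERIV_unique[OF dr_D[OF bc_smooth(1) t]] d0[OF roots_smooth(2)] by (simp add: bb_def)
  then show "yy (0, t) = 1" using p by (simp add: yy_def \<beta>_def G0 \<phi>_def)
  have "dr cc (0, t) = \<gamma> (0, t)"
    using DERIV_unique[OF dr_D[OF bc_smooth(2) t]] d0[OF roots_smooth(3)] by (simp add: cc_def)
  then show "zz (0, t) = 1" using p by (simp add: zz_def \<gamma>_def G0 \<phi>_def)
  have even: "uu (- r, t) = uu (r, t)" for r
    using berger_metric.E_even[OF berger[OF t']] G_E[OF t'] by (simp add: uu_def \<beta>_def \<gamma>_def)
  have "((\<lambda>r. uu (- r, t)) has_real_derivative dr uu (0, t) * (- 1)) (at 0)"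
    by (rule DERIV_chain2[of "\<lambda>r. uu (r, t)"]) (use dr_D[OF uv_smooth(1) t, of 0] in \<open>auto intro!: derivative_eq_intros\<close>)
  from DERIV_unique[OF dr_D[OF uv_smooth(1) t, of 0] this[unfolded even]]
  have "dr uu (0, t) = 0" by linarith
  then show "vv (0, t) = 0" by (simp add: vv_def)
qed

lemma vv_eq: assumes t: "t < 0" and r: "r > 0"
  shows "vv (r, t) = zz (r, t) / cc (r, t) - yy (r, t) / bb (r, t)"
proof -
  note p = bc_pos[OF t r]
  have p': "\<phi> (r, t) > 0" using roots_pos(1) t by simp
  have nz: "bb (r, t) \<noteq> 0" using p by simp
  have "((\<lambda>r. cc (r, t) / bb (r, t)) has_real_derivative \<phi> (r, t) * (zz (r, t) / cc (r, t) - yy (r, t) / bb (r, t)) * (cc (r, t) / bb (r, t))) (at r)"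
    apply (rule derivative_eq_intros r_derivs'[OF t] nz refl)+
  proof -
    have "(P * Z * B - C * (P * Y)) / (B * B) = P * (Z / C - Y / B) * (C / B)" if "B > 0" "C > 0" for P Z B C Y :: real
    proof -
      have "P * (Z / C - Y / B) * (C / B) = P * ((Z * B - Y * C) / (C * B)) * (C / B)" using that by (simp add: diff_frac_eq)
      also have "\<dots> = P * (Z * B - Y * C) / (B * B)" using that by simp
      finally show ?thesis by (simp add: algebra_simps)
    qed
    from this[OF p] show "(\<phi> (r, t) * zz (r, t) * bb (r, t) - cc (r, t) * (\<phi> (r, t) * yy (r, t))) / (bb (r, t) * bb (r, t)) =
      \<phi> (r, t) * (zz (r, t) / cc (r, t) - yy (r, t) / bb (r, t)) * (cc (r, t) / bb (r, t))" .
  qed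
  then have "((\<lambda>r. uu (r, t)) has_real_derivative \<phi> (r, t) * (zz (r, t) / cc (r, t) - yy (r, t) / bb (r, t)) * (cc (r, t) / bb (r, t))) (at r)"
    by (rule has_field_derivative_transform_within_open[of _ _ _ "{0<..}"]) (use r uu_bc[OF t] in auto)
  from DERIV_unique[OF dr_D[OF uv_smooth(1) t] this] show ?thesis
    using p p' by (simp add: vv_def uu_bc[OF t r])
qed

text \<open>Since \<open>f\<close> has a positive lower bound \<open>l\<close>,
  \<open>(b^2)_s = 2 b b_s \<ge> 2 l b u = 2 l c\<close>, and \<open>c\<close> is nondecreasing. So
  \<open>b^2\<close> grows at least linearly in arclength, which is unbounded by
  completeness.\<close>

lemma bb_unbounded: assumes t: "t < 0" shows "filterlim (\<lambda>r. bb (r, t)) at_top at_top"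
proof -
  have t': "t \<le> 0" using t by simp
  interpret B: berger_metric "g t" "b t" "c t" using berger[OF t'] .
  obtain l where l: "l > 0" "\<And>x. x \<ge> 1 \<Longrightarrow> f x \<ge> l" using positive_lower_bound[OF f] by blast
  define k where "k = 2 * l * cc (1, t)"
  have k: "k > 0" using l bc_pos[OF t, of 1] by (simp add: k_def)
  have phi: "sqrt (B.E 1 r) = \<phi> (r, t)" for r using G_E[OF t', of 1 r] by (simp add: \<phi>_def)
  have bd: "(bb (r, t))\<^sup>2 \<ge> k * (B.rho r - B.rho 1)" if "r \<ge> 1" for r
  proof -
    have "(bb (1, t))\<^sup>2 - k * B.rho 1 \<le> (bb (r, t))\<^sup>2 - k * B.rho r"
    proof (rule DERIV_nonneg_imp_nondecreasing[OF that])
      fix x :: real assume x: "1 \<le> x" "x \<le> r"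
      then have x0: "x > 0" by simp
      note p = bc_pos[OF t x0]
      have u: "uu (x, t) > 0" "1 / uu (x, t) \<ge> 1" using uu_pos[OF t] uu_le[OF t x0] by auto
      have "bb (x, t) * yy (x, t) \<ge> bb (x, t) * (uu (x, t) * l)"
        using yy_ge[OF t x0] l(2)[OF u(2)] u(1) p by (intro mult_left_mono) (auto intro: order_trans[OF mult_left_mono])
      moreover have "bb (x, t) * (uu (x, t) * l) = cc (x, t) * l" using p by (simp add: uu_bc[OF t x0])
      moreover have "cc (x, t) * l \<ge> cc (1, t) * l" using cc_mono[OF t zero_less_one x(1)] l by simp
      moreover have "k = 2 * (cc (1, t) * l)" by (simp add: k_def)
      ultimately have "2 * (bb (x, t) * yy (x, t)) - k \<ge> 0" by linarith
      then have "\<phi> (x, t) * (2 * (bb (x, t) * yy (x, t)) - k) \<ge> 0" using roots_pos(1)[OF t', of x] by simp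
      moreover have "((\<lambda>r. (bb (r, t))\<^sup>2 - k * B.rho r) has_real_derivative \<phi> (x, t) * (2 * (bb (x, t) * yy (x, t)) - k)) (at x)"
        by (rule derivative_eq_intros r_derivs'[OF t] B.rho_deriv[OF x0] refl)+ (simp add: phi algebra_simps)
      ultimately show "\<exists>y. ((\<lambda>r. (bb (r, t))\<^sup>2 - k * B.rho r) has_real_derivative y) (at x) \<and> 0 \<le> y" by blast
    qed
    moreover have "k * (B.rho r - B.rho 1) = k * B.rho r - k * B.rho 1" by (rule right_diff_distrib)
    ultimately show ?thesis using zero_le_power2[of "bb (1, t)"] by linarith
  qed
  show ?thesis
    unfolding filterlim_at_top eventually_at_top_linorder
  proof
    fix Z :: real
    obtain R where R: "R > 0" "B.rho R > Z\<^sup>2 / k + B.rho 1" using B.rho_unbounded by blast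
    show "\<exists>N. \<forall>n\<ge>N. Z \<le> bb (n, t)"
    proof (intro exI allI impI)
      fix n assume n: "max R 1 \<le> n"
      have "B.rho R \<le> B.rho n" using B.rho_mono[of R n] R n by (cases "R = n") auto
      then have "Z\<^sup>2 / k \<le> B.rho n - B.rho 1" using R by simp
      then have "Z\<^sup>2 \<le> k * (B.rho n - B.rho 1)" using k by (simp add: pos_divide_le_eq mult.commute)
      also have "\<dots> \<le> (bb (n, t))\<^sup>2" using bd n by simp
      finally have "Z\<^sup>2 \<le> (bb (n, t))\<^sup>2" .
      moreover have "0 \<le> bb (n, t)" using bc_pos(1)[OF t, of n] n by simp
      ultimately show "Z \<le> bb (n, t)" by (rule power2_le_imp_le)
    qed
  qed
qed

text \<open>The bounds come from the sectional curvatures of the horizontal and of the mixed planes.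
  The contribution of \<open>c\<close> is dropped by sign in the former and estimated by
  \<open>c \<le> b\<close> in the latter.\<close>

lemma curvature_bounds:
  obtains K where "K \<ge> 0"
    "\<And>r t. r > 0 \<Longrightarrow> t < 0 \<Longrightarrow> (yy (r, t))\<^sup>2 \<le> 4 + K * (bb (r, t))\<^sup>2"
    "\<And>r t. r > 0 \<Longrightarrow> t < 0 \<Longrightarrow> yy (r, t) * zz (r, t) / (bb (r, t) * cc (r, t)) \<le> K + 1 / (bb (r, t))\<^sup>2"
proof -
  obtain K where K: "\<And>t x. t \<le> 0 \<Longrightarrow> curvature_norm (g t) x \<le> K"
    using bounded unfolding uniformly_bounded_curvature_def by blast
  have bd: "\<bar>k\<bar> \<le> K" if "riemann (g t) i i j j (r *\<^sub>R e1) = k * G j (r, t)" "r > 0" "t < 0" for i j k r t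
  proof -
    have t': "t \<le> 0" using that by simp
    have "\<bar>riemann (g t) i i j j (r *\<^sub>R e1)\<bar> / G j (r, t) \<le> K"
      using order_trans[OF berger_metric.curvature_norm_axis[OF berger[OF t'] that(2)] K[OF t']] G_E[OF t'] by simp
    then show ?thesis using G_pos[OF t', of j r] by (simp add: that(1) abs_mult)
  qed
  show thesis
  proof (rule that)
    show "K \<ge> 0" using bd[OF curvature(9)[of "-1" 1]] by linarith
    fix r t :: real assume r: "r > 0" and t: "t < 0"
    note p = bc_pos[OF t r]
    have cb: "cc (r, t) \<le> bb (r, t)" using uu_le[OF t r] p by (simp add: uu_bc[OF t r])
    define q where "q = 3 * (cc (r, t))\<^sup>2 / (bb (r, t))^4"
    have q: "q \<ge> 0" by (simp add: q_def)
    have "(4 - (yy (r, t))\<^sup>2) / (bb (r, t))\<^sup>2 \<ge> - K"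
      using bd[OF curvature(9)[OF t r] r t] q unfolding q_def[symmetric] by linarith
    then show "(yy (r, t))\<^sup>2 \<le> 4 + K * (bb (r, t))\<^sup>2"
      using p by (simp add: pos_le_divide_eq)
    have "(cc (r, t))\<^sup>2 / (bb (r, t))^4 \<le> (bb (r, t))\<^sup>2 / (bb (r, t))^4"
      using cb p by (intro divide_right_mono power_mono) auto
    also have "\<dots> = 1 / (bb (r, t))\<^sup>2" using p by (simp add: divide_simps power2_eq_square eval_nat_numeral)
    finally show "yy (r, t) * zz (r, t) / (bb (r, t) * cc (r, t)) \<le> K + 1 / (bb (r, t))\<^sup>2"
      using bd[OF curvature(6)[OF t r] r t] by linarith
  qed
qed

lemma rigidity:
  assumes "r > 0" "t < 0"
  shows "yy (r, t) = 2 - uu (r, t)" "zz (r, t) = (uu (r, t))\<^sup>2"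
proof -
  obtain K where K: "K \<ge> 0"
    "\<And>r t. r > 0 \<Longrightarrow> t < 0 \<Longrightarrow> (yy (r, t))\<^sup>2 \<le> 4 + K * (bb (r, t))\<^sup>2"
    "\<And>r t. r > 0 \<Longrightarrow> t < 0 \<Longrightarrow> yy (r, t) * zz (r, t) / (bb (r, t) * cc (r, t)) \<le> K + 1 / (bb (r, t))\<^sup>2"
    using curvature_bounds by blast
  have cont: "continuous_on ({0..} \<times> {..<0}) (\<lambda>(r, t). h (r, t))" if "smooth_on past h" for h :: "real \<times> real \<Rightarrow> real"
    unfolding case_prod_eta by (rule continuous_on_subset[OF smooth_past_cont[OF that]]) auto
  interpret berger_pde "\<lambda>r t. \<phi> (r, t)" "\<lambda>r t. bb (r, t)" "\<lambda>r t. cc (r, t)" "\<lambda>r t. uu (r, t)" "\<lambda>r t. vv (r, t)"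
    "\<lambda>r t. yy (r, t)" "\<lambda>r t. zz (r, t)" "\<lambda>r t. yy2 (r, t)" "\<lambda>r t. zz2 (r, t)" "\<lambda>r t. yy3 (r, t)" "\<lambda>r t. zz3 (r, t)"
    f "inverse m" K
    using roots_pos(1) bc_pos
    by unfold_locales ((rule yy_t zz_t yy_ge uu_le uu_bc; assumption)
      | simp only: uu_bc r_derivs' bb_t cc_t vv_eq cont bc_smooth yz_smooth uv_smooth axis_values
        zz_ge cc_le f K bb_unbounded less_imp_le)+
  show "yy (r, t) = 2 - uu (r, t)" "zz (r, t) = (uu (r, t))\<^sup>2" using rigidity assms by auto
qed

end

section \<open>Isometry with the Taub-NUT metric\<close>

lemma ip_taub_nut:
  assumes "k > 0"
  shows "ip (taub_nut (1 / k)) p v w = (p \<bullet> p + 2 * k) / 4 * (v \<bullet> w)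
    - (p \<bullet> p + 4 * k) / (4 * (p \<bullet> p + 2 * k)) * ((X3 p \<bullet> v) * (X3 p \<bullet> w))"
proof -
  have eq: "v \<bullet> ((\<chi> i j. a * (if i = j then 1 else 0) - d * X $ i * X $ j) *v w) = a * (v \<bullet> w) - d * ((X \<bullet> v) * (X \<bullet> w))"
    for a d and X :: "real^4"
    by (simp add: inner_4 matrix_vector_mult_def sum_4) (simp add: algebra_simps)
  have k: "2 / (1 / k) = 2 * k" "4 / (1 / k) = 4 * k" by simp_all
  show ?thesis
    unfolding ip_def taub_nut_closed_form[of "1 / k" p, OF divide_pos_pos[OF zero_less_one assms]] k eq ..
qed

text \<open>\<open>N\<close> is the Taub-NUT radial coordinate and \<open>\<psi>\<close> the factor of the radial map realising it.\<close>

lemma taub_nut_profile: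
  fixes B C k r E1 \<psi> \<psi>' N :: real
  assumes pos: "B > 0" "C > 0" "k > 0" "r > 0"
    and rel: "B * (k\<^sup>2 - C\<^sup>2) = C * k\<^sup>2" and N: "N = 2 * B * C / k"
    and \<psi>: "\<psi>\<^sup>2 = N / r\<^sup>2" and d: "r * \<psi> * (\<psi> + r * \<psi>') = 2 * C * p / k" "p\<^sup>2 = E1"
  shows "(N + 2 * k) / 4 * (\<psi>\<^sup>2 * vw + (2 * \<psi> * \<psi>' / r + \<psi>'\<^sup>2) * P) - (N + 4 * k) / (4 * (N + 2 * k)) * ((\<psi>\<^sup>2)\<^sup>2 * X)
    = E1 * P / r\<^sup>2 + B\<^sup>2 / r\<^sup>2 * (r\<^sup>2 * vw - P - X) / r\<^sup>2 + C\<^sup>2 / r\<^sup>2 * X / r\<^sup>2"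
proof -
  have Np: "N > 0" using pos by (simp add: N)
  have Nk: "N * k = 2 * B * C" using pos by (simp add: N)
  \<comment> \<open>\<open>f1\<close>, \<open>f2\<close> and \<open>f3\<close> say that fibre, base
    and radial coefficient are those of the Taub-NUT metric at the coordinate \<open>N\<close>:
    \<open>C^2 = k^2 / (1 + 2 k / N)\<close>, \<open>4 B^2 = N^2 (1 + 2 k / N)\<close>, and
    \<open>E1\<close> is \<open>(N + 2 k) / 4\<close> times the squared derivative of
    \<open>r \<psi>\<close>.\<close>
  have f1: "C\<^sup>2 * (N + 2 * k) = k\<^sup>2 * N"
  proof -
    have "k * (C\<^sup>2 * (N + 2 * k)) = k * (k\<^sup>2 * N)" using Nk rel by algebra
    then show ?thesis using pos by simp
  qed
  have f2: "4 * B\<^sup>2 = N * (N + 2 * k)"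
  proof -
    have "k\<^sup>2 * (4 * B\<^sup>2) = k\<^sup>2 * (N * (N + 2 * k))" using Nk rel by algebra
    then show ?thesis using pos by simp
  qed
  have r\<psi>: "r\<^sup>2 * \<psi>\<^sup>2 = N" using \<psi> pos by simp
  have kd: "k * (r * \<psi> * (\<psi> + r * \<psi>')) = 2 * C * p" using d(1) pos by simp
  have f3: "(N + 2 * k) * (\<psi> + r * \<psi>')\<^sup>2 = 4 * E1"
  proof -
    have "k\<^sup>2 * (N * (\<psi> + r * \<psi>')\<^sup>2) = 4 * C\<^sup>2 * E1" using kd d(2) r\<psi> by algebra
    then have "k\<^sup>2 * N * ((N + 2 * k) * (\<psi> + r * \<psi>')\<^sup>2) = k\<^sup>2 * N * (4 * E1)" using f1 by algebra
    moreover have "k\<^sup>2 * N \<noteq> 0" using pos Np by simp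
    ultimately show ?thesis by simp
  qed
  define a where "a = (N + 2 * k) / 4"
  have a: "a > 0" "N + 2 * k = 4 * a" using Np pos by (simp_all add: a_def)
  have e3: "B\<^sup>2 / r\<^sup>2 = a * \<psi>\<^sup>2" using f2 a \<psi> by simp
  have e1: "E1 = a * (\<psi> + r * \<psi>')\<^sup>2" using f3 a by simp
  have t1: "a * ((2 * \<psi> * \<psi>' / r + \<psi>'\<^sup>2) * P) = (E1 - a * \<psi>\<^sup>2) * P / r\<^sup>2"
    unfolding e1 using pos by (simp add: divide_simps) algebra
  have e2: "C\<^sup>2 / r\<^sup>2 - a * \<psi>\<^sup>2 = - (N + 4 * k) / (4 * (N + 2 * k)) * (\<psi>\<^sup>2 * N)"
  proof -
    have "4 * (N + 2 * k) * (C\<^sup>2 - B\<^sup>2) = - (N + 4 * k) * N * N" using f1 f2 by algebra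
    then have "C\<^sup>2 - B\<^sup>2 = - (N + 4 * k) / (4 * (N + 2 * k)) * (N * N)" using Np pos by (simp add: eq_divide_eq mult.commute)
    then have "(C\<^sup>2 - B\<^sup>2) / r\<^sup>2 = - (N + 4 * k) / (4 * (N + 2 * k)) * (\<psi>\<^sup>2 * N)" by (simp add: \<psi>)
    then show ?thesis by (simp add: diff_divide_distrib e3)
  qed
  have "C\<^sup>2 / r\<^sup>2 * X / r\<^sup>2 - a * \<psi>\<^sup>2 * X / r\<^sup>2 = - (N + 4 * k) / (4 * (N + 2 * k)) * (\<psi>\<^sup>2 * N) * X / r\<^sup>2"
    unfolding e2[symmetric] by (simp add: left_diff_distrib diff_divide_distrib)
  also have "\<dots> = - (N + 4 * k) / (4 * (N + 2 * k)) * ((\<psi>\<^sup>2)\<^sup>2 * X)"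
  proof -
    have "\<psi>\<^sup>2 * N / r\<^sup>2 = (\<psi>\<^sup>2)\<^sup>2" unfolding \<psi> by (simp add: power2_eq_square)
    moreover have "q * (\<psi>\<^sup>2 * N) * X / r\<^sup>2 = q * ((\<psi>\<^sup>2 * N / r\<^sup>2) * X)" for q by simp
    ultimately show ?thesis by (simp only:)
  qed
  finally have t2: "- ((N + 4 * k) / (4 * (N + 2 * k)) * ((\<psi>\<^sup>2)\<^sup>2 * X)) = C\<^sup>2 / r\<^sup>2 * X / r\<^sup>2 - a * \<psi>\<^sup>2 * X / r\<^sup>2"
    by (simp only: minus_divide_left[symmetric] minus_mult_left[symmetric])
  have t3: "a * \<psi>\<^sup>2 * (r\<^sup>2 * vw - P - X) / r\<^sup>2 = a * \<psi>\<^sup>2 * vw - a * \<psi>\<^sup>2 * P / r\<^sup>2 - a * \<psi>\<^sup>2 * X / r\<^sup>2"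
    using pos by (simp add: right_diff_distrib diff_divide_distrib)
  have t4: "(E1 - a * \<psi>\<^sup>2) * P / r\<^sup>2 = E1 * P / r\<^sup>2 - a * \<psi>\<^sup>2 * P / r\<^sup>2" by (simp add: left_diff_distrib diff_divide_distrib)
  have "a * (\<psi>\<^sup>2 * vw + (2 * \<psi> * \<psi>' / r + \<psi>'\<^sup>2) * P) = a * \<psi>\<^sup>2 * vw + a * ((2 * \<psi> * \<psi>' / r + \<psi>'\<^sup>2) * P)"
    by (simp add: distrib_left)
  then show ?thesis unfolding a_def[symmetric] e3 t3 using t1 t2 t4 by linarith
qed

text \<open>The map acts on radii by the odd increasing bijection \<open>h r = r \<psi> r\<close>.
  Its inverse \<open>R\<close> is smooth and odd, so \<open>R y = y S y\<close> with an even smooth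
  \<open>S\<close>, and the inverse map is \<open>p \<mapsto> S (norm p) p\<close>, smooth also at
  the origin.\<close>

lemma radial_diffeomorphism:
  fixes \<psi> :: "real \<Rightarrow> real"
  assumes \<psi>: "smooth_on UNIV \<psi>" "\<And>r. \<psi> (- r) = \<psi> r" "\<And>r. \<psi> r > 0"
    and h': "\<And>r. r > 0 \<Longrightarrow> \<psi> r + r * deriv \<psi> r > 0"
    and h: "\<And>Z. \<exists>r>0. r * \<psi> r > Z"
  shows "bij (\<lambda>x :: real^'n. \<psi> (norm x) *\<^sub>R x)" "smooth_on UNIV (inv (\<lambda>x :: real^'n. \<psi> (norm x) *\<^sub>R x))"
proof -
  let ?\<Phi> = "\<lambda>x :: real^'n. \<psi> (norm x) *\<^sub>R x"
  define h where "h r = r * \<psi> r" for r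
  have hs: "smooth_on UNIV h" unfolding h_def[abs_def] by (intro smooth \<psi>)
  have hodd: "h (- r) = - h r" for r by (simp add: h_def \<psi>)
  have hd: "deriv h r = \<psi> r + r * deriv \<psi> r" for r
    unfolding h_def[abs_def]
    by (rule DERIV_imp_deriv) (rule derivative_eq_intros smooth_on_realD(1)[OF \<psi>(1)] refl | simp)+
  have dpos: "deriv h r > 0" for r
  proof -
    consider "r > 0" | "r = 0" | "r < 0" by linarith
    then show ?thesis
    proof cases
      case 1 then show ?thesis using h' hd by simp
    next
      case 2 then show ?thesis using hd \<psi>(3) by simp
    next
      case 3
      then have "deriv h (- r) > 0" using h'[of "- r"] hd by simp
      then show ?thesis using deriv_odd[OF hs hodd, of r] by simp
    qed
  qed
  have mono: "strict_mono h"
    by (rule strict_monoI, rule DERIV_pos_imp_increasing) (use smooth_on_realD(1)[OF hs] dpos in blast)+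
  have inj: "h x = h y \<longleftrightarrow> x = y" for x y using strict_mono_eq[OF mono] .
  have "\<exists>x. h x = y" for y
  proof -
    have pos: "\<exists>x. h x = y" if "y \<ge> 0" for y
    proof -
      obtain Z where Z: "Z > 0" "h Z > y" using h[of y] by (auto simp: h_def)
      have "\<exists>x\<ge>0. x \<le> Z \<and> h x = y"
        by (rule IVT') (use Z that in \<open>auto simp: h_def[of 0] intro: continuous_on_subset[OF smooth_on_continuous_on[OF hs]]\<close>)
      then show ?thesis by blast
    qed
    show ?thesis
    proof (cases "y \<ge> 0")
      case True then show ?thesis using pos by blast
    next
      case False
      then obtain x where "h x = - y" using pos[of "- y"] by auto
      then have "h (- x) = y" by (simp add: hodd)
      then show ?thesis ..
    qed
  qed
  then obtain R where R: "\<And>y. h (R y) = y" by metis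
  have Rh: "R (h x) = x" for x using R[of "h x"] inj by simp
  have Rs: "smooth_on UNIV R" by (rule smooth_on_inverse_function[OF hs dpos R])
  have Rodd: "R (- y) = - R y" for y using R[of "- y"] hodd[of "R y"] R[of y] inj by metis
  obtain S where S: "smooth_on UNIV S" "\<And>y. S (- y) = S y" "\<And>y. R y = y * S y"
    using odd_quotient[OF Rs Rodd] by metis
  let ?\<Psi> = "\<lambda>p :: real^'n. S (norm p) *\<^sub>R p"
  have \<psi>abs: "\<psi> \<bar>x\<bar> = \<psi> x" for x using \<psi>(2)[of x] by (cases "x \<ge> 0") auto
  have 1: "?\<Phi> (?\<Psi> p) = p" for p
  proof (cases "p = 0")
    case False
    have "norm (?\<Psi> p) = \<bar>R (norm p)\<bar>" by (simp add: S(3) abs_mult)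
    then have "\<psi> (norm (?\<Psi> p)) = \<psi> (R (norm p))" using \<psi>abs by simp
    moreover have "norm p * (\<psi> (R (norm p)) * S (norm p)) = norm p"
      using R[of "norm p"] S(3)[of "norm p"] by (simp add: h_def ac_simps)
    then have "\<psi> (R (norm p)) * S (norm p) = 1" using False by simp
    ultimately show ?thesis by simp
  qed simp
  have 2: "?\<Psi> (?\<Phi> x) = x" for x
  proof (cases "x = 0")
    case False
    have "norm (?\<Phi> x) = h (norm x)" using \<psi>(3)[of "norm x"] by (simp add: h_def)
    moreover have "norm x * (S (h (norm x)) * \<psi> (norm x)) = norm x"
      using Rh[of "norm x"] S(3)[of "h (norm x)"] by (simp add: h_def ac_simps)
    then have "S (h (norm x)) * \<psi> (norm x) = 1" using False by simp
    ultimately show ?thesis by simp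
  qed simp
  have "?\<Phi> \<circ> ?\<Psi> = id" "?\<Psi> \<circ> ?\<Phi> = id" unfolding fun_eq_iff o_apply id_apply using 1 2 by blast+
  then show "bij ?\<Phi>" by (rule o_bij[rotated])
  have "inv ?\<Phi> = ?\<Psi>" by (rule inv_equality) (use 1 2 in blast)+
  then show "smooth_on UNIV (inv ?\<Phi>)" using S by (simp add: smooth_on_scaleR smooth_on_even_norm smooth_on_id)
qed

lemma radial_derivative:
  fixes \<psi> :: "real \<Rightarrow> real" and x :: "real^'n"
  assumes \<psi>: "smooth_on UNIV \<psi>" "\<And>r. \<psi> (- r) = \<psi> r"
  shows "frechet_derivative (\<lambda>x. \<psi> (norm x) *\<^sub>R x) (at x) v
    = \<psi> (norm x) *\<^sub>R v + (if x = 0 then 0 else deriv \<psi> (norm x) * (x \<bullet> v) / norm x) *\<^sub>R x"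
proof (cases "x = 0")
  case True
  have s: "smooth_on UNIV (\<lambda>x :: real^'n. \<psi> (norm x))" by (rule smooth_on_even_norm[OF \<psi>])
  obtain F' where F': "\<And>x. x \<in> UNIV \<Longrightarrow> ((\<lambda>x :: real^'n. \<psi> (norm x)) has_derivative F' x) (at x within UNIV)"
      "\<And>v. Ck_on 0 UNIV (\<lambda>x. F' x v)"
    using Ck_on_SucE[OF smooth_on_Ck[OF s, of "Suc 0"]] by blast
  have "((\<lambda>x. \<psi> (norm x) *\<^sub>R x) has_derivative (\<lambda>v. \<psi> (norm x) *\<^sub>R v + F' x v *\<^sub>R x)) (at x)"
    by (rule has_derivative_scaleR[OF F'(1)[OF UNIV_I] has_derivative_ident])
  from fun_cong[OF frechet_derivative_at[OF this], of v, symmetric]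
  show ?thesis unfolding True by (simp only: scaleR_zero_right)
next
  case False
  have "(norm has_derivative (\<lambda>v. x \<bullet> v / norm x)) (at x)"
    using has_derivative_norm[OF False] by (simp add: sgn_div_norm inner_commute divide_inverse mult.commute)
  from diff_chain_at[OF this smooth_on_realD(1)[OF \<psi>(1), of "norm x", unfolded has_field_derivative_def]]
  have "((\<lambda>x. \<psi> (norm x)) has_derivative (\<lambda>v. deriv \<psi> (norm x) * (x \<bullet> v / norm x))) (at x)" by (simp only: o_def)
  from has_derivative_scaleR[OF this has_derivative_ident]
  have "((\<lambda>x. \<psi> (norm x) *\<^sub>R x) has_derivative (\<lambda>v. \<psi> (norm x) *\<^sub>R v + (deriv \<psi> (norm x) * (x \<bullet> v / norm x)) *\<^sub>R x)) (at x)" .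
  from fun_cong[OF frechet_derivative_at[OF this], of v, symmetric]
  show ?thesis by (simp only: False if_False times_divide_eq_right)
qed

context berger_metric
begin

lemma ip_E:
  assumes "x \<noteq> 0"
  defines "r \<equiv> norm x"
  shows "ip g x v w = E 1 r * ((x \<bullet> v) * (x \<bullet> w)) / r\<^sup>2
    + E 3 r * (r\<^sup>2 * (v \<bullet> w) - (x \<bullet> v) * (x \<bullet> w) - (X3 x \<bullet> v) * (X3 x \<bullet> w)) / r\<^sup>2
    + E 2 r * ((X3 x \<bullet> v) * (X3 x \<bullet> w)) / r\<^sup>2"
proof -
  have r: "r > 0" using assms by simp
  have f: "r\<^sup>2 * (v \<bullet> w) - (x \<bullet> v) * (x \<bullet> w) - (X3 x \<bullet> v) * (X3 x \<bullet> w) = (X1 x \<bullet> v) * (X1 x \<bullet> w) + (X2 x \<bullet> v) * (X2 x \<bullet> w)"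
    using frame_identity[of x v w] by (simp add: r_def power2_norm_eq_inner)
  show ?thesis
    unfolding ip_form[OF assms(1)] E_vals[OF r] f r_def[symmetric]
    by (simp add: power2_eq_square power4_eq_xxxx)
qed

text \<open>The entries are limits along the ray, where the metric is diagonal, and the four
  eigenvalues coincide at the origin.\<close>

lemma ip_origin: "ip g 0 v w = E 1 0 * (v \<bullet> w)"
proof -
  have "g 0 $ i $ j = E 1 0 * (if i = j then 1 else 0)" for i j
  proof -
    have "smooth_on UNIV (\<lambda>r. g (r *\<^sub>R e1 + 0) $ i $ j)"
      using g unfolding riemannian_metric_def
      by (intro smooth_on_vec_nth[of _ "\<lambda>r. g (r *\<^sub>R e1 + 0)"] smooth_on_vec_nth[of _ "\<lambda>r. g (r *\<^sub>R e1 + 0) $ i"] smooth_on_comp_affine[where L = "\<lambda>r. r *\<^sub>R e1" and p = 0 and T = UNIV] bounded_linear_scaleR_left) auto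
    then have s: "smooth_on UNIV (\<lambda>r. g (r *\<^sub>R e1) $ i $ j - E i r * dl i j)"
      by (intro smooth_on_diff smooth_on_mult smooth_on_const E_smooth) simp
    have "g (0 *\<^sub>R e1) $ i $ j - E i 0 * dl i j = 0"
      by (rule continuous_constant_on_closure[where S = "{0<..}"])
        (use metric_axis smooth_on_continuous_on[OF s] in \<open>auto intro: continuous_on_subset\<close>)
    moreover have "E i 0 = E 1 0" using exhaust_4[of i] E_0 E4[of 0] by auto
    ultimately show ?thesis by simp
  qed
  then show ?thesis by (simp add: ip_def inner_4 matrix_vector_mult_def sum_4) (simp add: algebra_simps)
qed

text \<open>For the Taub-NUT metric with \<open>k = 1 / \<mu>\<close> one has
  \<open>b^2 = x (x + 2 k) / 4\<close> and \<open>c^2 = k^2 x / (x + 2 k)\<close>, so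
  \<open>b c = k x / 2\<close>. This dictates the coordinate \<open>x = 2 B C / k\<close>, realised
  as the squared norm of the image point. It increases because \<open>(b c)_s = 2 c\<close>, and
  exhausts the half-line because \<open>b c\<close> is unbounded.\<close>

lemma taub_nut_isometric:
  fixes k :: real
  defines "B \<equiv> \<lambda>r. r * sqrt (E 3 r)" and "C \<equiv> \<lambda>r. r * sqrt (E 2 r)"
  assumes k: "k > 0" and rel: "\<And>r. r > 0 \<Longrightarrow> B r * (k\<^sup>2 - (C r)\<^sup>2) = C r * k\<^sup>2"
    and d: "\<And>r. r > 0 \<Longrightarrow> ((\<lambda>r. B r * C r) has_real_derivative 2 * C r * sqrt (E 1 r)) (at r)"
    and unbounded: "filterlim (\<lambda>r. B r * C r) at_top at_top"
  shows "isometric g (taub_nut (1 / k))"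
proof -
  \<comment> \<open>Equivalent to \<open>(r \<psi>)^2 = 2 B C / k\<close>, but written with the
    entries \<open>E 2\<close> and \<open>E 3\<close>, which are positive, smooth and even across
    the origin.\<close>
  define \<psi> where "\<psi> r = sqrt (2 / k * sqrt (E 2 r * E 3 r))" for r
  have \<psi>s: "smooth_on UNIV \<psi>" unfolding \<psi>_def[abs_def] using k E_pos by (intro smooth E_smooth) auto
  have \<psi>pos: "\<psi> r > 0" for r using k E_pos[of 2 r] E_pos[of 3 r] by (simp add: \<psi>_def)
  have \<psi>even: "\<psi> (- r) = \<psi> r" for r by (simp add: \<psi>_def E_even)
  have \<psi>2: "(\<psi> r)\<^sup>2 = 2 / k * sqrt (E 2 r * E 3 r)" for r
    using k E_pos[of 2 r] E_pos[of 3 r] by (simp add: \<psi>_def)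
  have N: "(r * \<psi> r)\<^sup>2 = 2 * (B r * C r) / k" for r
    unfolding power_mult_distrib \<psi>2 B_def C_def real_sqrt_mult by (simp add: power2_eq_square)
  have BC: "B r > 0" "C r > 0" if "r > 0" for r using that E_pos by (simp_all add: B_def C_def)
  have E23: "E 3 r = (B r)\<^sup>2 / r\<^sup>2" "E 2 r = (C r)\<^sup>2 / r\<^sup>2" if "r > 0" for r
    using that E_pos[of _ r] by (simp_all add: B_def C_def power_mult_distrib less_imp_le)
  have h: "r * \<psi> r * (\<psi> r + r * deriv \<psi> r) = 2 * C r * sqrt (E 1 r) / k" if r: "r > 0" for r
  proof -
    have "((\<lambda>r. (r * \<psi> r)\<^sup>2) has_real_derivative 2 * (r * \<psi> r * (\<psi> r + r * deriv \<psi> r))) (at r)"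
      by (rule derivative_eq_intros smooth_on_realD(1)[OF \<psi>s] refl)+ (simp add: algebra_simps)
    moreover have "((\<lambda>r. 2 * (B r * C r) / k) has_real_derivative 2 * (2 * C r * sqrt (E 1 r)) / k) (at r)"
      by (intro DERIV_cdivide DERIV_cmult d r)
    ultimately show ?thesis unfolding N using DERIV_unique by fastforce
  qed
  have h': "\<psi> r + r * deriv \<psi> r > 0" if r: "r > 0" for r
  proof -
    have "r * \<psi> r * (\<psi> r + r * deriv \<psi> r) > 0" unfolding h[OF r] using k BC(2)[OF r] E_pos[of 1 r] by simp
    from zero_less_mult_pos[OF this mult_pos_pos[OF r \<psi>pos]] show ?thesis .
  qed
  have hinf: "\<exists>r>0. r * \<psi> r > Z" for Z
  proof -
    obtain M where "\<And>r. r \<ge> M \<Longrightarrow> B r * C r \<ge> k * (Z\<^sup>2 + 1)"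
      using unbounded by (auto simp: filterlim_at_top eventually_at_top_linorder)
    then have "B r * C r \<ge> k * (Z\<^sup>2 + 1)" if "r = max M 1" for r using that by simp
    then obtain r where r: "r > 0" "B r * C r \<ge> k * (Z\<^sup>2 + 1)" by (metis less_max_iff_disj zero_less_one)
    have "Z\<^sup>2 + 1 \<le> B r * C r / k" unfolding pos_le_divide_eq[OF k] using r(2) by (simp only: mult.commute)
    moreover have "(r * \<psi> r)\<^sup>2 = 2 * (B r * C r / k)" unfolding N by simp
    ultimately have "Z\<^sup>2 < (r * \<psi> r)\<^sup>2" using zero_le_power2[of Z] by linarith
    moreover have "r * \<psi> r \<ge> 0" using mult_pos_pos[OF r(1) \<psi>pos[of r]] by simp
    ultimately have "Z < r * \<psi> r" by (rule power2_less_imp_less)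
    with r(1) show ?thesis by blast
  qed
  let ?\<Phi> = "\<lambda>x :: real^4. \<psi> (norm x) *\<^sub>R x"
  note diffeo = radial_diffeomorphism[OF \<psi>s \<psi>even \<psi>pos h' hinf, where 'n = 4]
  have pp: "?\<Phi> x \<bullet> ?\<Phi> x = (norm x * \<psi> (norm x))\<^sup>2" for x
    by (simp add: dot_square_norm power_mult_distrib)
  have X3: "X3 (a *\<^sub>R x) \<bullet> v = a * (X3 x \<bullet> v)" for a x v by (simp add: X_coords inner_4 algebra_simps)
  have "ip (taub_nut (1 / k)) (?\<Phi> x) (frechet_derivative ?\<Phi> (at x) v) (frechet_derivative ?\<Phi> (at x) w) = ip g x v w" for x v w
  proof (cases "x = 0")
    case True
    have "(\<psi> 0)\<^sup>2 = 2 / k * E 1 0" using E_0 E_pos[of 1 0] by (simp add: \<psi>2)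
    then have "2 * k / 4 * ((\<psi> 0)\<^sup>2 * (v \<bullet> w)) = E 1 0 * (v \<bullet> w)" using k by simp
    then show ?thesis
      unfolding ip_taub_nut[OF k] radial_derivative[OF \<psi>s \<psi>even] pp X3 using True
      by (simp add: ip_origin power2_eq_square mult.assoc X_coords inner_vec_def[of "vector _"] sum_4)
  next
    case False
    define r where "r = norm x"
    have r: "r > 0" using False by (simp add: r_def)
    define N' where "N' = 2 * B r * C r / k"
    define V where "V v = \<psi> r *\<^sub>R v + (deriv \<psi> r * (x \<bullet> v) / r) *\<^sub>R x" for v
    have fd: "frechet_derivative ?\<Phi> (at x) v = V v" for v
      using False by (simp add: radial_derivative[OF \<psi>s \<psi>even] V_def r_def)
    have xx: "x \<bullet> x = r * r" by (simp add: r_def power2_norm_eq_inner[symmetric] power2_eq_square)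
    have XV: "X3 x \<bullet> V v = \<psi> r * (X3 x \<bullet> v)" for v by (simp add: V_def inner_add_right X_self)
    have VV: "V v \<bullet> V w = (\<psi> r)\<^sup>2 * (v \<bullet> w) + (2 * \<psi> r * deriv \<psi> r / r + (deriv \<psi> r)\<^sup>2) * ((x \<bullet> v) * (x \<bullet> w))"
    proof -
      have "V v \<bullet> V w = (\<psi> r)\<^sup>2 * (v \<bullet> w) + (2 * \<psi> r * deriv \<psi> r / r) * ((x \<bullet> v) * (x \<bullet> w))
         + (deriv \<psi> r / r)\<^sup>2 * (r * r) * ((x \<bullet> v) * (x \<bullet> w))"
        unfolding V_def inner_add_left inner_add_right inner_scaleR_left inner_scaleR_right xx inner_commute[of v x]
        by (simp add: power2_eq_square algebra_simps)
      moreover have "(deriv \<psi> r / r)\<^sup>2 * (r * r) = (deriv \<psi> r)\<^sup>2" using r by (simp add: power2_eq_square)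
      ultimately show ?thesis by (simp only: distrib_right add.assoc)
    qed
    have pN: "?\<Phi> x \<bullet> ?\<Phi> x = N'" unfolding pp unfolding r_def[symmetric] N N'_def by (simp only: mult.assoc)
    have \<psi>N: "(\<psi> r)\<^sup>2 = N' / r\<^sup>2"
    proof -
      have "r\<^sup>2 * (\<psi> r)\<^sup>2 = N'" using N[of r] unfolding power_mult_distrib N'_def by (simp only: mult.assoc)
      then show ?thesis using r by (simp add: eq_divide_eq mult.commute)
    qed
    have sq: "(sqrt (E 1 r))\<^sup>2 = E 1 r" using E_pos[of 1 r] by simp
    have XX: "X3 (?\<Phi> x) \<bullet> V v * (X3 (?\<Phi> x) \<bullet> V w) = ((\<psi> r)\<^sup>2)\<^sup>2 * ((X3 x \<bullet> v) * (X3 x \<bullet> w))"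
      unfolding X3 XV r_def[symmetric] by (simp add: power2_eq_square)
    show ?thesis
      unfolding ip_taub_nut[OF k] fd pN VV XX ip_E[OF False] unfolding r_def[symmetric] E23[OF r]
      by (rule taub_nut_profile[OF BC[OF r] k r rel[OF r] N'_def \<psi>N h[OF r] sq])
  qed
  moreover have "smooth_on UNIV ?\<Phi>" by (intro smooth_on_scaleR smooth_on_even_norm \<psi>s \<psi>even smooth_on_id)
  ultimately show ?thesis unfolding isometric_def isometry_def using diffeo by blast
qed

end

section \<open>Stationarity and the mass\<close>

context class_A_flow
begin

lemma uu_r: assumes t: "t < 0" and r: "r > 0"
  shows "((\<lambda>r. uu (r, t)) has_real_derivative \<phi> (r, t) * (- 2 * uu (r, t) * (1 - uu (r, t)) / bb (r, t))) (at r)"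
proof -
  note p = bc_pos[OF t r]
  have p': "\<phi> (r, t) > 0" "uu (r, t) > 0" using roots_pos(1)[of t r] uu_pos[OF t] t by simp_all
  have "dr uu (r, t) = \<phi> (r, t) * (uu (r, t) * vv (r, t))" using p' by (simp add: vv_def)
  also have "uu (r, t) * vv (r, t) = - 2 * uu (r, t) * (1 - uu (r, t)) / bb (r, t)"
  proof -
    have "u * (u\<^sup>2 / c - (2 - u) / b) = - 2 * u * (1 - u) / b" if "u = c / b" "b > 0" "c > 0" for u b c :: real
    proof -
      have "u * u\<^sup>2 / c = u\<^sup>2 / b" using that by simp
      then have "u * (u\<^sup>2 / c - (2 - u) / b) = u\<^sup>2 / b - u * (2 - u) / b" by (simp add: right_diff_distrib)
      also have "\<dots> = (u\<^sup>2 - u * (2 - u)) / b" by (rule diff_divide_distrib[symmetric])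
      also have "u\<^sup>2 - u * (2 - u) = - 2 * u * (1 - u)" by algebra
      finally show ?thesis .
    qed
    then show ?thesis unfolding vv_eq[OF t r] rigidity[OF r t] using uu_bc[OF t r] p by blast
  qed
  finally show ?thesis using dr_D[OF uv_smooth(1) t, of r] by simp
qed

lemma second_derivatives: assumes t: "t < 0" and r: "r > 0"
  shows "yy2 (r, t) = 2 * uu (r, t) * (1 - uu (r, t)) / bb (r, t)"
    "zz2 (r, t) = - 4 * (uu (r, t))\<^sup>2 * (1 - uu (r, t)) / bb (r, t)"
proof -
  have p: "\<phi> (r, t) > 0" using roots_pos(1)[of t r] t by simp
  have "((\<lambda>r. 2 - uu (r, t)) has_real_derivative \<phi> (r, t) * (2 * uu (r, t) * (1 - uu (r, t)) / bb (r, t))) (at r)"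
    by (rule derivative_eq_intros uu_r[OF t r] refl)+ simp
  then have "((\<lambda>r. yy (r, t)) has_real_derivative \<phi> (r, t) * (2 * uu (r, t) * (1 - uu (r, t)) / bb (r, t))) (at r)"
    by (rule has_field_derivative_transform_within_open[of _ _ _ "{0<..}"]) (use r t rigidity in auto)
  from DERIV_unique[OF r_derivs'(3)[OF t] this]
  show "yy2 (r, t) = 2 * uu (r, t) * (1 - uu (r, t)) / bb (r, t)"
    by (rule mult_left_cancel[THEN iffD1, rotated]) (use p in simp)
  have "((\<lambda>r. (uu (r, t))\<^sup>2) has_real_derivative \<phi> (r, t) * (- 4 * (uu (r, t))\<^sup>2 * (1 - uu (r, t)) / bb (r, t))) (at r)"
    by (rule derivative_eq_intros uu_r[OF t r] refl)+ (simp add: power2_eq_square)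
  then have "((\<lambda>r. zz (r, t)) has_real_derivative \<phi> (r, t) * (- 4 * (uu (r, t))\<^sup>2 * (1 - uu (r, t)) / bb (r, t))) (at r)"
    by (rule has_field_derivative_transform_within_open[of _ _ _ "{0<..}"]) (use r t rigidity in auto)
  from DERIV_unique[OF r_derivs'(4)[OF t] this]
  show "zz2 (r, t) = - 4 * (uu (r, t))\<^sup>2 * (1 - uu (r, t)) / bb (r, t)"
    by (rule mult_left_cancel[THEN iffD1, rotated]) (use p in simp)
qed

text \<open>After insertion of the rigid relations each speed is a polynomial in \<open>u\<close>
  divided by \<open>b\<close>, or a multiple of such a quotient, and the polynomial vanishes: the
  metric is Ricci-flat.\<close>

lemma stationary: assumes t: "t < 0" and r: "r > 0"
  shows "((\<lambda>\<tau>. \<phi> (r, \<tau>)) has_real_derivative 0) (at t)" "((\<lambda>\<tau>. bb (r, \<tau>)) has_real_derivative 0) (at t)"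
    "((\<lambda>\<tau>. cc (r, \<tau>)) has_real_derivative 0) (at t)"
proof -
  note p = bc_pos[OF t r]
  define u where "u = uu (r, t)"
  have u: "u > 0" "cc (r, t) = u * bb (r, t)" "cc (r, t) / bb (r, t) = u"
    using uu_pos[OF t, of r] uu_bc[OF t r] p by (simp_all add: u_def)
  have v: "yy2 (r, t) = 2 * u * (1 - u) / bb (r, t)" "zz2 (r, t) = - 4 * u\<^sup>2 * (1 - u) / bb (r, t)" "yy (r, t) = 2 - u" "zz (r, t) = u\<^sup>2"
    using second_derivatives[OF t r] rigidity[OF r t] by (simp_all add: u_def)
  have "2 * yy2 (r, t) / bb (r, t) + zz2 (r, t) / cc (r, t) = 0"
    unfolding v u(2) using u(1) p by (simp add: power2_eq_square)
  then show "((\<lambda>\<tau>. \<phi> (r, \<tau>)) has_real_derivative 0) (at t)" by (intro DERIV_cong[OF phi_t[OF t r]]) simp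
  have "u\<^sup>2 * (2 - u) / (u * bb (r, t)) = u * (2 - u) / bb (r, t)" using u(1) by (simp add: power2_eq_square)
  then have "yy2 (r, t) + zz (r, t) * yy (r, t) / cc (r, t) + (yy (r, t))\<^sup>2 / bb (r, t) + (2 * (cc (r, t) / bb (r, t))\<^sup>2 - 4) / bb (r, t)
     = (2 * u * (1 - u) + u * (2 - u) + (2 - u)\<^sup>2 + (2 * u\<^sup>2 - 4)) / bb (r, t)"
    unfolding v u(3) unfolding u(2) by (simp only: add_divide_distrib)
  also have "2 * u * (1 - u) + u * (2 - u) + (2 - u)\<^sup>2 + (2 * u\<^sup>2 - 4) = 0" by algebra
  finally show "((\<lambda>\<tau>. bb (r, \<tau>)) has_real_derivative 0) (at t)" by (intro DERIV_cong[OF bb_t[OF t r]]) simp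
  have "zz2 (r, t) + 2 * yy (r, t) * zz (r, t) / bb (r, t) - 2 * (cc (r, t) / bb (r, t))^3 / bb (r, t)
     = (- 4 * u\<^sup>2 * (1 - u) + 2 * (2 - u) * u\<^sup>2 - 2 * u^3) / bb (r, t)"
    unfolding v u(3) by (simp only: add_divide_distrib diff_divide_distrib)
  also have "- 4 * u\<^sup>2 * (1 - u) + 2 * (2 - u) * u\<^sup>2 - 2 * u^3 = 0" by algebra
  finally show "((\<lambda>\<tau>. cc (r, \<tau>)) has_real_derivative 0) (at t)" by (intro DERIV_cong[OF cc_t[OF t r]]) simp
qed

text \<open>Constancy holds for negative times, where the evolution equations are available, and
  passes to time zero by continuity on the closed half-space.\<close>

lemma G_static: assumes t: "t \<le> 0" and r: "r > 0"
  shows "G i (r, t) = G i (r, - 1)"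
proof -
  have const: "h \<tau> = h (- 1)" if "\<And>t. t < 0 \<Longrightarrow> (h has_real_derivative 0) (at t)" "\<tau> < 0" for h :: "real \<Rightarrow> real" and \<tau>
  proof -
    have "\<exists>c. \<forall>x\<in>{..<0}. h x = c"
      by (rule has_field_derivative_zero_constant) (use that(1) in \<open>auto intro: has_field_derivative_at_within\<close>)
    then show ?thesis using that(2) by auto
  qed
  have "G i (r, \<tau>) = G i (r, - 1)" if \<tau>: "\<tau> < 0" for i \<tau>
  proof -
    have 123: "G 1 (r, \<tau>) = G 1 (r, - 1)" "G 2 (r, \<tau>) = G 2 (r, - 1)" "G 3 (r, \<tau>) = G 3 (r, - 1)"
      using E_eqs[OF \<tau> r] E_eqs[of "- 1" r] r const[OF stationary(1)[OF _ r] \<tau>] const[OF stationary(2)[OF _ r] \<tau>] const[OF stationary(3)[OF _ r] \<tau>]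
      by simp_all
    have "G 4 (r, s) = G 3 (r, s)" if "s \<le> 0" for s using berger_metric.E4[OF berger[OF that]] G_E[OF that] by simp
    then have "G 4 (r, \<tau>) = G 4 (r, - 1)" using 123 \<tau> by simp
    then show ?thesis using 123 exhaust_4[of i] by auto
  qed
  note past = this
  have "continuous_on (closure {..<0}) (\<lambda>\<tau>. G i (r, \<tau>))"
    by (rule continuous_on_compose2[OF smooth_on_continuous_on[OF G_smooth0]]) (auto intro!: continuous_intros)
  then show ?thesis
  proof (rule continuous_constant_on_closure)
    show "G i (r, \<tau>) = G i (r, - 1)" if "\<tau> \<in> {..<0}" for \<tau> using that by (intro past) simp
    show "t \<in> closure {..<0}" using t by simp
  qed
qed

text \<open>Off the origin the metric is determined by its entries along the ray; the origin follows
  by density.\<close>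

lemma static: assumes t: "t \<le> 0" shows "g t = g (- 1)"
proof
  fix x :: "real^4"
  have ne: "g t x = g (- 1) x" if "x \<noteq> 0" for x
  proof -
    have m: "- 1 \<le> (0 :: real)" by simp
    have "norm x > 0" using that by simp
    note E = G_static[OF t this, unfolded G_E[OF t] G_E[OF m]]
    show ?thesis
      by (simp only: vec_eq_iff berger_metric.metric_formula[OF berger[OF t] that] berger_metric.metric_formula[OF berger[OF m] that] E simp_thms)
  qed
  have "continuous_on UNIV (g s)" if "s \<le> 0" for s
    using flow that by (auto simp: ancient_ricci_flow_def riemannian_metric_def intro: smooth_on_continuous_on)
  then have "continuous_on UNIV (\<lambda>x. g t x - g (- 1) x)" using t by (intro continuous_on_diff) auto
  then have "continuous_on (closure (- {0})) (\<lambda>x. g t x - g (- 1) x)" by (rule continuous_on_subset) simp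
  moreover have "g t x - g (- 1) x = 0" if "x \<in> - {0}" for x using ne[of x] that by simp
  moreover have "x \<in> closure (- {0})" by (simp add: closure_complement interior_singleton)
  ultimately have "g t x - g (- 1) x = 0" by (rule continuous_constant_on_closure)
  then show "g t x = g (- 1) x" by simp
qed

text \<open>The first integral \<open>q = (1 - u) / c^2\<close> comes from
  \<open>u_s = - 2 u (1 - u) / b\<close> and \<open>c_s = u^2\<close>: the logarithmic derivatives
  of \<open>1 - u\<close> and of \<open>c^2\<close> are both \<open>2 u / b\<close>.\<close>

lemma taub_nut_form: obtains k where "k > 0" "isometric (g (- 1)) (taub_nut (1 / k))"
proof -
  define t :: real where "t = - 1"
  have t: "t < 0" "t \<le> 0" by (simp_all add: t_def)
  interpret B: berger_metric "g t" "b t" "c t" using berger[OF t(2)] .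
  have phi: "sqrt (B.E 1 r) = \<phi> (r, t)" for r using G_E[OF t(2), of 1 r] by (simp add: \<phi>_def)
  have BC: "r * sqrt (B.E 3 r) = bb (r, t)" "r * sqrt (B.E 2 r) = cc (r, t)" for r
    using G_E[OF t(2)] by (simp_all add: bb_def cc_def \<beta>_def \<gamma>_def)
  define q where "q r = (1 - uu (r, t)) / (cc (r, t))\<^sup>2" for r
  have "\<exists>q0. \<forall>r\<in>{0<..}. q r = q0"
  proof (rule has_field_derivative_zero_constant)
    fix r :: real assume "r \<in> {0<..}"
    then have r: "r > 0" by simp
    note p = bc_pos[OF t(1) r]
    have nz: "(cc (r, t))\<^sup>2 \<noteq> 0" using p by simp
    have "(q has_real_derivative 0) (at r)"
      unfolding q_def[abs_def]
      apply (rule derivative_eq_intros uu_r[OF t(1) r] r_derivs'(2)[OF t(1)] nz refl)+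
    proof -
      have "c / b = u \<Longrightarrow> (0 - P * (- 2 * u * (1 - u) / b)) * c\<^sup>2 - (1 - u) * (of_nat 2 * (P * u\<^sup>2 * c ^ (2 - Suc 0))) = 0"
        if "b > 0" "c > 0" for P u b c :: real
        using that by (simp add: field_simps power2_eq_square)
      then show "((0 - \<phi> (r, t) * (- 2 * uu (r, t) * (1 - uu (r, t)) / bb (r, t))) * (cc (r, t))\<^sup>2 -
         (1 - uu (r, t)) * (of_nat 2 * (\<phi> (r, t) * zz (r, t) * cc (r, t) ^ (2 - Suc 0)))) / ((cc (r, t))\<^sup>2 * (cc (r, t))\<^sup>2) = 0"
        unfolding rigidity(2)[OF r t(1)] using uu_bc[OF t(1) r] p by (simp only: div_0)
    qed
    then show "(q has_real_derivative 0) (at r within {0<..})" by (rule has_field_derivative_at_within)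
  qed simp
  then obtain q0 where q0: "\<And>r. r > 0 \<Longrightarrow> q r = q0" by auto
  have q0': "1 - uu (r, t) = q0 * (cc (r, t))\<^sup>2" if "r > 0" for r
    using q0[OF that] bc_pos(2)[OF t(1) that] by (simp add: q_def field_simps)
  have "q0 \<ge> 0" using q0[of 1] uu_le[OF t(1), of 1] by (auto simp: q_def)
  moreover have "q0 \<noteq> 0"
  proof
    assume "q0 = 0"
    \<comment> \<open>The vanishing integral is the flat case: \<open>c_s = 1\<close>, so
      \<open>c\<close> grows with the distance, against its upper bound.\<close>
    then have u1: "uu (r, t) = 1" if "r > 0" for r using q0'[OF that] by simp
    have "\<exists>a. \<forall>r\<in>{0<..}. cc (r, t) - B.rho r = a"
    proof (rule has_field_derivative_zero_constant)
      fix r :: real assume "r \<in> {0<..}"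
      then have r: "r > 0" by simp
      have "((\<lambda>r. cc (r, t) - B.rho r) has_real_derivative \<phi> (r, t) * zz (r, t) - \<phi> (r, t)) (at r)"
        using DERIV_diff[OF r_derivs'(2)[OF t(1)] B.rho_deriv[OF r]] by (simp add: phi)
      then show "((\<lambda>r. cc (r, t) - B.rho r) has_real_derivative 0) (at r within {0<..})"
        using rigidity(2)[OF r t(1)] u1[OF r] by (simp add: has_field_derivative_at_within)
    qed simp
    then obtain a where a: "\<And>r. r > 0 \<Longrightarrow> cc (r, t) = a + B.rho r" by (metis add.commute diff_add_cancel greaterThan_iff)
    obtain r where "r > 0" "B.rho r > inverse m - a" using B.rho_unbounded by blast
    then show False using cc_le[OF t(1), of r] a[of r] by simp
  qed
  ultimately have q0p: "q0 > 0" by simp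
  \<comment> \<open>Turns the first integral into \<open>1 - u = c^2 / k^2\<close>, the relation
    satisfied by the Taub-NUT metric of mass \<open>1 / k\<close>.\<close>
  define k where "k = 1 / sqrt q0"
  have k: "k > 0" "k\<^sup>2 * q0 = 1" using q0p by (simp_all add: k_def power_divide)
  have "isometric (g t) (taub_nut (1 / k))"
  proof (rule B.taub_nut_isometric[OF k(1)], unfold BC phi)
    fix r :: real assume r: "r > 0"
    have cb: "cc (r, t) = uu (r, t) * bb (r, t)" using bc_pos[OF t(1) r] by (simp add: uu_bc[OF t(1) r])
    show "bb (r, t) * (k\<^sup>2 - (cc (r, t))\<^sup>2) = cc (r, t) * k\<^sup>2" using cb q0'[OF r] k(2) by algebra
    show "((\<lambda>r. bb (r, t) * cc (r, t)) has_real_derivative 2 * cc (r, t) * \<phi> (r, t)) (at r)"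
    proof (rule DERIV_cong[OF DERIV_mult[OF r_derivs'(1,2)[OF t(1)]]])
      show "\<phi> (r, t) * yy (r, t) * cc (r, t) + \<phi> (r, t) * zz (r, t) * bb (r, t) = 2 * cc (r, t) * \<phi> (r, t)"
        unfolding rigidity[OF r t(1)] cb by algebra
    qed
  next
    have "filterlim (\<lambda>r. cc (1, t) * bb (r, t)) at_top at_top"
      by (rule filterlim_tendsto_pos_mult_at_top[OF tendsto_const _ bb_unbounded[OF t(1)]]) (use bc_pos(2)[OF t(1), of 1] in simp)
    then show "filterlim (\<lambda>r. bb (r, t) * cc (r, t)) at_top at_top"
    proof (rule filterlim_at_top_mono)
      show "\<forall>\<^sub>F r in at_top. cc (1, t) * bb (r, t) \<le> bb (r, t) * cc (r, t)"
        using eventually_ge_at_top[of 1]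
      proof eventually_elim
        case (elim r)
        then have "bb (r, t) * cc (1, t) \<le> bb (r, t) * cc (r, t)" using cc_mono[OF t(1) zero_less_one elim] bc_pos(1)[OF t(1), of r] by simp
        then show ?case by (simp only: mult.commute)
      qed
    qed
  qed
  with k(1) show thesis using that by (simp add: t_def)
qed

end

theorem theorem2:
  fixes m :: real and g :: "real \<Rightarrow> 4 metric"
  assumes "m > 0" and "g \<in> class_A m"
  shows "(\<forall>t\<le>0. g t = g 0) \<and> (\<exists>\<mu>>0. \<forall>t\<le>0. isometric (g t) (taub_nut \<mu>))"
proof -
  obtain b c f where "class_A_flow g b c f m"
    using assms(2) unfolding class_A_def class_A_flow_def by blast
  then interpret class_A_flow g b c f m .
  obtain k where k: "k > 0" "isometric (g (- 1)) (taub_nut (1 / k))" using taub_nut_form .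
  show ?thesis
  proof (intro conjI exI[of _ "1 / k"] allI impI)
    show "g t = g 0" if "t \<le> 0" for t using static[OF that] static[of 0] by simp
    show "1 / k > 0" using k by simp
    show "isometric (g t) (taub_nut (1 / k))" if "t \<le> 0" for t using static[OF that] k by simp
  qed
qed

end
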